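(* Let $r\ge1$ and let $R$ be a Noetherian standard $\mathbb{N}^r$-graded ring such that $R_{\boldsymbol 0}=A$ is a local ring. Let $M$ be a finitely generated $\mathbb{Z}^r$-graded $R$-module and let $N$ be a graded $R$-submodule of $M$. Let $\boldsymbol b\in\mathbb{Z}^r$ and let $\ell\ge|\boldsymbol b|+s(M)-1$ be an integer. Assume that (i) $[H^i_{R_{++}}(M)]_{\boldsymbol n}=(0)$ for all $i\ge0$ and all $\boldsymbol n\in\mathbb{Z}^r$ with $\boldsymbol n\ge\boldsymbol b$; (ii) $[M/N]_{\boldsymbol n}=(0)$ for all $\boldsymbol n\in\mathbb{Z}^r$ with $\boldsymbol n\ge\boldsymbol b$ and $|\boldsymbol n|=\ell$. Then $[M/N]_{\boldsymbol n}=(0)$ for all $\boldsymbol n\in\mathbb{Z}^r$ with $\boldsymbol n\ge\boldsymbol b$ and $|\boldsymbol n|\ge\ell$.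
   Context: Notation: $\mathbb{N}$ contains $0$. For $\boldsymbol n\in\mathbb{Z}^r$, $|\boldsymbol n|=n_1+\cdots+n_r$; $\boldsymbol n\ge\boldsymbol m$ means $n_i\ge m_i$ for all $i$. $\boldsymbol e_i$ is the $i$th standard basis vector of $\mathbb{Z}^r$ and $\boldsymbol e=(1,\dots,1)$. $[L]_{\boldsymbol n}$ is the degree $\boldsymbol n$ component of a graded module $L$. All rings are commutative. An $\mathbb{N}^r$-graded ring $R$ with $R_{\boldsymbol 0}=A$ is standard if it is generated over $A$ by $R_{\boldsymbol e_1},\dots,R_{\boldsymbol e_r}$ and $R_{\boldsymbol e_i}\ne(0)$ for all $i$. Set $R_{++}=R_{\boldsymbol e}R$ (the irrelevant ideal) and let $H^i_{R_{++}}(M)$ be the $i$th ($\mathbb{Z}^r$-graded) local cohomology module of $M$ with respect to $R_{++}$. Let $\mathfrak m$ be the maximal ideal of $A$. $\mathrm{Supp}_{++}(M)=\{P\in\mathrm{Spec}\,R : M_P\ne(0),\ P\text{ graded},\ R_{++}\not\subseteq P\}$. The spread of $M$ is $s(M)=\dim\mathrm{Supp}_{++}(M/\mathfrak mM)+1$, where the dimension is the supremum of lengths of chains of primes in the set and $\dim\emptyset=-1$. *)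

theory Defs
  imports
    "HOL-Algebra.Ring_Divisibility"
    "HOL-Algebra.Generated_Rings"
    "HOL-Algebra.Ideal_Product"
    "HOL-Algebra.Module"
    "HOL-Analysis.Finite_Cartesian_Product"
    "HOL-Library.Extended_Real"
begin

section \<open>Graded rings and graded modules\<close>

text \<open>
  Gradings are indexed by a type \<open>'d\<close>, which is \<open>int ^ 'r\<close> in the application.
  An \<open>\<nat>\<^sup>r\<close>-graded ring is a \<open>\<int>\<^sup>r\<close>-graded ring whose components
  outside of \<open>\<nat>\<^sup>r\<close> are zero.
\<close>

record ('a, 'd) gring = "'a ring" +
  rcomp :: "'d \<Rightarrow> 'a set"

record ('a, 'm, 'd) gmodule = "('a, 'm) module" +
  gcomp :: "'d \<Rightarrow> 'm set"

definition internal_direct_sum :: "('m, 'x) ring_scheme \<Rightarrow> ('d \<Rightarrow> 'm set) \<Rightarrow> bool" where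
  "internal_direct_sum G C \<longleftrightarrow>
     (\<forall>n. additive_subgroup (C n) G) \<and>
     (\<forall>x\<in>carrier G. \<exists>!c. (\<forall>n. c n \<in> C n) \<and> finite {n. c n \<noteq> \<zero>\<^bsub>G\<^esub>} \<and>
        x = (\<Oplus>\<^bsub>G\<^esub>n\<in>{n. c n \<noteq> \<zero>\<^bsub>G\<^esub>}. c n))"

definition graded_ring :: "('a, 'd :: comm_monoid_add) gring \<Rightarrow> bool" where
  "graded_ring R \<longleftrightarrow>
     cring R \<and> internal_direct_sum R (rcomp R) \<and> \<one>\<^bsub>R\<^esub> \<in> rcomp R 0 \<and>
     (\<forall>p q. \<forall>x\<in>rcomp R p. \<forall>y\<in>rcomp R q. x \<otimes>\<^bsub>R\<^esub> y \<in> rcomp R (p + q))"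

definition graded_module ::
    "('a, 'd :: comm_monoid_add) gring \<Rightarrow> ('a, 'm, 'd) gmodule \<Rightarrow> bool" where
  "graded_module R M \<longleftrightarrow>
     Module.module R M \<and> internal_direct_sum M (gcomp M) \<and>
     (\<forall>p q. \<forall>a\<in>rcomp R p. \<forall>x\<in>gcomp M q. a \<odot>\<^bsub>M\<^esub> x \<in> gcomp M (p + q))"

definition grestrict :: "('a, 'm, 'd) gmodule \<Rightarrow> 'm set \<Rightarrow> ('a, 'm, 'd) gmodule" where
  "grestrict M S = M\<lparr>carrier := S, gcomp := \<lambda>n. S \<inter> gcomp M n\<rparr>"

definition graded_submodule ::
    "('a, 'd :: comm_monoid_add) gring \<Rightarrow> 'm set \<Rightarrow> ('a, 'm, 'd) gmodule \<Rightarrow> bool" where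
  "graded_submodule R N M \<longleftrightarrow> submodule N R M \<and> graded_module R (grestrict M N)"

definition graded_ideal :: "'a set \<Rightarrow> ('a, 'd) gring \<Rightarrow> bool" where
  "graded_ideal P R \<longleftrightarrow>
     ideal P R \<and> internal_direct_sum (R\<lparr>carrier := P\<rparr>) (\<lambda>n. P \<inter> rcomp R n)"

text \<open>The ring structure inherited by a module record is irrelevant, hence the two
  \<^const>\<open>undefined\<close> fields.\<close>

definition gquot :: "('a, 'm, 'd) gmodule \<Rightarrow> 'm set \<Rightarrow> ('a, 'm set, 'd) gmodule" where
  "gquot M N =
     \<lparr>carrier = a_rcosets\<^bsub>M\<^esub> N, mult = undefined, one = undefined,
      zero = N, add = set_add M,
      smult = (\<lambda>a X. \<Union>x\<in>X. N +>\<^bsub>M\<^esub> (a \<odot>\<^bsub>M\<^esub> x)),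
      gcomp = (\<lambda>n. (\<lambda>x. N +>\<^bsub>M\<^esub> x) ` gcomp M n)\<rparr>"

definition gen_submodule ::
    "('a, 'x) ring_scheme \<Rightarrow> ('a, 'm, 'y) module_scheme \<Rightarrow> 'm set \<Rightarrow> 'm set" where
  "gen_submodule R M S = \<Inter>{H. submodule H R M \<and> S \<subseteq> H}"

definition fin_gen_module :: "('a, 'x) ring_scheme \<Rightarrow> ('a, 'm, 'y) module_scheme \<Rightarrow> bool" where
  "fin_gen_module R M \<longleftrightarrow>
     (\<exists>S. finite S \<and> S \<subseteq> carrier M \<and> gen_submodule R M S = carrier M)"

definition graded_hom ::
    "('a, 'd) gring \<Rightarrow> ('a, 'm, 'd) gmodule \<Rightarrow> ('a, 'n, 'd) gmodule \<Rightarrow> ('m \<Rightarrow> 'n) set" where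
  "graded_hom R M N =
     {f \<in> carrier M \<rightarrow> carrier N.
        (\<forall>x\<in>carrier M. \<forall>y\<in>carrier M. f (x \<oplus>\<^bsub>M\<^esub> y) = f x \<oplus>\<^bsub>N\<^esub> f y) \<and>
        (\<forall>a\<in>carrier R. \<forall>x\<in>carrier M. f (a \<odot>\<^bsub>M\<^esub> x) = a \<odot>\<^bsub>N\<^esub> f x) \<and>
        (\<forall>n. f ` gcomp M n \<subseteq> gcomp N n)}"


section \<open>Standard graded rings over a local ring\<close>

definition standard_graded :: "('a, int ^ 'r) gring \<Rightarrow> bool" where
  "standard_graded R \<longleftrightarrow>
     graded_ring R \<and>
     (\<forall>n. \<not> 0 \<le> n \<longrightarrow> rcomp R n = {\<zero>\<^bsub>R\<^esub>}) \<and>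
     generate_ring R (rcomp R 0 \<union> (\<Union>i. rcomp R (axis i 1))) = carrier R \<and>
     (\<forall>i. rcomp R (axis i 1) \<noteq> {\<zero>\<^bsub>R\<^esub>})"

definition degree_zero_ring :: "('a, 'd :: zero) gring \<Rightarrow> 'a ring" where
  "degree_zero_ring R =
     \<lparr>carrier = rcomp R 0, mult = mult R, one = \<one>\<^bsub>R\<^esub>, zero = \<zero>\<^bsub>R\<^esub>, add = add R\<rparr>"

definition local_ring :: "('a, 'x) ring_scheme \<Rightarrow> bool" where
  "local_ring A \<longleftrightarrow> cring A \<and> (\<exists>!\<mm>. maximalideal \<mm> A)"

definition the_maximal_ideal :: "('a, 'x) ring_scheme \<Rightarrow> 'a set" where
  "the_maximal_ideal A = (THE \<mm>. maximalideal \<mm> A)"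

text \<open>In \<open>int ^ 'r\<close>, the element \<open>1\<close> is the vector \<open>(1, \<dots>, 1)\<close>.\<close>

definition irrelevant_ideal :: "('a, int ^ 'r) gring \<Rightarrow> 'a set" where
  "irrelevant_ideal R = Idl\<^bsub>R\<^esub> (rcomp R 1)"

definition total_degree :: "int ^ 'r \<Rightarrow> int" where
  "total_degree n = (\<Sum>i\<in>UNIV. n $ i)"


section \<open>Spread\<close>

text \<open>The fraction \<open>x / s\<close>, as an equivalence class of pairs, in the localization of
  \<open>M\<close> at the prime ideal \<open>P\<close>.\<close>

definition fraction ::
    "('a, 'x) ring_scheme \<Rightarrow> ('a, 'm, 'y) module_scheme \<Rightarrow> 'a set \<Rightarrow> 'm \<Rightarrow> 'a \<Rightarrow> ('m \<times> 'a) set" where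
  "fraction R M P x s =
     {(y, t). y \<in> carrier M \<and> t \<in> carrier R - P \<and>
        (\<exists>u\<in>carrier R - P. u \<odot>\<^bsub>M\<^esub> (t \<odot>\<^bsub>M\<^esub> x) = u \<odot>\<^bsub>M\<^esub> (s \<odot>\<^bsub>M\<^esub> y))}"

definition localization ::
    "('a, 'x) ring_scheme \<Rightarrow> ('a, 'm, 'y) module_scheme \<Rightarrow> 'a set \<Rightarrow> ('m \<times> 'a) set set" where
  "localization R M P = {fraction R M P x s | x s. x \<in> carrier M \<and> s \<in> carrier R - P}"

definition relevant_support ::
    "('a, int ^ 'r) gring \<Rightarrow> ('a, 'm, int ^ 'r) gmodule \<Rightarrow> 'a set set" where
  "relevant_support R M =
     {P. primeideal P R \<and> localization R M P \<noteq> {fraction R M P \<zero>\<^bsub>M\<^esub> \<one>\<^bsub>R\<^esub>} \<and>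
         graded_ideal P R \<and> \<not> irrelevant_ideal R \<subseteq> P}"

definition chain_dim :: "'a set set \<Rightarrow> ereal" where
  "chain_dim S =
     (if S = {} then -1
      else SUP k \<in> {k. \<exists>p. (\<forall>i\<le>k. p i \<in> S) \<and> (\<forall>i<k. p i \<subset> p (Suc i))}. ereal (real k))"

definition ideal_smult ::
    "('a, 'x) ring_scheme \<Rightarrow> 'a set \<Rightarrow> ('a, 'm, 'y) module_scheme \<Rightarrow> 'm set" where
  "ideal_smult R J M = gen_submodule R M {a \<odot>\<^bsub>M\<^esub> x | a x. a \<in> J \<and> x \<in> carrier M}"

definition spread :: "('a, int ^ 'r) gring \<Rightarrow> ('a, 'm, int ^ 'r) gmodule \<Rightarrow> ereal" where
  "spread R M =
     chain_dim (relevant_support R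
       (gquot M (ideal_smult R (the_maximal_ideal (degree_zero_ring R)) M))) + 1"


section \<open>Graded local cohomology\<close>

text \<open>
  Local cohomology consists of the right derived functors of the torsion functor
  \<open>\<Gamma>\<^sub>I\<close> on the category of graded modules, computed from an injective resolution in that
  category. The lifting property below is tested on graded modules carried by
  the type \<open>'a\<close> of the ring elements. This includes all shifts of \<open>R\<close> and all their graded
  submodules, so by the graded form of Baer's criterion it is injectivity with respect
  to all graded modules.
\<close>

definition graded_injective ::
    "('a, 'd :: comm_monoid_add) gring \<Rightarrow> ('a, 'e, 'd) gmodule \<Rightarrow> bool" where
  "graded_injective R E \<longleftrightarrow>
     (\<forall>(L' :: ('a, 'a, 'd) gmodule) (L :: ('a, 'a, 'd) gmodule) f g.
        graded_module R L' \<and> graded_module R L \<and>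
        f \<in> graded_hom R L' L \<and> inj_on f (carrier L') \<and> g \<in> graded_hom R L' E \<longrightarrow>
        (\<exists>h\<in>graded_hom R L E. \<forall>x\<in>carrier L'. h (f x) = g x))"

definition graded_injective_resolution ::
    "('a, 'd :: comm_monoid_add) gring \<Rightarrow> ('a, 'm, 'd) gmodule \<Rightarrow>
     ('m \<Rightarrow> 'e) \<Rightarrow> (nat \<Rightarrow> ('a, 'e, 'd) gmodule) \<Rightarrow> (nat \<Rightarrow> 'e \<Rightarrow> 'e) \<Rightarrow> bool" where
  "graded_injective_resolution R M \<epsilon> E \<delta> \<longleftrightarrow>
     (\<forall>i. graded_module R (E i) \<and> graded_injective R (E i)) \<and>
     (\<forall>i. \<delta> i \<in> graded_hom R (E i) (E (Suc i))) \<and>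
     \<epsilon> \<in> graded_hom R M (E 0) \<and> inj_on \<epsilon> (carrier M) \<and>
     \<epsilon> ` carrier M = {x \<in> carrier (E 0). \<delta> 0 x = \<zero>\<^bsub>E 1\<^esub>} \<and>
     (\<forall>i. \<delta> i ` carrier (E i) =
        {x \<in> carrier (E (Suc i)). \<delta> (Suc i) x = \<zero>\<^bsub>E (Suc (Suc i))\<^esub>})"

definition torsion_part ::
    "('a, 'x) ring_scheme \<Rightarrow> 'a set \<Rightarrow> ('a, 'm, 'y) module_scheme \<Rightarrow> 'm set" where
  "torsion_part R I M =
     {x \<in> carrier M. \<exists>k::nat. \<forall>a \<in> I [^]\<^bsub>ideals_set R\<^esub> k. a \<odot>\<^bsub>M\<^esub> x = \<zero>\<^bsub>M\<^esub>}"

text \<open>The cohomology of \<open>\<Gamma>\<^sub>I(E)\<close>. If \<open>E\<close> and \<open>\<delta>\<close> form a graded injective resolution of \<open>M\<close>,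
  this is \<open>H\<^sup>i\<^sub>I(M)\<close>, which up to isomorphism does not depend on the resolution.\<close>

definition local_cohomology ::
    "('a, 'd) gring \<Rightarrow> 'a set \<Rightarrow> (nat \<Rightarrow> ('a, 'e, 'd) gmodule) \<Rightarrow> (nat \<Rightarrow> 'e \<Rightarrow> 'e) \<Rightarrow>
     nat \<Rightarrow> ('a, 'e set, 'd) gmodule" where
  "local_cohomology R I E \<delta> i =
     gquot (grestrict (E i) {x \<in> torsion_part R I (E i). \<delta> i x = \<zero>\<^bsub>E (Suc i)\<^esub>})
       (case i of 0 \<Rightarrow> {\<zero>\<^bsub>E 0\<^esub>} | Suc j \<Rightarrow> \<delta> j ` torsion_part R I (E j))"

end

theory Submission
  imports Defs "HOL-Library.Function_Algebras" "HOL-Computational_Algebra.Polynomial"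
begin

text \<open>Let \<open>q = l + 1 - |b|\<close>, so that \<open>s(M) \<le> q\<close>. It suffices to show
  \<open>M_n = \<Sum> R_{e_i} M_{n - e_i}\<close>, the sum running over the \<open>i\<close> with \<open>n - e_i \<ge> b\<close>, whenever
  \<open>n \<ge> b\<close> and \<open>|n| \<ge> |b| + q\<close>; the vanishing of \<open>M/N\<close> then propagates by induction on \<open>|n|\<close>.
  Elements of \<open>M\<close> are regarded as cocycles in degree 0 of the injective resolution \<open>E\<close>.

  The key observation is that a homogeneous element acts up to torsion by zero on the cohomology of a
  complex as soon as it annihilates \<open>M\<close> or is a member of the system from which a Koszul
  complex over \<open>E\<close> is formed. When the elements obtained in this way generate an ideal containing a
  power of \<open>R_{++}\<close>, the complex is acyclic up to torsion, since \<open>E\<close> splits into its torsion part and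
  a torsion-free injective part. Applied to \<open>q\<close> homogeneous parameters for
  \<open>Supp_{++}(M/mM)\<close>, this shows that the torsion part of \<open>E\<close> is exact in degrees above \<open>q\<close>.

  Now choose \<open>m\<close> with \<open>0 \<le> m \<le> n - b\<close> and \<open>|m| = q\<close>, and form the Koszul complex over
  \<open>E\<close> of generators of the modules \<open>R_{e_i}\<close>. Its index sets are sorted by comparing their multidegree with
  \<open>m\<close>. Where the multidegree is free in one direction \<open>i\<close>, all of \<open>R_{e_i}\<close> acts by zero, so this part
  is acyclic up to torsion; the part with all multidegrees above \<open>m\<close> involves only sets with at least
  \<open>q + r\<close> elements and is controlled by the bound \<open>q\<close>. Removing the directions one after the
  other, one finds that the part with multidegrees at most \<open>m\<close> is acyclic up to torsion in the
  relevant degree. There the torsion can be corrected as well, because only degrees \<open>\<ge> b\<close> occur and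
  local cohomology vanishes in them. A cocycle \<open>y\<close> placed at the empty index set therefore bounds,
  which exhibits it as a combination of the generators.\<close>

section \<open>Homogeneous ideals and relevant primes\<close>

text \<open>Hypothesis (i) controls torsion only in degrees \<open>n >= b\<close>, while the full
  Koszul complex of the generators involves degree \<open>n - mdeg S\<close> for every index set
  \<open>S\<close>. Only sets with \<open>mdeg S <= m <= n - b\<close> are safe, and the contracting
  homotopy of a generator may leave this family. Peeling off directions repairs this: leaving one
  direction free gives a family that is acyclic up to torsion, so its two halves have the same
  cohomology up to torsion, shifted by one degree. After \<open>r\<close> shifts, degree 0 of the
  wanted half has become degree \<open>-r\<close> of the part where all bounds are exceeded. There
  \<open>|S| >= |m| + r = q + r\<close>, so every component lies in some \<open>E j\<close> with
  \<open>j >= q\<close>. This is the origin of \<open>|m| = q\<close>, and hence of the bound on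
  \<open>l\<close>.

  All arguments concern homogeneous elements and complexes up to torsion, with explicit homotopies
  and chases instead of long exact sequences. Injectivity enters through Baer's criterion, the
  Noetherian hypothesis through the ascending chain condition for homogeneous ideals.\<close>

definition subgrp :: "'x::ab_group_add set \<Rightarrow> bool" where
  "subgrp S \<longleftrightarrow> 0 \<in> S \<and> (\<forall>x\<in>S. \<forall>y\<in>S. x - y \<in> S)"

lemma subgrpI: "0 \<in> S \<Longrightarrow> (\<And>x y. x \<in> S \<Longrightarrow> y \<in> S \<Longrightarrow> x - y \<in> S) \<Longrightarrow> subgrp S"
  by (auto simp: subgrp_def)

lemma subgrp_0: "subgrp S \<Longrightarrow> 0 \<in> S"
  by (auto simp: subgrp_def)

lemma subgrp_diff: "subgrp S \<Longrightarrow> x \<in> S \<Longrightarrow> y \<in> S \<Longrightarrow> x - y \<in> S"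
  by (auto simp: subgrp_def)

lemma subgrp_minus: "subgrp S \<Longrightarrow> x \<in> S \<Longrightarrow> - x \<in> S"
  using subgrp_diff[of S 0 x] subgrp_0[of S] by simp

lemma subgrp_add: "subgrp S \<Longrightarrow> x \<in> S \<Longrightarrow> y \<in> S \<Longrightarrow> x + y \<in> S"
  using subgrp_diff[of S x "- y"] subgrp_minus[of S y] by simp

lemma subgrp_sum: "subgrp S \<Longrightarrow> (\<And>i. i \<in> I \<Longrightarrow> f i \<in> S) \<Longrightarrow> sum f I \<in> S"
  by (induction I rule: infinite_finite_induct) (auto simp: subgrp_0 subgrp_add)

definition addspan :: "'x::ab_group_add set \<Rightarrow> 'x set" where
  "addspan S = \<Inter>{T. subgrp T \<and> S \<subseteq> T}"

lemma subgrp_addspan: "subgrp (addspan S)"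
  by (auto simp: subgrp_def addspan_def)

lemma addspan_superset: "S \<subseteq> addspan S"
  by (auto simp: addspan_def)

lemma addspan_induct [consumes 1, case_names base zero diff]:
  assumes "x \<in> addspan S" and "\<And>s. s \<in> S \<Longrightarrow> P s" and "P 0"
    and "\<And>x y. P x \<Longrightarrow> P y \<Longrightarrow> P (x - y)"
  shows "P x"
proof -
  have "subgrp {x. P x}" using assms(3,4) by (auto simp: subgrp_def)
  moreover have "S \<subseteq> {x. P x}" using assms(2) by auto
  ultimately show ?thesis using assms(1) unfolding addspan_def by auto
qed

lemma addspan_subset: "subgrp T \<Longrightarrow> S \<subseteq> T \<Longrightarrow> addspan S \<subseteq> T"
  by (auto simp: addspan_def)

lemma of_nat_index: "(of_nat K :: int ^ 'r) $ i = of_nat K"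
  by (induction K) simp_all

lemma total_degree_axis: "total_degree (axis i (1::int) :: int ^ 'r) = 1"
  by (simp add: total_degree_def axis_def)

lemma total_degree_diff: "total_degree (p - q) = total_degree p - total_degree q"
  by (simp add: total_degree_def sum_subtractf)

lemma total_degree_add: "total_degree (p + q) = total_degree p + total_degree q"
  by (simp add: total_degree_def sum.distrib)

lemma total_degree_nonneg: "0 \<le> p \<Longrightarrow> 0 \<le> total_degree p"
  by (simp add: total_degree_def less_eq_vec_def sum_nonneg)

lemma nonneg_vec_induct [consumes 1, case_names zero step]:
  fixes k :: "int ^ 'r"
  assumes "0 \<le> k" and z: "P 0"
    and st: "\<And>k i. 0 \<le> k \<Longrightarrow> P k \<Longrightarrow> P (k + axis i 1)"
  shows "P k"
  using assms(1)
proof (induction "nat (total_degree k)" arbitrary: k rule: less_induct)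
  case less
  show ?case
  proof (cases "k = 0")
    case True
    then show ?thesis using z by simp
  next
    case False
    then obtain i where i: "k $ i \<noteq> 0" by (auto simp: vec_eq_iff)
    define k' where "k' = k - axis i 1"
    have k': "0 \<le> k'" using less.prems i unfolding k'_def less_eq_vec_def
      by (auto simp: axis_def) (metis add.commute add_0 le_neq_trans zless_imp_add1_zle)
    have "total_degree k' = total_degree k - 1"
      by (simp add: k'_def total_degree_diff total_degree_axis)
    then have "nat (total_degree k') < nat (total_degree k)"
      using total_degree_nonneg[OF k'] by simp
    from less.hyps[OF this k'] have "P k'" .
    from st[OF k' this, of i] show ?thesis by (simp add: k'_def)
  qed
qed

text \<open>A graded ring is represented by its homogeneous components, which are subgroups of an ambient ring
  type that need not share its unit. Ideals and primes are families of subgroups of the components;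
  only homogeneous elements occur.\<close>

definition hideal :: "(int ^ 'r \<Rightarrow> 'b::comm_ring set) \<Rightarrow> (int ^ 'r \<Rightarrow> 'b set) \<Rightarrow> bool" where
  "hideal R J \<longleftrightarrow> (\<forall>p. subgrp (J p) \<and> J p \<subseteq> R p) \<and>
     (\<forall>p q. \<forall>a\<in>R p. \<forall>x\<in>J q. a * x \<in> J (p + q))"

text \<open>\<open>R_gen\<close> is standardness in the form used inside the locale: a factor of
  degree \<open>e_i\<close> splits off as soon as the degree is positive in direction
  \<open>i\<close>. \<open>ACC\<close> is the Noetherian condition, stated as existence of maximal
  members because most applications pick an ideal maximal with some property.\<close>

locale hring =
  fixes R :: "int ^ 'r \<Rightarrow> 'b::comm_ring set" and one :: 'b
  assumes R_sub: "subgrp (R n)"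
    and R_mult: "a \<in> R p \<Longrightarrow> b \<in> R q \<Longrightarrow> a * b \<in> R (p + q)"
    and one_R: "one \<in> R 0"
    and one_mult: "a \<in> R p \<Longrightarrow> one * a = a"
    and ACC: "\<J> \<noteq> {} \<Longrightarrow> (\<And>J. J \<in> \<J> \<Longrightarrow> hideal R J) \<Longrightarrow>
       \<exists>J\<in>\<J>. \<forall>J'\<in>\<J>. J \<le> J' \<longrightarrow> J' = J"
    and R_gen: "x \<in> R n \<Longrightarrow> 1 \<le> n $ i \<Longrightarrow>
       x \<in> addspan {a * g | a g. a \<in> R (n - axis i 1) \<and> g \<in> R (axis i 1)}"
begin

lemma mult_one: "a \<in> R p \<Longrightarrow> a * one = a"
  using one_mult by (simp add: mult.commute)

lemma hidealD:
  assumes "hideal R J"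
  shows "subgrp (J p)" "x \<in> J p \<Longrightarrow> x \<in> R p" "a \<in> R p \<Longrightarrow> x \<in> J q \<Longrightarrow> a * x \<in> J (p + q)"
  using assms by (auto simp: hideal_def)

lemma hideal_mult2: "hideal R J \<Longrightarrow> x \<in> J q \<Longrightarrow> a \<in> R p \<Longrightarrow> x * a \<in> J (q + p)"
  using hidealD(3)[of J a p x q] by (simp add: ac_simps)

lemma hideal_mult_deg: "hideal R J \<Longrightarrow> a \<in> R (n - q) \<Longrightarrow> x \<in> J q \<Longrightarrow> a * x \<in> J n"
  using hidealD(3)[of J a "n - q" x q] by simp

lemma R_mult_deg: "a \<in> R (n - q) \<Longrightarrow> x \<in> R q \<Longrightarrow> a * x \<in> R n"
  using R_mult[of a "n - q" x q] by simp

text \<open>The index 1 is the vector \<open>(1, \<dots>, 1)\<close>, so that \<open>R 1\<close> generates the irrelevant ideal.\<close>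

definition relevant_prime :: "(int ^ 'r \<Rightarrow> 'b set) \<Rightarrow> bool" where
  "relevant_prime P \<longleftrightarrow> hideal R P \<and>
     (\<forall>p q. \<forall>a\<in>R p. \<forall>b\<in>R q. a * b \<in> P (p + q) \<longrightarrow> a \<in> P p \<or> b \<in> P q) \<and> \<not> R 1 \<subseteq> P 1"

lemma relevant_prime_hideal: "relevant_prime P \<Longrightarrow> hideal R P"
  by (simp add: relevant_prime_def)

lemma relevant_prime_prime: "relevant_prime P \<Longrightarrow> a \<in> R p \<Longrightarrow> b \<in> R q \<Longrightarrow> a \<notin> P p \<Longrightarrow> b \<notin> P q \<Longrightarrow> a * b \<notin> P (p + q)"
  unfolding relevant_prime_def by blast

text \<open>The ideal \<open>Q + (a)\<close>, for \<open>a\<close> homogeneous of degree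
  \<open>p\<close>.\<close>

definition hadd :: "(int ^ 'r \<Rightarrow> 'b set) \<Rightarrow> int ^ 'r \<Rightarrow> 'b \<Rightarrow> int ^ 'r \<Rightarrow> 'b set" where
  "hadd Q p a n = {x + r * a | x r. x \<in> Q n \<and> r \<in> R (n - p)}"

lemma haddI: "x \<in> Q n \<Longrightarrow> r \<in> R (n - p) \<Longrightarrow> x + r * a \<in> hadd Q p a n"
  by (auto simp: hadd_def)

lemma haddE:
  assumes "y \<in> hadd Q p a n"
  obtains x r where "y = x + r * a" "x \<in> Q n" "r \<in> R (n - p)"
  using assms by (auto simp: hadd_def)

lemma hideal_hadd:
  assumes Q: "hideal R Q" and a: "a \<in> R p"
  shows "hideal R (hadd Q p a)"
  unfolding hideal_def
proof (intro conjI allI ballI)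
  fix n
  show "subgrp (hadd Q p a n)"
  proof (rule subgrpI)
    show "0 \<in> hadd Q p a n"
      using haddI[of 0 Q n 0 p a] subgrp_0[OF R_sub] subgrp_0[OF hidealD(1)[OF Q]] by simp
    fix x y assume "x \<in> hadd Q p a n" "y \<in> hadd Q p a n"
    then obtain u r v s where *: "x = u + r * a" "u \<in> Q n" "r \<in> R (n - p)"
      "y = v + s * a" "v \<in> Q n" "s \<in> R (n - p)" by (metis haddE)
    have "x - y = (u - v) + (r - s) * a" using * by (simp add: algebra_simps)
    then show "x - y \<in> hadd Q p a n"
      using haddI[of "u - v" Q n "r - s" p a] subgrp_diff[OF hidealD(1)[OF Q] *(2,5)] subgrp_diff[OF R_sub *(3,6)] by simp
  qed
  show "hadd Q p a n \<subseteq> R n"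
    using hidealD(2)[OF Q] subgrp_add[OF R_sub] R_mult_deg[OF _ a] by (auto simp: hadd_def)
next
  fix m n b x assume b: "b \<in> R m" and "x \<in> hadd Q p a n"
  then obtain u r where *: "x = u + r * a" "u \<in> Q n" "r \<in> R (n - p)" by (metis haddE)
  have "b * r \<in> R (m + n - p)" using R_mult[OF b *(3)] by (simp add: add_diff_eq)
  moreover have "b * x = b * u + (b * r) * a" using * by (simp add: algebra_simps)
  ultimately show "b * x \<in> hadd Q p a (m + n)"
    using haddI[of "b * u" Q "m + n" "b * r" p a] hidealD(3)[OF Q b *(2)] by simp
qed

lemma hadd_ge: "Q \<le> hadd Q p a"
proof (intro le_funI subsetI)
  fix n x assume "x \<in> Q n"
  then show "x \<in> hadd Q p a n" using haddI[of x Q n 0 p a] subgrp_0[OF R_sub] by simp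
qed

lemma hadd_mem: "hideal R Q \<Longrightarrow> a \<in> R p \<Longrightarrow> a \<in> hadd Q p a p"
  using haddI[of 0 Q p one p a] one_R subgrp_0[OF hidealD(1)] one_mult by auto

lemma hadd_le: "hideal R J \<Longrightarrow> Q \<le> J \<Longrightarrow> a \<in> J p \<Longrightarrow> hadd Q p a \<le> J"
  by (auto simp: le_fun_def hadd_def intro!: subgrp_add[OF hidealD(1)] hideal_mult_deg[of J])

lemma hideal_maximal:
  assumes "hideal R V" "\<phi> V"
  obtains Q where "hideal R Q" "\<phi> Q" "\<And>J. hideal R J \<Longrightarrow> \<phi> J \<Longrightarrow> Q \<le> J \<Longrightarrow> J = Q"
  using ACC[of "{J. hideal R J \<and> \<phi> J}"] assms by blast

text \<open>Induction on \<open>k\<close>: a factor of degree \<open>e_i\<close> is split off and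
  moved to the second factor. In particular \<open>R_(K+L) = R_K R_L\<close> for the constant
  vectors \<open>K\<close>, \<open>L\<close>, so that \<open>R (of_nat K)\<close> plays the role of
  the \<open>K\<close>-th power of the irrelevant ideal.\<close>

lemma R_split:
  assumes "0 \<le> k" "0 \<le> n" "x \<in> R (n + k)"
  shows "x \<in> addspan {a * c | a c. a \<in> R n \<and> c \<in> R k}"
  using assms(1,3)
proof (induction k arbitrary: x rule: nonneg_vec_induct)
  case zero
  then have "x = x * one" using mult_one by simp
  then have "x \<in> {a * c | a c. a \<in> R n \<and> c \<in> R 0}" using zero one_R by auto
  then show ?case by (rule subsetD[OF addspan_superset])
next
  case (step k i)
  let ?T = "addspan {a * c | a c. a \<in> R n \<and> c \<in> R (k + axis i 1)}"
  have "1 \<le> (n + (k + axis i 1)) $ i" using step(1) assms(2) by (simp add: less_eq_vec_def axis_def)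
  from R_gen[OF step(3) this] have "x \<in> addspan {a * g | a g. a \<in> R (n + k) \<and> g \<in> R (axis i 1)}"
    by (simp add: algebra_simps)
  moreover have "{a * g | a g. a \<in> R (n + k) \<and> g \<in> R (axis i 1)} \<subseteq> ?T"
  proof
    fix y assume "y \<in> {a * g | a g. a \<in> R (n + k) \<and> g \<in> R (axis i 1)}"
    then obtain a g where y: "y = a * g" "a \<in> R (n + k)" "g \<in> R (axis i 1)" by auto
    from step(2)[OF y(2)] have "a * g \<in> ?T"
    proof (induction rule: addspan_induct)
      case (base s)
      then obtain c d where "s = c * d" "c \<in> R n" "d \<in> R k" by auto
      then have "s * g = c * (d * g)" "c \<in> R n" "d * g \<in> R (k + axis i 1)"
        using R_mult y(3) by (auto simp: mult.assoc)
      then show ?case using addspan_superset by fastforce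
    qed (auto simp: algebra_simps subgrp_0[OF subgrp_addspan] intro: subgrp_diff[OF subgrp_addspan])
    then show "y \<in> ?T" using y by simp
  qed
  ultimately show ?case using addspan_subset[OF subgrp_addspan] by blast
qed

lemma of_nat_vec_nonneg: "0 \<le> (of_nat K :: int ^ 'r)"
  by (simp add: less_eq_vec_def of_nat_index)

text \<open>An ideal that is maximal among those above \<open>V\<close> containing no
  \<open>R (of_nat K)\<close> is prime, and it is relevant by the case \<open>K = 1\<close>.\<close>

lemma irrelevant_power_le:
  assumes V: "hideal R V" and no: "\<And>P. relevant_prime P \<Longrightarrow> \<not> V \<le> P"
  shows "\<exists>K. R (of_nat K) \<subseteq> V (of_nat K)"
proof (rule ccontr)
  assume neg: "\<not> ?thesis"
  then obtain Q where hQ: "hideal R Q" and VQ: "V \<le> Q" and nQ: "\<And>K. \<not> R (of_nat K) \<subseteq> Q (of_nat K)"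
    and max: "\<And>J. hideal R J \<Longrightarrow> V \<le> J \<Longrightarrow> (\<forall>K. \<not> R (of_nat K) \<subseteq> J (of_nat K)) \<Longrightarrow> Q \<le> J \<Longrightarrow> J = Q"
    using hideal_maximal[OF V, of "\<lambda>J. V \<le> J \<and> (\<forall>K. \<not> R (of_nat K) \<subseteq> J (of_nat K))"] by (metis order_refl)
  have big: "\<exists>K. R (of_nat K) \<subseteq> hadd Q p a (of_nat K)" if a: "a \<in> R p" "a \<notin> Q p" for a p
  proof (rule ccontr)
    assume "\<not> ?thesis"
    then have "hadd Q p a = Q"
      using max[OF hideal_hadd[OF hQ a(1)] order_trans[OF VQ hadd_ge]] hadd_ge by blast
    then show False using hadd_mem[OF hQ a(1)] a(2) by simp
  qed
  have "a \<in> Q p \<or> b \<in> Q q" if a: "a \<in> R p" and b: "b \<in> R q" and ab: "a * b \<in> Q (p + q)" for a b p q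
  proof (rule ccontr)
    assume "\<not> ?thesis"
    then obtain K L where K: "R (of_nat K) \<subseteq> hadd Q p a (of_nat K)" and L: "R (of_nat L) \<subseteq> hadd Q q b (of_nat L)"
      using big a b by meson
    \<comment> \<open>\<open>R_(K+L) = R_K R_L\<close> is contained in
      \<open>(Q + (a)) (Q + (b))\<close>, hence in \<open>Q + (ab) = Q\<close>.\<close>
    have "R (of_nat (K + L)) \<subseteq> Q (of_nat (K + L))"
    proof
      fix x assume "x \<in> R (of_nat (K + L))"
      then have "x \<in> addspan {c * d | c d. c \<in> R (of_nat K) \<and> d \<in> R (of_nat L)}"
        using R_split[OF of_nat_vec_nonneg of_nat_vec_nonneg] by simp
      moreover have "{c * d | c d. c \<in> R (of_nat K) \<and> d \<in> R (of_nat L)} \<subseteq> Q (of_nat (K + L))"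
      proof
        fix y assume "y \<in> {c * d | c d. c \<in> R (of_nat K) \<and> d \<in> R (of_nat L)}"
        then obtain c d where y: "y = c * d" and c: "c \<in> R (of_nat K)" and d: "d \<in> R (of_nat L)" by auto
        obtain u r where u: "c = u + r * a" "u \<in> Q (of_nat K)" "r \<in> R (of_nat K - p)"
          using K c by (meson haddE subsetD)
        obtain v s where v: "d = v + s * b" "v \<in> Q (of_nat L)" "s \<in> R (of_nat L - q)"
          using L d by (meson haddE subsetD)
        have "y = u * d + ((r * a) * v + (r * s) * (a * b))"
          using u v by (simp add: y algebra_simps)
        moreover have "u * d \<in> Q (of_nat (K + L))"
          using hideal_mult2[OF hQ u(2) d] by simp
        moreover have "(r * a) * v \<in> Q (of_nat (K + L))"
          using hidealD(3)[OF hQ R_mult_deg[OF u(3) a] v(2)] by simp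
        moreover have "(r * s) * (a * b) \<in> Q (of_nat (K + L))"
        proof -
          have "r * s \<in> R (of_nat (K + L) - (p + q))" using R_mult[OF u(3) v(3)] by (simp add: algebra_simps)
          then show ?thesis using hideal_mult_deg[OF hQ _ ab] by blast
        qed
        ultimately show "y \<in> Q (of_nat (K + L))" using subgrp_add[OF hidealD(1)[OF hQ]] by simp
      qed
      ultimately show "x \<in> Q (of_nat (K + L))" using addspan_subset[OF hidealD(1)[OF hQ]] by blast
    qed
    then show False using nQ by blast
  qed
  then have "relevant_prime Q" using hQ nQ[of 1] by (auto simp: relevant_prime_def)
  with no VQ show False by blast
qed

text \<open>Since \<open>R_1 = R_(1 - e_i) R_(e_i)\<close>, a homogeneous ideal containing
  \<open>R_(e_i)\<close> contains \<open>R_1\<close>.\<close>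

lemma relevant_prime_axis: "relevant_prime P \<Longrightarrow> \<exists>g\<in>R (axis i 1). g \<notin> P (axis i 1)"
proof (rule ccontr)
  assume P: "relevant_prime P" and "\<not> ?thesis"
  then have *: "R (axis i 1) \<subseteq> P (axis i 1)" by auto
  have "x \<in> P 1" if "x \<in> R 1" for x
  proof -
    have "x \<in> addspan {a * g | a g. a \<in> R (1 - axis i 1) \<and> g \<in> R (axis i 1)}"
      using R_gen[OF that, of i] by simp
    moreover have "{a * g | a g. a \<in> R (1 - axis i 1) \<and> g \<in> R (axis i 1)} \<subseteq> P 1"
      using * hideal_mult_deg[OF relevant_prime_hideal[OF P]] by blast
    ultimately show ?thesis using addspan_subset[OF hidealD(1)[OF relevant_prime_hideal[OF P]]] by blast
  qed
  then show False using P by (auto simp: relevant_prime_def)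
qed

lemma relevant_prime_one: assumes P: "relevant_prime P" shows "one \<notin> P 0"
proof
  assume *: "one \<in> P 0"
  have "x \<in> P 1" if "x \<in> R 1" for x
    using hidealD(3)[OF relevant_prime_hideal[OF P] that *] mult_one[OF that] by simp
  then show False using P by (auto simp: relevant_prime_def)
qed

text \<open>Supplies multipliers outside \<open>P\<close> of any prescribed nonnegative degree;
  prime avoidance needs them to give two summands the same degree.\<close>

lemma relevant_prime_degree:
  assumes P: "relevant_prime P" and "0 \<le> k"
  shows "\<exists>t\<in>R k. t \<notin> P k"
  using assms(2)
proof (induction k rule: nonneg_vec_induct)
  case zero
  then show ?case using relevant_prime_one[OF P] one_R by blast
next
  case (step k i)
  then obtain t where "t \<in> R k" "t \<notin> P k" by blast
  moreover obtain g where "g \<in> R (axis i 1)" "g \<notin> P (axis i 1)" using relevant_prime_axis[OF P] by blast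
  ultimately show ?case using relevant_prime_prime[OF P] R_mult by blast
qed

text \<open>The ambient type has no unit, so powers are iterated multiplications starting at the
  unit \<open>one\<close> of the graded ring.\<close>

definition pw :: "'b \<Rightarrow> nat \<Rightarrow> 'b" where
  "pw y t = (((*) y) ^^ t) one"

lemma pw_0 [simp]: "pw y 0 = one" and pw_Suc [simp]: "pw y (Suc t) = y * pw y t"
  by (simp_all add: pw_def)

lemma pw_R: "y \<in> R d \<Longrightarrow> pw y t \<in> R (of_nat t * d)"
  by (induction t) (auto simp: one_R distrib_right intro: R_mult)

lemma relevant_prime_pw: "relevant_prime P \<Longrightarrow> y \<in> R d \<Longrightarrow> y \<notin> P d \<Longrightarrow> pw y t \<notin> P (of_nat t * d)"
  by (induction t) (auto simp: relevant_prime_one distrib_right dest: relevant_prime_prime[OF _ _ pw_R])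

lemma hideal_pw: "hideal R P \<Longrightarrow> y \<in> R d \<Longrightarrow> y \<in> P d \<Longrightarrow> t > 0 \<Longrightarrow> pw y t \<in> P (of_nat t * d)"
  by (cases t) (auto simp: distrib_right intro: hideal_mult2 pw_R)

text \<open>Noetherian induction. A maximal counterexample \<open>Q\<close> is prime, because for
  \<open>ab\<close> in \<open>Q\<close> the finite sets belonging to \<open>Q + (a)\<close> and
  \<open>Q + (b)\<close> together serve for \<open>Q\<close>. But for a prime \<open>Q\<close>
  either \<open>{Q}\<close> or, if \<open>Q\<close> contains \<open>R_1\<close>, the empty set
  serves.\<close>

lemma finite_minimal_relevant_prime:
  assumes "hideal R V"
  shows "\<exists>F. finite F \<and> (\<forall>P\<in>F. relevant_prime P \<and> V \<le> P) \<and> (\<forall>P. relevant_prime P \<and> V \<le> P \<longrightarrow> (\<exists>Q\<in>F. Q \<le> P))"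
    (is "?ok V")
proof (rule ccontr)
  assume neg: "\<not> ?ok V"
  define ok where "ok V \<longleftrightarrow> ?ok V" for V
  have "\<not> ok V" using neg by (simp add: ok_def)
  then obtain Q where hQ: "hideal R Q" and nok: "\<not> ok Q"
    and max: "\<And>J. hideal R J \<Longrightarrow> \<not> ok J \<Longrightarrow> Q \<le> J \<Longrightarrow> J = Q"
    using hideal_maximal[of V "\<lambda>V. \<not> ok V", OF assms] by metis
  have nQ: "\<not> ?ok Q" using nok by (simp add: ok_def)
  have big: "?ok (hadd Q p a)" if a: "a \<in> R p" "a \<notin> Q p" for a p
  proof (rule ccontr)
    assume "\<not> ?thesis"
    then have "\<not> ok (hadd Q p a)" by (simp add: ok_def)
    from max[OF hideal_hadd[OF hQ a(1)] this hadd_ge] have "hadd Q p a = Q" .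
    then show False using hadd_mem[OF hQ a(1)] a(2) by simp
  qed
  have "a \<in> Q p \<or> b \<in> Q q" if a: "a \<in> R p" and b: "b \<in> R q" and ab: "a * b \<in> Q (p + q)" for a b p q
  proof (rule ccontr)
    assume "\<not> ?thesis"
    then have na: "a \<notin> Q p" and nb: "b \<notin> Q q" by auto
    obtain F where F: "finite F" "\<And>P. P \<in> F \<Longrightarrow> relevant_prime P \<and> hadd Q p a \<le> P"
        "\<And>P. relevant_prime P \<Longrightarrow> hadd Q p a \<le> P \<Longrightarrow> \<exists>Q\<in>F. Q \<le> P"
      using big[OF a na] by auto
    obtain G where G: "finite G" "\<And>P. P \<in> G \<Longrightarrow> relevant_prime P \<and> hadd Q q b \<le> P"
        "\<And>P. relevant_prime P \<Longrightarrow> hadd Q q b \<le> P \<Longrightarrow> \<exists>Q\<in>G. Q \<le> P"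
      using big[OF b nb] by auto
    have "?ok Q"
    proof (intro exI[of _ "F \<union> G"] conjI ballI allI impI)
      show "finite (F \<union> G)" using F G by simp
      fix P assume "P \<in> F \<union> G"
      then show "relevant_prime P" "Q \<le> P" using F(2) G(2) hadd_ge order_trans by blast+
    next
      fix P assume P: "relevant_prime P \<and> Q \<le> P"
      then have "a \<in> P p \<or> b \<in> P q" using relevant_prime_prime a b ab by (meson le_funD subsetD)
      then show "\<exists>Q\<in>F \<union> G. Q \<le> P"
      proof
        assume "a \<in> P p"
        then show ?thesis using F(3)[of P] hadd_le[OF relevant_prime_hideal, of P Q a p] P by auto
      next
        assume "b \<in> P q"
        then show ?thesis using G(3)[of P] hadd_le[OF relevant_prime_hideal, of P Q b q] P by auto
      qed
    qed
    then show False using nQ by simp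
  qed
  then have pr: "\<forall>p q. \<forall>a\<in>R p. \<forall>b\<in>R q. a * b \<in> Q (p + q) \<longrightarrow> a \<in> Q p \<or> b \<in> Q q" by blast
  have "?ok Q"
  proof (cases "R 1 \<subseteq> Q 1")
    case True
    then have "\<not> Q \<le> P" if "relevant_prime P" for P
      using that by (metis le_funD order_trans relevant_prime_def)
    then show ?thesis by (intro exI[of _ "{}"]) auto
  next
    case False
    then have "relevant_prime Q" using pr hQ by (simp add: relevant_prime_def)
    then show ?thesis by (intro exI[of _ "{Q}"]) auto
  qed
  then show False using nQ by simp
qed

section \<open>Homogeneous prime avoidance and systems of parameters\<close>

lemma avoid_product:
  assumes P: "relevant_prime P" and "finite G"
    and "\<And>Q. Q \<in> G \<Longrightarrow> hideal R Q \<and> \<not> Q \<le> P"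
  shows "\<exists>p c. c \<in> R p \<and> c \<notin> P p \<and> (\<forall>Q\<in>G. c \<in> Q p)"
  using assms(2,3)
proof (induction G rule: finite_induct)
  case empty
  then show ?case using relevant_prime_one[OF P] one_R by blast
next
  case (insert Q G)
  then obtain p c where c: "c \<in> R p" "c \<notin> P p" "\<forall>Q\<in>G. c \<in> Q p" by blast
  have hQ: "hideal R Q" and "\<not> Q \<le> P" using insert by auto
  then obtain q d where d: "d \<in> Q q" "d \<notin> P q" by (auto simp: le_fun_def)
  have dR: "d \<in> R q" using hidealD(2)[OF hQ d(1)] .
  have "c * d \<in> R (p + q)" "c * d \<notin> P (p + q)" "c * d \<in> Q (p + q)"
    using R_mult c dR relevant_prime_prime[OF P] d hidealD(3)[OF hQ c(1) d(1)] by blast+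
  moreover have "c * d \<in> Q' (p + q)" if "Q' \<in> G" for Q'
    using hideal_mult2[of Q' c p d q] that insert c(3) dR by auto
  ultimately show ?case by blast
qed

text \<open>The usual induction on the number of primes, with the extra difficulty that only
  elements of equal degree may be added. The condition \<open>1 <= d\<close> makes this possible,
  and it later ensures that the \<open>t\<close>-th power of a parameter lies in the ideal generated
  by \<open>R (of_nat t)\<close>.\<close>

lemma prime_avoidance:
  assumes "finite F" "\<And>P. P \<in> F \<Longrightarrow> relevant_prime P"
  shows "\<exists>d y. 1 \<le> d \<and> y \<in> R d \<and> (\<forall>P\<in>F. y \<notin> P d)"
  using assms
proof (induction F rule: finite_psubset_induct)
  case (psubset F)
  have IH: "\<exists>d y. 1 \<le> d \<and> y \<in> R d \<and> (\<forall>P\<in>G. y \<notin> P d)" if "G \<subset> F" for G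
    using psubset.IH[OF that] psubset.prems that by blast
  consider "F = {}" | (c) P Q where "P \<in> F" "Q \<in> F" "P \<noteq> Q" "Q \<le> P" |
    (i) P where "P \<in> F" "\<And>Q. Q \<in> F \<Longrightarrow> Q \<noteq> P \<Longrightarrow> \<not> Q \<le> P" by blast
  then show ?case
  proof cases
    case 1
    then show ?thesis using subgrp_0[OF R_sub] by blast
  next
    case c
    then obtain d y where *: "1 \<le> d" "y \<in> R d" "\<forall>P\<in>F - {Q}. y \<notin> P d" using IH[of "F - {Q}"] by blast
    have "y \<notin> P d" using * c by auto
    then have "y \<notin> Q d" using c(4) by (auto simp: le_fun_def)
    then show ?thesis using * by (intro exI[of _ d] exI[of _ y]) auto
  next
    case i
    then have P: "relevant_prime P" using psubset by blast
    obtain d y where y: "1 \<le> d" "y \<in> R d" "\<forall>P\<in>F - {P}. y \<notin> P d" using IH[of "F - {P}"] i by blast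
    show ?thesis
    proof (cases "y \<in> P d")
      case False
      then show ?thesis using y by (intro exI[of _ d] exI[of _ y]) auto
    next
      case True
      obtain p c where c: "c \<in> R p" "c \<notin> P p" "\<forall>Q\<in>F - {P}. c \<in> Q p"
        using avoid_product[OF P, of "F - {P}"] i psubset by (auto simp: relevant_prime_def)
      \<comment> \<open>Large enough that \<open>N d >= p\<close>, using \<open>d >= 1\<close>, so
        that a multiplier \<open>t\<close> of degree \<open>N d - p\<close> exists outside
        \<open>P\<close>. Then \<open>y^N + t c\<close> avoids \<open>P\<close> because only
        \<open>y^N\<close> is in \<open>P\<close>, and it avoids the other primes because they
        contain only \<open>t c\<close>; \<open>N > 0\<close> puts \<open>y^N\<close> into
        \<open>P\<close>.\<close>
      define N where "N = Suc (nat (\<Sum>i\<in>UNIV. \<bar>p $ i\<bar>))"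
      have N: "p $ i \<le> of_nat N * d $ i" "1 \<le> of_nat N * d $ i" for i
      proof -
        have "p $ i \<le> \<bar>p $ i\<bar>" by simp
        also have "\<dots> \<le> (\<Sum>i\<in>UNIV. \<bar>p $ i\<bar>)" by (rule member_le_sum) auto
        also have "\<dots> \<le> of_nat N" by (simp add: N_def sum_nonneg)
        finally have 1: "p $ i \<le> of_nat N" .
        have 2: "1 \<le> d $ i" using y(1) by (simp add: less_eq_vec_def)
        have "of_nat N * 1 \<le> of_nat N * d $ i" using 2 by (intro mult_left_mono) auto
        moreover have "1 \<le> (of_nat N :: int)" by (simp add: N_def)
        ultimately show "p $ i \<le> of_nat N * d $ i" "1 \<le> of_nat N * d $ i" using 1 by linarith+
      qed
      have "0 \<le> of_nat N * d - p" using N(1) by (simp add: less_eq_vec_def of_nat_index)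
      from relevant_prime_degree[OF P this] obtain t where t: "t \<in> R (of_nat N * d - p)" "t \<notin> P (of_nat N * d - p)"
        by blast
      define z where "z = pw y N + t * c"
      have tc: "t * c \<in> R (of_nat N * d)" "t * c \<notin> P (of_nat N * d)"
        using R_mult_deg[OF t(1) c(1)] relevant_prime_prime[OF P t(1) c(1) t(2) c(2)] by auto
      have "z \<in> R (of_nat N * d)" using subgrp_add[OF R_sub pw_R[OF y(2)] tc(1)] by (simp add: z_def)
      moreover have "1 \<le> of_nat N * d" using N(2) by (simp add: less_eq_vec_def of_nat_index)
      moreover have "z \<notin> P (of_nat N * d)"
      proof
        assume "z \<in> P (of_nat N * d)"
        moreover have "pw y N \<in> P (of_nat N * d)"
          by (rule hideal_pw[OF relevant_prime_hideal[OF P] y(2) True]) (simp add: N_def)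
        ultimately have "z - pw y N \<in> P (of_nat N * d)" using subgrp_diff hidealD(1) relevant_prime_hideal P by blast
        then show False using tc by (simp add: z_def)
      qed
      moreover have "z \<notin> Q (of_nat N * d)" if Q: "Q \<in> F - {P}" for Q
      proof
        assume "z \<in> Q (of_nat N * d)"
        moreover have rQ: "relevant_prime Q" using Q psubset by blast
        moreover have "t * c \<in> Q (of_nat N * d)"
          using hideal_mult_deg[OF relevant_prime_hideal[OF rQ] t(1)] c(3) Q by blast
        ultimately have "z - t * c \<in> Q (of_nat N * d)" using subgrp_diff hidealD(1) relevant_prime_hideal by blast
        then show False using relevant_prime_pw[OF rQ y(2)] y(3) Q by (simp add: z_def)
      qed
      ultimately show ?thesis by blast
    qed
  qed
qed

text \<open>The dimension plus one of the set of relevant primes above \<open>V\<close> is at most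
  \<open>q\<close>; for \<open>q = 0\<close> there is no such prime.\<close>

definition chain_bound :: "(int ^ 'r \<Rightarrow> 'b set) \<Rightarrow> nat \<Rightarrow> bool" where
  "chain_bound V q \<longleftrightarrow> (\<forall>k P. (\<forall>i\<le>k. relevant_prime (P i) \<and> V \<le> P i) \<longrightarrow> (\<forall>i<k. P i < P (Suc i)) \<longrightarrow> k < q)"

text \<open>An element \<open>z\<close> outside the finitely many minimal primes above
  \<open>V\<close> lowers the bound by one: a chain above \<open>V + (z)\<close> can be prolonged
  downwards by a minimal prime of \<open>V\<close>, which does not contain \<open>z\<close>.\<close>

lemma dimension_parameters:
  assumes "hideal R V" "chain_bound V q"
  shows "\<exists>d y. (\<forall>k<q. 1 \<le> d k \<and> y k \<in> R (d k)) \<and> (\<forall>P. relevant_prime P \<longrightarrow> V \<le> P \<longrightarrow> \<not> (\<forall>k<q. y k \<in> P (d k)))"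
  using assms
proof (induction q arbitrary: V)
  case 0
  have "False" if "relevant_prime P" "V \<le> P" for P
    using 0(2)[unfolded chain_bound_def, rule_format, of 0 "\<lambda>_. P"] that by auto
  then show ?case by blast
next
  case (Suc q)
  obtain F where F: "finite F" "\<And>P. P \<in> F \<Longrightarrow> relevant_prime P \<and> V \<le> P" "\<And>P. relevant_prime P \<Longrightarrow> V \<le> P \<Longrightarrow> \<exists>Q\<in>F. Q \<le> P"
    using finite_minimal_relevant_prime[OF Suc.prems(1)] by metis
  then obtain e z where z: "1 \<le> e" "z \<in> R e" "\<forall>P\<in>F. z \<notin> P e" using prime_avoidance[of F] by blast
  let ?V = "hadd V e z"
  have hV: "hideal R ?V" using hideal_hadd Suc.prems(1) z(2) by blast
  have "chain_bound ?V q"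
    unfolding chain_bound_def
  proof (intro allI impI)
    fix k P assume P: "\<forall>i\<le>k. relevant_prime (P i) \<and> ?V \<le> P i" and ch: "\<forall>i<k. P i < P (Suc i)"
    have VP: "V \<le> P i" if "i \<le> k" for i using P that hadd_ge order_trans by blast
    obtain Q where Q: "Q \<in> F" "Q \<le> P 0" using F(3)[of "P 0"] P VP by blast
    have "z \<in> P 0 e" using P hadd_mem[OF Suc.prems(1) z(2)] by (auto simp: le_fun_def)
    then have "Q < P 0" using Q z(3) by (auto simp: less_le)
    then have "\<forall>i<Suc k. (case_nat Q P) i < (case_nat Q P) (Suc i)"
      using ch by (auto split: nat.split)
    moreover have "\<forall>i\<le>Suc k. relevant_prime (case_nat Q P i) \<and> V \<le> case_nat Q P i"
      using P VP F(2)[OF Q(1)] by (auto split: nat.split)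
    ultimately have "Suc k < Suc q" using Suc.prems(2) unfolding chain_bound_def by blast
    then show "k < q" by simp
  qed
  from Suc.IH[OF hV this] obtain d y where dy: "\<forall>k<q. 1 \<le> d k \<and> y k \<in> R (d k)"
    "\<And>P. relevant_prime P \<Longrightarrow> ?V \<le> P \<Longrightarrow> \<not> (\<forall>k<q. y k \<in> P (d k))" by blast
  show ?case
  proof (intro exI[of _ "d(q := e)"] exI[of _ "y(q := z)"] conjI allI impI)
    fix k assume "k < Suc q"
    then show "1 \<le> (d(q := e)) k" "(y(q := z)) k \<in> R ((d(q := e)) k)"
      using dy z by (auto simp: less_Suc_eq)
  next
    fix P assume P: "relevant_prime P" "V \<le> P"
    show "\<not> (\<forall>k<Suc q. (y(q := z)) k \<in> P ((d(q := e)) k))"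
    proof
      assume *: "\<forall>k<Suc q. (y(q := z)) k \<in> P ((d(q := e)) k)"
      then have "z \<in> P e" by (auto dest: spec[of _ q])
      then have "?V \<le> P" using hadd_le[OF relevant_prime_hideal[OF P(1)] P(2)] by blast
      moreover have "y k \<in> P (d k)" if "k < q" for k using *[rule_format, of k] that by auto
      ultimately show False using dy(2)[OF P(1)] by blast
    qed
  qed
qed

end

section \<open>Finite generation and Nakayama's lemma\<close>

text \<open>\<open>mm_unit\<close> says that \<open>mm\<close> lies in the Jacobson radical of
  \<open>R 0\<close>, which is what Nakayama's lemma consumes.\<close>

locale hlocal = hring R one
  for R :: "int ^ 'r \<Rightarrow> 'b::comm_ring set" and one :: 'b +
  fixes mm :: "'b set"
  assumes mm_sub: "subgrp mm" and mm_R: "mm \<subseteq> R 0"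
    and mm_mult: "a \<in> R 0 \<Longrightarrow> \<mu> \<in> mm \<Longrightarrow> a * \<mu> \<in> mm"
    and mm_unit: "\<mu> \<in> mm \<Longrightarrow> \<exists>u\<in>R 0. u * (one - \<mu>) = one"

context hring
begin

lemma R0_mult: "a \<in> R 0 \<Longrightarrow> x \<in> R n \<Longrightarrow> a * x \<in> R n"
  using R_mult[of a 0 x n] by simp

lemma addspan_mult_closed:
  fixes a :: 'b
  assumes "x \<in> addspan S" and "\<And>s. s \<in> S \<Longrightarrow> a * s \<in> addspan T"
  shows "a * x \<in> addspan T"
  using assms(1)
proof (induction rule: addspan_induct)
  case (diff x y)
  then show ?case using subgrp_diff[OF subgrp_addspan, of "a * x" T "a * y"] by (simp only: right_diff_distrib)
qed (auto simp: assms(2) subgrp_0[OF subgrp_addspan])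

definition gen :: "int ^ 'r \<Rightarrow> 'b set \<Rightarrow> int ^ 'r \<Rightarrow> 'b set" where
  "gen n G p = addspan {a * g | a g. a \<in> R (p - n) \<and> g \<in> G}"

lemma genI: "a \<in> R (p - n) \<Longrightarrow> g \<in> G \<Longrightarrow> a * g \<in> gen n G p"
  unfolding gen_def using addspan_superset[of "{a * g | a g. a \<in> R (p - n) \<and> g \<in> G}"] by blast

lemma gen_sup: "G \<subseteq> R n \<Longrightarrow> g \<in> G \<Longrightarrow> g \<in> gen n G n"
  using genI[of one n n g G] one_R one_mult by auto

lemma hideal_gen:
  assumes "G \<subseteq> R n"
  shows "hideal R (gen n G)"
  unfolding hideal_def
proof (intro conjI allI ballI)
  fix p
  show "subgrp (gen n G p)" by (simp add: gen_def subgrp_addspan)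
  show "gen n G p \<subseteq> R p" unfolding gen_def
    by (rule addspan_subset[OF R_sub]) (use assms R_mult_deg in auto)
next
  fix p q a x assume a: "a \<in> R p" and "x \<in> gen n G q"
  then show "a * x \<in> gen n G (p + q)"
    unfolding gen_def
  proof (elim addspan_mult_closed)
    fix s assume "s \<in> {a * g |a g. a \<in> R (q - n) \<and> g \<in> G}"
    then obtain c g where s: "s = c * g" "c \<in> R (q - n)" "g \<in> G" by auto
    have "a * c \<in> R (p + q - n)" using R_mult[OF a s(2)] by (simp add: algebra_simps)
    from genI[OF this s(3)] show "a * s \<in> addspan {a * g |a g. a \<in> R (p + q - n) \<and> g \<in> G}"
      by (simp add: s(1) gen_def mult.assoc)
  qed
qed

lemma gen_mono: "G \<subseteq> H \<Longrightarrow> gen n G \<le> gen n H"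
  unfolding le_fun_def gen_def
  by (intro allI addspan_subset[OF subgrp_addspan] order_trans[OF _ addspan_superset]) auto

text \<open>Among the ideals generated by finitely many elements of \<open>R n\<close> a maximal one
  contains all of \<open>R n\<close>, and in degree \<open>n\<close> the coefficients have degree
  0.\<close>

lemma R_finite_generators:
  "\<exists>G. finite G \<and> G \<subseteq> R n \<and> R n \<subseteq> addspan {a * g | a g. a \<in> R 0 \<and> g \<in> G}"
proof -
  define \<phi> where "\<phi> J \<longleftrightarrow> (\<exists>G. finite G \<and> G \<subseteq> R n \<and> J = gen n G)" for J
  have "\<phi> (gen n {})" "hideal R (gen n {})" by (auto simp: \<phi>_def hideal_gen intro!: exI[of _ "{}"])
  then obtain Q where "\<phi> Q" and max: "\<And>J. hideal R J \<Longrightarrow> \<phi> J \<Longrightarrow> Q \<le> J \<Longrightarrow> J = Q"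
    using hideal_maximal[of "gen n {}" \<phi>] by metis
  then obtain G where G: "finite G" "G \<subseteq> R n" "Q = gen n G" by (auto simp: \<phi>_def)
  have "x \<in> gen n G n" if x: "x \<in> R n" for x
  proof -
    have "gen n (insert x G) = Q"
    proof (rule max)
      show "hideal R (gen n (insert x G))" using G x by (intro hideal_gen) auto
      show "\<phi> (gen n (insert x G))" unfolding \<phi>_def using G x by (intro exI[of _ "insert x G"]) auto
      show "Q \<le> gen n (insert x G)" using G gen_mono by blast
    qed
    moreover have "x \<in> gen n (insert x G) n" using gen_sup[of "insert x G" n x] G x by auto
    ultimately show ?thesis using G by simp
  qed
  then show ?thesis using G by (auto simp: gen_def)
qed

end

context hlocal
begin

definition msp :: "'b set \<Rightarrow> 'b set" where
  "msp G = addspan {\<mu> * g | \<mu> g. \<mu> \<in> mm \<and> g \<in> G}"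

lemma mspI: "\<mu> \<in> mm \<Longrightarrow> g \<in> G \<Longrightarrow> \<mu> * g \<in> msp G"
  unfolding msp_def using addspan_superset[of "{\<mu> * g | \<mu> g. \<mu> \<in> mm \<and> g \<in> G}"] by blast

lemma subgrp_msp: "subgrp (msp G)"
  by (simp add: msp_def subgrp_addspan)

lemma msp_mult: "a \<in> R 0 \<Longrightarrow> x \<in> msp G \<Longrightarrow> a * x \<in> msp G"
proof -
  assume a: "a \<in> R 0" and "x \<in> msp G"
  then show ?thesis
    unfolding msp_def
  proof (elim addspan_mult_closed)
    fix s assume "s \<in> {\<mu> * g |\<mu> g. \<mu> \<in> mm \<and> g \<in> G}"
    then obtain \<mu> g where "s = \<mu> * g" "\<mu> \<in> mm" "g \<in> G" by auto
    then show "a * s \<in> addspan {\<mu> * g |\<mu> g. \<mu> \<in> mm \<and> g \<in> G}"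
      using mspI[of "a * \<mu>" g G] mm_mult[OF a] by (simp add: mult.assoc msp_def)
  qed
qed

lemma msp_insert:
  assumes "x \<in> msp (insert g G)"
  shows "\<exists>\<mu>\<in>mm. \<exists>s\<in>msp G. x = \<mu> * g + s"
  using assms unfolding msp_def[of "insert g G"]
proof (induction rule: addspan_induct)
  case (base s)
  then obtain \<mu> h where s: "s = \<mu> * h" "\<mu> \<in> mm" "h = g \<or> h \<in> G" by auto
  show ?case
  proof (cases "h = g")
    case True
    then show ?thesis using s subgrp_0[OF subgrp_msp] by (metis add.right_neutral)
  next
    case False
    then show ?thesis using s mspI subgrp_0[OF mm_sub] by (metis add_0 mult_zero_left)
  qed
next
  case zero
  then show ?case using subgrp_0[OF subgrp_msp] subgrp_0[OF mm_sub] by (metis add_0 mult_zero_left)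
next
  case (diff x y)
  then obtain \<mu> s \<nu> t where *: "\<mu> \<in> mm" "s \<in> msp G" "x = \<mu> * g + s" "\<nu> \<in> mm" "t \<in> msp G" "y = \<nu> * g + t"
    by blast
  then have "x - y = (\<mu> - \<nu>) * g + (s - t)" by (simp add: algebra_simps)
  then show ?case using * subgrp_diff[OF mm_sub] subgrp_diff[OF subgrp_msp] by blast
qed

text \<open>Elimination in place of a determinant: the relation for \<open>g\<close> is solved for
  \<open>g\<close> by inverting \<open>one - \<mu>\<close>, and the solution is substituted into the
  relations of the remaining generators, to which the induction hypothesis applies.\<close>

lemma nakayama:
  assumes "finite G" "G \<subseteq> R n" and U: "subgrp U" "\<And>a u. a \<in> R 0 \<Longrightarrow> u \<in> U \<Longrightarrow> a * u \<in> U"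
    and "\<And>g. g \<in> G \<Longrightarrow> \<exists>u\<in>U. \<exists>s\<in>msp G. g = u + s"
  shows "G \<subseteq> U"
  using assms(1,2,5)
proof (induction G rule: finite_induct)
  case (insert g G)
  have gR: "g \<in> R n" using insert by auto
  from insert obtain u s where us: "u \<in> U" "s \<in> msp (insert g G)" "g = u + s" by blast
  then obtain \<mu> t where t: "\<mu> \<in> mm" "t \<in> msp G" "s = \<mu> * g + t" using msp_insert by blast
  obtain w where w: "w \<in> R 0" "w * (one - \<mu>) = one" using mm_unit[OF t(1)] by blast
  have "(one - \<mu>) * g = g - \<mu> * g" using one_mult[OF gR] by (simp only: left_diff_distrib)
  also have "\<dots> = u + t" by (metis add.assoc add.commute diff_eq_eq t(3) us(3))
  finally have "(one - \<mu>) * g = u + t" .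
  then have "w * ((one - \<mu>) * g) = w * (u + t)" by simp
  then have "(w * (one - \<mu>)) * g = w * u + w * t" by (simp only: mult.assoc distrib_left)
  then have g: "g = w * u + w * t" unfolding w(2) one_mult[OF gR] .
  have wu: "w * u \<in> U" "w * t \<in> msp G" using U(2)[OF w(1) us(1)] msp_mult[OF w(1) t(2)] by blast+
  have "G \<subseteq> U"
  proof (rule insert.IH)
    fix h assume "h \<in> G"
    then obtain v r where v: "v \<in> U" "r \<in> msp (insert g G)" "h = v + r" using insert.prems by blast
    then obtain \<nu> k where k: "\<nu> \<in> mm" "k \<in> msp G" "r = \<nu> * g + k" using msp_insert by blast
    have "h = (v + \<nu> * (w * u)) + (\<nu> * (w * t) + k)"
      unfolding v(3) k(3) arg_cong[OF g, of "(*) \<nu>"] by (simp add: algebra_simps)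
    moreover have "v + \<nu> * (w * u) \<in> U" using v wu U k mm_R by (intro subgrp_add) auto
    moreover have "\<nu> * (w * t) + k \<in> msp G" using wu k mm_R msp_mult by (intro subgrp_add[OF subgrp_msp]) auto
    ultimately show "\<exists>u\<in>U. \<exists>s\<in>msp G. h = u + s" by blast
  qed (use insert in auto)
  moreover have "msp G \<subseteq> U" unfolding msp_def
    using \<open>G \<subseteq> U\<close> U mm_R by (intro addspan_subset) auto
  then have "g \<in> U" using g wu subgrp_add[OF U(1)] by (metis subsetD)
  ultimately show ?case by simp
qed simp

text \<open>The ideal \<open>P + mm R\<close>. For the annihilator of \<open>M\<close> in place of
  \<open>P\<close>, the relevant primes above it are tied to the support of
  \<open>M/mM\<close>.\<close>

definition msum :: "(int ^ 'r \<Rightarrow> 'b set) \<Rightarrow> int ^ 'r \<Rightarrow> 'b set" where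
  "msum P n = {x + y | x y. x \<in> P n \<and> y \<in> msp (R n)}"

lemma msp_R: "msp (R n) \<subseteq> R n"
  unfolding msp_def using mm_R R0_mult by (intro addspan_subset[OF R_sub]) auto

lemma hideal_msum:
  assumes P: "hideal R P"
  shows "hideal R (msum P)"
  unfolding hideal_def
proof (intro conjI allI ballI)
  fix p
  show "subgrp (msum P p)"
  proof (rule subgrpI)
    show "0 \<in> msum P p" using subgrp_0[OF hidealD(1)[OF P]] subgrp_0[OF subgrp_msp]
      unfolding msum_def by (metis (mono_tags, lifting) add_0 mem_Collect_eq)
    fix x y assume "x \<in> msum P p" "y \<in> msum P p"
    then obtain u s v t where *: "x = u + s" "u \<in> P p" "s \<in> msp (R p)" "y = v + t" "v \<in> P p" "t \<in> msp (R p)"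
      unfolding msum_def by blast
    have "x - y = (u - v) + (s - t)" using * by simp
    then show "x - y \<in> msum P p" unfolding msum_def
      using * subgrp_diff[OF hidealD(1)[OF P]] subgrp_diff[OF subgrp_msp] by blast
  qed
  show "msum P p \<subseteq> R p" unfolding msum_def
    using hidealD(2)[OF P] msp_R subgrp_add[OF R_sub] by blast
next
  fix p q a x assume a: "a \<in> R p" and "x \<in> msum P q"
  then obtain u s where *: "x = u + s" "u \<in> P q" "s \<in> msp (R q)" unfolding msum_def by blast
  have "a * s \<in> msp (R (p + q))"
    using *(3) unfolding msp_def
  proof (elim addspan_mult_closed)
    fix r assume "r \<in> {\<mu> * g |\<mu> g. \<mu> \<in> mm \<and> g \<in> R q}"
    then obtain \<mu> g where "r = \<mu> * g" "\<mu> \<in> mm" "g \<in> R q" by auto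
    then show "a * r \<in> addspan {\<mu> * g |\<mu> g. \<mu> \<in> mm \<and> g \<in> R (p + q)}"
      using mspI[of \<mu> "a * g" "R (p + q)"] R_mult[OF a] by (simp add: mult.left_commute msp_def)
  qed
  then show "a * x \<in> msum P (p + q)"
    using hidealD(3)[OF P a *(2)] by (auto simp: *(1) distrib_left msum_def)
qed

lemma msum_ge: "P \<le> msum P"
proof (intro le_funI subsetI)
  fix n x assume "x \<in> P n"
  then show "x \<in> msum P n" unfolding msum_def using subgrp_0[OF subgrp_msp]
    by (metis (mono_tags, lifting) add.right_neutral mem_Collect_eq)
qed

lemma msum_mono: "P \<le> Q \<Longrightarrow> msum P \<le> msum Q"
  unfolding msum_def le_fun_def by blast

lemma mm_msum: "hideal R P \<Longrightarrow> mm \<subseteq> msum P 0"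
proof
  fix \<mu> assume "hideal R P" and \<mu>: "\<mu> \<in> mm"
  moreover have "\<mu> * one \<in> msp (R 0)" using mspI[OF \<mu> one_R] .
  moreover have "\<mu> * one = \<mu>" using mult_one \<mu> mm_R by blast
  ultimately show "\<mu> \<in> msum P 0" unfolding msum_def using subgrp_0[OF hidealD(1)]
    by (metis (mono_tags, lifting) add_0 mem_Collect_eq)
qed

text \<open>By Nakayama's lemma, a relevant prime remains contained in a relevant prime after adding the
  maximal ideal of the local ring in degree 0.\<close>

lemma relevant_prime_above_mm:
  assumes P: "relevant_prime P"
  shows "\<exists>Q. relevant_prime Q \<and> msum P \<le> Q"
proof (rule ccontr)
  assume "\<not> ?thesis"
  then obtain K where K: "R (of_nat K) \<subseteq> msum P (of_nat K)"
    using irrelevant_power_le[OF hideal_msum[OF relevant_prime_hideal[OF P]]] by blast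
  obtain G where G: "finite G" "G \<subseteq> R (of_nat K)"
    "R (of_nat K) \<subseteq> addspan {a * g | a g. a \<in> R 0 \<and> g \<in> G}" using R_finite_generators by blast
  note hP = relevant_prime_hideal[OF P]
  have U: "a * u \<in> P (of_nat K)" if "a \<in> R 0" "u \<in> P (of_nat K)" for a u
    using hidealD(3)[OF hP that] by simp
  \<comment> \<open>\<open>mm R_K = mm G\<close>, since coefficients from \<open>R 0\<close> are
    absorbed into \<open>mm\<close>. This gives the relations required by \<open>nakayama\<close>
    with \<open>U = P_K\<close>.\<close>
  have "msp (R (of_nat K)) \<subseteq> msp G"
    unfolding msp_def[of "R _"]
  proof (rule addspan_subset[OF subgrp_msp], clarify)
    fix \<mu> r assume \<mu>: "\<mu> \<in> mm" and "r \<in> R (of_nat K)"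
    then have "r \<in> addspan {a * g | a g. a \<in> R 0 \<and> g \<in> G}" using G by blast
    then show "\<mu> * r \<in> msp G"
      unfolding msp_def
    proof (rule addspan_mult_closed)
      fix s assume "s \<in> {a * g | a g. a \<in> R 0 \<and> g \<in> G}"
      then obtain a g where s: "s = a * g" "a \<in> R 0" "g \<in> G" by auto
      have "\<mu> * s = (a * \<mu>) * g" by (simp add: s(1) ac_simps)
      then show "\<mu> * s \<in> addspan {\<mu> * g |\<mu> g. \<mu> \<in> mm \<and> g \<in> G}"
        using mspI[OF mm_mult[OF s(2) \<mu>] s(3)] by (simp add: msp_def)
    qed
  qed
  then have "\<exists>u\<in>P (of_nat K). \<exists>s\<in>msp G. g = u + s" if "g \<in> G" for g
    using K G(2) that unfolding msum_def by blast
  from nakayama[OF G(1,2) hidealD(1)[OF hP] U this] have "G \<subseteq> P (of_nat K)" .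
  then have "R (of_nat K) \<subseteq> P (of_nat K)"
    using U by (intro order_trans[OF G(3)] addspan_subset[OF hidealD(1)[OF hP]]) auto
  moreover obtain f where "f \<in> R 1" "f \<notin> P 1" using P by (auto simp: relevant_prime_def)
  ultimately show False using relevant_prime_pw[OF P, of f 1 K] pw_R[of f 1 K] by auto
qed

text \<open>The parameters are chosen for the primes above \<open>A + mm R\<close> but work for all
  relevant primes above \<open>A\<close>: a prime containing all of them would be contained in a
  relevant prime that also contains \<open>mm R\<close>. Hence a bound for \<open>M/mM\<close>
  yields parameters for \<open>M\<close>.\<close>

lemma parameters:
  assumes A: "hideal R A" and "chain_bound (msum A) q"
  shows "\<exists>d y. (\<forall>k<q. 1 \<le> d k \<and> y k \<in> R (d k)) \<and> (\<forall>P. relevant_prime P \<longrightarrow> A \<le> P \<longrightarrow> \<not> (\<forall>k<q. y k \<in> P (d k)))"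
proof -
  obtain d y where dy: "\<forall>k<q. 1 \<le> d k \<and> y k \<in> R (d k)"
    "\<And>P. relevant_prime P \<Longrightarrow> msum A \<le> P \<Longrightarrow> \<not> (\<forall>k<q. y k \<in> P (d k))"
    using dimension_parameters[OF hideal_msum[OF A] assms(2)] by blast
  have "\<not> (\<forall>k<q. y k \<in> P (d k))" if P: "relevant_prime P" "A \<le> P" for P
  proof
    assume *: "\<forall>k<q. y k \<in> P (d k)"
    obtain Q where Q: "relevant_prime Q" "msum P \<le> Q" using relevant_prime_above_mm[OF P(1)] by blast
    have "msum A \<le> Q" using msum_mono[OF P(2)] Q by order
    moreover have "P \<le> Q" using msum_ge Q order_trans by blast
    then have "\<forall>k<q. y k \<in> Q (d k)" using * by (auto simp: le_fun_def)
    ultimately show False using dy(2) Q by blast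
  qed
  then show ?thesis using dy(1) by blast
qed

end

section \<open>Graded modules, injectivity and torsion\<close>

text \<open>The laws hold on whole ambient types. The unit law belongs to the components and is
  therefore part of \<open>hmod\<close>.\<close>

locale action =
  fixes act :: "'b::comm_ring \<Rightarrow> 'x::ab_group_add \<Rightarrow> 'x"
  assumes act_add: "act a (x + y) = act a x + act a y"
    and act_plus: "act (a + b) x = act a x + act b x"
    and act_mult: "act (a * b) x = act a (act b x)"
begin

lemma act_0 [simp]: "act a 0 = 0" using act_add[of a 0 0] by simp
lemma act_zero [simp]: "act 0 x = 0" using act_plus[of 0 0 x] by simp
lemma act_minus: "act a (- x) = - act a x" using act_add[of a x "- x"] by (simp add: eq_neg_iff_add_eq_0 add.commute)
lemma act_uminus: "act (- a) x = - act a x" using act_plus[of a "- a" x] by (simp add: eq_neg_iff_add_eq_0 add.commute)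
lemma act_diff: "act a (x - y) = act a x - act a y" using act_add[of a x "- y"] by (simp add: act_minus)
lemma act_subtract: "act (a - b) x = act a x - act b x" using act_plus[of a "- b" x] by (simp add: act_uminus)
lemma act_commute: "act a (act b x) = act b (act a x)" by (metis act_mult mult.commute)
lemma act_sum: "act a (sum f I) = (\<Sum>i\<in>I. act a (f i))"
  by (induction I rule: infinite_finite_induct) (auto simp: act_add)

lemma act_pow_0 [simp]: "(act f ^^ t) 0 = 0" by (induction t) auto
lemma act_pow_diff: "(act f ^^ t) (x - y) = (act f ^^ t) x - (act f ^^ t) y"
  by (induction t) (auto simp: act_diff)
lemma act_pow_act: "(act f ^^ t) (act a x) = act a ((act f ^^ t) x)"
  by (induction t) (auto simp: act_commute)
lemma act_pow_mono: "(act f ^^ s) x = 0 \<Longrightarrow> s \<le> t \<Longrightarrow> (act f ^^ t) x = 0"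
proof -
  assume *: "(act f ^^ s) x = 0" and "s \<le> t"
  then have "t = (t - s) + s" by simp
  then have "(act f ^^ t) x = (act f ^^ (t - s)) ((act f ^^ s) x)" by (metis funpow_add o_apply)
  with * show ?thesis by simp
qed

end

section \<open>Homogeneous modules and Baer's criterion\<close>

context hring
begin

lemma hideal_chain_stable:
  assumes "\<And>k. hideal R (J k)" "\<And>k. J k \<le> J (Suc k)"
  shows "\<exists>k. \<forall>t\<ge>k. J t = J k"
proof -
  have mono: "J s \<le> J t" if "s \<le> t" for s t using lift_Suc_mono_le[of J, OF assms(2) that] .
  obtain K where K: "K \<in> range J" "\<And>J'. J' \<in> range J \<Longrightarrow> K \<le> J' \<Longrightarrow> J' = K"
    using ACC[of "range J"] assms(1) by blast
  then obtain k where "K = J k" by blast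
  then show ?thesis using K(2) mono by blast
qed

definition hmod :: "('b \<Rightarrow> 'x::ab_group_add \<Rightarrow> 'x) \<Rightarrow> (int ^ 'r \<Rightarrow> 'x set) \<Rightarrow> bool" where
  "hmod act X \<longleftrightarrow> (\<forall>n. subgrp (X n)) \<and> (\<forall>p q. \<forall>a\<in>R p. \<forall>x\<in>X q. act a x \<in> X (p + q)) \<and>
     (\<forall>n. \<forall>x\<in>X n. act one x = x)"

lemma hmodD:
  assumes "hmod act X"
  shows "subgrp (X n)" "a \<in> R p \<Longrightarrow> x \<in> X q \<Longrightarrow> act a x \<in> X (p + q)" "x \<in> X n \<Longrightarrow> act one x = x"
  using assms by (auto simp: hmod_def)

lemma hmod_deg: "hmod act X \<Longrightarrow> a \<in> R (n - p) \<Longrightarrow> x \<in> X p \<Longrightarrow> act a x \<in> X n"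
  using hmodD(2)[of act X a "n - p" x p] by simp

text \<open>The map takes the degree as an argument because an element of the ambient type does not
  determine a degree; \<open>0\<close> lies in every component.\<close>

definition hhom :: "('b \<Rightarrow> 'x::ab_group_add \<Rightarrow> 'x) \<Rightarrow> ('b \<Rightarrow> 'y::ab_group_add \<Rightarrow> 'y) \<Rightarrow>
    (int ^ 'r \<Rightarrow> 'x set) \<Rightarrow> (int ^ 'r \<Rightarrow> 'y set) \<Rightarrow> int ^ 'r \<Rightarrow> (int ^ 'r \<Rightarrow> 'x \<Rightarrow> 'y) \<Rightarrow> bool" where
  "hhom ax ay X Y d h \<longleftrightarrow> (\<forall>n. \<forall>x\<in>X n. h n x \<in> Y (n + d)) \<and>
     (\<forall>n. \<forall>x\<in>X n. \<forall>y\<in>X n. h n (x - y) = h n x - h n y) \<and>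
     (\<forall>p n. \<forall>a\<in>R p. \<forall>x\<in>X n. h (p + n) (ax a x) = ay a (h n x))"

lemma hhomD:
  assumes "hhom ax ay X Y d h"
  shows "x \<in> X n \<Longrightarrow> h n x \<in> Y (n + d)"
    "x \<in> X n \<Longrightarrow> y \<in> X n \<Longrightarrow> h n (x - y) = h n x - h n y"
    "a \<in> R p \<Longrightarrow> x \<in> X n \<Longrightarrow> h (p + n) (ax a x) = ay a (h n x)"
  using assms by (auto simp: hhom_def)

lemma hhom_0: "hhom ax ay X Y d h \<Longrightarrow> subgrp (X n) \<Longrightarrow> h n 0 = 0"
  using hhomD(2)[of ax ay X Y d h 0 n 0] subgrp_0 by auto

lemma hhom_minus: "hhom ax ay X Y d h \<Longrightarrow> subgrp (X n) \<Longrightarrow> x \<in> X n \<Longrightarrow> h n (- x) = - h n x"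
  using hhomD(2)[of ax ay X Y d h 0 n x] subgrp_0 hhom_0[of ax ay X Y d h n] by auto

lemma hhom_add: "hhom ax ay X Y d h \<Longrightarrow> subgrp (X n) \<Longrightarrow> x \<in> X n \<Longrightarrow> y \<in> X n \<Longrightarrow> h n (x + y) = h n x + h n y"
  using hhomD(2)[of ax ay X Y d h x n "- y"] subgrp_minus[of "X n" y] hhom_minus[of ax ay X Y d h n y] by auto

lemma hhom_sum:
  assumes "hhom ax ay X Y d h" "subgrp (X n)" "\<And>i. i \<in> I \<Longrightarrow> f i \<in> X n"
  shows "h n (sum f I) = (\<Sum>i\<in>I. h n (f i))"
  using assms(3)
proof (induction I rule: infinite_finite_induct)
  case (insert i I)
  then show ?case using hhom_add[OF assms(1,2), of "f i" "sum f I"] subgrp_sum[OF assms(2), of I f] by simp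
qed (simp_all add: hhom_0[OF assms(1,2)])

text \<open>Baer's criterion, taken as the definition of injectivity.\<close>

definition baer :: "('b \<Rightarrow> 'y::ab_group_add \<Rightarrow> 'y) \<Rightarrow> (int ^ 'r \<Rightarrow> 'y set) \<Rightarrow> bool" where
  "baer act Y \<longleftrightarrow> (\<forall>J d \<phi>. hideal R J \<longrightarrow> hhom (*) act J Y d \<phi> \<longrightarrow>
     (\<exists>e\<in>Y d. \<forall>p. \<forall>a\<in>J p. \<phi> p a = act a e))"

lemma baerD:
  "baer act Y \<Longrightarrow> hideal R J \<Longrightarrow> hhom (*) act J Y d \<phi> \<Longrightarrow> \<exists>e\<in>Y d. \<forall>p. \<forall>a\<in>J p. \<phi> p a = act a e"
  unfolding baer_def by blast

text \<open>Graphs of partially defined homogeneous maps of degree \<open>d\<close>; by additivity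
  the last clause means single-valuedness. As sets of triples they are closed under unions of
  chains, which suits Zorn's lemma.\<close>

definition lingraph :: "('b \<Rightarrow> 'x::ab_group_add \<Rightarrow> 'x) \<Rightarrow> ('b \<Rightarrow> 'y::ab_group_add \<Rightarrow> 'y) \<Rightarrow>
    (int ^ 'r \<Rightarrow> 'x set) \<Rightarrow> (int ^ 'r \<Rightarrow> 'y set) \<Rightarrow> int ^ 'r \<Rightarrow> ((int ^ 'r) \<times> 'x \<times> 'y) set \<Rightarrow> bool" where
  "lingraph ax ay X Y d G \<longleftrightarrow>
     (\<forall>n x y. (n, x, y) \<in> G \<longrightarrow> x \<in> X n \<and> y \<in> Y (n + d)) \<and> (\<forall>n. (n, 0, 0) \<in> G) \<and>
     (\<forall>n x y x' y'. (n, x, y) \<in> G \<longrightarrow> (n, x', y') \<in> G \<longrightarrow> (n, x - x', y - y') \<in> G) \<and>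
     (\<forall>p n a x y. a \<in> R p \<longrightarrow> (n, x, y) \<in> G \<longrightarrow> (p + n, ax a x, ay a y) \<in> G) \<and>
     (\<forall>n y. (n, 0, y) \<in> G \<longrightarrow> y = 0)"

lemma lingraphD:
  assumes "lingraph ax ay X Y d G"
  shows "(n, x, y) \<in> G \<Longrightarrow> x \<in> X n" "(n, x, y) \<in> G \<Longrightarrow> y \<in> Y (n + d)" "(n, 0, 0) \<in> G"
    "(n, x, y) \<in> G \<Longrightarrow> (n, x', y') \<in> G \<Longrightarrow> (n, x - x', y - y') \<in> G"
    "a \<in> R p \<Longrightarrow> (n, x, y) \<in> G \<Longrightarrow> (p + n, ax a x, ay a y) \<in> G"
    "(n, 0, y) \<in> G \<Longrightarrow> y = 0"
    "(n, x, y) \<in> G \<Longrightarrow> (n, x, z) \<in> G \<Longrightarrow> y = z"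
proof -
  note * = assms[unfolded lingraph_def]
  show "(n, x, y) \<in> G \<Longrightarrow> x \<in> X n" "(n, x, y) \<in> G \<Longrightarrow> y \<in> Y (n + d)" "(n, 0, 0) \<in> G"
    "(n, x, y) \<in> G \<Longrightarrow> (n, x', y') \<in> G \<Longrightarrow> (n, x - x', y - y') \<in> G"
    "a \<in> R p \<Longrightarrow> (n, x, y) \<in> G \<Longrightarrow> (p + n, ax a x, ay a y) \<in> G"
    "(n, 0, y) \<in> G \<Longrightarrow> y = 0" using * by blast+
  assume "(n, x, y) \<in> G" "(n, x, z) \<in> G"
  then have "(n, x - x, y - z) \<in> G" using * by blast
  then have "(n, 0, y - z) \<in> G" by simp
  then have "y - z = 0" using * by blast
  then show "y = z" by simp
qed

text \<open>The elements \<open>a\<close> for which \<open>a x0\<close> is already in the domain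
  form an ideal \<open>J\<close>, and the prescribed values define a homomorphism on
  \<open>J\<close>. By Baer's criterion it is multiplication on some \<open>e\<close>, and
  \<open>e\<close> is a consistent value at \<open>x0\<close>.\<close>

lemma lingraph_extend:
  assumes "action ax" "action ay" "hmod ax X" "hmod ay Y" "baer ay Y"
    and M: "lingraph ax ay X Y d M" and x0: "x0 \<in> X n0"
  shows "\<exists>M'. lingraph ax ay X Y d M' \<and> M \<subseteq> M' \<and> (\<exists>e. (n0, x0, e) \<in> M')"
proof -
  interpret ax: action ax by fact
  interpret ay: action ay by fact
  note MD = lingraphD[OF M]
  define J where "J p = {a \<in> R p. \<exists>y. (p + n0, ax a x0, y) \<in> M}" for p
  define \<phi> where "\<phi> p a = (THE y. (p + n0, ax a x0, y) \<in> M)" for p a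
  have \<phi>: "\<phi> p a = y" if "(p + n0, ax a x0, y) \<in> M" for p a y
    unfolding \<phi>_def using that MD(7) by blast
  have J: "hideal R J"
    unfolding hideal_def
  proof (intro conjI allI ballI)
    fix p
    show "J p \<subseteq> R p" by (auto simp: J_def)
    show "subgrp (J p)"
    proof (rule subgrpI)
      have "(p + n0, ax 0 x0, 0) \<in> M" using MD(3) by simp
      then show "0 \<in> J p" unfolding J_def using subgrp_0[OF R_sub] by blast
      fix a b assume "a \<in> J p" "b \<in> J p"
      then obtain y z where "(p + n0, ax a x0, y) \<in> M" "(p + n0, ax b x0, z) \<in> M" "a \<in> R p" "b \<in> R p"
        unfolding J_def by blast
      moreover from MD(4)[OF this(1,2)] have "(p + n0, ax (a - b) x0, y - z) \<in> M"
        by (simp add: ax.act_subtract)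
      ultimately show "a - b \<in> J p" unfolding J_def using subgrp_diff[OF R_sub] by blast
    qed
  next
    fix p q a b assume a: "a \<in> R p" and "b \<in> J q"
    then obtain y where y: "(q + n0, ax b x0, y) \<in> M" "b \<in> R q" unfolding J_def by blast
    from MD(5)[OF a y(1)] have "(p + q + n0, ax (a * b) x0, ay a y) \<in> M" by (simp add: ax.act_mult ac_simps)
    then show "a * b \<in> J (p + q)" unfolding J_def using R_mult[OF a y(2)] by blast
  qed
  have JM: "(p + n0, ax a x0, \<phi> p a) \<in> M" if "a \<in> J p" for a p
    using that \<phi> unfolding J_def by blast
  have "hhom (*) ay J Y (n0 + d) \<phi>"
    unfolding hhom_def
  proof (intro conjI allI ballI)
    fix p a assume a: "a \<in> J p"
    show "\<phi> p a \<in> Y (p + (n0 + d))" using MD(2)[OF JM[OF a]] by (simp add: add.assoc)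
    fix b assume b: "b \<in> J p"
    show "\<phi> p (a - b) = \<phi> p a - \<phi> p b"
      using MD(4)[OF JM[OF a] JM[OF b]] by (intro \<phi>) (simp add: ax.act_subtract)
  next
    fix p q a b assume a: "a \<in> R p" and b: "b \<in> J q"
    show "\<phi> (p + q) (a * b) = ay a (\<phi> q b)"
      using MD(5)[OF a JM[OF b]] by (intro \<phi>) (simp add: ax.act_mult ac_simps)
  qed
  then obtain e where e: "e \<in> Y (n0 + d)" "\<And>p a. a \<in> J p \<Longrightarrow> \<phi> p a = ay a e"
    using baerD[OF \<open>baer ay Y\<close> J] by blast
  define M' where "M' = {(n, x + ax a x0, y + ay a e) | n x y a. (n, x, y) \<in> M \<and> a \<in> R (n - n0)}"
  have M'I: "(n, x + ax a x0, y + ay a e) \<in> M'" if "(n, x, y) \<in> M" "a \<in> R (n - n0)" for n x y a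
    unfolding M'_def using that by blast
  have "lingraph ax ay X Y d M'"
    unfolding lingraph_def
  proof (intro conjI allI impI)
    fix n u v assume "(n, u, v) \<in> M'"
    then obtain x y a where *: "u = x + ax a x0" "v = y + ay a e" "(n, x, y) \<in> M" "a \<in> R (n - n0)"
      unfolding M'_def by blast
    show "u \<in> X n" unfolding *(1)
      by (intro subgrp_add[OF hmodD(1)[OF \<open>hmod ax X\<close>]] MD(1)[OF *(3)] hmod_deg[OF \<open>hmod ax X\<close> *(4) x0])
    have "ay a e \<in> Y (n - n0 + (n0 + d))" using hmodD(2)[OF \<open>hmod ay Y\<close> *(4) e(1)] .
    then have "ay a e \<in> Y (n + d)" by (simp add: algebra_simps)
    then show "v \<in> Y (n + d)" unfolding *(2)
      by (intro subgrp_add[OF hmodD(1)[OF \<open>hmod ay Y\<close>]] MD(2)[OF *(3)])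
  next
    fix n
    show "(n, 0, 0) \<in> M'" using M'I[OF MD(3)[of n] subgrp_0[OF R_sub]] by simp
  next
    fix n u v u' v' assume "(n, u, v) \<in> M'" "(n, u', v') \<in> M'"
    then obtain x y a x' y' a' where *: "u = x + ax a x0" "v = y + ay a e" "(n, x, y) \<in> M" "a \<in> R (n - n0)"
      "u' = x' + ax a' x0" "v' = y' + ay a' e" "(n, x', y') \<in> M" "a' \<in> R (n - n0)"
      unfolding M'_def by blast
    have "u - u' = (x - x') + ax (a - a') x0" "v - v' = (y - y') + ay (a - a') e"
      using * by (simp_all add: ax.act_subtract ay.act_subtract)
    then show "(n, u - u', v - v') \<in> M'"
      using M'I[OF MD(4)[OF *(3,7)] subgrp_diff[OF R_sub *(4,8)]] by simp
  next
    fix p n c u v assume c: "c \<in> R p" and "(n, u, v) \<in> M'"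
    then obtain x y a where *: "u = x + ax a x0" "v = y + ay a e" "(n, x, y) \<in> M" "a \<in> R (n - n0)"
      unfolding M'_def by blast
    have "c * a \<in> R (p + n - n0)" using R_mult[OF c *(4)] by (simp add: algebra_simps)
    from M'I[OF MD(5)[OF c *(3)] this] show "(p + n, ax c u, ay c v) \<in> M'"
      by (simp add: * ax.act_add ay.act_add ax.act_mult ay.act_mult)
  next
    fix n v assume "(n, 0, v) \<in> M'"
    then obtain x y a where *: "0 = x + ax a x0" "v = y + ay a e" "(n, x, y) \<in> M" "a \<in> R (n - n0)"
      unfolding M'_def by blast
    have "ax a x0 = - x" using *(1) by (metis minus_unique)
    moreover have "(n, - x, - y) \<in> M" using MD(4)[OF MD(3) *(3)] by simp
    ultimately have m: "(n - n0 + n0, ax a x0, - y) \<in> M" by simp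
    then have "a \<in> J (n - n0)" unfolding J_def using *(4) by blast
    then have "- y = ay a e" using \<phi>[OF m] e(2) by simp
    then show "v = 0" using *(2) by (metis add.right_inverse)
  qed
  moreover have "M \<subseteq> M'"
  proof
    fix m assume m: "m \<in> M"
    obtain n x y where "m = (n, x, y)" by (cases m)
    then show "m \<in> M'" using M'I[of n x y 0] m subgrp_0[OF R_sub] by simp
  qed
  moreover have "(n0, x0, e) \<in> M'"
    using M'I[OF MD(3)[of n0], of one] one_R hmodD(3)[OF \<open>hmod ax X\<close> x0] hmodD(3)[OF \<open>hmod ay Y\<close> e(1)] by simp
  ultimately show ?thesis by blast
qed

text \<open>Zorn's lemma applied to \<open>lingraph_extend\<close>. Stated for graphs, because the
  retraction, the contractions and the null homotopies below are all prescribed on an image, where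
  the graph is easier to write down than a map.\<close>

theorem baer_extension:
  assumes "action ax" "action ay" "hmod ax X" "hmod ay Y" "baer ay Y"
    and G: "lingraph ax ay X Y d G"
  shows "\<exists>h. hhom ax ay X Y d h \<and> (\<forall>n x y. (n, x, y) \<in> G \<longrightarrow> h n x = y)"
proof -
  define \<A> where "\<A> = {H. lingraph ax ay X Y d H \<and> G \<subseteq> H}"
  have "\<exists>M\<in>\<A>. \<forall>H\<in>\<A>. M \<subseteq> H \<longrightarrow> H = M"
  proof (rule subset_Zorn_nonempty)
    show "\<A> \<noteq> {}" using G by (auto simp: \<A>_def)
    fix \<C> assume ne: "\<C> \<noteq> {}" and ch: "subset.chain \<A> \<C>"
    have C: "lingraph ax ay X Y d H" "G \<subseteq> H" if "H \<in> \<C>" for H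
      using ch that by (auto simp: \<A>_def subset.chain_def)
    have two: "\<exists>H\<in>\<C>. u \<in> H \<and> v \<in> H" if "u \<in> \<Union>\<C>" "v \<in> \<Union>\<C>" for u v
    proof -
      obtain H1 H2 where H: "H1 \<in> \<C>" "u \<in> H1" "H2 \<in> \<C>" "v \<in> H2"
        using \<open>u \<in> \<Union>\<C>\<close> \<open>v \<in> \<Union>\<C>\<close> by blast
      then have "H1 \<subseteq> H2 \<or> H2 \<subseteq> H1" using ch unfolding subset_chain_def by blast
      then show ?thesis using H by blast
    qed
    have "lingraph ax ay X Y d (\<Union>\<C>)"
      unfolding lingraph_def
    proof (intro conjI allI impI)
      fix n x y assume "(n, x, y) \<in> \<Union>\<C>"
      then show "x \<in> X n" "y \<in> Y (n + d)" using lingraphD(1,2)[OF C(1)] by blast+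
    next
      fix n show "(n, 0, 0) \<in> \<Union>\<C>" using ne lingraphD(3)[OF C(1)] by blast
    next
      fix n x y x' y' assume "(n, x, y) \<in> \<Union>\<C>" "(n, x', y') \<in> \<Union>\<C>"
      from two[OF this] show "(n, x - x', y - y') \<in> \<Union>\<C>" using lingraphD(4)[OF C(1)] by blast
    next
      fix p n a x y assume "a \<in> R p" "(n, x, y) \<in> \<Union>\<C>"
      then show "(p + n, ax a x, ay a y) \<in> \<Union>\<C>" using lingraphD(5)[OF C(1)] by blast
    next
      fix n y assume "(n, 0, y) \<in> \<Union>\<C>"
      then show "y = 0" using lingraphD(6)[OF C(1)] by blast
    qed
    then show "\<Union>\<C> \<in> \<A>" using ne C(2) unfolding \<A>_def by blast
  qed
  then obtain M where M: "lingraph ax ay X Y d M" "G \<subseteq> M"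
    and max: "\<And>H. lingraph ax ay X Y d H \<Longrightarrow> G \<subseteq> H \<Longrightarrow> M \<subseteq> H \<Longrightarrow> H = M" by (auto simp: \<A>_def)
  have tot: "\<exists>y. (n, x, y) \<in> M" if "x \<in> X n" for n x
  proof -
    obtain M' where M': "lingraph ax ay X Y d M'" "M \<subseteq> M'" "\<exists>e. (n, x, e) \<in> M'"
      using lingraph_extend[OF assms(1-5) M(1) \<open>x \<in> X n\<close>] by blast
    then have "M' = M" using max M by blast
    then show ?thesis using M' by blast
  qed
  define h where "h n x = (THE y. (n, x, y) \<in> M)" for n x
  have h: "h n x = y" if "(n, x, y) \<in> M" for n x y
    unfolding h_def using that lingraphD(7)[OF M(1)] by blast
  have hM: "(n, x, h n x) \<in> M" if "x \<in> X n" for n x using tot[OF that] h by blast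
  have "hhom ax ay X Y d h"
    unfolding hhom_def
    using lingraphD(2)[OF M(1) hM] h[OF lingraphD(4)[OF M(1) hM hM]] h[OF lingraphD(5)[OF M(1) _ hM]] by blast
  then show ?thesis using h M(2) by blast
qed

text \<open>Torsion tested on each element of \<open>R 1\<close> separately: closure under
  differences and homomorphisms then needs no finiteness. A uniform exponent for a homogeneous
  element is recovered in \<open>tors_annihilated\<close>.\<close>

definition tors :: "('b \<Rightarrow> 'x::ab_group_add \<Rightarrow> 'x) \<Rightarrow> 'x \<Rightarrow> bool" where
  "tors act x \<longleftrightarrow> (\<forall>f\<in>R 1. \<exists>t. (act f ^^ t) x = 0)"

lemma tors_0: "action act \<Longrightarrow> tors act 0"
  by (auto simp: tors_def intro!: exI[of _ 0])

lemma tors_diff: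
  assumes "action act" "tors act x" "tors act y"
  shows "tors act (x - y)"
  unfolding tors_def
proof
  interpret action act by fact
  fix f assume "f \<in> R 1"
  with assms(2,3) obtain s t where "(act f ^^ s) x = 0" "(act f ^^ t) y = 0" unfolding tors_def by blast
  then have "(act f ^^ max s t) (x - y) = 0"
    by (simp add: act_pow_diff act_pow_mono[of s f x "max s t"] act_pow_mono[of t f y "max s t"])
  then show "\<exists>t. (act f ^^ t) (x - y) = 0" by blast
qed

lemma subgrp_tors: "action act \<Longrightarrow> subgrp {x. tors act x}"
  by (auto intro!: subgrpI tors_0 tors_diff)

lemma tors_act:
  assumes "action act" "tors act x"
  shows "tors act (act a x)"
proof -
  interpret action act by fact
  show ?thesis using assms(2) unfolding tors_def act_pow_act by (metis act_0)
qed

lemma tors_additive: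
  assumes "action act" "tors act x" "tors act y" shows "tors act (x + y)"
  using subgrp_add[OF subgrp_tors[OF assms(1)], of x y] assms by auto

lemma act_pw:
  assumes "action act" shows "act (pw f t) x = (act f ^^ t) (act one x)"
proof -
  interpret action act by fact
  show ?thesis by (induction t) (auto simp: act_mult)
qed

lemma hhom_pow:
  assumes "hhom ax ay X Y d h" "f \<in> R 1" "x \<in> X n" "hmod ax X"
  shows "(ax f ^^ t) x \<in> X (of_nat t + n) \<and> h (of_nat t + n) ((ax f ^^ t) x) = (ay f ^^ t) (h n x)"
proof (induction t)
  case (Suc t)
  then show ?case using hhomD(3)[OF assms(1,2), of "(ax f ^^ t) x" "of_nat t + n"]
      hmodD(2)[OF assms(4,2), of "(ax f ^^ t) x" "of_nat t + n"] by (simp add: add.assoc)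
qed (simp add: assms)

lemma hhom_tors:
  assumes h: "hhom ax ay X Y d h" and X: "hmod ax X" and x: "x \<in> X n" "tors ax x"
  shows "tors ay (h n x)"
  unfolding tors_def
proof
  fix f assume f: "f \<in> R 1"
  then obtain t where t: "(ax f ^^ t) x = 0" using x(2) by (auto simp: tors_def)
  have "(ay f ^^ t) (h n x) = 0"
    using hhom_pow[OF h f x(1) X, of t] t hhom_0[OF h hmodD(1)[OF X]] by simp
  then show "\<exists>t. (ay f ^^ t) (h n x) = 0" by blast
qed

definition tpart :: "('b \<Rightarrow> 'x::ab_group_add \<Rightarrow> 'x) \<Rightarrow> (int ^ 'r \<Rightarrow> 'x set) \<Rightarrow> int ^ 'r \<Rightarrow> 'x set" where
  "tpart act X n = {x \<in> X n. tors act x}"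

lemma hmod_tpart: "action act \<Longrightarrow> hmod act X \<Longrightarrow> hmod act (tpart act X)"
  unfolding hmod_def tpart_def by (auto intro!: subgrpI tors_0 tors_diff tors_act dest: subgrp_0 subgrp_diff)

lemma hideal_ker:
  assumes J: "hideal R J" and "hhom (*) act J Y d \<phi>" "action act"
  shows "hideal R (\<lambda>p. {a \<in> J p. (act f ^^ t) (\<phi> p a) = 0})"
proof -
  interpret action act by fact
  show ?thesis
    unfolding hideal_def
    using hidealD[OF J] hhomD(2,3)[OF assms(2)] hhom_0[OF assms(2) hidealD(1)[OF J]]
    by (auto intro!: subgrpI dest: subgrp_0 subgrp_diff simp: act_pow_diff act_pow_act)
qed

text \<open>The torsion part of an injective module is injective. A homomorphism on an ideal \<open>J\<close> with
  torsion values is first extended by zero to \<open>J + Q\<close>, where \<open>Q\<close> is maximal among the ideals that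
  meet \<open>J\<close> in the kernel; maximality forces \<open>Q\<close> to contain a power of every element of degree
  \<open>(1, \<dots>, 1)\<close>, so that every extension to \<open>R\<close> again has torsion values.\<close>

lemma baer_tpart:
  assumes act: "action act" and Y: "hmod act Y" and B: "baer act Y"
  shows "baer act (tpart act Y)"
  unfolding baer_def
proof (intro allI impI)
  interpret action act by fact
  fix J d \<phi> assume J: "hideal R J" and \<phi>: "hhom (*) act J (tpart act Y) d \<phi>"
  define K where "K p = {a \<in> J p. \<phi> p a = 0}" for p
  have K: "hideal R K" using hideal_ker[OF J \<phi> act, where t = 0] by (simp add: K_def[abs_def])
  obtain Q where Q: "hideal R Q" and KQ: "K \<le> Q" and QJ: "\<And>p. Q p \<inter> J p \<subseteq> K p"
    and max: "\<And>Q'. hideal R Q' \<Longrightarrow> K \<le> Q' \<and> (\<forall>p. Q' p \<inter> J p \<subseteq> K p) \<Longrightarrow> Q \<le> Q' \<Longrightarrow> Q' = Q"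
    using hideal_maximal[OF K, of "\<lambda>Q. K \<le> Q \<and> (\<forall>p. Q p \<inter> J p \<subseteq> K p)"] by (metis Int_lower1 order_refl)
  note hQ = hidealD[OF Q] and hJ = hidealD[OF J]
  have power: "\<exists>k. pw f k \<in> Q (of_nat k)" if f: "f \<in> R 1" for f
  proof -
    have pwR: "pw f k \<in> R (of_nat k)" for k using pw_R[OF f, of k] by simp
    \<comment> \<open>The kernels of \<open>f^t \<phi>\<close> form an ascending chain with union
      \<open>J\<close>, because all values are torsion. Hence one exponent \<open>t\<close> kills
      all values of \<open>\<phi>\<close>.\<close>
    define Js where "Js t p = {a \<in> J p. (act f ^^ t) (\<phi> p a) = 0}" for t p
    have "hideal R (Js t)" for t using hideal_ker[OF J \<phi> act] by (simp add: Js_def[abs_def])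
    moreover have "Js t \<le> Js (Suc t)" for t by (auto simp: Js_def le_fun_def)
    ultimately obtain t where t: "\<And>s. s \<ge> t \<Longrightarrow> Js s = Js t" using hideal_chain_stable[of Js] by blast
    have kill: "(act f ^^ t) (\<phi> p a) = 0" if a: "a \<in> J p" for p a
    proof -
      have "tors act (\<phi> p a)" using hhomD(1)[OF \<phi> a] by (simp add: tpart_def)
      then obtain s where "(act f ^^ s) (\<phi> p a) = 0" using f by (auto simp: tors_def)
      then have "(act f ^^ max s t) (\<phi> p a) = 0" by (rule act_pow_mono) simp
      then have "a \<in> Js (max s t) p" using a by (simp add: Js_def)
      then show ?thesis using t[of "max s t"] by (simp add: Js_def)
    qed
    \<comment> \<open>The colon ideals \<open>(Q : f^k)\<close>, again an ascending and hence
      stationary chain.\<close>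
    define Qs where "Qs k p = {r \<in> R p. pw f k * r \<in> Q (of_nat k + p)}" for k p
    have "hideal R (Qs k)" for k
      unfolding hideal_def Qs_def
    proof (intro conjI allI ballI)
      fix p
      show "subgrp {r \<in> R p. pw f k * r \<in> Q (of_nat k + p)}"
        using subgrp_0[OF hQ(1)] subgrp_0[OF R_sub] subgrp_diff[OF hQ(1)] subgrp_diff[OF R_sub]
        by (auto intro!: subgrpI simp: right_diff_distrib)
    next
      fix p q a r assume "a \<in> R p" "r \<in> {r \<in> R q. pw f k * r \<in> Q (of_nat k + q)}"
      then show "a * r \<in> {r \<in> R (p + q). pw f k * r \<in> Q (of_nat k + (p + q))}"
        using hQ(3)[of a p "pw f k * r" "of_nat k + q"] R_mult by (auto simp: ac_simps)
    qed auto
    moreover have "Qs k \<le> Qs (Suc k)" for k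
      using hQ(3)[OF f, of "pw f k * _" "of_nat k + _"] by (auto simp: Qs_def le_fun_def ac_simps)
    ultimately obtain k where k: "\<And>s. s \<ge> k \<Longrightarrow> Qs s = Qs k" using hideal_chain_stable[of Qs] by blast
    let ?Q = "hadd Q (of_nat k) (pw f k)"
    \<comment> \<open>Let \<open>a = u + r f^k\<close>. Since \<open>f^t a\<close> is in
      \<open>K\<close> and so in \<open>Q\<close>, also \<open>r f^(t+k)\<close> is in
      \<open>Q\<close>; stationarity gives \<open>r f^k\<close> in \<open>Q\<close>. So
      \<open>a\<close> is in both \<open>Q\<close> and \<open>J\<close>, that is, in
      \<open>K\<close>. By maximality \<open>Q + (f^k) = Q\<close>.\<close>
    have "a \<in> K p" if a: "a \<in> ?Q p" "a \<in> J p" for a p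
    proof -
      obtain u r where ur: "a = u + r * pw f k" "u \<in> Q p" "r \<in> R (p - of_nat k)" using a(1) by (rule haddE)
      have "\<phi> (of_nat t + p) (pw f t * a) = act (pw f t) (\<phi> p a)" using hhomD(3)[OF \<phi> pwR a(2)] .
      also have "\<dots> = (act f ^^ t) (\<phi> p a)"
        using hhomD(1)[OF \<phi> a(2)] hmodD(3)[OF Y, of "\<phi> p a" "p + d"] by (simp add: act_pw[OF act] tpart_def)
      finally have "\<phi> (of_nat t + p) (pw f t * a) = 0" using kill[OF a(2)] by simp
      then have "pw f t * a \<in> K (of_nat t + p)" using hJ(3)[OF pwR a(2)] by (simp add: K_def)
      then have 1: "pw f t * a \<in> Q (of_nat t + p)" using KQ by (auto simp: le_fun_def)
      have 2: "pw f t * u \<in> Q (of_nat t + p)" using hQ(3)[OF pwR ur(2)] .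
      have pw_add: "pw f (t + k) = pw f t * pw f k" for t
        using mult.assoc one_mult[OF pwR] by (induction t) (auto simp: mult.assoc)
      have "pw f (t + k) * r = pw f t * a - pw f t * u" unfolding pw_add ur(1) by (simp add: algebra_simps)
      then have "pw f (t + k) * r \<in> Q (of_nat t + p)" using subgrp_diff[OF hQ(1) 1 2] by simp
      then have "r \<in> Qs (t + k) (p - of_nat k)" using ur(3) by (simp add: Qs_def)
      then have "r \<in> Qs k (p - of_nat k)" using k[of "t + k"] by simp
      then have "r * pw f k \<in> Q p" by (simp add: Qs_def mult.commute)
      then have "a \<in> Q p" using ur subgrp_add[OF hQ(1)] by simp
      then show ?thesis using QJ a(2) by blast
    qed
    then have "?Q = Q" using max[OF hideal_hadd[OF Q pwR], of k] hadd_ge order_trans[OF KQ hadd_ge] by blast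
    then show ?thesis using hadd_mem[OF Q pwR, of k] by auto
  qed
  define S where "S p = {x + y | x y. x \<in> J p \<and> y \<in> Q p}" for p
  have SI: "x + y \<in> S p" if "x \<in> J p" "y \<in> Q p" for x y p unfolding S_def using that by blast
  have JS: "x \<in> S p" if "x \<in> J p" for x p using SI[OF that subgrp_0[OF hQ(1)]] by simp
  have QS: "x \<in> S p" if "x \<in> Q p" for x p using SI[OF subgrp_0[OF hJ(1)] that] by simp
  define \<psi> where "\<psi> p c = (THE z. \<exists>x\<in>J p. c - x \<in> Q p \<and> z = \<phi> p x)" for p c
  have \<psi>: "\<psi> p (x + y) = \<phi> p x" if x: "x \<in> J p" and y: "y \<in> Q p" for p x y
    unfolding \<psi>_def
  proof (rule the_equality)
    show "\<exists>x'\<in>J p. x + y - x' \<in> Q p \<and> \<phi> p x = \<phi> p x'" using x y by (intro bexI[of _ x]) auto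
    fix z assume "\<exists>x'\<in>J p. x + y - x' \<in> Q p \<and> z = \<phi> p x'"
    then obtain x' where x': "x' \<in> J p" "x + y - x' \<in> Q p" "z = \<phi> p x'" by blast
    have "(x + y - x') - y \<in> Q p" using subgrp_diff[OF hQ(1) x'(2) y] .
    then have "x - x' \<in> K p" using QJ subgrp_diff[OF hJ(1) x x'(1)] by (auto simp: algebra_simps)
    then show "z = \<phi> p x" using hhomD(2)[OF \<phi> x x'(1)] x'(3) by (simp add: K_def)
  qed
  have "hideal R S"
    unfolding hideal_def
  proof (intro conjI allI ballI)
    fix p
    show "subgrp (S p)"
    proof (rule subgrpI)
      show "0 \<in> S p" using JS subgrp_0[OF hJ(1)] by blast
      fix c c' assume "c \<in> S p" "c' \<in> S p"
      then obtain x y x' y' where *: "c = x + y" "x \<in> J p" "y \<in> Q p" "c' = x' + y'" "x' \<in> J p" "y' \<in> Q p"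
        unfolding S_def by blast
      have "c - c' = (x - x') + (y - y')" using * by simp
      then show "c - c' \<in> S p" using SI * subgrp_diff[OF hJ(1)] subgrp_diff[OF hQ(1)] by metis
    qed
    show "S p \<subseteq> R p" unfolding S_def using hJ(2) hQ(2) subgrp_add[OF R_sub] by blast
  next
    fix p q a c assume a: "a \<in> R p" and "c \<in> S q"
    then obtain x y where *: "c = x + y" "x \<in> J q" "y \<in> Q q" unfolding S_def by blast
    then show "a * c \<in> S (p + q)" using SI[OF hJ(3)[OF a *(2)] hQ(3)[OF a *(3)]] by (simp add: distrib_left)
  qed
  moreover have "hhom (*) act S Y d \<psi>"
    unfolding hhom_def
  proof (intro conjI allI ballI)
    fix p c assume "c \<in> S p"
    then obtain x y where *: "c = x + y" "x \<in> J p" "y \<in> Q p" unfolding S_def by blast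
    show "\<psi> p c \<in> Y (p + d)" using hhomD(1)[OF \<phi> *(2)] \<psi>[OF *(2,3)] *(1) by (simp add: tpart_def)
    fix c' assume "c' \<in> S p"
    then obtain x' y' where **: "c' = x' + y'" "x' \<in> J p" "y' \<in> Q p" unfolding S_def by blast
    have cc: "c - c' = (x - x') + (y - y')" using * ** by simp
    show "\<psi> p (c - c') = \<psi> p c - \<psi> p c'"
      unfolding cc
      using \<psi>[OF subgrp_diff[OF hJ(1) *(2) **(2)] subgrp_diff[OF hQ(1) *(3) **(3)]]
        \<psi>[OF *(2,3)] \<psi>[OF **(2,3)] hhomD(2)[OF \<phi> *(2) **(2)] *(1) **(1) by simp
  next
    fix p q a c assume a: "a \<in> R p" and "c \<in> S q"
    then obtain x y where *: "c = x + y" "x \<in> J q" "y \<in> Q q" unfolding S_def by blast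
    show "\<psi> (p + q) (a * c) = act a (\<psi> q c)"
      using \<psi>[OF hJ(3)[OF a *(2)] hQ(3)[OF a *(3)]] \<psi>[OF *(2,3)] hhomD(3)[OF \<phi> a *(2)] *(1)
      by (simp add: distrib_left)
  qed
  ultimately obtain e where e: "e \<in> Y d" "\<And>p c. c \<in> S p \<Longrightarrow> \<psi> p c = act c e" using baerD[OF B] by blast
  have "tors act e"
    unfolding tors_def
  proof
    fix f assume "f \<in> R 1"
    then obtain k where k: "pw f k \<in> Q (of_nat k)" using power by blast
    have "act (pw f k) e = \<psi> (of_nat k) (0 + pw f k)" using e(2)[OF QS[OF k]] by simp
    also have "\<dots> = 0" using \<psi>[OF subgrp_0[OF hJ(1)] k] hhom_0[OF \<phi> hJ(1)] by simp
    finally show "\<exists>t. (act f ^^ t) e = 0" using act_pw[OF act, of f k e] hmodD(3)[OF Y e(1)] by metis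
  qed
  moreover have "\<phi> p a = act a e" if a: "a \<in> J p" for p a
    using e(2)[OF JS[OF a]] \<psi>[OF a subgrp_0[OF hQ(1)]] by simp
  ultimately show "\<exists>e\<in>tpart act Y d. \<forall>p. \<forall>a\<in>J p. \<phi> p a = act a e"
    using e(1) by (intro bexI[of _ e]) (auto simp: tpart_def)
qed

text \<open>The identity of the torsion part extends to the whole module because the torsion part is
  itself injective. This is the splitting into torsion part and torsion-free complement.\<close>

lemma torsion_retraction:
  assumes "action act" "hmod act Y" "baer act Y"
  shows "\<exists>\<rho>. hhom act act Y (tpart act Y) 0 \<rho> \<and> (\<forall>n x. x \<in> tpart act Y n \<longrightarrow> \<rho> n x = x)"
proof -
  have "lingraph act act Y (tpart act Y) 0 {(n, x, x) | n x. x \<in> tpart act Y n}"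
    (is "lingraph _ _ _ _ _ ?G")
    unfolding lingraph_def
  proof (intro conjI allI impI)
    note T = hmodD(1,2)[OF hmod_tpart[OF assms(1,2)]]
    fix n x y assume "(n, x, y) \<in> ?G"
    then show "x \<in> Y n" "y \<in> tpart act Y (n + 0)" by (auto simp: tpart_def)
  next
    fix n show "(n, 0, 0) \<in> ?G" using subgrp_0[OF hmodD(1)[OF hmod_tpart[OF assms(1,2)]]] by blast
  next
    fix n x y x' y' assume "(n, x, y) \<in> ?G" "(n, x', y') \<in> ?G"
    then show "(n, x - x', y - y') \<in> ?G"
      using subgrp_diff[OF hmodD(1)[OF hmod_tpart[OF assms(1,2)]]] by blast
  next
    fix p n a x y assume "a \<in> R p" "(n, x, y) \<in> ?G"
    then show "(p + n, act a x, act a y) \<in> ?G" using hmodD(2)[OF hmod_tpart[OF assms(1,2)]] by blast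
  qed blast
  from baer_extension[OF assms(1,1,2) hmod_tpart[OF assms(1,2)] baer_tpart[OF assms] this]
  obtain h where h: "hhom act act Y (tpart act Y) 0 h" "\<And>n x y. (n, x, y) \<in> ?G \<Longrightarrow> h n x = y" by blast
  then show ?thesis by (intro exI[of _ h]) auto
qed

end

section \<open>Koszul complexes over an injective resolution\<close>

lemma antisymmetric_sum:
  fixes g :: "'i \<Rightarrow> 'i \<Rightarrow> 'w::ab_group_add"
  assumes "finite A" "\<And>k l. k \<in> A \<Longrightarrow> l \<in> A \<Longrightarrow> k \<noteq> l \<Longrightarrow> g k l = - g l k"
  shows "(\<Sum>k\<in>A. \<Sum>l\<in>A - {k}. g k l) = 0"
  using assms
proof (induction A rule: finite_induct)
  case (insert a A)
  have IH: "(\<Sum>k\<in>A. \<Sum>l\<in>A - {k}. g k l) = 0"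
    by (rule insert.IH) (use insert.prems in blast)
  have "(\<Sum>l\<in>insert a A - {k}. g k l) = g k a + (\<Sum>l\<in>A - {k}. g k l)" if "k \<in> A" for k
  proof -
    have "insert a A - {k} = insert a (A - {k})" using that insert.hyps by auto
    then show ?thesis using insert.hyps by simp
  qed
  then have "(\<Sum>k\<in>A. \<Sum>l\<in>insert a A - {k}. g k l) = (\<Sum>k\<in>A. g k a)"
    using IH by (simp add: sum.distrib)
  also have "\<dots> = (\<Sum>k\<in>A. - g a k)" by (intro sum.cong refl insert.prems) (use insert.hyps in auto)
  finally have "(\<Sum>k\<in>A. \<Sum>l\<in>insert a A - {k}. g k l) = - (\<Sum>k\<in>A. g a k)" by (simp add: sum_negf)
  moreover have "insert a A - {a} = A" using insert.hyps by auto
  ultimately show ?case using insert.hyps by simp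
qed simp

definition alt :: "nat \<Rightarrow> 'w::ab_group_add \<Rightarrow> 'w" where
  "alt n v = (if even n then v else - v)"

lemma alt_0 [simp]: "alt n 0 = 0" by (simp add: alt_def)
lemma alt_Suc: "alt (Suc n) v = - alt n v" by (simp add: alt_def)
lemma alt_alt: "alt m (alt n v) = alt (m + n) v" by (auto simp: alt_def)
lemma alt_same [simp]: "alt n (alt n v) = v" by (simp add: alt_def)
lemma alt_diff: "alt n (v - w) = alt n v - alt n w" by (simp add: alt_def)
lemma alt_add: "alt n (v + w) = alt n v + alt n w" by (simp add: alt_def)
lemma alt_minus: "alt n (- v) = - alt n v" by (simp add: alt_def)
lemma alt_sum: "alt n (sum f I) = (\<Sum>i\<in>I. alt n (f i))" by (simp add: alt_def sum_negf)
lemma alt_subgrp: "subgrp X \<Longrightarrow> x \<in> X \<Longrightarrow> alt n x \<in> X" by (simp add: alt_def subgrp_minus)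

definition pos :: "nat set \<Rightarrow> nat \<Rightarrow> nat" where
  "pos S k = card {l \<in> S. l < k}"

lemma pos_insert: "finite S \<Longrightarrow> l \<notin> S \<Longrightarrow> pos (insert l S) k = (if l < k then Suc (pos S k) else pos S k)"
proof -
  assume "finite S" "l \<notin> S"
  moreover have "{j \<in> insert l S. j < k} = (if l < k then insert l {j \<in> S. j < k} else {j \<in> S. j < k})" by auto
  ultimately show ?thesis by (simp add: pos_def)
qed

definition actf :: "('b \<Rightarrow> 'w \<Rightarrow> 'w) \<Rightarrow> 'b \<Rightarrow> ('s \<Rightarrow> 'w) \<Rightarrow> 's \<Rightarrow> 'w" where
  "actf act a z = (\<lambda>S. act a (z S))"

lemma actf_pow: "(actf act a ^^ t) z = (\<lambda>S. (act a ^^ t) (z S))"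
  by (induction t) (auto simp: actf_def)

text \<open>One map \<open>\<delta>\<close> on the ambient group serves all degrees, and the complex
  is zero in negative degrees, so that index arithmetic takes place in \<open>int\<close>. The
  resolved module is the kernel of \<open>\<delta>\<close> on \<open>E 0\<close>.\<close>

locale hcomplex = hring R one + action act
  for R :: "int ^ 'r \<Rightarrow> 'b::comm_ring set" and one :: 'b
    and act :: "'b \<Rightarrow> 'w::ab_group_add \<Rightarrow> 'w" +
  fixes E :: "int \<Rightarrow> int ^ 'r \<Rightarrow> 'w set" and \<delta> :: "'w \<Rightarrow> 'w"
  assumes E_mod: "hmod act (E j)"
    and E_neg: "j < 0 \<Longrightarrow> E j n = {0}"
    and \<delta>_diff: "\<delta> (x - y) = \<delta> x - \<delta> y"
    and \<delta>_act: "\<delta> (act a x) = act a (\<delta> x)"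
    and \<delta>_E: "x \<in> E j n \<Longrightarrow> \<delta> x \<in> E (j + 1) n"
    and \<delta>_\<delta> [simp]: "\<delta> (\<delta> x) = 0"
    and E_exact: "1 \<le> j \<Longrightarrow> x \<in> E j n \<Longrightarrow> \<delta> x = 0 \<Longrightarrow> \<exists>y\<in>E (j - 1) n. \<delta> y = x"
    and E_baer: "baer act (E j)"
begin

lemma \<delta>_0 [simp]: "\<delta> 0 = 0" using \<delta>_diff[of 0 0] by simp
lemma \<delta>_minus: "\<delta> (- x) = - \<delta> x" using \<delta>_diff[of 0 x] by simp
lemma \<delta>_add: "\<delta> (x + y) = \<delta> x + \<delta> y" using \<delta>_diff[of x "- y"] by (simp add: \<delta>_minus)
lemma \<delta>_sum: "\<delta> (sum f I) = (\<Sum>i\<in>I. \<delta> (f i))"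
  by (induction I rule: infinite_finite_induct) (auto simp: \<delta>_add)
lemma \<delta>_alt: "\<delta> (alt n x) = alt n (\<delta> x)" by (simp add: alt_def \<delta>_minus)
lemma act_alt: "act a (alt n x) = alt n (act a x)" by (simp add: alt_def act_minus)

lemma action_act: "action act" by (rule action_axioms)

lemma action_actf: "action (actf act)"
  by unfold_locales (auto simp: actf_def act_add act_plus act_mult)

text \<open>Families of coefficients closed under \<open>\<delta>\<close>; the instances are
  \<open>E\<close> and its torsion part.\<close>

definition cfam :: "(int \<Rightarrow> int ^ 'r \<Rightarrow> 'w set) \<Rightarrow> bool" where
  "cfam X \<longleftrightarrow> (\<forall>j. hmod act (X j)) \<and> (\<forall>j n. \<forall>x\<in>X j n. \<delta> x \<in> X (j + 1) n)"

lemma cfam_E: "cfam E"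
  by (simp add: cfam_def E_mod \<delta>_E)

lemma tors_\<delta>: "tors act x \<Longrightarrow> tors act (\<delta> x)"
proof -
  have "(act f ^^ t) (\<delta> x) = \<delta> ((act f ^^ t) x)" for f t by (induction t) (auto simp: \<delta>_act)
  then show "tors act x \<Longrightarrow> tors act (\<delta> x)" unfolding tors_def by (metis \<delta>_0)
qed

lemma cfam_tpart: "cfam (\<lambda>j. tpart act (E j))"
  using hmod_tpart[OF action_act E_mod] \<delta>_E tors_\<delta> by (auto simp: cfam_def tpart_def)

end

locale koszul = hcomplex R one act E \<delta>
  for R :: "int ^ 'r \<Rightarrow> 'b::comm_ring set" and one :: 'b
    and act :: "'b \<Rightarrow> 'w::ab_group_add \<Rightarrow> 'w" and E \<delta> +
  fixes h :: nat and g :: "nat \<Rightarrow> 'b" and dg :: "nat \<Rightarrow> int ^ 'r"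
  assumes g_R: "k < h \<Longrightarrow> g k \<in> R (dg k)"
begin

text \<open>The differential of the total complex of \<open>E\<close> and the Koszul complex of \<open>g\<close>. A chain \<open>z\<close> of degree
  \<open>k\<close> has its component \<open>z S\<close> in \<open>E (k + |S|)\<close>, and \<open>alt\<close> and \<open>pos\<close> produce the signs.\<close>

definition D :: "(nat set \<Rightarrow> 'w) \<Rightarrow> nat set \<Rightarrow> 'w" where
  "D z S = alt (card S) (\<delta> (z S)) + (\<Sum>k\<in>{..<h} - S. alt (pos S k) (act (g k) (z (insert k S))))"

text \<open>The mixed terms cancel because inserting an index changes \<open>card S\<close> by one;
  the pure Koszul terms are antisymmetric in the two inserted indices.\<close>

lemma D_D:
  assumes S: "S \<subseteq> {..<h}"
  shows "D (D z) S = 0"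
proof -
  have fin: "finite S" using S finite_subset by blast
  let ?A = "{..<h} - S"
  define G where "G k l = alt (pos S k + pos (insert k S) l) (act (g k) (act (g l) (z (insert l (insert k S)))))" for k l
  have "(\<Sum>k\<in>?A. alt (pos S k) (act (g k) (D z (insert k S)))) =
     (\<Sum>k\<in>?A. - alt (card S) (\<delta> (alt (pos S k) (act (g k) (z (insert k S))))) + (\<Sum>l\<in>?A - {k}. G k l))"
  proof (rule sum.cong[OF refl])
    fix k assume k: "k \<in> ?A"
    have *: "{..<h} - insert k S = ?A - {k}" by auto
    have c: "card (insert k S) = Suc (card S)" using k fin by simp
    show "alt (pos S k) (act (g k) (D z (insert k S))) =
      - alt (card S) (\<delta> (alt (pos S k) (act (g k) (z (insert k S))))) + (\<Sum>l\<in>?A - {k}. G k l)"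
      unfolding D_def[of z "insert k S"] * c G_def
      by (simp only: act_minus act_add act_sum act_alt alt_add alt_Suc alt_minus \<delta>_alt \<delta>_act alt_sum alt_alt add.commute[of "pos S k" "card S"])
  qed
  also have "\<dots> = - alt (card S) (\<delta> (\<Sum>k\<in>?A. alt (pos S k) (act (g k) (z (insert k S))))) +
      (\<Sum>k\<in>?A. \<Sum>l\<in>?A - {k}. G k l)"
    by (simp only: sum.distrib sum_negf \<delta>_sum alt_sum)
  also have "(\<Sum>k\<in>?A. \<Sum>l\<in>?A - {k}. G k l) = 0"
  proof (rule antisymmetric_sum)
    fix k l assume kl: "k \<in> ?A" "l \<in> ?A" "k \<noteq> l"
    have "pos (insert k S) l = (if k < l then Suc (pos S l) else pos S l)"
      "pos (insert l S) k = (if l < k then Suc (pos S k) else pos S k)"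
      using kl fin by (simp_all add: pos_insert)
    moreover have "act (g k) (act (g l) (z (insert l (insert k S)))) = act (g l) (act (g k) (z (insert k (insert l S))))"
      by (simp add: act_commute insert_commute)
    ultimately show "G k l = - G l k" unfolding G_def using kl(3) by (cases "k < l") (auto simp: alt_def)
  qed simp
  finally show ?thesis
    unfolding D_def[of "D z" S] by (subst D_def[of z S]) (simp add: \<delta>_add \<delta>_alt alt_diff)
qed

lemma D_diff: "D (z - w) S = D z S - D w S"
  by (simp add: D_def \<delta>_diff alt_diff act_diff sum_subtractf)

lemma D_act: "D (actf act a z) S = act a (D z S)"
  by (simp add: D_def actf_def \<delta>_act act_add act_alt act_sum act_commute[of a])

definition contracting :: "nat \<Rightarrow> (nat set \<Rightarrow> 'w) \<Rightarrow> nat set \<Rightarrow> 'w" where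
  "contracting u z S = (if u \<in> S then alt (pos S u) (z (S - {u})) else 0)"

text \<open>The classical homotopy by which a member of the system acts by zero on its Koszul
  complex. It also commutes with \<open>\<delta>\<close> up to the right sign, since it changes
  \<open>card S\<close> by one.\<close>

lemma D_contracting:
  assumes S: "S \<subseteq> {..<h}" and u: "u < h"
  shows "D (contracting u z) S + contracting u (D z) S = act (g u) (z S)"
proof (cases "u \<in> S")
  case False
  have fin: "finite S" using S finite_subset by blast
  have "(\<Sum>k\<in>{..<h} - S. alt (pos S k) (act (g k) (contracting u z (insert k S)))) =
      (\<Sum>k\<in>{..<h} - S. if k = u then act (g u) (z S) else 0)"
    using False fin by (intro sum.cong) (auto simp: contracting_def pos_insert act_alt)
  also have "\<dots> = act (g u) (z S)" using False u by simp
  finally show ?thesis using False by (simp add: D_def contracting_def)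
next
  case True
  have fin: "finite S" using S finite_subset by blast
  define T where "T = S - {u}"
  have T: "S = insert u T" "u \<notin> T" "finite T" using True fin by (auto simp: T_def)
  have A: "{..<h} - T = insert u ({..<h} - S)" "u \<notin> {..<h} - S" using T u by auto
  have c: "card S = Suc (card T)" using T by simp
  have pu: "pos S u = pos T u" using T by (simp add: pos_insert)
  have "contracting u (D z) S = alt (pos T u) (alt (card T) (\<delta> (z T))) + act (g u) (z S) +
     (\<Sum>k\<in>{..<h} - S. alt (pos T u) (alt (pos T k) (act (g k) (z (insert k T)))))"
  proof -
    have "D z T = alt (card T) (\<delta> (z T)) + (alt (pos T u) (act (g u) (z S)) +
        (\<Sum>k\<in>{..<h} - S. alt (pos T k) (act (g k) (z (insert k T)))))"
      unfolding D_def A(1) using A(2) by (simp add: T(1)[symmetric])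
    moreover have "contracting u (D z) S = alt (pos T u) (D z T)" using True by (simp add: contracting_def pu T_def)
    ultimately show ?thesis by (simp only: alt_add alt_sum alt_same add.assoc)
  qed
  moreover have "D (contracting u z) S = - alt (card T) (\<delta> (alt (pos T u) (z T))) +
     (\<Sum>k\<in>{..<h} - S. - alt (pos T u) (alt (pos T k) (act (g k) (z (insert k T)))))"
  proof -
    have "alt (pos S k) (act (g k) (contracting u z (insert k S))) =
      - alt (pos T u) (alt (pos T k) (act (g k) (z (insert k T))))" if k: "k \<in> {..<h} - S" for k
    proof -
      have ku: "k \<noteq> u" "k \<notin> S" using k T by auto
      have "insert k S - {u} = insert k T" using T ku by auto
      moreover have "pos (insert k S) u = (if k < u then Suc (pos T u) else pos T u)"
        using ku fin pu by (simp add: pos_insert)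
      moreover have "pos S k = (if u < k then Suc (pos T k) else pos T k)" using T by (simp add: pos_insert)
      ultimately show ?thesis using True ku by (simp add: contracting_def act_alt) (auto simp: alt_def)
    qed
    then show ?thesis by (simp add: D_def c alt_Suc contracting_def True pu T_def[symmetric])
  qed
  ultimately show ?thesis by (simp add: sum_negf \<delta>_alt) (simp add: alt_def)
qed

definition mdeg :: "nat set \<Rightarrow> int ^ 'r" where
  "mdeg S = (\<Sum>k\<in>S. dg k)"

text \<open>The shifts make \<open>D\<close> raise \<open>k\<close> by one and preserve
  \<open>n\<close>: the component at \<open>S\<close> receives \<open>g k\<close> times the
  component at \<open>insert k S\<close>, which has multidegree larger by \<open>dg k\<close> and
  sits one step higher in \<open>E\<close>.\<close>

definition chains :: "(int \<Rightarrow> int ^ 'r \<Rightarrow> 'w set) \<Rightarrow> nat set set \<Rightarrow> int \<Rightarrow> int ^ 'r \<Rightarrow> (nat set \<Rightarrow> 'w) set" where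
  "chains X B k n = {z. (\<forall>S. S \<notin> B \<longrightarrow> z S = 0) \<and> (\<forall>S\<in>B. z S \<in> X (k + int (card S)) (n - mdeg S))}"

text \<open>The components with index in a convex family \<open>B\<close> form a subquotient of the total complex.\<close>

definition DB :: "nat set set \<Rightarrow> (nat set \<Rightarrow> 'w) \<Rightarrow> nat set \<Rightarrow> 'w" where
  "DB B z S = (if S \<in> B then D z S else 0)"

definition convex_family :: "nat set set \<Rightarrow> bool" where
  "convex_family B \<longleftrightarrow> B \<subseteq> Pow {..<h} \<and> (\<forall>S T U. S \<in> B \<longrightarrow> U \<in> B \<longrightarrow> S \<subseteq> T \<longrightarrow> T \<subseteq> U \<longrightarrow> T \<in> B)"

lemma convex_family_finite: "convex_family B \<Longrightarrow> S \<in> B \<Longrightarrow> S \<subseteq> {..<h} \<and> finite S"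
  unfolding convex_family_def using finite_subset by blast

lemma finite_convex_family: "convex_family B \<Longrightarrow> finite B"
  unfolding convex_family_def by (meson finite_Pow_iff finite_lessThan finite_subset)

lemma chainsD:
  assumes "z \<in> chains X B k n"
  shows "S \<notin> B \<Longrightarrow> z S = 0" "S \<in> B \<Longrightarrow> z S \<in> X (k + int (card S)) (n - mdeg S)"
  using assms by (auto simp: chains_def)

lemma chains_mono: "(\<And>j n. X j n \<subseteq> Y j n) \<Longrightarrow> chains X B k n \<subseteq> chains Y B k n"
  unfolding chains_def by blast

lemma hmod_chains:
  assumes "\<And>j. hmod act (X j)"
  shows "hmod (actf act) (chains X B k)"
  unfolding hmod_def
proof (intro conjI allI ballI)
  fix n show "subgrp (chains X B k n)"
    using hmodD(1)[OF assms] by (auto simp: chains_def subgrp_def)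
next
  fix p q a z assume "a \<in> R p" "z \<in> chains X B k q"
  then show "actf act a z \<in> chains X B k (p + q)"
    using hmodD(2)[OF assms, of a p] by (auto simp: chains_def actf_def add_diff_eq[symmetric])
next
  fix n z assume "z \<in> chains X B k n"
  then show "actf act one z = z"
  proof (intro ext)
    fix S show "actf act one z S = z S"
      using \<open>z \<in> chains X B k n\<close> hmodD(3)[OF assms] by (cases "S \<in> B") (auto simp: actf_def chains_def)
  qed
qed

lemma mdeg_insert: "finite S \<Longrightarrow> k \<notin> S \<Longrightarrow> mdeg (insert k S) = dg k + mdeg S"
  by (simp add: mdeg_def)

lemma DB_chains:
  assumes X: "cfam X" and B: "convex_family B" and z: "z \<in> chains X B k n"
  shows "DB B z \<in> chains X B (k + 1) n"
proof -
  have Xm: "hmod act (X j)" for j using X by (simp add: cfam_def)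
  have "D z S \<in> X (k + 1 + int (card S)) (n - mdeg S)" if S: "S \<in> B" for S
  proof -
    note fin = convex_family_finite[OF B S]
    have "\<delta> (z S) \<in> X (k + int (card S) + 1) (n - mdeg S)"
      using X chainsD(2)[OF z S] unfolding cfam_def by blast
    then have 1: "\<delta> (z S) \<in> X (k + 1 + int (card S)) (n - mdeg S)" by (simp add: algebra_simps)
    have 2: "act (g l) (z (insert l S)) \<in> X (k + 1 + int (card S)) (n - mdeg S)" if l: "l \<in> {..<h} - S" for l
    proof (cases "insert l S \<in> B")
      case True
      have "act (g l) (z (insert l S)) \<in> X (k + int (card (insert l S))) (dg l + (n - mdeg (insert l S)))"
        using hmodD(2)[OF Xm g_R chainsD(2)[OF z True]] l by simp
      then show ?thesis using l fin by (simp add: mdeg_insert algebra_simps)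
    next
      case False
      then show ?thesis using chainsD(1)[OF z] subgrp_0[OF hmodD(1)[OF Xm]] by simp
    qed
    show ?thesis unfolding D_def
      by (intro subgrp_add[OF hmodD(1)[OF Xm]] subgrp_sum[OF hmodD(1)[OF Xm]] alt_subgrp[OF hmodD(1)[OF Xm]] 1 2)
  qed
  then show ?thesis by (auto simp: chains_def DB_def)
qed

lemma DB_diff: "DB B (z - w) = DB B z - DB B w"
  by (auto simp: DB_def D_diff fun_eq_iff)

lemma DB_act: "DB B (actf act a z) = actf act a (DB B z)"
  by (auto simp: DB_def D_act fun_eq_iff actf_def[of act a "DB B z"])

lemma DB_0 [simp]: "DB B 0 = 0" using DB_diff[of B 0 0] by simp
lemma DB_minus: "DB B (- z) = - DB B z" using DB_diff[of B 0 z] by simp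
lemma DB_add: "DB B (z + w) = DB B z + DB B w" using DB_diff[of B z "- w"] by (simp add: DB_minus)

text \<open>Convexity enters here: if \<open>insert k S\<close> leaves \<open>B\<close>, then so
  does every larger set, so that \<open>D z\<close> vanishes at \<open>insert k S\<close> by itself
  and truncating it between the two differentials changes nothing.\<close>

lemma DB_DB:
  assumes B: "convex_family B" and z: "\<And>S. S \<notin> B \<Longrightarrow> z S = 0"
  shows "DB B (DB B z) = 0"
proof
  fix S
  show "DB B (DB B z) S = 0 S"
  proof (cases "S \<in> B")
    case True
    note fin = convex_family_finite[OF B True]
    have "act (g k) (DB B z (insert k S)) = act (g k) (D z (insert k S))" if k: "k \<in> {..<h} - S" for k
    proof (cases "insert k S \<in> B")
      case False
      have "insert l (insert k S) \<notin> B" for l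
      proof
        assume "insert l (insert k S) \<in> B"
        moreover have "S \<subseteq> insert k S" "insert k S \<subseteq> insert l (insert k S)" by auto
        ultimately show False using B True False unfolding convex_family_def by metis
      qed
      then have "z (insert l (insert k S)) = 0" for l using z by simp
      then have "D z (insert k S) = 0" using z[OF False] by (simp add: D_def)
      then show ?thesis using False by (simp add: DB_def)
    qed (simp add: DB_def)
    then have "D (DB B z) S = D (D z) S" using True by (simp add: D_def[of _ S] DB_def[of B z S])
    then show ?thesis using D_D fin True by (simp add: DB_def)
  qed (simp add: DB_def)
qed

text \<open>There are only finitely many components, so the exponents for a given \<open>f\<close>
  can be added up.\<close>

lemma tors_chain:
  assumes "finite B" "\<And>S. S \<notin> B \<Longrightarrow> z S = 0"
  shows "tors (actf act) z \<longleftrightarrow> (\<forall>S\<in>B. tors act (z S))"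
proof
  assume "tors (actf act) z"
  then show "\<forall>S\<in>B. tors act (z S)" unfolding tors_def actf_pow by (metis zero_fun_apply)
next
  assume *: "\<forall>S\<in>B. tors act (z S)"
  show "tors (actf act) z"
    unfolding tors_def
  proof
    fix f assume f: "f \<in> R 1"
    then have "\<forall>S\<in>B. \<exists>t. (act f ^^ t) (z S) = 0" using * by (auto simp: tors_def)
    then obtain t where t: "\<And>S. S \<in> B \<Longrightarrow> (act f ^^ t S) (z S) = 0" by metis
    have "(actf act f ^^ (\<Sum>S\<in>B. t S)) z = 0"
      unfolding actf_pow
    proof (rule ext)
      fix S show "(act f ^^ (\<Sum>S\<in>B. t S)) (z S) = 0 S"
      proof (cases "S \<in> B")
        case True
        then show ?thesis using act_pow_mono[OF t[OF True]] member_le_sum[of S B t] assms(1) by simp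
      qed (simp add: assms)
    qed
    then show "\<exists>t. (actf act f ^^ t) z = 0" by blast
  qed
qed

lemma tors_DB: "tors (actf act) z \<Longrightarrow> tors (actf act) (DB B z)"
proof -
  have "(actf act f ^^ t) (DB B z) = DB B ((actf act f ^^ t) z)" for f t
    by (induction t) (auto simp: DB_act)
  then show "tors (actf act) z \<Longrightarrow> tors (actf act) (DB B z)" unfolding tors_def by (metis DB_0)
qed

end

section \<open>Acyclicity up to torsion by contracting homotopies\<close>

context koszul
begin

text \<open>The annihilator of the cohomology of the complex on \<open>B\<close> taken modulo its
  torsion chains.\<close>

definition kill :: "nat set set \<Rightarrow> int ^ 'r \<Rightarrow> 'b set" where
  "kill B d = {a \<in> R d. \<forall>k n. \<forall>z\<in>chains E B k n. tors (actf act) (DB B z) \<longrightarrow>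
     (\<exists>w\<in>chains E B (k - 1) (d + n). tors (actf act) (actf act a z - DB B w))}"

lemma action_chains: "action (actf act)" by (rule action_actf)

lemma hmod_chains_E: "hmod (actf act) (chains E B k)"
  by (rule hmod_chains[OF E_mod])

lemma hideal_kill: "hideal R (kill B)"
  unfolding hideal_def
proof (intro conjI allI ballI)
  interpret c: action "actf act" by (rule action_chains)
  note C = hmodD[OF hmod_chains_E]
  fix p
  show "kill B p \<subseteq> R p" by (auto simp: kill_def)
  show "subgrp (kill B p)"
  proof (rule subgrpI)
    show "0 \<in> kill B p"
      unfolding kill_def
    proof (intro CollectI conjI subgrp_0[OF R_sub] allI ballI impI)
      fix k n z
      show "\<exists>w\<in>chains E B (k - 1) (p + n). tors (actf act) (actf act 0 z - DB B w)"
        by (rule bexI[of _ 0]) (auto simp: tors_0[OF action_chains] subgrp_0[OF C(1)])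
    qed
    fix a b assume a: "a \<in> kill B p" and b: "b \<in> kill B p"
    show "a - b \<in> kill B p"
      unfolding kill_def
    proof (intro CollectI conjI allI ballI impI)
      show "a - b \<in> R p" using a b subgrp_diff[OF R_sub] by (auto simp: kill_def)
      fix k n z assume "z \<in> chains E B k n" "tors (actf act) (DB B z)"
      then obtain v w where *: "v \<in> chains E B (k - 1) (p + n)" "tors (actf act) (actf act a z - DB B v)"
        "w \<in> chains E B (k - 1) (p + n)" "tors (actf act) (actf act b z - DB B w)"
        using a b unfolding kill_def by blast
      have "actf act (a - b) z - DB B (v - w) = (actf act a z - DB B v) - (actf act b z - DB B w)"
        by (simp add: DB_diff c.act_subtract)
      then show "\<exists>w\<in>chains E B (k - 1) (p + n). tors (actf act) (actf act (a - b) z - DB B w)"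
        using tors_diff[OF action_chains *(2,4)] subgrp_diff[OF C(1) *(1,3)] by (intro bexI[of _ "v - w"]) simp_all
    qed
  qed
next
  interpret c: action "actf act" by (rule action_chains)
  fix p q a x assume a: "a \<in> R p" and x: "x \<in> kill B q"
  show "a * x \<in> kill B (p + q)"
    unfolding kill_def
  proof (intro CollectI conjI allI ballI impI)
    show "a * x \<in> R (p + q)" using R_mult[OF a] x by (auto simp: kill_def)
    fix k n z assume "z \<in> chains E B k n" "tors (actf act) (DB B z)"
    then obtain w where *: "w \<in> chains E B (k - 1) (q + n)" "tors (actf act) (actf act x z - DB B w)"
      using x unfolding kill_def by blast
    have "actf act (a * x) z - DB B (actf act a w) = actf act a (actf act x z - DB B w)"
      by (simp add: DB_act c.act_mult c.act_diff)
    then show "\<exists>w\<in>chains E B (k - 1) (p + q + n). tors (actf act) (actf act (a * x) z - DB B w)"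
      using tors_act[OF action_chains *(2), of a] hmodD(2)[OF hmod_chains_E a *(1)]
      by (intro bexI[of _ "actf act a w"]) (simp_all add: add.assoc)
  qed
qed

definition acyclic_mod_tors :: "nat set set \<Rightarrow> int \<Rightarrow> bool" where
  "acyclic_mod_tors B k \<longleftrightarrow> (\<forall>n. \<forall>z\<in>chains E B k n. tors (actf act) (DB B z) \<longrightarrow>
     (\<exists>w\<in>chains E B (k - 1) n. tors (actf act) (z - DB B w)))"

text \<open>A retraction onto the torsion part; its kernel \<open>E0\<close> is the torsion-free complement.\<close>

definition \<rho> :: "int \<Rightarrow> int ^ 'r \<Rightarrow> 'w \<Rightarrow> 'w" where
  "\<rho> j = (SOME r. hhom act act (E j) (tpart act (E j)) 0 r \<and> (\<forall>n x. x \<in> tpart act (E j) n \<longrightarrow> r n x = x))"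

lemma \<rho>: "hhom act act (E j) (tpart act (E j)) 0 (\<rho> j)" "x \<in> E j n \<Longrightarrow> tors act x \<Longrightarrow> \<rho> j n x = x"
  using someI_ex[OF torsion_retraction[OF action_act E_mod E_baer], of j]
  unfolding \<rho>_def[symmetric] by (auto simp: tpart_def)

lemma \<rho>_tors: "x \<in> E j n \<Longrightarrow> tors act (\<rho> j n x) \<and> \<rho> j n x \<in> E j n"
  using hhomD(1)[OF \<rho>(1)] by (auto simp: tpart_def)

definition E0 :: "int \<Rightarrow> int ^ 'r \<Rightarrow> 'w set" where
  "E0 j n = {x \<in> E j n. \<rho> j n x = 0}"

lemma hmod_E0: "hmod act (E0 j)"
  unfolding hmod_def E0_def
proof (intro conjI allI ballI)
  note Es = hmodD[OF E_mod]
  fix n show "subgrp {x \<in> E j n. \<rho> j n x = 0}"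
    using subgrp_0[OF Es(1)] subgrp_diff[OF Es(1)] hhom_0[OF \<rho>(1) Es(1)] hhomD(2)[OF \<rho>(1)]
    by (intro subgrpI) auto
next
  note Es = hmodD[OF E_mod]
  fix p q a x assume "a \<in> R p" "x \<in> {x \<in> E j q. \<rho> j q x = 0}"
  then show "act a x \<in> {x \<in> E j (p + q). \<rho> j (p + q) x = 0}"
    using Es(2) hhomD(3)[OF \<rho>(1)] by auto
next
  fix n x assume "x \<in> {x \<in> E j n. \<rho> j n x = 0}"
  then show "act one x = x" using hmodD(3)[OF E_mod] by blast
qed

text \<open>A direct summand of an injective module: the element representing \<open>\<phi>\<close>
  in \<open>E j\<close> is replaced by its \<open>E0\<close>-part, which represents
  \<open>\<phi>\<close> too because \<open>\<rho>\<close> kills the values of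
  \<open>\<phi>\<close>.\<close>

lemma baer_E0: "baer act (E0 j)"
  unfolding baer_def
proof (intro allI impI)
  note Es = hmodD[OF E_mod]
  fix J d \<phi> assume J: "hideal R J" and \<phi>: "hhom (*) act J (E0 j) d \<phi>"
  have "hhom (*) act J (E j) d \<phi>" using \<phi> unfolding hhom_def E0_def by blast
  then obtain e where e: "e \<in> E j d" "\<And>p a. a \<in> J p \<Longrightarrow> \<phi> p a = act a e" using baerD[OF E_baer J] by blast
  define e' where "e' = e - \<rho> j d e"
  have "e' \<in> E j d" using subgrp_diff[OF Es(1) e(1)] \<rho>_tors[OF e(1)] by (simp add: e'_def)
  moreover have "\<rho> j d e' = 0"
    using hhomD(2)[OF \<rho>(1) e(1), of "\<rho> j d e"] \<rho>_tors[OF e(1)] \<rho>(2)[of "\<rho> j d e" j d] by (simp add: e'_def)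
  moreover have "\<phi> p a = act a e'" if a: "a \<in> J p" for p a
  proof -
    have "0 = \<rho> j (p + d) (\<phi> p a)" using hhomD(1)[OF \<phi> a] by (simp add: E0_def)
    also have "\<dots> = act a (\<rho> j d e)" using e(2)[OF a] hhomD(3)[OF \<rho>(1) hidealD(2)[OF J a] e(1)] by simp
    finally show ?thesis using e(2)[OF a] by (simp add: e'_def act_diff)
  qed
  ultimately show "\<exists>e\<in>E0 j d. \<forall>p. \<forall>a\<in>J p. \<phi> p a = act a e" unfolding E0_def by blast
qed

lemma baer_chains_E0: "baer (actf act) (chains E0 B k)"
  unfolding baer_def
proof (intro allI impI)
  fix J d \<phi> assume J: "hideal R J" and \<phi>: "hhom (*) (actf act) J (chains E0 B k) d \<phi>"
  have "\<exists>e\<in>E0 (k + int (card S)) (d - mdeg S). \<forall>p. \<forall>a\<in>J p. \<phi> p a S = act a e" if S: "S \<in> B" for S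
  proof -
    have "hhom (*) act J (E0 (k + int (card S))) (d - mdeg S) (\<lambda>p a. \<phi> p a S)"
      unfolding hhom_def
      using chainsD(2)[OF hhomD(1)[OF \<phi>] S] hhomD(2,3)[OF \<phi>] by (auto simp: actf_def add_diff_eq)
    from baerD[OF baer_E0 J this] show ?thesis .
  qed
  then obtain e where e: "\<And>S. S \<in> B \<Longrightarrow> e S \<in> E0 (k + int (card S)) (d - mdeg S)"
    "\<And>S p a. S \<in> B \<Longrightarrow> a \<in> J p \<Longrightarrow> \<phi> p a S = act a (e S)" by metis
  define e' where "e' S = (if S \<in> B then e S else 0)" for S
  have "e' \<in> chains E0 B k d" using e(1) by (auto simp: chains_def e'_def)
  moreover have "\<phi> p a = actf act a e'" if a: "a \<in> J p" for p a
  proof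
    fix S show "\<phi> p a S = actf act a e' S"
      using e(2)[OF _ a] chainsD(1)[OF hhomD(1)[OF \<phi> a]] by (simp add: actf_def e'_def)
  qed
  ultimately show "\<exists>e\<in>chains E0 B k d. \<forall>p. \<forall>a\<in>J p. \<phi> p a = actf act a e" by blast
qed

text \<open>The projection along the torsion chains. It identifies the chains modulo torsion with
  the injective, torsion-free chains over \<open>E0\<close>.\<close>

definition pr :: "nat set set \<Rightarrow> int \<Rightarrow> int ^ 'r \<Rightarrow> (nat set \<Rightarrow> 'w) \<Rightarrow> nat set \<Rightarrow> 'w" where
  "pr B k n z S = (if S \<in> B then z S - \<rho> (k + int (card S)) (n - mdeg S) (z S) else 0)"

lemma pr_hom: "hhom (actf act) (actf act) (chains E B k) (chains E0 B k) 0 (pr B k)"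
  unfolding hhom_def
proof (intro conjI allI ballI)
  fix n z assume z: "z \<in> chains E B k n"
  have "x - \<rho> j m x \<in> E0 j m" if x: "x \<in> E j m" for j m x
    unfolding E0_def
    using subgrp_diff[OF hmodD(1)[OF E_mod] x] \<rho>_tors[OF x] hhomD(2)[OF \<rho>(1) x, of "\<rho> j m x"] \<rho>(2)[of "\<rho> j m x"]
    by simp
  then show "pr B k n z \<in> chains E0 B k (n + 0)"
    using chainsD(2)[OF z] by (simp add: chains_def pr_def)
  fix w assume w: "w \<in> chains E B k n"
  show "pr B k n (z - w) = pr B k n z - pr B k n w"
    using hhomD(2)[OF \<rho>(1)] chainsD(2)[OF z] chainsD(2)[OF w] by (auto simp: pr_def fun_eq_iff)
next
  fix p n a z assume a: "a \<in> R p" and z: "z \<in> chains E B k n"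
  have "\<rho> (k + int (card S)) (p + n - mdeg S) (act a (z S)) = act a (\<rho> (k + int (card S)) (n - mdeg S) (z S))"
    if "S \<in> B" for S
    using hhomD(3)[OF \<rho>(1) a chainsD(2)[OF z that]] by (simp add: add_diff_eq)
  then show "pr B k (p + n) (actf act a z) = actf act a (pr B k n z)"
    by (auto simp: pr_def actf_def act_diff)
qed

lemma pr_tors:
  assumes B: "finite B" and z: "z \<in> chains E B k n"
  shows "tors (actf act) z \<Longrightarrow> pr B k n z = 0" "tors (actf act) (z - pr B k n z)"
proof -
  show "tors (actf act) z \<Longrightarrow> pr B k n z = 0"
    using tors_chain[OF B chainsD(1)[OF z]] \<rho>(2)[OF chainsD(2)[OF z]] by (auto simp: pr_def fun_eq_iff)
  show "tors (actf act) (z - pr B k n z)"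
    using \<rho>_tors[OF chainsD(2)[OF z]] chainsD(1)[OF z] by (subst tors_chain[OF B]) (auto simp: pr_def)
qed

lemma E0_sub: "E0 j n \<subseteq> E j n" by (auto simp: E0_def)

lemma chains_E0_sub: "chains E0 B k n \<subseteq> chains E B k n"
  by (rule chains_mono[OF E0_sub])

lemma chains_E0_torsfree:
  assumes B: "finite B" and z: "z \<in> chains E0 B k n" and t: "tors (actf act) z"
  shows "z = 0"
proof
  fix S show "z S = 0 S"
    using tors_chain[OF B chainsD(1)[OF z]] t \<rho>(2)[of "z S" "k + int (card S)" "n - mdeg S"] chainsD[OF z, of S]
    by (cases "S \<in> B") (auto simp: E0_def)
qed

lemma chains_neg: "k < - int h \<Longrightarrow> B \<subseteq> Pow {..<h} \<Longrightarrow> z \<in> chains E B k n \<Longrightarrow> z = 0"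
proof
  fix S assume k: "k < - int h" and B: "B \<subseteq> Pow {..<h}" and z: "z \<in> chains E B k n"
  show "z S = 0 S"
  proof (cases "S \<in> B")
    case True
    then have "card S \<le> h" using B card_mono[of "{..<h}" S] by auto
    then show ?thesis using chainsD(2)[OF z True] E_neg[of "k + int (card S)"] k by simp
  qed (simp add: chainsD(1)[OF z])
qed

text \<open>Modulo torsion, the complexes below consist of torsion-free injective modules and are bounded
  below. If moreover their cohomology is torsion, a contracting homotopy \<open>s\<close> can be built by recursion
  on the degree.\<close>

definition contraction :: "nat set set \<Rightarrow> int \<Rightarrow> (int ^ 'r \<Rightarrow> (nat set \<Rightarrow> 'w) \<Rightarrow> nat set \<Rightarrow> 'w) \<Rightarrow> bool" where
  "contraction B k s \<longleftrightarrow> hhom (actf act) (actf act) (chains E B k) (chains E0 B (k - 1)) 0 s \<and>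
     (\<forall>n. \<forall>z\<in>chains E B k n. tors (actf act) z \<longrightarrow> s n z = 0) \<and>
     (\<forall>n. \<forall>w\<in>chains E B (k - 1) n. tors (actf act) (DB B (s n (DB B w)) - DB B w))"

text \<open>For a cocycle \<open>z\<close> some \<open>f^t z\<close> is a boundary up to torsion,
  and on boundaries \<open>D s\<close> is the identity up to torsion. So a power of each
  \<open>f\<close> kills the projection of \<open>z - D s z\<close>, and this lies over
  \<open>E0\<close>, where there is no torsion.\<close>

lemma contraction_acyclic:
  assumes B: "convex_family B" and K: "\<And>f. f \<in> R 1 \<Longrightarrow> \<exists>t. pw f t \<in> kill B (of_nat t)"
    and s: "contraction B k s" and z: "z \<in> chains E B k n" and tz: "tors (actf act) (DB B z)"
  shows "tors (actf act) (z - DB B (s n z))"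
proof -
  interpret c: action "actf act" by (rule action_chains)
  note fB = finite_convex_family[OF B] and C = hmodD[OF hmod_chains_E[of B]]
  have s1: "hhom (actf act) (actf act) (chains E B k) (chains E0 B (k - 1)) 0 s"
    and s2: "\<And>n z. z \<in> chains E B k n \<Longrightarrow> tors (actf act) z \<Longrightarrow> s n z = 0"
    and s3: "\<And>n w. w \<in> chains E B (k - 1) n \<Longrightarrow> tors (actf act) (DB B (s n (DB B w)) - DB B w)"
    using s unfolding contraction_def by blast+
  have sC: "s n z \<in> chains E B (k - 1) n" if "z \<in> chains E B k n" for n z
    using hhomD(1)[OF s1 that] chains_E0_sub by auto
  have DC: "DB B w \<in> chains E B k n" if "w \<in> chains E B (k - 1) n" for n w
    using DB_chains[OF cfam_E B that] by simp
  define y where "y n z = z - DB B (s n z)" for n z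
  have yC: "y n z \<in> chains E B k n" if "z \<in> chains E B k n" for n z
    unfolding y_def using subgrp_diff[OF C(1) that DC[OF sC[OF that]]] .
  have gz: "pr B k n (y n z) \<in> chains E0 B k n" using hhomD(1)[OF pr_hom yC[OF z]] by simp
  have "tors (actf act) (pr B k n (y n z))"
    unfolding tors_def
  proof
    fix f assume f: "f \<in> R 1"
    then obtain t where t: "pw f t \<in> kill B (of_nat t)" using K by blast
    let ?m = "of_nat t + n"
    have pR: "pw f t \<in> R (of_nat t)" using t by (simp add: kill_def)
    obtain w where w: "w \<in> chains E B (k - 1) ?m" "tors (actf act) (actf act (pw f t) z - DB B w)"
      using t z tz unfolding kill_def by blast
    define \<gamma> where "\<gamma> = actf act (pw f t) z - DB B w"
    have pz: "actf act (pw f t) z \<in> chains E B k ?m" using C(2)[OF pR z] .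
    have \<gamma>C: "\<gamma> \<in> chains E B k ?m" unfolding \<gamma>_def using subgrp_diff[OF C(1) pz DC[OF w(1)]] .
    have sp: "s ?m (actf act (pw f t) z) = actf act (pw f t) (s n z)" using hhomD(3)[OF s1 pR z] .
    have "actf act (pw f t) (pr B k n (y n z)) = pr B k ?m (actf act (pw f t) (y n z))"
      using hhomD(3)[OF pr_hom pR yC[OF z]] by simp
    also have "actf act (pw f t) (y n z) = y ?m (actf act (pw f t) z)"
      by (simp add: y_def c.act_diff sp DB_act)
    also have "pr B k ?m \<dots> = 0"
    proof (rule pr_tors(1)[OF fB yC[OF pz]])
      have pz_eq: "actf act (pw f t) z = DB B w + \<gamma>" by (simp add: \<gamma>_def)
      have "s ?m (actf act (pw f t) z) = s ?m (DB B w)"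
        using hhom_add[OF s1 C(1) DC[OF w(1)] \<gamma>C] s2[OF \<gamma>C] w(2) by (simp add: pz_eq)
      then have "y ?m (actf act (pw f t) z) = \<gamma> - (DB B (s ?m (DB B w)) - DB B w)"
        by (simp add: y_def pz_eq)
      then show "tors (actf act) (y ?m (actf act (pw f t) z))"
        using tors_diff[OF action_chains w(2)[folded \<gamma>_def] s3[OF w(1)]] by simp
    qed
    finally have "(actf act f ^^ t) (actf act one (pr B k n (y n z))) = 0"
      unfolding act_pw[OF action_chains] .
    then show "\<exists>t. (actf act f ^^ t) (pr B k n (y n z)) = 0"
      using hmodD(3)[OF hmod_chains[OF hmod_E0] gz] by auto
  qed
  then have "pr B k n (y n z) = 0" using chains_E0_torsfree[OF fB gz] by blast
  then show ?thesis using pr_tors(2)[OF fB yC[OF z]] by (simp add: y_def)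
qed

text \<open>By \<open>contraction_acyclic\<close> the map \<open>q z = pr (z - D s z)\<close>
  vanishes whenever \<open>D z\<close> is torsion, so it is a function of \<open>D z\<close> modulo
  torsion. Injectivity of the chains over \<open>E0\<close> extends this function to the next
  homotopy.\<close>

lemma contraction_step:
  assumes B: "convex_family B" and K: "\<And>f. f \<in> R 1 \<Longrightarrow> \<exists>t. pw f t \<in> kill B (of_nat t)"
    and s: "contraction B k s"
  shows "\<exists>s'. contraction B (k + 1) s'"
proof -
  interpret c: action "actf act" by (rule action_chains)
  note fB = finite_convex_family[OF B] and C = hmodD[OF hmod_chains_E[of B]]
  have s1: "hhom (actf act) (actf act) (chains E B k) (chains E0 B (k - 1)) 0 s"
    using s unfolding contraction_def by blast
  have sC: "s n z \<in> chains E B (k - 1) n" if "z \<in> chains E B k n" for n z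
    using hhomD(1)[OF s1 that] chains_E0_sub by auto
  have DC: "DB B w \<in> chains E B (k + 1) n" if "w \<in> chains E B k n" for n w
    using DB_chains[OF cfam_E B that] .
  define y where "y n z = z - DB B (s n z)" for n z
  have yC: "y n z \<in> chains E B k n" if "z \<in> chains E B k n" for n z
    unfolding y_def using subgrp_diff[OF C(1) that] DB_chains[OF cfam_E B sC[OF that]] by simp
  define q where "q n z = pr B k n (y n z)" for n z
  have q1: "hhom (actf act) (actf act) (chains E B k) (chains E0 B k) 0 q"
    unfolding hhom_def
  proof (intro conjI allI ballI)
    fix n z assume z: "z \<in> chains E B k n"
    show "q n z \<in> chains E0 B k (n + 0)" unfolding q_def by (rule hhomD(1)[OF pr_hom yC[OF z]])
    fix w assume w: "w \<in> chains E B k n"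
    have "y n (z - w) = y n z - y n w" using hhomD(2)[OF s1 z w] by (simp add: y_def DB_diff)
    then show "q n (z - w) = q n z - q n w" using hhomD(2)[OF pr_hom yC[OF z] yC[OF w]] by (simp add: q_def)
  next
    fix p n a z assume a: "a \<in> R p" and z: "z \<in> chains E B k n"
    have "y (p + n) (actf act a z) = actf act a (y n z)"
      using hhomD(3)[OF s1 a z] by (simp add: y_def DB_act c.act_diff)
    then show "q (p + n) (actf act a z) = actf act a (q n z)"
      using hhomD(3)[OF pr_hom a yC[OF z]] by (simp add: q_def)
  qed
  have q0: "q n z = 0" if z: "z \<in> chains E B k n" "tors (actf act) (DB B z)" for n z
    unfolding q_def
    using pr_tors(1)[OF fB yC[OF z(1)]] contraction_acyclic[OF B K s z] by (simp add: y_def)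
  define G where "G = {(n, DB B z + \<gamma>, q n z) | n z \<gamma>. z \<in> chains E B k n \<and> \<gamma> \<in> chains E B (k + 1) n \<and> tors (actf act) \<gamma>}"
  have GI: "(n, DB B z + \<gamma>, q n z) \<in> G" if "z \<in> chains E B k n" "\<gamma> \<in> chains E B (k + 1) n" "tors (actf act) \<gamma>" for n z \<gamma>
    unfolding G_def using that by blast
  have "lingraph (actf act) (actf act) (chains E B (k + 1)) (chains E0 B k) 0 G"
    unfolding lingraph_def
  proof (intro conjI allI impI)
    fix n u v assume "(n, u, v) \<in> G"
    then obtain z \<gamma> where *: "u = DB B z + \<gamma>" "v = q n z" "z \<in> chains E B k n" "\<gamma> \<in> chains E B (k + 1) n"
      unfolding G_def by blast
    show "u \<in> chains E B (k + 1) n" unfolding *(1) using subgrp_add[OF C(1) DC[OF *(3)] *(4)] .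
    show "v \<in> chains E0 B k (n + 0)" unfolding *(2) by (rule hhomD(1)[OF q1 *(3)])
  next
    fix n show "(n, 0, 0) \<in> G"
      using GI[OF subgrp_0[OF C(1)] subgrp_0[OF C(1)] tors_0[OF action_chains], of n] hhom_0[OF q1 C(1)] by simp
  next
    fix n u v u' v' assume "(n, u, v) \<in> G" "(n, u', v') \<in> G"
    then obtain z \<gamma> z' \<gamma>' where *: "u = DB B z + \<gamma>" "v = q n z" "z \<in> chains E B k n" "\<gamma> \<in> chains E B (k + 1) n"
      "tors (actf act) \<gamma>" "u' = DB B z' + \<gamma>'" "v' = q n z'" "z' \<in> chains E B k n" "\<gamma>' \<in> chains E B (k + 1) n"
      "tors (actf act) \<gamma>'"
      unfolding G_def by blast
    have "u - u' = DB B (z - z') + (\<gamma> - \<gamma>')" "v - v' = q n (z - z')"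
      using * hhomD(2)[OF q1 *(3,8)] by (simp_all add: DB_diff)
    then show "(n, u - u', v - v') \<in> G"
      using GI[OF subgrp_diff[OF C(1) *(3,8)] subgrp_diff[OF C(1) *(4,9)] tors_diff[OF action_chains *(5,10)]] by simp
  next
    fix p n a u v assume a: "a \<in> R p" and "(n, u, v) \<in> G"
    then obtain z \<gamma> where *: "u = DB B z + \<gamma>" "v = q n z" "z \<in> chains E B k n" "\<gamma> \<in> chains E B (k + 1) n"
      "tors (actf act) \<gamma>" unfolding G_def by blast
    show "(p + n, actf act a u, actf act a v) \<in> G"
      using GI[OF C(2)[OF a *(3)] C(2)[OF a *(4)] tors_act[OF action_chains *(5)]] hhomD(3)[OF q1 a *(3)]
      by (simp add: *(1,2) c.act_add DB_act)
  next
    fix n v assume "(n, 0, v) \<in> G"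
    then obtain z \<gamma> where *: "0 = DB B z + \<gamma>" "v = q n z" "z \<in> chains E B k n" "\<gamma> \<in> chains E B (k + 1) n"
      "tors (actf act) \<gamma>" unfolding G_def by blast
    have "DB B z = 0 - \<gamma>" using *(1) by (metis add_diff_cancel_right')
    then have "tors (actf act) (DB B z)" using tors_diff[OF action_chains tors_0[OF action_chains] *(5)] by simp
    then show "v = 0" using q0 *(2,3) by blast
  qed
  from baer_extension[OF action_chains action_chains hmod_chains_E hmod_chains[OF hmod_E0] baer_chains_E0 this]
  obtain s' where s': "hhom (actf act) (actf act) (chains E B (k + 1)) (chains E0 B k) 0 s'"
    "\<And>n u v. (n, u, v) \<in> G \<Longrightarrow> s' n u = v" by blast
  have "contraction B (k + 1) s'"
    unfolding contraction_def
  proof (intro conjI allI ballI impI)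
    show "hhom (actf act) (actf act) (chains E B (k + 1)) (chains E0 B (k + 1 - 1)) 0 s'" using s'(1) by simp
    fix n \<gamma> assume \<gamma>: "\<gamma> \<in> chains E B (k + 1) n" "tors (actf act) \<gamma>"
    show "s' n \<gamma> = 0"
      using s'(2)[OF GI[OF subgrp_0[OF C(1)] \<gamma>]] hhom_0[OF q1 C(1)] by simp
  next
    fix n w assume "w \<in> chains E B (k + 1 - 1) n"
    then have w: "w \<in> chains E B k n" by simp
    have "s' n (DB B w) = q n w"
      using s'(2)[OF GI[OF w subgrp_0[OF C(1)] tors_0[OF action_chains]]] by simp
    moreover have "DB B (y n w) = DB B w"
      using DB_DB[OF B chainsD(1)[OF sC[OF w]]] by (simp add: y_def DB_diff)
    ultimately have "DB B (s' n (DB B w)) - DB B w = DB B (0 - (y n w - q n w))"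
      by (simp add: DB_diff DB_minus)
    then show "tors (actf act) (DB B (s' n (DB B w)) - DB B w)"
      using tors_DB[OF tors_diff[OF action_chains tors_0[OF action_chains] pr_tors(2)[OF fB yC[OF w]]]]
      by (simp add: q_def)
  qed
  then show ?thesis by blast
qed

theorem acyclic_mod_torsI:
  assumes B: "convex_family B" and K: "\<And>f. f \<in> R 1 \<Longrightarrow> \<exists>t. pw f t \<in> kill B (of_nat t)"
  shows "acyclic_mod_tors B k"
proof -
  have sub: "B \<subseteq> Pow {..<h}" using B by (simp add: convex_family_def)
  \<comment> \<open>Index sets have at most \<open>h\<close> elements and \<open>E\<close> is zero
    in negative degrees, so there are no nonzero chains of degree \<open>k - 1\<close> and the
    recursion can start with the zero homotopy.\<close>
  have base: "contraction B k (\<lambda>n z. 0)" if "k \<le> - int h" for k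
    unfolding contraction_def hhom_def
  proof (intro conjI allI ballI impI)
    fix n show "0 \<in> chains E0 B (k - 1) (n + 0)" by (rule subgrp_0[OF hmodD(1)[OF hmod_chains[OF hmod_E0]]])
  next
    fix n w assume "w \<in> chains E B (k - 1) n"
    then have "w = 0" using chains_neg[OF _ sub, of "k - 1" w n] that by simp
    then show "tors (actf act) (DB B 0 - DB B w)" using tors_0[OF action_chains] by simp
  qed (auto simp: actf_def)
  have "\<exists>s. contraction B (- int h + int m) s" for m
  proof (induction m)
    case 0
    then show ?case using base[of "- int h"] by auto
  next
    case (Suc m)
    then obtain s where "contraction B (- int h + int m) s" by blast
    moreover have "- int h + int (Suc m) = - int h + int m + 1" by simp
    ultimately show ?case using contraction_step[OF B K] by metis
  qed
  from this[of "nat (k + int h)"] base[of k] obtain s where "contraction B k s"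
    by (cases "k \<le> - int h") auto
  then have s: "contraction B k s" .
  show ?thesis
    unfolding acyclic_mod_tors_def
  proof (intro allI ballI impI)
    fix n z assume z: "z \<in> chains E B k n" "tors (actf act) (DB B z)"
    have "hhom (actf act) (actf act) (chains E B k) (chains E0 B (k - 1)) 0 s"
      using s by (simp add: contraction_def)
    from hhomD(1)[OF this z(1)] have "s n z \<in> chains E B (k - 1) n" using chains_E0_sub by auto
    then show "\<exists>w\<in>chains E B (k - 1) n. tors (actf act) (z - DB B w)"
      using contraction_acyclic[OF B K s z] by blast
  qed
qed

text \<open>If the rows are exact, then so is the total complex; elements are killed from the largest
  index sets downwards.\<close>

lemma rows_exact:
  assumes X: "cfam X" and B: "convex_family B"
    and nul: "nul 0" "\<And>x y. nul x \<Longrightarrow> nul y \<Longrightarrow> nul (x - y)" "\<And>a x. nul x \<Longrightarrow> nul (act a x)"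
    and z: "z \<in> chains X B k n" "\<And>S. S \<in> B \<Longrightarrow> p0 \<le> card S \<Longrightarrow> nul (DB B z S)"
    and rows: "\<And>S x. S \<in> B \<Longrightarrow> p0 \<le> card S \<Longrightarrow> x \<in> X (k + int (card S)) (n - mdeg S) \<Longrightarrow> nul (\<delta> x) \<Longrightarrow>
      \<exists>y\<in>X (k - 1 + int (card S)) (n - mdeg S). nul (x - \<delta> y)"
  shows "\<exists>u\<in>chains X B (k - 1) n. \<forall>S\<in>B. p0 \<le> card S \<longrightarrow> nul ((z - DB B u) S)"
proof -
  have Xm: "hmod act (X j)" for j using X by (simp add: cfam_def)
  note C = hmodD[OF hmod_chains[OF Xm]]
  \<comment> \<open>In the applications \<open>nul\<close> means being zero or being
    torsion.\<close>
  have nul_uminus: "nul (- x)" if "nul x" for x using nul(2)[OF nul(1) that] by simp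
  have nul_add: "nul (x + y)" if "nul x" "nul y" for x y using nul(2)[OF that(1) nul_uminus[OF that(2)]] by simp
  have nul_alt: "nul (alt i x)" if "nul x" for i x using that nul_uminus by (simp add: alt_def)
  have nul_sum: "nul (sum f I)" if "\<And>i. i \<in> I \<Longrightarrow> nul (f i)" for f and I :: "nat set"
    using that by (induction I rule: infinite_finite_induct) (auto simp: nul nul_add)
  \<comment> \<open>Descending induction on the size of the sets already treated; it starts above
    \<open>h\<close>, where there are none.\<close>
  have "p0 \<le> max p0 (Suc h)" by simp
  then show ?thesis
  proof (induction rule: inc_induct)
    case base
    have "card S \<le> h" if "S \<in> B" for S
      using convex_family_finite[OF B that] card_mono[of "{..<h}" S] by simp
    then show ?case using subgrp_0[OF C(1)] by (intro bexI[of _ 0]) force+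
  next
    case (step p)
    then obtain u where u: "u \<in> chains X B (k - 1) n" "\<And>S. S \<in> B \<Longrightarrow> Suc p \<le> card S \<Longrightarrow> nul ((z - DB B u) S)"
      by blast
    define z' where "z' = z - DB B u"
    have z'C: "z' \<in> chains X B k n" unfolding z'_def using subgrp_diff[OF C(1) z(1)] DB_chains[OF X B u(1)] by simp
    have Dz': "DB B z' = DB B z" using DB_DB[OF B chainsD(1)[OF u(1)]] by (simp add: z'_def DB_diff)
    have "\<exists>y\<in>X (k - 1 + int (card S)) (n - mdeg S). nul (z' S - \<delta> y)" if S: "S \<in> B" "card S = p" for S
    proof (rule rows[OF S(1) _ chainsD(2)[OF z'C S(1)]])
      show "p0 \<le> card S" using S(2) step.hyps(1) by simp
      have nz: "nul (z' (insert l S))" if l: "l \<in> {..<h} - S" for l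
      proof (cases "insert l S \<in> B")
        case True
        then show ?thesis using u(2)[of "insert l S"] l convex_family_finite[OF B S(1)] S(2) by (simp add: z'_def)
      qed (simp add: chainsD(1)[OF z'C] nul)
      have n1: "nul (\<Sum>l\<in>{..<h} - S. alt (pos S l) (act (g l) (z' (insert l S))))"
        by (rule nul_sum, rule nul_alt, rule nul(3), rule nz)
      have "D z' S = DB B z S" using S(1) Dz' by (metis DB_def)
      moreover have "nul (DB B z S)" using z(2)[OF S(1) \<open>p0 \<le> card S\<close>] .
      ultimately have n2: "nul (D z' S)" by (simp only:)
      have "nul (alt (card S) (\<delta> (z' S)))" using nul(2)[OF n2 n1] by (simp add: D_def)
      from nul_alt[OF this, of "card S"] show "nul (\<delta> (z' S))" by simp
    qed
    then obtain y where y: "\<And>S. S \<in> B \<Longrightarrow> card S = p \<Longrightarrow> y S \<in> X (k - 1 + int (card S)) (n - mdeg S) \<and> nul (z' S - \<delta> (y S))"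
      by metis
    \<comment> \<open>\<open>D\<close> passes from larger to smaller sets, so a correction at sets
      of size \<open>p\<close> does not disturb the larger ones. The sign compensates the one in
      front of \<open>\<delta>\<close> in \<open>D\<close>.\<close>
    define u' where "u' S = (if S \<in> B \<and> card S = p then alt (card S) (y S) else 0)" for S
    have u'C: "u' \<in> chains X B (k - 1) n"
      using y alt_subgrp[OF hmodD(1)[OF Xm]] subgrp_0[OF hmodD(1)[OF Xm]] by (simp add: chains_def u'_def)
    have "nul ((z - DB B (u + u')) S)" if S: "S \<in> B" "p \<le> card S" for S
    proof -
      have "u' (insert l S) = 0" if "l \<in> {..<h} - S" for l
        using that S convex_family_finite[OF B S(1)] by (simp add: u'_def)
      then have "DB B u' S = alt (card S) (\<delta> (u' S))" using S(1) by (simp add: DB_def D_def)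
      then have *: "(z - DB B (u + u')) S = z' S - alt (card S) (\<delta> (u' S))" by (simp add: DB_add z'_def)
      show ?thesis
      proof (cases "card S = p")
        case True
        then have "alt (card S) (\<delta> (u' S)) = \<delta> (y S)" using S(1) by (simp add: u'_def \<delta>_alt)
        then show ?thesis using * y S True by simp
      next
        case False
        then show ?thesis using * u(2)[OF S(1)] S(2) by (simp add: u'_def z'_def)
      qed
    qed
    then show ?case using subgrp_add[OF C(1) u(1) u'C] by blast
  qed
qed

end

section \<open>Elements acting by zero\<close>

context hcomplex
begin

text \<open>The annihilator of the resolved module, read off from the cocycles in
  \<open>E 0\<close>.\<close>

definition ann :: "int ^ 'r \<Rightarrow> 'b set" where
  "ann p = {a \<in> R p. \<forall>n. \<forall>x\<in>E 0 n. \<delta> x = 0 \<longrightarrow> act a x = 0}"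

lemma hideal_ann: "hideal R ann"
  unfolding hideal_def
proof (intro conjI allI ballI)
  fix p
  show "ann p \<subseteq> R p" by (auto simp: ann_def)
  show "subgrp (ann p)" using subgrp_0[OF R_sub] subgrp_diff[OF R_sub]
    by (intro subgrpI) (auto simp: ann_def act_subtract)
next
  fix p q a x assume "a \<in> R p" "x \<in> ann q"
  then show "a * x \<in> ann (p + q)" using R_mult by (auto simp: ann_def act_mult)
qed

text \<open>An element that annihilates the resolved module acts on its injective resolution by a
  map that is homotopic to zero.\<close>

lemma null_homotopy:
  assumes a: "a \<in> ann d"
  shows "\<exists>\<eta>. (\<forall>j. hhom act act (E j) (E (j - 1)) d (\<eta> j)) \<and>
    (\<forall>j n. \<forall>x\<in>E j n. act a x = \<delta> (\<eta> j n x) + \<eta> (j + 1) n (\<delta> x))"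
proof -
  note Es = hmodD[OF E_mod]
  have aR: "a \<in> R d" using a by (simp add: ann_def)
  define P where "P j \<eta> \<longleftrightarrow> hhom act act (E (int j)) (E (int j - 1)) d \<eta> \<and>
     (\<forall>n. \<forall>x\<in>E (int j) n. \<delta> x = 0 \<longrightarrow> act a x = \<delta> (\<eta> n x))" for j \<eta>
  define Q where "Q j \<eta> \<eta>' \<longleftrightarrow> (\<forall>n. \<forall>x\<in>E (int j) n. \<eta>' n (\<delta> x) = act a x - \<delta> (\<eta> n x))"
    for j and \<eta> \<eta>' :: "int ^ 'r \<Rightarrow> 'w \<Rightarrow> 'w"
  have zero: "hhom act act X (E j) d (\<lambda>n x. 0)" for X j
    using subgrp_0[OF Es(1)] by (auto simp: hhom_def)
  have "P 0 (\<lambda>n x. 0)" using a zero by (auto simp: P_def ann_def)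
  moreover have "\<exists>\<eta>'. P (Suc j) \<eta>' \<and> Q j \<eta> \<eta>'" if \<eta>: "P j \<eta>" for j \<eta>
  proof -
    have h: "hhom act act (E (int j)) (E (int j - 1)) d \<eta>"
      and k: "\<And>n x. x \<in> E (int j) n \<Longrightarrow> \<delta> x = 0 \<Longrightarrow> act a x = \<delta> (\<eta> n x)" using \<eta> by (auto simp: P_def)
    define q where "q n x = act a x - \<delta> (\<eta> n x)" for n x
    have q: "q n x \<in> E (int j) (n + d)" if "x \<in> E (int j) n" for n x
      unfolding q_def
      using subgrp_diff[OF Es(1) Es(2)[OF aR that], of "\<delta> (\<eta> n x)"] \<delta>_E[OF hhomD(1)[OF h that]] by (simp add: add.commute)
    have qd: "q n (x - x') = q n x - q n x'" if "x \<in> E (int j) n" "x' \<in> E (int j) n" for n x x'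
      using hhomD(2)[OF h that] by (simp add: q_def act_diff \<delta>_diff)
    \<comment> \<open>\<open>q = a - \<delta> \<eta>\<close> vanishes on cocycles, hence is a
      function of \<open>\<delta> x\<close>; the next \<open>\<eta>'\<close> is an extension of this
      function. Exactness of \<open>E\<close> then passes the property \<open>P\<close> on to
      \<open>\<eta>'\<close>.\<close>
    define G where "G = {(n, \<delta> x, q n x) | n x. x \<in> E (int j) n}"
    have GI: "(n, \<delta> x, q n x) \<in> G" if "x \<in> E (int j) n" for n x unfolding G_def using that by blast
    have "lingraph act act (E (int (Suc j))) (E (int j)) d G"
      unfolding lingraph_def
    proof (intro conjI allI impI)
      fix n u v assume "(n, u, v) \<in> G"
      then obtain x where "u = \<delta> x" "v = q n x" "x \<in> E (int j) n" unfolding G_def by blast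
      then show "v \<in> E (int j) (n + d)" using q by simp
      show "u \<in> E (int (Suc j)) n" using \<delta>_E[of x "int j" n] \<open>u = \<delta> x\<close> \<open>x \<in> E (int j) n\<close> by (simp add: add.commute)
    next
      fix n show "(n, 0, 0) \<in> G" using GI[OF subgrp_0[OF Es(1)]] hhom_0[OF h Es(1)] by (simp add: q_def)
    next
      fix n u v u' v' assume "(n, u, v) \<in> G" "(n, u', v') \<in> G"
      then obtain x x' where *: "u = \<delta> x" "v = q n x" "x \<in> E (int j) n" "u' = \<delta> x'" "v' = q n x'" "x' \<in> E (int j) n"
        unfolding G_def by blast
      show "(n, u - u', v - v') \<in> G" using GI[OF subgrp_diff[OF Es(1) *(3,6)]] qd[OF *(3,6)] by (simp add: * \<delta>_diff)
    next
      fix p n c u v assume c: "c \<in> R p" and "(n, u, v) \<in> G"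
      then obtain x where *: "u = \<delta> x" "v = q n x" "x \<in> E (int j) n" unfolding G_def by blast
      show "(p + n, act c u, act c v) \<in> G"
        using GI[OF Es(2)[OF c *(3)]] hhomD(3)[OF h c *(3)]
        by (simp add: * q_def \<delta>_act act_diff act_commute[of a c])
    next
      fix n v assume "(n, 0, v) \<in> G"
      then obtain x where *: "0 = \<delta> x" "v = q n x" "x \<in> E (int j) n" unfolding G_def by blast
      then show "v = 0" using k[OF *(3)] by (simp add: q_def)
    qed
    from baer_extension[OF action_act action_act E_mod E_mod E_baer this]
    obtain \<eta>' where \<eta>': "hhom act act (E (int (Suc j))) (E (int j)) d \<eta>'" "\<And>n u v. (n, u, v) \<in> G \<Longrightarrow> \<eta>' n u = v"
      by blast
    have *: "\<eta>' n (\<delta> x) = act a x - \<delta> (\<eta> n x)" if "x \<in> E (int j) n" for n x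
      using \<eta>'(2)[OF GI[OF that]] by (simp add: q_def)
    have "act a x = \<delta> (\<eta>' n x)" if x: "x \<in> E (int (Suc j)) n" "\<delta> x = 0" for n x
    proof -
      have "\<exists>y\<in>E (int j) n. \<delta> y = x" using E_exact[OF _ x] by simp
      then obtain y where y: "y \<in> E (int j) n" "\<delta> y = x" by blast
      show ?thesis unfolding y(2)[symmetric] *[OF y(1)] by (simp add: \<delta>_diff \<delta>_act)
    qed
    then have "P (Suc j) \<eta>'" using \<eta>'(1) by (simp add: P_def)
    then show ?thesis using * by (auto simp: Q_def)
  qed
  ultimately obtain f where f: "\<And>j. P j (f j)" "\<And>j. Q j (f j) (f (Suc j))"
    using dependent_nat_choice[of P Q] by metis
  define \<eta> where "\<eta> j = (if j < 0 then (\<lambda>n x. 0) else f (nat j))" for j :: int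
  have "hhom act act (E j) (E (j - 1)) d (\<eta> j)" for j
  proof (cases "j < 0")
    case True
    then show ?thesis using zero by (simp add: \<eta>_def)
  next
    case False
    then show ?thesis using f(1)[of "nat j"] by (simp add: \<eta>_def P_def)
  qed
  note hh = this
  moreover have "act a x = \<delta> (\<eta> j n x) + \<eta> (j + 1) n (\<delta> x)" if x: "x \<in> E j n" for j n x
  proof (cases "j < 0")
    case True
    then have "x = 0" using x E_neg by simp
    then show ?thesis using hhom_0[OF hh Es(1)] by simp
  next
    case False
    then show ?thesis using f(2)[of "nat j"] x by (simp add: \<eta>_def Q_def nat_add_distrib)
  qed
  ultimately show ?thesis by blast
qed

text \<open>A relevant prime misses some \<open>f\<close> in \<open>R 1\<close>, a power of which
  kills \<open>x\<close>. So no relevant prime contains the annihilator of \<open>x\<close>, and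
  \<open>irrelevant_power_le\<close> gives a uniform exponent.\<close>

lemma tors_annihilated:
  assumes x: "x \<in> E j n" "tors act x"
  shows "\<exists>N. \<forall>a\<in>R (of_nat N). act a x = 0"
proof -
  define V where "V p = {a \<in> R p. act a x = 0}" for p
  have V: "hideal R V"
    unfolding hideal_def V_def
    using subgrp_0[OF R_sub] subgrp_diff[OF R_sub] R_mult by (auto intro!: subgrpI simp: act_subtract act_mult)
  have "\<not> V \<le> P" if P: "relevant_prime P" for P
  proof
    assume VP: "V \<le> P"
    obtain f where f: "f \<in> R 1" "f \<notin> P 1" using P by (auto simp: relevant_prime_def)
    then obtain t where "(act f ^^ t) x = 0" using x(2) by (auto simp: tors_def)
    then have "pw f t \<in> V (of_nat t)"
      using pw_R[OF f(1), of t] hmodD(3)[OF E_mod x(1)] by (simp add: V_def act_pw[OF action_act])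
    then have "pw f t \<in> P (of_nat t)" using VP by (auto simp: le_fun_def)
    then show False using relevant_prime_pw[OF P f, of t] by simp
  qed
  then obtain N where "R (of_nat N) \<subseteq> V (of_nat N)" using irrelevant_power_le[OF V] by blast
  then show ?thesis by (auto simp: V_def)
qed

end

context koszul
begin

text \<open>The null homotopy is applied in each component. With the sign from \<open>card S\<close>
  the Koszul terms match, and \<open>a z - D w\<close> equals \<open>\<eta>\<close> of
  \<open>D z\<close> up to sign, which is torsion together with \<open>D z\<close>.\<close>

lemma ann_kill:
  assumes B: "convex_family B" and a: "a \<in> ann d"
  shows "a \<in> kill B d"
  unfolding kill_def
proof (intro CollectI conjI allI ballI impI)
  show aR: "a \<in> R d" using a by (simp add: ann_def)
  obtain \<eta> where \<eta>: "\<And>j. hhom act act (E j) (E (j - 1)) d (\<eta> j)"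
    "\<And>j n x. x \<in> E j n \<Longrightarrow> act a x = \<delta> (\<eta> j n x) + \<eta> (j + 1) n (\<delta> x)" using null_homotopy[OF a] by blast
  note Es = hmodD[OF E_mod] and fB = finite_convex_family[OF B]
  fix k n z assume z: "z \<in> chains E B k n" and tz: "tors (actf act) (DB B z)"
  define w where "w S = (if S \<in> B then alt (card S) (\<eta> (k + int (card S)) (n - mdeg S) (z S)) else 0)" for S
  have wC: "w \<in> chains E B (k - 1) (d + n)"
    unfolding chains_def
  proof (intro CollectI conjI allI ballI impI)
    fix S assume S: "S \<in> B"
    have "\<eta> (k + int (card S)) (n - mdeg S) (z S) \<in> E (k - 1 + int (card S)) (d + n - mdeg S)"
      using hhomD(1)[OF \<eta>(1) chainsD(2)[OF z S]] by (simp add: algebra_simps)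
    then show "w S \<in> E (k - 1 + int (card S)) (d + n - mdeg S)" using S alt_subgrp[OF Es(1)] by (simp add: w_def)
  qed (simp add: w_def)
  have key: "actf act a z S - DB B w S = alt (card S) (\<eta> (k + int (card S) + 1) (n - mdeg S) (DB B z S))" if S: "S \<in> B" for S
  proof -
    note fin = convex_family_finite[OF B S]
    let ?e = "\<eta> (k + int (card S) + 1) (n - mdeg S)"
    let ?I = "{..<h} - S"
    have zk: "act (g l) (z (insert l S)) \<in> E (k + int (card S) + 1) (n - mdeg S)"
      and wk: "act (g l) (w (insert l S)) = - alt (card S) (?e (act (g l) (z (insert l S))))" if l: "l \<in> ?I" for l
    proof -
      have l': "l < h" "l \<notin> S" using l by auto
      have c: "card (insert l S) = Suc (card S)" using l' fin by simp
      have mdeg: "dg l + (n - mdeg (insert l S)) = n - mdeg S" using mdeg_insert[OF _ l'(2)] fin by simp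
      show "act (g l) (z (insert l S)) \<in> E (k + int (card S) + 1) (n - mdeg S)"
      proof (cases "insert l S \<in> B")
        case True
        have "z (insert l S) \<in> E (k + int (card S) + 1) (n - mdeg (insert l S))"
          using chainsD(2)[OF z True] unfolding c by (simp add: algebra_simps)
        from Es(2)[OF g_R[OF l'(1)] this] show ?thesis by (simp add: mdeg)
      next
        case False
        then show ?thesis using chainsD(1)[OF z] subgrp_0[OF Es(1)] by simp
      qed
      show "act (g l) (w (insert l S)) = - alt (card S) (?e (act (g l) (z (insert l S))))"
      proof (cases "insert l S \<in> B")
        case True
        have zz: "z (insert l S) \<in> E (k + int (card S) + 1) (n - mdeg (insert l S))"
          using chainsD(2)[OF z True] unfolding c by (simp add: algebra_simps)
        have "?e (act (g l) (z (insert l S))) = act (g l) (\<eta> (k + int (card S) + 1) (n - mdeg (insert l S)) (z (insert l S)))"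
          using hhomD(3)[OF \<eta>(1) g_R[OF l'(1)] zz] by (simp add: mdeg)
        moreover have "w (insert l S) = - alt (card S) (\<eta> (k + int (card S) + 1) (n - mdeg (insert l S)) (z (insert l S)))"
          using True unfolding w_def c by (simp add: alt_Suc algebra_simps)
        ultimately show ?thesis by (simp add: act_minus act_alt)
      next
        case False
        then show ?thesis using chainsD(1)[OF z] hhom_0[OF \<eta>(1) Es(1)] by (simp add: w_def)
      qed
    qed
    have dz: "\<delta> (z S) \<in> E (k + int (card S) + 1) (n - mdeg S)" using \<delta>_E[OF chainsD(2)[OF z S]] .
    have alt_e: "?e (alt i x) = alt i (?e x)" if "x \<in> E (k + int (card S) + 1) (n - mdeg S)" for i x
      using hhom_minus[OF \<eta>(1) Es(1) that] by (simp add: alt_def)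
    define \<Sigma> where "\<Sigma> = (\<Sum>l\<in>?I. alt (pos S l) (?e (act (g l) (z (insert l S)))))"
    have "?e (D z S) = ?e (alt (card S) (\<delta> (z S))) + ?e (\<Sum>l\<in>?I. alt (pos S l) (act (g l) (z (insert l S))))"
      unfolding D_def
      by (rule hhom_add[OF \<eta>(1) Es(1) alt_subgrp[OF Es(1) dz] subgrp_sum[OF Es(1) alt_subgrp[OF Es(1) zk]]])
    also have "?e (\<Sum>l\<in>?I. alt (pos S l) (act (g l) (z (insert l S)))) = \<Sigma>"
      unfolding \<Sigma>_def by (subst hhom_sum[OF \<eta>(1) Es(1) alt_subgrp[OF Es(1) zk]]) (auto simp: alt_e[OF zk] intro!: sum.cong)
    also have "?e (alt (card S) (\<delta> (z S))) = alt (card S) (?e (\<delta> (z S)))" by (rule alt_e[OF dz])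
    finally have 1: "?e (D z S) = alt (card S) (?e (\<delta> (z S))) + \<Sigma>" .
    have "(\<Sum>l\<in>?I. alt (pos S l) (act (g l) (w (insert l S)))) = (\<Sum>l\<in>?I. - alt (card S) (alt (pos S l) (?e (act (g l) (z (insert l S))))))"
    proof (rule sum.cong[OF refl])
      fix l assume l: "l \<in> ?I"
      show "alt (pos S l) (act (g l) (w (insert l S))) = - alt (card S) (alt (pos S l) (?e (act (g l) (z (insert l S)))))"
        unfolding wk[OF l] by (simp add: alt_minus alt_alt add.commute)
    qed
    also have "\<dots> = - alt (card S) \<Sigma>" by (simp add: \<Sigma>_def sum_negf alt_sum)
    finally have 2: "D w S = \<delta> (\<eta> (k + int (card S)) (n - mdeg S) (z S)) - alt (card S) \<Sigma>"
      using S by (simp add: D_def w_def \<delta>_alt)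
    have "act a (z S) = \<delta> (\<eta> (k + int (card S)) (n - mdeg S) (z S)) + ?e (\<delta> (z S))"
      by (rule \<eta>(2)[OF chainsD(2)[OF z S]])
    then have "act a (z S) - D w S = ?e (\<delta> (z S)) + alt (card S) \<Sigma>" by (simp add: 2)
    also have "\<dots> = alt (card S) (?e (D z S))" by (simp add: 1 alt_add)
    finally show ?thesis using S by (simp add: DB_def actf_def)
  qed
  have DzC: "DB B z \<in> chains E B (k + 1) n" by (rule DB_chains[OF cfam_E B z])
  have "tors (actf act) (actf act a z - DB B w)"
  proof (subst tors_chain[OF fB])
    fix S assume "S \<notin> B"
    then show "(actf act a z - DB B w) S = 0" using chainsD(1)[OF z] by (simp add: actf_def DB_def)
  next
    have "tors (actf act) (DB B z) \<longleftrightarrow> (\<forall>S\<in>B. tors act (DB B z S))"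
      by (rule tors_chain[OF fB]) (simp add: DB_def)
    then have "tors act (DB B z S)" if "S \<in> B" for S using tz that by blast
    moreover have "DB B z S \<in> E (k + int (card S) + 1) (n - mdeg S)" if "S \<in> B" for S
      using chainsD(2)[OF DzC that] by (simp add: algebra_simps)
    ultimately have "tors act (\<eta> (k + int (card S) + 1) (n - mdeg S) (DB B z S))" if "S \<in> B" for S
      using hhom_tors[OF \<eta>(1) E_mod] that by blast
    then show "\<forall>S\<in>B. tors act ((actf act a z - DB B w) S)"
      using alt_subgrp[OF subgrp_tors[OF action_act]] by (simp add: key)
  qed
  then show "\<exists>w\<in>chains E B (k - 1) (d + n). tors (actf act) (actf act a z - DB B w)" using wC by blast
qed

text \<open>Closure of \<open>B\<close> under inserting and removing \<open>u\<close> keeps the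
  homotopy \<open>contracting u\<close> inside the chains on \<open>B\<close>, so
  \<open>D_contracting\<close> survives the truncation.\<close>

lemma generator_kill:
  assumes B: "convex_family B" and u: "u < h" and tg: "\<And>S. S \<in> B \<Longrightarrow> insert u S \<in> B \<and> S - {u} \<in> B"
  shows "g u \<in> kill B (dg u)"
  unfolding kill_def
proof (intro CollectI conjI allI ballI impI)
  show "g u \<in> R (dg u)" by (rule g_R[OF u])
  note Es = hmodD[OF E_mod] and fB = finite_convex_family[OF B]
  fix k n z assume z: "z \<in> chains E B k n" and tz: "tors (actf act) (DB B z)"
  have wC: "contracting u z \<in> chains E B (k - 1) (dg u + n)"
    unfolding chains_def
  proof (intro CollectI conjI allI ballI impI)
    fix S assume S: "S \<notin> B"
    have "S - {u} \<notin> B" if "u \<in> S" using tg[of "S - {u}"] S that by (auto simp: insert_absorb)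
    then show "contracting u z S = 0" using chainsD(1)[OF z] by (simp add: contracting_def)
  next
    fix S assume S: "S \<in> B"
    note fin = convex_family_finite[OF B S]
    show "contracting u z S \<in> E (k - 1 + int (card S)) (dg u + n - mdeg S)"
    proof (cases "u \<in> S")
      case True
      have "card S = Suc (card (S - {u}))" using True fin by (metis card_Suc_Diff1)
      moreover have "mdeg S = dg u + mdeg (S - {u})" using mdeg_insert[of "S - {u}" u] True fin by (simp add: insert_absorb)
      moreover have "z (S - {u}) \<in> E (k + int (card (S - {u}))) (n - mdeg (S - {u}))"
        using chainsD(2)[OF z] tg[OF S] by blast
      ultimately have "z (S - {u}) \<in> E (k - 1 + int (card S)) (dg u + n - mdeg S)" by simp
      then show ?thesis using True alt_subgrp[OF Es(1)] by (simp add: contracting_def)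
    qed (simp add: contracting_def subgrp_0[OF Es(1)])
  qed
  have "tors (actf act) (DB B z) \<longleftrightarrow> (\<forall>S\<in>B. tors act (DB B z S))"
    by (rule tors_chain[OF fB]) (simp add: DB_def)
  then have t: "tors act (DB B z S)" if "S \<in> B" for S using tz that by blast
  have "tors (actf act) (actf act (g u) z - DB B (contracting u z))"
  proof (subst tors_chain[OF fB])
    fix S assume "S \<notin> B"
    then show "(actf act (g u) z - DB B (contracting u z)) S = 0" using chainsD(1)[OF z] by (simp add: actf_def DB_def)
  next
    show "\<forall>S\<in>B. tors act ((actf act (g u) z - DB B (contracting u z)) S)"
    proof
      fix S assume S: "S \<in> B"
      have "act (g u) (z S) = D (contracting u z) S + contracting u (D z) S"
        using D_contracting[OF _ u] convex_family_finite[OF B S] by simp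
      then have "(actf act (g u) z - DB B (contracting u z)) S = contracting u (D z) S"
        using S by (simp add: actf_def DB_def)
      also have "\<dots> = (if u \<in> S then alt (pos S u) (DB B z (S - {u})) else 0)"
        using tg[OF S] by (simp add: contracting_def DB_def)
      finally show "tors act ((actf act (g u) z - DB B (contracting u z)) S)"
        using t[of "S - {u}"] tg[OF S] alt_subgrp[OF subgrp_tors[OF action_act]] tors_0[OF action_act] by simp
    qed
  qed
  then show "\<exists>w\<in>chains E B (k - 1) (dg u + n). tors (actf act) (actf act (g u) z - DB B w)" using wC by blast
qed

end

lemma (in koszul) tors_chains:
  "finite B \<Longrightarrow> z \<in> chains X B k n \<Longrightarrow> tors (actf act) z \<longleftrightarrow> (\<forall>S\<in>B. tors act (z S))"
  by (rule tors_chain) (auto dest: chainsD(1))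

section \<open>Generation in degrees above the spread\<close>

text \<open>The parameter \<open>q\<close> bounds the spread; it corresponds to \<open>l + 1 - |b|\<close> in the theorem.\<close>

locale regularity = hcomplex R one act E \<delta> + hlocal R one mm
  for R :: "int ^ 'r \<Rightarrow> 'b::comm_ring set" and one :: 'b
    and act :: "'b \<Rightarrow> 'w::ab_group_add \<Rightarrow> 'w" and E \<delta> and mm :: "'b set" +
  fixes b :: "int ^ 'r" and q :: nat
  assumes vanishing: "b \<le> n \<Longrightarrow> x \<in> E j n \<Longrightarrow> tors act x \<Longrightarrow> \<delta> x = 0 \<Longrightarrow>
      \<exists>y\<in>E (j - 1) n. tors act y \<and> \<delta> y = x"
    and spread_bound: "chain_bound (msum ann) q"
begin

text \<open>Intended for \<open>K = kill B\<close>, to produce the hypothesis of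
  \<open>acyclic_mod_torsI\<close>. Powers \<open>pw (y k) t\<close> are allowed because a prime
  that contains a power of \<open>y k\<close> contains \<open>y k\<close>.\<close>

lemma parameter_system:
  obtains d y where "\<And>k. k < q \<Longrightarrow> 1 \<le> d k" "\<And>k. k < q \<Longrightarrow> y k \<in> R (d k)"
    "\<And>K t. hideal R K \<Longrightarrow> ann \<le> K \<Longrightarrow> (\<And>k. k < q \<Longrightarrow> pw (y k) t \<in> K (of_nat t * d k)) \<Longrightarrow>
       \<exists>N. R (of_nat N) \<subseteq> K (of_nat N)"
proof -
  obtain d y where dy: "\<And>k. k < q \<Longrightarrow> 1 \<le> d k" "\<And>k. k < q \<Longrightarrow> y k \<in> R (d k)"
    and no: "\<And>P. relevant_prime P \<Longrightarrow> ann \<le> P \<Longrightarrow> \<not> (\<forall>k<q. y k \<in> P (d k))"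
    using parameters[OF hideal_ann spread_bound] by metis
  have "\<exists>N. R (of_nat N) \<subseteq> K (of_nat N)"
    if K: "hideal R K" "ann \<le> K" and pk: "\<And>k. k < q \<Longrightarrow> pw (y k) t \<in> K (of_nat t * d k)" for K t
  proof (rule irrelevant_power_le[OF K(1)], rule notI)
    fix P assume P: "relevant_prime P" "K \<le> P"
    have "y k \<in> P (d k)" if k: "k < q" for k
    proof (rule ccontr)
      assume "y k \<notin> P (d k)"
      from relevant_prime_pw[OF P(1) dy(2)[OF k] this, of t] show False using pk[OF k] P(2) by (auto simp: le_fun_def)
    qed
    moreover have "ann \<le> P" using K(2) P(2) by order
    ultimately show False using no P(1) by blast
  qed
  with dy that show ?thesis by blast
qed

text \<open>The vanishing of \<open>H^j\<close> for \<open>j > q\<close>. Powers of the parameters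
  that kill \<open>x\<close> form the Koszul system, so that \<open>x\<close>, placed at the full
  index set, becomes a cocycle; it bounds over \<open>E\<close>, and acyclicity up to torsion makes
  it bound in the torsion part.\<close>

lemma torsion_cohomological_dimension:
  assumes j: "int q < j" and x: "x \<in> E j n" "tors act x" "\<delta> x = 0"
  shows "\<exists>y\<in>E (j - 1) n. tors act y \<and> \<delta> y = x"
proof -
  obtain d y where dy: "\<And>k. k < q \<Longrightarrow> 1 \<le> d k" "\<And>k. k < q \<Longrightarrow> y k \<in> R (d k)"
    and rad: "\<And>K t. hideal R K \<Longrightarrow> ann \<le> K \<Longrightarrow> (\<And>k. k < q \<Longrightarrow> pw (y k) t \<in> K (of_nat t * d k)) \<Longrightarrow>
       \<exists>N. R (of_nat N) \<subseteq> K (of_nat N)"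
    using parameter_system by blast
  obtain t where t: "\<And>a. a \<in> R (of_nat t) \<Longrightarrow> act a x = 0" using tors_annihilated[OF x(1,2)] by blast
  define g where "g k = pw (y k) t" for k
  define dg where "dg k = of_nat t * d k" for k
  interpret K: koszul R one act E \<delta> q g dg
    by unfold_locales (auto simp: g_def dg_def intro: pw_R dy)
  have gx: "act (g k) x = 0" if k: "k < q" for k
  proof -
    \<comment> \<open>Since \<open>d k >= 1\<close>, the degree of \<open>g k\<close> is at least
      \<open>(t, ..., t)\<close>; hence \<open>g k\<close> is a combination of elements of
      \<open>R (of_nat t)\<close>, and these kill \<open>x\<close>.\<close>
    have "0 \<le> dg k - of_nat t"
    proof -
      have "1 \<le> d k $ i" for i using dy(1)[OF k] by (simp add: less_eq_vec_def)
      then have "int t * 1 \<le> int t * d k $ i" for i by (intro mult_left_mono) auto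
      then show ?thesis by (simp add: less_eq_vec_def dg_def of_nat_index)
    qed
    moreover have "g k \<in> R (dg k - of_nat t + of_nat t)" using K.g_R[OF k] by simp
    ultimately have "g k \<in> addspan {a * c | a c. a \<in> R (dg k - of_nat t) \<and> c \<in> R (of_nat t)}"
      using R_split[OF of_nat_vec_nonneg] by blast
    then show ?thesis
      by (induction rule: addspan_induct) (auto simp: act_mult t act_subtract)
  qed
  let ?B = "Pow {..<q}" and ?T = "{..<q}"
  have B: "K.convex_family ?B" by (auto simp: K.convex_family_def)
  note fB = K.finite_convex_family[OF B]
  have ac: "K.acyclic_mod_tors ?B k" for k
  proof (rule K.acyclic_mod_torsI[OF B])
    fix f assume f: "f \<in> R 1"
    have "ann \<le> K.kill ?B" using K.ann_kill[OF B] by (auto simp: le_fun_def)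
    moreover have "pw (y k) t \<in> K.kill ?B (of_nat t * d k)" if "k < q" for k
      using K.generator_kill[OF B that] that by (auto simp: g_def dg_def)
    ultimately obtain N where "R (of_nat N) \<subseteq> K.kill ?B (of_nat N)" using rad[OF K.hideal_kill] by blast
    then show "\<exists>t. pw f t \<in> K.kill ?B (of_nat t)" using pw_R[OF f, of N] by auto
  qed
  define z where "z S = (if S = ?T then x else 0)" for S
  \<comment> \<open>With this degree the full index set carries \<open>E j\<close>, and
    \<open>j > q\<close> makes every row index \<open>k + card S\<close> at least 1, so that the
    rows are exact.\<close>
  define k where "k = j - int q"
  define m where "m = n + K.mdeg ?T"
  have zC: "z \<in> K.chains E ?B k m"
    using x(1) subgrp_0[OF hmodD(1)[OF E_mod]] by (auto simp: K.chains_def z_def k_def m_def)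
  have Dz: "K.DB ?B z = 0"
  proof
    fix S
    have "act (g l) (z (insert l S)) = 0" if "l \<in> ?T - S" for l using that gx by (auto simp: z_def)
    moreover have "\<delta> (z S) = 0" using x(3) by (simp add: z_def)
    ultimately show "K.DB ?B z S = 0 S" by (simp add: K.DB_def K.D_def)
  qed
  have "\<exists>u\<in>K.chains E ?B (k - 1) m. \<forall>S\<in>?B. 0 \<le> card S \<longrightarrow> (z - K.DB ?B u) S = 0"
  proof (rule K.rows_exact[OF cfam_E B _ _ _ zC])
    fix S v assume "v \<in> E (k + int (card S)) (m - K.mdeg S)" "\<delta> v = 0"
    then show "\<exists>y\<in>E (k - 1 + int (card S)) (m - K.mdeg S). v - \<delta> y = 0"
      using E_exact[of "k + int (card S)" v "m - K.mdeg S"] j by (auto simp: k_def algebra_simps)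
  qed (auto simp: Dz)
  then obtain u where u: "u \<in> K.chains E ?B (k - 1) m" "\<And>S. S \<in> ?B \<Longrightarrow> z S = K.DB ?B u S" by auto
  have zu: "z = K.DB ?B u"
  proof
    fix S show "z S = K.DB ?B u S" using u(2)[of S] K.chainsD(1)[OF zC, of S] by (cases "S \<in> ?B") (auto simp: K.DB_def)
  qed
  \<comment> \<open>As \<open>z = D u\<close> is torsion, \<open>u\<close> is a cocycle up to
    torsion and hence a boundary plus a torsion chain \<open>\<gamma>\<close> with
    \<open>D \<gamma> = z\<close>. At the full set no index can be inserted, so there
    \<open>D\<close> is \<open>\<delta>\<close> up to sign.\<close>
  have "tors (actf act) z" using K.tors_chains[OF fB zC] x(2) tors_0[OF action_act] by (simp add: z_def)
  then obtain w where w: "w \<in> K.chains E ?B (k - 1 - 1) m" "tors (actf act) (u - K.DB ?B w)"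
    using ac u(1) unfolding zu K.acyclic_mod_tors_def by blast
  define \<gamma> where "\<gamma> = u - K.DB ?B w"
  have "K.DB ?B w \<in> K.chains E ?B (k - 1) m" using K.DB_chains[OF cfam_E B w(1)] by simp
  then have \<gamma>C: "\<gamma> \<in> K.chains E ?B (k - 1) m"
    unfolding \<gamma>_def using subgrp_diff[OF hmodD(1)[OF K.hmod_chains_E] u(1)] by blast
  have "K.DB ?B \<gamma> = z" using K.DB_DB[OF B K.chainsD(1)[OF w(1)]] zu by (simp add: \<gamma>_def K.DB_diff)
  then have "K.D \<gamma> ?T = x" by (auto simp: K.DB_def z_def fun_eq_iff split: if_splits)
  then have "\<delta> (alt q (\<gamma> ?T)) = x" by (simp add: K.D_def \<delta>_alt)
  moreover have "tors act (\<gamma> ?T)" using K.tors_chains[OF fB \<gamma>C] w(2) by (auto simp: \<gamma>_def)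
  moreover have "\<gamma> ?T \<in> E (j - 1) n" using K.chainsD(2)[OF \<gamma>C, of ?T] by (simp add: k_def m_def)
  ultimately show ?thesis
    using alt_subgrp[OF hmodD(1)[OF E_mod]] alt_subgrp[OF subgrp_tors[OF action_act]] by blast
qed

text \<open>Includes \<open>j = q\<close>: the torsion cocycle \<open>\<delta> x\<close> has degree
  above \<open>q\<close>, so it is \<open>\<delta> c\<close> with \<open>c\<close> torsion, and
  \<open>x - c\<close> is a true cocycle.\<close>

lemma rows_exact_mod_tors:
  assumes j: "int q \<le> j" and x: "x \<in> E j n" "tors act (\<delta> x)"
  shows "\<exists>y\<in>E (j - 1) n. tors act (x - \<delta> y)"
proof -
  have "\<exists>y\<in>E (j + 1 - 1) n. tors act y \<and> \<delta> y = \<delta> x"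
    by (rule torsion_cohomological_dimension) (use j x \<delta>_E in auto)
  then obtain c where c: "c \<in> E j n" "tors act c" "\<delta> c = \<delta> x" by auto
  have xc: "x - c \<in> E j n" "\<delta> (x - c) = 0" using subgrp_diff[OF hmodD(1)[OF E_mod] x(1) c(1)] c(3) by (auto simp: \<delta>_diff)
  show ?thesis
  proof (cases "1 \<le> j")
    case True
    from E_exact[OF this xc] obtain y where "y \<in> E (j - 1) n" "\<delta> y = x - c" by blast
    then show ?thesis using c(2) by (intro bexI[of _ y]) auto
  next
    case False
    then have j0: "j = 0" "q = 0" using j by auto
    obtain d y where "\<And>k. k < q \<Longrightarrow> 1 \<le> d k" "\<And>k. k < q \<Longrightarrow> y k \<in> R (d k)"
      and rad: "\<And>K t. hideal R K \<Longrightarrow> ann \<le> K \<Longrightarrow> (\<And>k. k < q \<Longrightarrow> pw (y k) t \<in> K (of_nat t * d k)) \<Longrightarrow>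
       \<exists>N. R (of_nat N) \<subseteq> K (of_nat N)"
      using parameter_system by blast
    obtain N where N: "R (of_nat N) \<subseteq> ann (of_nat N)" using rad[OF hideal_ann order_refl] j0 by blast
    have "tors act (x - c)"
      unfolding tors_def
    proof
      fix f assume "f \<in> R 1"
      then have "pw f N \<in> ann (of_nat N)" using pw_R[of f 1 N] N by auto
      then have "act (pw f N) (x - c) = 0" using xc j0 by (auto simp: ann_def)
      then show "\<exists>t. (act f ^^ t) (x - c) = 0"
        using act_pw[OF action_act, of f N "x - c"] hmodD(3)[OF E_mod xc(1)] by auto
    qed
    then have "tors act x" using tors_additive[OF action_act _ c(2), of "x - c"] by simp
    then show ?thesis using subgrp_0[OF hmodD(1)[OF E_mod]] by (intro bexI[of _ 0]) auto
  qed
qed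

end

text \<open>\<open>dir k\<close> is the direction of the generator \<open>g k\<close>;
  \<open>rk\<close> is the order in which the directions are removed.\<close>

locale box = regularity R one act E \<delta> mm b q
  for R :: "int ^ 'r \<Rightarrow> 'b::comm_ring set" and one :: 'b
    and act :: "'b \<Rightarrow> 'w::ab_group_add \<Rightarrow> 'w" and E \<delta> and mm :: "'b set"
    and b :: "int ^ 'r" and q :: nat +
  fixes h :: nat and g :: "nat \<Rightarrow> 'b" and dir :: "nat \<Rightarrow> 'r" and rk :: "'r \<Rightarrow> nat" and m :: "int ^ 'r"
  assumes g_axis: "k < h \<Longrightarrow> g k \<in> R (axis (dir k) 1)"
    and g_gen: "R (axis i 1) \<subseteq> addspan {a * g k | a k. a \<in> R 0 \<and> k < h \<and> dir k = i}"
    and rk: "bij_betw rk UNIV {..<CARD('r)}"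
    and m: "0 \<le> m" "total_degree m = int q"

sublocale box \<subseteq> koszul R one act E \<delta> h g "\<lambda>k. axis (dir k) 1"
  by unfold_locales (rule g_axis)

section \<open>Koszul complexes truncated by multidegree\<close>

context box
begin

lemma mdeg_index: "finite S \<Longrightarrow> mdeg S $ i = int (card {k \<in> S. dir k = i})"
proof -
  assume S: "finite S"
  have "mdeg S $ i = (\<Sum>k\<in>S. if dir k = i then 1 else 0)"
    unfolding mdeg_def sum_component by (intro sum.cong) (auto simp: axis_def)
  also have "\<dots> = int (card {k \<in> S. dir k = i})" using S by (simp add: sum.If_cases Int_def)
  finally show ?thesis .
qed

lemma mdeg_mono: "finite T \<Longrightarrow> S \<subseteq> T \<Longrightarrow> mdeg S $ i \<le> mdeg T $ i"
  using finite_subset[of S T] by (auto simp: mdeg_index intro!: card_mono)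

lemma total_mdeg: "finite S \<Longrightarrow> total_degree (mdeg S) = int (card S)"
proof (induction S rule: finite_induct)
  case empty
  then show ?case by (simp add: mdeg_def total_degree_def)
qed (simp add: mdeg_insert total_degree_add total_degree_axis)

lemma rk_surj: "t < CARD('r) \<Longrightarrow> \<exists>i. rk i = t"
proof -
  assume "t < CARD('r)"
  then have "t \<in> range rk" using rk by (simp add: bij_betw_def)
  then show ?thesis by auto
qed

text \<open>The family \<open>slab t\<close> collects the index sets whose multidegree exceeds \<open>m\<close> in the first \<open>t\<close>
  directions and is bounded by \<open>m\<close> in all others; \<open>slab2 t\<close> leaves direction \<open>t\<close> free, so that the
  generators of that direction act on its cohomology by zero.\<close>

definition slab :: "nat \<Rightarrow> nat set set" where
  "slab t = {S. S \<subseteq> {..<h} \<and> (\<forall>i. (rk i < t \<longrightarrow> m $ i < mdeg S $ i) \<and> (t \<le> rk i \<longrightarrow> mdeg S $ i \<le> m $ i))}"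

definition slab2 :: "nat \<Rightarrow> nat set set" where
  "slab2 t = {S. S \<subseteq> {..<h} \<and> (\<forall>i. (rk i < t \<longrightarrow> m $ i < mdeg S $ i) \<and> (t < rk i \<longrightarrow> mdeg S $ i \<le> m $ i))}"

lemma slab_convex: "convex_family (slab t)" "convex_family (slab2 t)"
proof -
  have le: "mdeg S $ i \<le> mdeg T $ i" "mdeg T $ i \<le> mdeg U $ i" "T \<subseteq> {..<h}"
    if "U \<subseteq> {..<h}" "S \<subseteq> T" "T \<subseteq> U" for S T U i
  proof -
    have "finite U" using that(1) finite_subset by blast
    then show "mdeg T $ i \<le> mdeg U $ i" using that(3) by (rule mdeg_mono)
    have "finite T" using \<open>finite U\<close> that(3) by (rule rev_finite_subset)
    then show "mdeg S $ i \<le> mdeg T $ i" using that(2) by (rule mdeg_mono)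
    show "T \<subseteq> {..<h}" using that by blast
  qed
  have "T \<in> slab t" if S: "S \<in> slab t" and U: "U \<in> slab t" and ST: "S \<subseteq> T" "T \<subseteq> U" for S T U
    unfolding slab_def
  proof (intro CollectI conjI allI impI)
    have Uh: "U \<subseteq> {..<h}" using U by (simp add: slab_def)
    show "T \<subseteq> {..<h}" by (rule le(3)[OF Uh ST])
    fix i
    show "m $ i < mdeg T $ i" if "rk i < t" using le(1)[OF Uh ST, of i] S that by (auto simp: slab_def less_le_trans)
    show "mdeg T $ i \<le> m $ i" if "t \<le> rk i" using le(2)[OF Uh ST, of i] U that by (auto simp: slab_def intro: order_trans)
  qed
  moreover have "slab t \<subseteq> Pow {..<h}" by (auto simp: slab_def)
  ultimately show "convex_family (slab t)" unfolding convex_family_def by blast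
  have "T \<in> slab2 t" if S: "S \<in> slab2 t" and U: "U \<in> slab2 t" and ST: "S \<subseteq> T" "T \<subseteq> U" for S T U
    unfolding slab2_def
  proof (intro CollectI conjI allI impI)
    have Uh: "U \<subseteq> {..<h}" using U by (simp add: slab2_def)
    show "T \<subseteq> {..<h}" by (rule le(3)[OF Uh ST])
    fix i
    show "m $ i < mdeg T $ i" if "rk i < t" using le(1)[OF Uh ST, of i] S that by (auto simp: slab2_def less_le_trans)
    show "mdeg T $ i \<le> m $ i" if "t < rk i" using le(2)[OF Uh ST, of i] U that by (auto simp: slab2_def intro: order_trans)
  qed
  moreover have "slab2 t \<subseteq> Pow {..<h}" by (auto simp: slab2_def)
  ultimately show "convex_family (slab2 t)" unfolding convex_family_def by blast
qed

lemma slab_split: "slab2 t = slab t \<union> slab (Suc t)" if "t < CARD('r)"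
proof -
  obtain i where i: "rk i = t" using rk_surj \<open>t < CARD('r)\<close> by blast
  then have j: "rk j = t \<longleftrightarrow> j = i" for j using rk unfolding bij_betw_def inj_on_def by blast
  have "slab2 t \<subseteq> slab t \<union> slab (Suc t)"
  proof
    fix S assume S: "S \<in> slab2 t"
    show "S \<in> slab t \<union> slab (Suc t)"
    proof (cases "mdeg S $ i \<le> m $ i")
      case True
      have "mdeg S $ l \<le> m $ l" if "t \<le> rk l" for l
        using True S j[of l] that by (cases "l = i") (auto simp: slab2_def)
      then have "S \<in> slab t" using S by (simp add: slab_def slab2_def)
      then show ?thesis by simp
    next
      case False
      have "m $ l < mdeg S $ l" if "rk l < Suc t" for l
        using False S j[of l] that by (cases "l = i") (auto simp: slab2_def less_Suc_eq)
      then have "S \<in> slab (Suc t)" using S by (simp add: slab_def slab2_def Suc_le_eq)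
      then show ?thesis by simp
    qed
  qed
  moreover have "slab t \<union> slab (Suc t) \<subseteq> slab2 t"
    unfolding slab_def slab2_def by (auto simp: less_Suc_eq Suc_le_eq)
  ultimately show ?thesis by blast
qed

text \<open>As \<open>D\<close> passes to smaller sets, this makes the chains on
  \<open>slab t\<close> a subcomplex of those on \<open>slab2 t\<close>, with quotient the chains on
  \<open>slab (Suc t)\<close>.\<close>

lemma slab_disjoint: "t < CARD('r) \<Longrightarrow> S \<in> slab (Suc t) \<Longrightarrow> T \<in> slab t \<Longrightarrow> \<not> S \<subseteq> T"
proof
  assume t: "t < CARD('r)" and S: "S \<in> slab (Suc t)" and T: "T \<in> slab t" and "S \<subseteq> T"
  obtain i where i: "rk i = t" using rk_surj t by blast
  have "finite T" using T finite_subset by (auto simp: slab_def)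
  then have "mdeg S $ i \<le> mdeg T $ i" using mdeg_mono \<open>S \<subseteq> T\<close> by blast
  moreover have "m $ i < mdeg S $ i" "mdeg T $ i \<le> m $ i" using S T i by (auto simp: slab_def)
  ultimately show False by simp
qed

text \<open>Generators of direction \<open>t\<close> can be added and removed within the family, so
  they lie in the ideal \<open>kill\<close>. It then contains \<open>R_(e_i)\<close> and, because
  \<open>R_1 = R_(1 - e_i) R_(e_i)\<close>, all of \<open>R_1\<close>; the exponent 1
  suffices.\<close>

lemma slab2_acyclic:
  assumes t: "t < CARD('r)"
  shows "acyclic_mod_tors (slab2 t) k"
proof (rule acyclic_mod_torsI[OF slab_convex(2)])
  obtain i where i: "rk i = t" using rk_surj t by blast
  then have j: "rk j = t \<longleftrightarrow> j = i" for j using rk unfolding bij_betw_def inj_on_def by blast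
  note hk = hideal_kill[of "slab2 t"]
  have gk: "g u \<in> kill (slab2 t) (axis i 1)" if u: "u < h" "dir u = i" for u
  proof -
    have eq: "mdeg S $ l = mdeg (S - {u}) $ l" "mdeg (insert u S) $ l = mdeg S $ l" if "S \<subseteq> {..<h}" "l \<noteq> i" for S l
    proof -
      have "finite S" using that(1) finite_subset by blast
      moreover have "{k \<in> S. dir k = l} = {k \<in> S - {u}. dir k = l}" "{k \<in> insert u S. dir k = l} = {k \<in> S. dir k = l}"
        using u that(2) by auto
      ultimately show "mdeg S $ l = mdeg (S - {u}) $ l" "mdeg (insert u S) $ l = mdeg S $ l" by (simp_all add: mdeg_index)
    qed
    have "insert u S \<in> slab2 t \<and> S - {u} \<in> slab2 t" if S: "S \<in> slab2 t" for S
    proof -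
      have "S \<subseteq> {..<h}" using S by (simp add: slab2_def)
      note e = eq[OF this]
      have "insert u S \<subseteq> {..<h}" "S - {u} \<subseteq> {..<h}" using u(1) \<open>S \<subseteq> {..<h}\<close> by auto
      moreover have "mdeg (S - {u}) $ l = mdeg S $ l" "mdeg (insert u S) $ l = mdeg S $ l" if "rk l < t \<or> t < rk l" for l
        using e[of l] that j[of l] by auto
      ultimately show ?thesis using S by (auto simp: slab2_def)
    qed
    then show ?thesis using generator_kill[OF slab_convex(2) u(1), of t] u(2) by auto
  qed
  have "R (axis i 1) \<subseteq> kill (slab2 t) (axis i 1)"
    using hidealD(3)[OF hk, of _ 0 _ "axis i 1"] gk
    by (intro order_trans[OF g_gen] addspan_subset[OF hidealD(1)[OF hk]]) auto
  then have "{a * g |a g. a \<in> R (1 - axis i 1) \<and> g \<in> R (axis i 1)} \<subseteq> kill (slab2 t) 1"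
    using hideal_mult_deg[OF hk] by blast
  then have K1: "x \<in> kill (slab2 t) 1" if "x \<in> R 1" for x
    using R_gen[OF that, of i] subsetD[OF addspan_subset[OF hidealD(1)[OF hk]], of _ 1 x] by simp
  fix f assume f: "f \<in> R 1"
  then have "pw f 1 \<in> kill (slab2 t) (of_nat 1)" using K1 mult_one[OF f] by simp
  then show "\<exists>s. pw f s \<in> kill (slab2 t) (of_nat s)" by blast
qed

text \<open>The connecting map of a long exact sequence, done on elements. A cocycle
  \<open>z\<close> on \<open>slab t\<close> is \<open>D w\<close> on \<open>slab2 t\<close> up to
  torsion. The part \<open>w'\<close> of \<open>w\<close> on \<open>slab (Suc t)\<close> is a
  cocycle there and hence \<open>D v\<close> up to torsion; then \<open>w - D v\<close> is torsion
  outside \<open>slab t\<close>, and its part on \<open>slab t\<close> bounds \<open>z\<close> up to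
  torsion.\<close>

lemma slab_step:
  assumes t: "t < CARD('r)" and S: "acyclic_mod_tors (slab (Suc t)) (k - 1)"
  shows "acyclic_mod_tors (slab t) k"
  unfolding acyclic_mod_tors_def
proof (intro allI ballI impI)
  let ?B = "slab t" and ?B' = "slab (Suc t)" and ?F = "slab2 t"
  note cv = slab_convex and Es0 = subgrp_0[OF hmodD(1)[OF E_mod]]
  have fin: "finite ?B" "finite ?B'" "finite ?F" using finite_convex_family cv by blast+
  have F: "?F = ?B \<union> ?B'" by (rule slab_split[OF t])
  have dis: "?B \<inter> ?B' = {}" using slab_disjoint[OF t] by blast
  have ins: "insert l S \<notin> ?B" if "S \<in> ?B'" for l S using slab_disjoint[OF t that, of "insert l S"] by blast
  fix n z assume z: "z \<in> chains E ?B k n" and tz: "tors (actf act) (DB ?B z)"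
  have zF: "z \<in> chains E ?F k n" using z Es0 by (auto simp: chains_def F)
  have tDB: "tors (actf act) (DB C w) \<longleftrightarrow> (\<forall>S\<in>C. tors act (D w S))" if "finite C" for C w
    by (subst tors_chain[OF that]) (auto simp: DB_def)
  have "D z S = 0" if S: "S \<in> ?B'" for S
  proof -
    have "z S = 0" using chainsD(1)[OF z] S dis by blast
    then show ?thesis using chainsD(1)[OF z ins[OF S]] by (simp add: D_def)
  qed
  then have "tors (actf act) (DB ?F z)" using tz tors_0[OF action_act] by (auto simp: tDB fin F)
  then obtain w where w: "w \<in> chains E ?F (k - 1) n" "tors (actf act) (z - DB ?F w)"
    using slab2_acyclic[OF t] zF unfolding acyclic_mod_tors_def by blast
  have tw: "tors act (z S - D w S)" if "S \<in> ?F" for S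
  proof -
    have "tors (actf act) (z - DB ?F w) \<longleftrightarrow> (\<forall>S\<in>?F. tors act ((z - DB ?F w) S))"
      by (rule tors_chain[OF fin(3)]) (simp add: chainsD(1)[OF zF] DB_def)
    then show ?thesis using w(2) that by (simp add: DB_def)
  qed
  define w' where "w' S = (if S \<in> ?B' then w S else 0)" for S
  have w'C: "w' \<in> chains E ?B' (k - 1) n" using w(1) by (auto simp: chains_def w'_def F)
  have "act (g l) (w' (insert l S)) = act (g l) (w (insert l S))" if "S \<in> ?B'" for l S
  proof (cases "insert l S \<in> ?B'")
    case False
    then have "insert l S \<notin> ?F" using ins[OF that] F by blast
    then show ?thesis using False chainsD(1)[OF w(1)] by (simp add: w'_def)
  qed (simp add: w'_def)
  then have "D w' S = D w S" if "S \<in> ?B'" for S using that by (simp add: D_def w'_def)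
  moreover have "tors act (D w S)" if "S \<in> ?B'" for S
  proof -
    have "z S = 0" using chainsD(1)[OF z] that dis by blast
    moreover have "tors act (0 - (z S - D w S))"
      using tors_diff[OF action_act tors_0[OF action_act] tw] that F by blast
    ultimately show ?thesis by simp
  qed
  ultimately have "tors (actf act) (DB ?B' w')" by (simp add: tDB fin)
  then obtain v where v: "v \<in> chains E ?B' (k - 1 - 1) n" "tors (actf act) (w' - DB ?B' v)"
    using S w'C unfolding acyclic_mod_tors_def by blast
  have vF: "v \<in> chains E ?F (k - 1 - 1) n" using v(1) Es0 by (auto simp: chains_def F)
  define u where "u = w - DB ?F v"
  have "DB ?F v \<in> chains E ?F (k - 1) n" using DB_chains[OF cfam_E cv(2) vF] by simp
  then have uC: "u \<in> chains E ?F (k - 1) n"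
    unfolding u_def using subgrp_diff[OF hmodD(1)[OF hmod_chains_E] w(1)] by blast
  have ut: "tors act (u S)" if S: "S \<in> ?B'" for S
  proof -
    have "tors (actf act) (w' - DB ?B' v) \<longleftrightarrow> (\<forall>S\<in>?B'. tors act ((w' - DB ?B' v) S))"
      by (rule tors_chain[OF fin(2)]) (simp add: chainsD(1)[OF w'C] DB_def)
    then show ?thesis using v(2) S by (auto simp: u_def DB_def w'_def F)
  qed
  have DuF: "DB ?F u = DB ?F w" using DB_DB[OF cv(2) chainsD(1)[OF vF]] by (simp add: u_def DB_diff)
  define u' where "u' S = (if S \<in> ?B then u S else 0)" for S
  have u'C: "u' \<in> chains E ?B (k - 1) n" using uC by (auto simp: chains_def u'_def F)
  have "tors act (z S - D u' S)" if S: "S \<in> ?B" for S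
  proof -
    have "D u S = D w S" using fun_cong[OF DuF, of S] S F by (simp add: DB_def)
    moreover have "tors act (D (u - u') S)"
    proof -
      have 1: "(u - u') S = 0" using S by (simp add: u'_def)
      have "tors act ((u - u') T)" for T
        using ut[of T] tors_0[OF action_act] chainsD(1)[OF uC, of T] F dis by (auto simp: u'_def)
      then have "tors act (alt (pos S l) (act (g l) ((u - u') (insert l S))))" for l
        using alt_subgrp[OF subgrp_tors[OF action_act]] tors_act[OF action_act] by blast
      then have "(\<Sum>l\<in>{..<h} - S. alt (pos S l) (act (g l) ((u - u') (insert l S)))) \<in> {x. tors act x}"
        by (intro subgrp_sum[OF subgrp_tors[OF action_act]]) auto
      then show ?thesis unfolding D_def 1 by simp
    qed
    moreover have "tors act (z S - D w S)" using tw S F by blast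
    ultimately show ?thesis using tors_additive[OF action_act, of "z S - D w S" "D (u - u') S"] by (simp add: D_diff)
  qed
  then have "tors (actf act) (z - DB ?B u')"
    by (subst tors_chain[OF fin(1)]) (auto simp: chainsD(1)[OF z] DB_def)
  then show "\<exists>w\<in>chains E ?B (k - 1) n. tors (actf act) (z - DB ?B w)" using u'C by blast
qed

text \<open>All \<open>r\<close> bounds are exceeded, so \<open>card S >= q + r\<close> and every
  row index is at least \<open>q\<close>; the rows are then exact up to torsion by
  \<open>rows_exact_mod_tors\<close>.\<close>

lemma slab_last: "acyclic_mod_tors (slab CARD('r)) (- int CARD('r))"
  unfolding acyclic_mod_tors_def
proof (intro allI ballI impI)
  let ?B = "slab CARD('r)" and ?k = "- int CARD('r)"
  note cv = slab_convex(1)[of "CARD('r)"]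
  note fB = finite_convex_family[OF cv]
  have rk_less: "rk i < CARD('r)" for i using rk by (auto simp: bij_betw_def)
  have big: "int q \<le> ?k + int (card S)" if S: "S \<in> ?B" for S
  proof -
    have "finite S" using convex_family_finite[OF cv S] by blast
    then have "int (card S) = (\<Sum>i\<in>UNIV. mdeg S $ i)" using total_mdeg by (simp add: total_degree_def)
    also have "\<dots> \<ge> (\<Sum>i\<in>UNIV. m $ i + 1)"
      using S rk_less by (intro sum_mono) (auto simp: slab_def add1_zle_eq)
    also have "(\<Sum>i\<in>UNIV. m $ i + 1) = int q + int CARD('r)"
      using m(2) by (simp add: sum.distrib total_degree_def)
    finally show ?thesis by simp
  qed
  fix n z assume z: "z \<in> chains E ?B ?k n" and tz: "tors (actf act) (DB ?B z)"
  have "\<exists>u\<in>chains E ?B (?k - 1) n. \<forall>S\<in>?B. 0 \<le> card S \<longrightarrow> tors act ((z - DB ?B u) S)"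
  proof (rule rows_exact[OF cfam_E cv tors_0[OF action_act] tors_diff[OF action_act] tors_act[OF action_act] z])
    fix S assume "S \<in> ?B"
    moreover have "tors (actf act) (DB ?B z) \<longleftrightarrow> (\<forall>S\<in>?B. tors act (DB ?B z S))"
      by (rule tors_chain[OF fB]) (simp add: DB_def)
    ultimately show "tors act (DB ?B z S)" using tz by blast
  next
    fix S x assume "S \<in> ?B" "x \<in> E (?k + int (card S)) (n - mdeg S)" "tors act (\<delta> x)"
    from rows_exact_mod_tors[OF big[OF this(1)] this(2,3)]
    show "\<exists>y\<in>E (?k - 1 + int (card S)) (n - mdeg S). tors act (x - \<delta> y)" by (simp add: algebra_simps)
  qed
  then obtain u where u: "u \<in> chains E ?B (?k - 1) n" "\<And>S. S \<in> ?B \<Longrightarrow> tors act ((z - DB ?B u) S)" by auto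
  have "tors (actf act) (z - DB ?B u)"
    using u(2) by (subst tors_chain[OF fB]) (auto simp: chainsD(1)[OF z] DB_def)
  then show "\<exists>w\<in>chains E ?B (?k - 1) n. tors (actf act) (z - DB ?B w)" using u(1) by blast
qed

lemma slab_acyclic: "t \<le> CARD('r) \<Longrightarrow> acyclic_mod_tors (slab t) (- int t)"
proof (induction rule: inc_induct)
  case base
  show ?case by (rule slab_last)
next
  case (step t)
  have "- int (Suc t) = - int t - 1" by simp
  with step show ?case using slab_step[of t "- int t"] by metis
qed

lemma generation:
  assumes n: "b \<le> n - m" and y: "y \<in> E 0 n" "\<delta> y = 0"
  shows "y \<in> addspan {act a z | a z i. a \<in> R (axis i 1) \<and> z \<in> E 0 (n - axis i 1) \<and> \<delta> z = 0 \<and> b \<le> n - axis i 1}"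
proof -
  let ?B = "slab 0"
  note cv = slab_convex(1)[of 0] and Es = hmodD[OF E_mod]
  note fB = finite_convex_family[OF cv]
  have e: "{} \<in> ?B" using m(1) by (auto simp: slab_def mdeg_def less_eq_vec_def)
  define z where "z S = (if S = {} then y else 0)" for S :: "nat set"
  have zC: "z \<in> chains E ?B 0 n" using y(1) e subgrp_0[OF Es(1)] by (auto simp: chains_def z_def mdeg_def)
  have Dz: "DB ?B z = 0"
    by (rule ext) (auto simp: DB_def D_def z_def y(2))
  have "acyclic_mod_tors ?B 0" using slab_acyclic[of 0] by simp
  then obtain w where w: "w \<in> chains E ?B (0 - 1) n" "tors (actf act) (z - DB ?B w)"
    using zC Dz tors_0[OF action_actf] unfolding acyclic_mod_tors_def by metis
  \<comment> \<open>A torsion cocycle. All its components have degree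
    \<open>n - mdeg S >= n - m >= b\<close>, so the hypothesis \<open>vanishing\<close> makes the
    rows of the torsion part exact and \<open>c\<close> bounds there.\<close>
  define c where "c = z - DB ?B w"
  have "DB ?B w \<in> chains E ?B 0 n" using DB_chains[OF cfam_E cv w(1)] by simp
  then have "c \<in> chains E ?B 0 n"
    unfolding c_def using subgrp_diff[OF hmodD(1)[OF hmod_chains_E] zC] by blast
  moreover have "\<forall>S\<in>?B. tors act (c S)" using tors_chains[OF fB calculation] w(2) by (simp add: c_def)
  ultimately have cC: "c \<in> chains (\<lambda>j. tpart act (E j)) ?B 0 n" by (auto simp: chains_def tpart_def)
  have Dc: "DB ?B c = 0" using DB_DB[OF cv chainsD(1)[OF w(1)]] Dz by (simp add: c_def DB_diff)
  have bS: "b \<le> n - mdeg S" if "S \<in> ?B" for S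
  proof -
    have "mdeg S $ i \<le> m $ i" for i using that by (simp add: slab_def)
    then have "b $ i \<le> n $ i - mdeg S $ i" for i using n by (auto simp: less_eq_vec_def) (smt (verit, best))
    then show ?thesis by (simp add: less_eq_vec_def)
  qed
  have "\<exists>u\<in>chains (\<lambda>j. tpart act (E j)) ?B (0 - 1) n. \<forall>S\<in>?B. 0 \<le> card S \<longrightarrow> (c - DB ?B u) S = 0"
  proof (rule rows_exact[OF cfam_tpart cv _ _ _ cC])
    fix S x assume S: "S \<in> ?B" and x: "x \<in> tpart act (E (0 + int (card S))) (n - mdeg S)" "\<delta> x = 0"
    then show "\<exists>y\<in>tpart act (E (0 - 1 + int (card S))) (n - mdeg S). x - \<delta> y = 0"
      using vanishing[OF bS[OF S], of x "int (card S)"] by (auto simp: tpart_def)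
  qed (auto simp: Dc)
  then obtain u where u: "u \<in> chains (\<lambda>j. tpart act (E j)) ?B (0 - 1) n" "\<And>S. S \<in> ?B \<Longrightarrow> c S = DB ?B u S"
    by auto
  have uC: "u \<in> chains E ?B (- 1) n" using u(1) by (auto simp: chains_def tpart_def)
  define w1 where "w1 = w + u"
  have w1C: "w1 \<in> chains E ?B (- 1) n"
    unfolding w1_def using subgrp_add[OF hmodD(1)[OF hmod_chains_E], of w ?B "- 1" n u] w(1) uC by simp
  have Dw1: "DB ?B w1 S = z S" if "S \<in> ?B" for S
    using u(2)[OF that] by (simp add: w1_def DB_add c_def diff_eq_eq add.commute)
  \<comment> \<open>At sets with at least two elements the row index \<open>card S - 1\<close> is
    positive, so \<open>w1\<close> can be made zero there by a boundary. Nothing then contributes to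
    \<open>D w2\<close> at a singleton but \<open>\<delta>\<close>, so the coefficients
    \<open>w2 {k}\<close> become cocycles.\<close>
  have "\<exists>v\<in>chains E ?B (- 1 - 1) n. \<forall>S\<in>?B. 2 \<le> card S \<longrightarrow> (w1 - DB ?B v) S = 0"
  proof (rule rows_exact[OF cfam_E cv _ _ _ w1C])
    fix S assume "S \<in> ?B" "2 \<le> card S"
    then show "DB ?B w1 S = 0" using Dw1 by (auto simp: z_def)
  next
    fix S x assume "2 \<le> card S" "x \<in> E (- 1 + int (card S)) (n - mdeg S)" "\<delta> x = 0"
    then show "\<exists>y\<in>E (- 1 - 1 + int (card S)) (n - mdeg S). x - \<delta> y = 0"
      using E_exact[of "- 1 + int (card S)" x "n - mdeg S"] by (auto simp: algebra_simps)
  qed auto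
  then obtain v where v: "v \<in> chains E ?B (- 1 - 1) n" "\<And>S. S \<in> ?B \<Longrightarrow> 2 \<le> card S \<Longrightarrow> (w1 - DB ?B v) S = 0" by auto
  define w2 where "w2 = w1 - DB ?B v"
  have w2C: "w2 \<in> chains E ?B (- 1) n"
    unfolding w2_def using subgrp_diff[OF hmodD(1)[OF hmod_chains_E] w1C] DB_chains[OF cfam_E cv v(1)] by simp
  have Dw2: "D w2 S = z S" if "S \<in> ?B" for S
  proof -
    have "DB ?B (DB ?B v) = 0" using DB_DB[OF cv, of v] chainsD(1)[OF v(1)] by blast
    moreover have "DB ?B (DB ?B v) S = D (DB ?B v) S" using that by (simp add: DB_def)
    ultimately have "D (DB ?B v) S = 0" by simp
    then show ?thesis using Dw1[OF that] that by (simp add: w2_def D_diff DB_def[of ?B w1])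
  qed
  have w2_0: "w2 {} = 0" using chainsD(2)[OF w2C e] E_neg by simp
  have sing: "\<delta> (w2 {k}) = 0" if k: "k < h" "{k} \<in> ?B" for k
  proof -
    have "w2 (insert l {k}) = 0" if "l \<in> {..<h} - {k}" for l
      using v(2)[of "{l, k}"] that chainsD(1)[OF w2C, of "{l, k}"] by (cases "{l, k} \<in> ?B") (auto simp: w2_def)
    then have "alt (card {k}) (\<delta> (w2 {k})) = z {k}" using Dw2[OF k(2)] by (simp add: D_def)
    then show ?thesis by (simp add: z_def alt_def)
  qed
  have "y = (\<Sum>k<h. alt (pos {} k) (act (g k) (w2 {k})))" using Dw2[OF e] by (simp add: D_def z_def w2_0)
  \<comment> \<open>Only singletons in \<open>slab 0\<close> contribute, and these satisfy
    \<open>b <= n - e_i\<close> for the direction \<open>i\<close> of their generator.\<close>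
  also have "\<dots> \<in> addspan {act a z | a z i. a \<in> R (axis i 1) \<and> z \<in> E 0 (n - axis i 1) \<and> \<delta> z = 0 \<and> b \<le> n - axis i 1}"
    (is "_ \<in> ?T")
  proof (intro subgrp_sum[OF subgrp_addspan] alt_subgrp[OF subgrp_addspan])
    fix k assume "k \<in> {..<h}"
    then have k: "k < h" by simp
    show "act (g k) (w2 {k}) \<in> ?T"
    proof (cases "{k} \<in> ?B")
      case False
      then show ?thesis using chainsD(1)[OF w2C] subgrp_0[OF subgrp_addspan] by simp
    next
      case True
      have "w2 {k} \<in> E 0 (n - axis (dir k) 1)" using chainsD(2)[OF w2C True] by (simp add: mdeg_def)
      moreover have "b \<le> n - axis (dir k) 1" using bS[OF True] by (simp add: mdeg_def)
      ultimately have "act (g k) (w2 {k}) \<in> {act a z | a z i. a \<in> R (axis i 1) \<and> z \<in> E 0 (n - axis i 1) \<and> \<delta> z = 0 \<and> b \<le> n - axis i 1}"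
        using sing[OF k True] g_axis[OF k] by blast
      then show ?thesis by (rule subsetD[OF addspan_superset])
    qed
  qed
  finally show ?thesis .
qed

end

lemma nonneg_vec_between:
  fixes v :: "int ^ 'r"
  assumes "0 \<le> v" "int q \<le> total_degree v"
  shows "\<exists>m. 0 \<le> m \<and> m \<le> v \<and> total_degree m = int q"
  using assms(2)
proof (induction q)
  case 0
  then show ?case using assms(1) by (intro exI[of _ 0]) (simp add: total_degree_def)
next
  case (Suc q)
  then obtain m where m: "0 \<le> m" "m \<le> v" "total_degree m = int q" by auto
  have "\<exists>i. m $ i < v $ i"
  proof (rule ccontr)
    assume "\<not> ?thesis"
    then have "m = v" using m(2) by (auto simp: vec_eq_iff less_eq_vec_def intro: antisym) (meson antisym not_less)
    then show False using m(3) Suc.prems by simp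
  qed
  then obtain i where i: "m $ i < v $ i" by blast
  have "0 \<le> m + axis i 1" "m + axis i 1 \<le> v"
    using m(1,2) i by (auto simp: less_eq_vec_def axis_def add_nonneg_nonneg)
  moreover have "total_degree (m + axis i 1) = int (Suc q)" using m(3) by (simp add: total_degree_add total_degree_axis)
  ultimately show ?case by blast
qed

context regularity
begin

theorem generation:
  assumes n: "b \<le> n" "total_degree b + int q \<le> total_degree n" and y: "y \<in> E 0 n" "\<delta> y = 0"
  shows "y \<in> addspan {act a z | a z i. a \<in> R (axis i 1) \<and> z \<in> E 0 (n - axis i 1) \<and> \<delta> z = 0 \<and> b \<le> n - axis i 1}"
proof -
  have "0 \<le> n - b" using n(1) by (simp add: less_eq_vec_def)
  then obtain m where m0: "0 \<le> m" "m \<le> n - b" "total_degree m = int q"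
    using nonneg_vec_between[of "n - b" q] n(2) by (auto simp: total_degree_diff)
  have "\<forall>i. \<exists>G. finite G \<and> G \<subseteq> R (axis i 1) \<and> R (axis i 1) \<subseteq> addspan {a * g | a g. a \<in> R 0 \<and> g \<in> G}"
    using R_finite_generators by blast
  then have "\<exists>G. \<forall>i. finite (G i) \<and> G i \<subseteq> R (axis i 1) \<and> R (axis i 1) \<subseteq> addspan {a * g | a g. a \<in> R 0 \<and> g \<in> G i}"
    by (rule choice)
  then obtain G where G0: "\<forall>i. finite (G i) \<and> G i \<subseteq> R (axis i 1) \<and> R (axis i 1) \<subseteq> addspan {a * g | a g. a \<in> R 0 \<and> g \<in> G i}" ..
  have G: "finite (G i)" "G i \<subseteq> R (axis i 1)" "R (axis i 1) \<subseteq> addspan {a * g | a g. a \<in> R 0 \<and> g \<in> G i}" for i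
    using spec[OF G0, of i] by simp_all
  have "finite (SIGMA i:UNIV. G i)" using G(1) by auto
  \<comment> \<open>A single list of all pairs of a direction and one of its generators; the Koszul
    system consists of its entries.\<close>
  then obtain L where L: "set L = (SIGMA i:UNIV. G i)" using finite_list by blast
  obtain rk :: "'r \<Rightarrow> nat" where rk: "bij_betw rk UNIV {0..<CARD('r)}" using ex_bij_betw_finite_nat[OF finite_class.finite_UNIV] by blast
  define g where "g k = snd (L ! k)" for k
  define dir where "dir k = fst (L ! k)" for k
  have Lk: "g k \<in> G (dir k)" if "k < length L" for k
    using nth_mem[OF that] unfolding L g_def dir_def by auto
  have "{a * g | a g. a \<in> R 0 \<and> g \<in> G i} \<subseteq> {a * g k | a k. a \<in> R 0 \<and> k < length L \<and> dir k = i}" for i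
  proof
    fix x assume "x \<in> {a * g | a g. a \<in> R 0 \<and> g \<in> G i}"
    then obtain a c where ac: "x = a * c" "a \<in> R 0" "c \<in> G i" by blast
    then have "(i, c) \<in> set L" unfolding L by simp
    then obtain k where "k < length L" "L ! k = (i, c)" by (auto simp: in_set_conv_nth)
    then show "x \<in> {a * g k | a k. a \<in> R 0 \<and> k < length L \<and> dir k = i}"
      using ac by (auto simp: g_def dir_def intro!: exI[of _ a] exI[of _ k])
  qed
  note gen = order_trans[OF G(3) addspan_subset[OF subgrp_addspan order_trans[OF this addspan_superset]]]
  interpret box R one act E \<delta> mm b q "length L" g dir rk m
  proof
    fix k i
    show "k < length L \<Longrightarrow> g k \<in> R (axis (dir k) 1)" using Lk G(2) by blast
    show "R (axis i 1) \<subseteq> addspan {a * g k | a k. a \<in> R 0 \<and> k < length L \<and> dir k = i}" by (rule gen)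
    show "bij_betw rk UNIV {..<CARD('r)}" using rk by (simp add: atLeast0LessThan)
  qed (use m0 in auto)
  have "m $ i \<le> n $ i - b $ i" for i using m0(2) by (simp add: less_eq_vec_def)
  then have "b $ i \<le> n $ i - m $ i" for i by (simp add: le_diff_eq add.commute)
  then have "b \<le> n - m" by (simp add: less_eq_vec_def)
  from generation[OF this y] show ?thesis .
qed

end

section \<open>Graded objects as families in a type class\<close>

locale gsum = abelian_group G for G :: "('m, 'x) ring_scheme" (structure) +
  fixes C :: "'d \<Rightarrow> 'm set"
  assumes ids: "internal_direct_sum G C"
begin

definition cmp :: "'m \<Rightarrow> 'd \<Rightarrow> 'm" where
  "cmp x = (THE c. (\<forall>n. c n \<in> C n) \<and> finite {n. c n \<noteq> \<zero>} \<and> x = (\<Oplus>n\<in>{n. c n \<noteq> \<zero>}. c n))"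

lemma C_subgroup: "additive_subgroup (C n) G"
  using ids by (simp add: internal_direct_sum_def)

lemma C_carrier: "x \<in> C n \<Longrightarrow> x \<in> carrier G"
  using additive_subgroup.a_Hcarr[OF C_subgroup] .

lemma C_zero [simp]: "\<zero> \<in> C n" by (rule additive_subgroup.zero_closed[OF C_subgroup])
lemma C_add: "x \<in> C n \<Longrightarrow> y \<in> C n \<Longrightarrow> x \<oplus> y \<in> C n" by (rule additive_subgroup.a_closed[OF C_subgroup])
lemma C_minus: "x \<in> C n \<Longrightarrow> \<ominus> x \<in> C n"
  using subgroup.m_inv_closed[OF additive_subgroup.a_subgroup[OF C_subgroup]] by (simp add: a_inv_def)

lemma cmp_ex:
  assumes "x \<in> carrier G"
  shows "(\<forall>n. cmp x n \<in> C n) \<and> finite {n. cmp x n \<noteq> \<zero>} \<and> x = (\<Oplus>n\<in>{n. cmp x n \<noteq> \<zero>}. cmp x n)"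
proof -
  have "\<exists>!c. (\<forall>n. c n \<in> C n) \<and> finite {n. c n \<noteq> \<zero>} \<and> x = (\<Oplus>n\<in>{n. c n \<noteq> \<zero>}. c n)"
    using ids assms unfolding internal_direct_sum_def by blast
  from theI'[OF this] show ?thesis unfolding cmp_def[symmetric] .
qed

lemma cmp_C: "x \<in> carrier G \<Longrightarrow> cmp x n \<in> C n" using cmp_ex by blast
lemma cmp_finite: "x \<in> carrier G \<Longrightarrow> finite {n. cmp x n \<noteq> \<zero>}" using cmp_ex by blast
lemma cmp_sum: "x \<in> carrier G \<Longrightarrow> x = (\<Oplus>n\<in>{n. cmp x n \<noteq> \<zero>}. cmp x n)" using cmp_ex by blast
lemma cmp_carrier: "x \<in> carrier G \<Longrightarrow> cmp x n \<in> carrier G" using cmp_C C_carrier by blast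

lemma cmp_sum_superset:
  assumes "x \<in> carrier G" "finite A" "{n. cmp x n \<noteq> \<zero>} \<subseteq> A"
  shows "x = (\<Oplus>n\<in>A. cmp x n)"
proof -
  have "(\<Oplus>n\<in>{n. cmp x n \<noteq> \<zero>}. cmp x n) = (\<Oplus>n\<in>A. cmp x n)"
    by (rule add.finprod_mono_neutral_cong_left) (use assms cmp_carrier in auto)
  then show ?thesis using cmp_sum[OF assms(1)] by simp
qed

lemma cmp_unique:
  assumes c: "\<And>n. c n \<in> C n" and A: "finite A" "\<And>n. n \<notin> A \<Longrightarrow> c n = \<zero>" and x: "x = (\<Oplus>n\<in>A. c n)"
  shows "cmp x = c"
proof -
  have "(\<Oplus>n\<in>{n. c n \<noteq> \<zero>}. c n) = (\<Oplus>n\<in>A. c n)"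
    by (rule add.finprod_mono_neutral_cong_left) (use A c C_carrier in auto)
  moreover have "finite {n. c n \<noteq> \<zero>}" by (rule finite_subset[OF _ A(1)]) (use A(2) in auto)
  moreover have "x \<in> carrier G" unfolding x by (rule finsum_closed) (use c C_carrier in auto)
  ultimately show ?thesis using cmp_ex[of x] c x ids unfolding internal_direct_sum_def by metis
qed

lemma cmp_add:
  assumes "x \<in> carrier G" "y \<in> carrier G"
  shows "cmp (x \<oplus> y) n = cmp x n \<oplus> cmp y n"
proof -
  let ?A = "{n. cmp x n \<noteq> \<zero>} \<union> {n. cmp y n \<noteq> \<zero>}"
  have A: "finite ?A" using cmp_finite assms by simp
  have "x \<oplus> y = (\<Oplus>n\<in>?A. cmp x n) \<oplus> (\<Oplus>n\<in>?A. cmp y n)"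
    using cmp_sum_superset[OF assms(1) A] cmp_sum_superset[OF assms(2) A] by auto
  also have "\<dots> = (\<Oplus>n\<in>?A. cmp x n \<oplus> cmp y n)"
    by (rule finsum_addf[symmetric]) (use assms cmp_carrier in auto)
  finally have "cmp (x \<oplus> y) = (\<lambda>n. cmp x n \<oplus> cmp y n)"
    using A by (intro cmp_unique[of _ ?A]) (use assms cmp_C C_add in auto)
  then show ?thesis by simp
qed

lemma cmp_homogeneous:
  assumes "x \<in> C m"
  shows "cmp x n = (if n = m then x else \<zero>)"
proof -
  have "cmp x = (\<lambda>n. if n = m then x else \<zero>)"
    by (rule cmp_unique[of _ "{m}"]) (use assms C_carrier in auto)
  then show ?thesis by simp
qed

lemma cmp_zero: "cmp \<zero> n = \<zero>"
  using cmp_homogeneous[OF C_zero, of n n] by simp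

lemma cmp_minus:
  assumes "x \<in> carrier G" shows "cmp (\<ominus> x) n = \<ominus> cmp x n"
proof -
  have "cmp x n \<oplus> cmp (\<ominus> x) n = \<zero>" using cmp_add[of x "\<ominus> x" n] assms by (simp add: r_neg cmp_zero)
  then show ?thesis using assms cmp_carrier by (metis a_inv_closed add.inv_equality a_comm)
qed

lemma sum_closed_induct:
  assumes "finite A" "P \<zero>" "\<And>x y. x \<in> carrier G \<Longrightarrow> y \<in> carrier G \<Longrightarrow> P x \<Longrightarrow> P y \<Longrightarrow> P (x \<oplus> y)"
    "\<And>n. n \<in> A \<Longrightarrow> f n \<in> carrier G" "\<And>n. n \<in> A \<Longrightarrow> P (f n)"
  shows "P (\<Oplus>n\<in>A. f n)"
  using assms(1,4,5)
proof (induction A rule: finite_induct)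
  case (insert a A)
  have "(\<Oplus>n\<in>insert a A. f n) = f a \<oplus> (\<Oplus>n\<in>A. f n)"
    by (rule finsum_insert) (use insert in auto)
  then show ?case using insert assms(3)[of "f a" "\<Oplus>n\<in>A. f n"] by (auto intro: finsum_closed)
qed (simp add: assms(2))

lemma cmp_closed_induct:
  assumes x: "x \<in> carrier G" and "P \<zero>" "\<And>x y. x \<in> carrier G \<Longrightarrow> y \<in> carrier G \<Longrightarrow> P x \<Longrightarrow> P y \<Longrightarrow> P (x \<oplus> y)"
    "\<And>n. P (cmp x n)"
  shows "P x"
proof -
  have "P (\<Oplus>n\<in>{n. cmp x n \<noteq> \<zero>}. cmp x n)"
    by (rule sum_closed_induct) (use assms cmp_finite cmp_carrier in auto)
  then show ?thesis using cmp_sum[OF x] by simp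
qed

lemma homogeneous_induct [consumes 1, case_names zero add homogeneous]:
  assumes "x \<in> carrier G" "P \<zero>" "\<And>x y. x \<in> carrier G \<Longrightarrow> y \<in> carrier G \<Longrightarrow> P x \<Longrightarrow> P y \<Longrightarrow> P (x \<oplus> y)"
    "\<And>n x. x \<in> C n \<Longrightarrow> P x"
  shows "P x"
proof (rule cmp_closed_induct[of x P])
  show "P (cmp x n)" for n by (rule assms(4)[OF cmp_C[OF assms(1)]])
qed (use assms in auto)

end

text \<open>Components commute with additive maps of degree \<open>d\<close>. The instances are
  multiplication by a homogeneous element, evaluation at a homogeneous module element,
  \<open>\<delta>\<close> and \<open>\<epsilon>\<close>.\<close>

lemma cmp_map:
  fixes C :: "'d::ab_group_add \<Rightarrow> 'm set" and C' :: "'d \<Rightarrow> 'n set"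
  assumes "gsum G C" "gsum G' C'"
    and f: "\<And>x y. x \<in> carrier G \<Longrightarrow> y \<in> carrier G \<Longrightarrow> f (x \<oplus>\<^bsub>G\<^esub> y) = f x \<oplus>\<^bsub>G'\<^esub> f y"
    and d: "\<And>n x. x \<in> C n \<Longrightarrow> f x \<in> C' (d + n)"
    and x: "x \<in> carrier G"
  shows "f x \<in> carrier G'" "gsum.cmp G' C' (f x) (d + n) = f (gsum.cmp G C x n)"
proof -
  interpret G: gsum G C by fact
  interpret H: gsum G' C' by fact
  have f0: "f \<zero>\<^bsub>G\<^esub> = \<zero>\<^bsub>G'\<^esub>"
  proof -
    have "f \<zero>\<^bsub>G\<^esub> \<in> carrier G'" using d[OF G.C_zero] H.C_carrier by blast
    moreover have "f \<zero>\<^bsub>G\<^esub> = f \<zero>\<^bsub>G\<^esub> \<oplus>\<^bsub>G'\<^esub> f \<zero>\<^bsub>G\<^esub>" using f[of "\<zero>\<^bsub>G\<^esub>" "\<zero>\<^bsub>G\<^esub>"] by simp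
    ultimately show ?thesis by (metis H.add.r_cancel_one')
  qed
  have fc: "f x \<in> carrier G'" if "x \<in> carrier G" for x
    using that by (induction rule: G.homogeneous_induct) (auto simp: f0 f dest: d H.C_carrier)
  then show "f x \<in> carrier G'" using x .
  show "H.cmp (f x) (d + n) = f (G.cmp x n)"
    using x
  proof (induction rule: G.homogeneous_induct)
    case zero
    then show ?case by (simp add: f0 G.cmp_zero H.cmp_zero)
  next
    case (add x y)
    then show ?case by (simp add: f G.cmp_add H.cmp_add G.cmp_carrier fc)
  next
    case (homogeneous m x)
    then show ?case using H.cmp_homogeneous[OF d[OF homogeneous]] G.cmp_homogeneous[OF homogeneous] f0 by simp
  qed
qed

lemma abelian_group_restrict:
  fixes G :: "('m, 'x) ring_scheme" and G' :: "('m, 'y) ring_scheme"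
  assumes "abelian_group G" "additive_subgroup H G" and G': "carrier G' = H" "add G' = add G" "zero G' = zero G"
  shows "abelian_group G'"
proof -
  interpret G: abelian_group G by fact
  interpret H: additive_subgroup H G by fact
  show ?thesis
  proof (rule abelian_groupI)
    fix x assume "x \<in> carrier G'"
    then have "\<ominus>\<^bsub>G\<^esub> x \<in> carrier G' \<and> \<ominus>\<^bsub>G\<^esub> x \<oplus>\<^bsub>G'\<^esub> x = \<zero>\<^bsub>G'\<^esub>"
      using subgroup.m_inv_closed[OF H.a_subgroup, of x] H.a_Hcarr G.l_neg G' by (simp add: a_inv_def)
    then show "\<exists>y\<in>carrier G'. y \<oplus>\<^bsub>G'\<^esub> x = \<zero>\<^bsub>G'\<^esub>" by blast
  qed (auto simp: G' G.add.m_ac H.a_Hcarr)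
qed

lemma finsum_restrict:
  fixes G :: "('m, 'x) ring_scheme" and G' :: "('m, 'y) ring_scheme"
  assumes "abelian_group G" "abelian_group G'" and G': "carrier G' \<subseteq> carrier G" "add G' = add G" "zero G' = zero G"
    and "finite A" "\<And>n. n \<in> A \<Longrightarrow> f n \<in> carrier G'"
  shows "finsum G' f A = finsum G f A"
  using assms(6,7)
proof (induction A rule: finite_induct)
  interpret G: abelian_group G by fact
  interpret H: abelian_group G' by fact
  case (insert a A)
  have "finsum G' f (insert a A) = f a \<oplus>\<^bsub>G'\<^esub> finsum G' f A" by (rule H.finsum_insert) (use insert in auto)
  moreover have "finsum G f (insert a A) = f a \<oplus>\<^bsub>G\<^esub> finsum G f A"
    by (rule G.finsum_insert) (use insert G'(1) in auto)
  ultimately show ?case using insert G' by simp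
qed (simp add: G' abelian_monoid.finsum_empty abelian_group.axioms assms(1,2))

text \<open>The shift \<open>d\<close> allows an ideal to carry the grading in which a homomorphism
  of degree \<open>d\<close> preserves degrees; \<open>d = 0\<close> gives graded ideals.\<close>

lemma internal_direct_sum_restrict:
  fixes G :: "('m, 'x) ring_scheme" and G' :: "('m, 'y) ring_scheme" and C :: "'d::ab_group_add \<Rightarrow> 'm set"
  assumes "gsum G C" "additive_subgroup H G" and G': "carrier G' = H" "add G' = add G" "zero G' = zero G"
    and H: "\<And>x n. x \<in> H \<Longrightarrow> gsum.cmp G C x n \<in> H"
  shows "internal_direct_sum G' (\<lambda>n. H \<inter> C (n - d))"
proof -
  interpret G: gsum G C by fact
  interpret H: additive_subgroup H G by fact
  have ab: "abelian_group G'" by (rule abelian_group_restrict[OF G.abelian_group_axioms assms(2) G'])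
  interpret G': abelian_group G' by fact
  have sub: "additive_subgroup (H \<inter> C (n - d)) G'" for n
  proof (rule additive_subgroup.intro, rule subgroup.intro)
    show "H \<inter> C (n - d) \<subseteq> carrier (add_monoid G')" by (auto simp: G')
    show "\<one>\<^bsub>add_monoid G'\<^esub> \<in> H \<inter> C (n - d)" by (simp add: G')
    fix x y assume x: "x \<in> H \<inter> C (n - d)" and y: "y \<in> H \<inter> C (n - d)"
    show "x \<otimes>\<^bsub>add_monoid G'\<^esub> y \<in> H \<inter> C (n - d)" using x y by (simp add: G' G.C_add)
    have xc: "x \<in> carrier G'" using x by (simp add: G')
    have "\<ominus>\<^bsub>G'\<^esub> x = \<ominus>\<^bsub>G\<^esub> x"
    proof (rule G'.minus_equality)
      show "\<ominus>\<^bsub>G\<^esub> x \<oplus>\<^bsub>G'\<^esub> x = \<zero>\<^bsub>G'\<^esub>" using x by (simp add: G' G.l_neg H.a_Hcarr)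
      show "\<ominus>\<^bsub>G\<^esub> x \<in> carrier G'"
        using x subgroup.m_inv_closed[OF H.a_subgroup, of x] by (simp add: G' a_inv_def)
    qed (rule xc)
    moreover have "\<ominus>\<^bsub>G\<^esub> x \<in> H \<inter> C (n - d)"
      using x subgroup.m_inv_closed[OF H.a_subgroup, of x] G.C_minus by (simp add: a_inv_def)
    ultimately show "inv\<^bsub>add_monoid G'\<^esub> x \<in> H \<inter> C (n - d)" by (simp add: a_inv_def)
  qed
  have re: "finsum G (\<lambda>n. c (n - d)) ((\<lambda>n. n + d) ` B) = finsum G c B"
    if "\<And>n. c n \<in> carrier G" for c :: "'d \<Rightarrow> 'm" and B
    using G.add.finprod_reindex[of "\<lambda>n. c (n - d)" "\<lambda>n. n + d" B] that by (auto simp: inj_on_def)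
  have "\<exists>!c. (\<forall>n. c n \<in> H \<inter> C (n - d)) \<and> finite {n. c n \<noteq> \<zero>\<^bsub>G'\<^esub>} \<and> x = finsum G' c {n. c n \<noteq> \<zero>\<^bsub>G'\<^esub>}"
    if x: "x \<in> carrier G'" for x
  proof (rule ex1I[of _ "\<lambda>n. G.cmp x (n - d)"])
    have xG: "x \<in> carrier G" using x H.a_Hcarr by (simp add: G')
    let ?B = "{n. G.cmp x n \<noteq> \<zero>\<^bsub>G\<^esub>}"
    have B: "{n. G.cmp x (n - d) \<noteq> \<zero>\<^bsub>G\<^esub>} = (\<lambda>n. n + d) ` ?B"
    proof
      show "{n. G.cmp x (n - d) \<noteq> \<zero>\<^bsub>G\<^esub>} \<subseteq> (\<lambda>n. n + d) ` ?B"
        by (rule subsetI, rule_tac x = "xa - d" in image_eqI) auto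
    qed auto
    have fin: "finite {n. G.cmp x (n - d) \<noteq> \<zero>\<^bsub>G\<^esub>}" unfolding B using G.cmp_finite[OF xG] by simp
    have "x = finsum G (\<lambda>n. G.cmp x (n - d)) {n. G.cmp x (n - d) \<noteq> \<zero>\<^bsub>G\<^esub>}"
      using G.cmp_sum[OF xG] re[of "G.cmp x" ?B] G.cmp_carrier[OF xG] unfolding B by simp
    also have "\<dots> = finsum G' (\<lambda>n. G.cmp x (n - d)) {n. G.cmp x (n - d) \<noteq> \<zero>\<^bsub>G\<^esub>}"
      by (rule finsum_restrict[symmetric, OF G.abelian_group_axioms ab]) (use H x fin H.a_Hcarr in \<open>auto simp: G'\<close>)
    finally show "(\<forall>n. G.cmp x (n - d) \<in> H \<inter> C (n - d)) \<and> finite {n. G.cmp x (n - d) \<noteq> \<zero>\<^bsub>G'\<^esub>} \<and>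
      x = finsum G' (\<lambda>n. G.cmp x (n - d)) {n. G.cmp x (n - d) \<noteq> \<zero>\<^bsub>G'\<^esub>}"
      using H x G.cmp_C[OF xG] fin by (simp add: G')
    fix c assume c: "(\<forall>n. c n \<in> H \<inter> C (n - d)) \<and> finite {n. c n \<noteq> \<zero>\<^bsub>G'\<^esub>} \<and> x = finsum G' c {n. c n \<noteq> \<zero>\<^bsub>G'\<^esub>}"
    let ?A = "{n. c n \<noteq> \<zero>\<^bsub>G\<^esub>}"
    have cH: "c n \<in> H" "c n \<in> C (n - d)" for n using c by auto
    have fA: "finite ?A" using c by (simp add: G')
    have "x = finsum G' c ?A" using c by (simp add: G')
    also have "\<dots> = finsum G c ?A"
      by (rule finsum_restrict[OF G.abelian_group_axioms ab]) (use cH fA H.a_Hcarr in \<open>auto simp: G'\<close>)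
    also have "\<dots> = finsum G (\<lambda>n. c (n + d)) ((\<lambda>n. n - d) ` ?A)"
      using G.add.finprod_reindex[of "\<lambda>n. c (n + d)" "\<lambda>n. n - d" ?A] cH H.a_Hcarr by (auto simp: inj_on_def)
    finally have "G.cmp x = (\<lambda>n. c (n + d))"
    proof (rule G.cmp_unique[rotated 3])
      show "c (n + d) \<in> C n" for n using cH(2)[of "n + d"] by simp
      show "finite ((\<lambda>n. n - d) ` ?A)" using fA by simp
      fix n assume "n \<notin> (\<lambda>n. n - d) ` ?A"
      then have "n + d \<notin> ?A" by (metis (no_types, lifting) add_diff_cancel imageI)
      then show "c (n + d) = \<zero>\<^bsub>G\<^esub>" by simp
    qed
    then show "c = (\<lambda>n. G.cmp x (n - d))" by simp
  qed
  then show ?thesis using sub unfolding internal_direct_sum_def by blast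
qed

text \<open>Every commutative ring on a type embeds, without preserving the unit, into the product of all of
  them, which is an instance of the type class. This allows calculations in an arbitrary ring to use the
  algebraic type classes. The same device is applied to the abelian groups \<open>E i\<close> of a resolution.\<close>

typedef ('a, 'd) pring = "{f :: ('a, 'd) gring \<Rightarrow> 'a. \<forall>K. if cring K then f K \<in> carrier K else f K = undefined}"
  by (rule exI[of _ "\<lambda>K. if cring K then \<zero>\<^bsub>K\<^esub> else undefined"]) (auto simp: cring_def ring_def abelian_group_def abelian_monoid.zero_closed)

typedef ('a, 'e, 'd) pgrp = "{f :: nat \<times> ('a, 'e, 'd) gmodule \<Rightarrow> 'e.
    \<forall>K. if abelian_group (snd K) then f K \<in> carrier (snd K) else f K = undefined}"
  by (rule exI[of _ "\<lambda>K. if abelian_group (snd K) then \<zero>\<^bsub>snd K\<^esub> else undefined"])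
    (auto simp: abelian_group_def abelian_monoid.zero_closed)

lemma Rep_pring_carrier: "cring K \<Longrightarrow> Rep_pring f K \<in> carrier K"
  using Rep_pring[of f] by auto

lemma Rep_pring_undefined: "\<not> cring K \<Longrightarrow> Rep_pring f K = undefined"
  using Rep_pring[of f] by auto

lemma pring_eqI: "(\<And>K. cring K \<Longrightarrow> Rep_pring f K = Rep_pring g K) \<Longrightarrow> f = g"
  by (metis Rep_pring_undefined Rep_pring_inject ext)

definition mk_pring :: "(('a, 'd) gring \<Rightarrow> 'a) \<Rightarrow> ('a, 'd) pring" where
  "mk_pring f = Abs_pring (\<lambda>K. if cring K then f K else undefined)"

lemma Rep_mk_pring:
  assumes "\<And>K. cring K \<Longrightarrow> f K \<in> carrier K" "cring K"
  shows "Rep_pring (mk_pring f) K = f K"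
  unfolding mk_pring_def by (subst Abs_pring_inverse) (use assms in auto)

instantiation pring :: (type, type) comm_ring
begin
definition "0 = mk_pring (\<lambda>K. \<zero>\<^bsub>K\<^esub>)"
definition "f + g = mk_pring (\<lambda>K. Rep_pring f K \<oplus>\<^bsub>K\<^esub> Rep_pring g K)"
definition "- f = mk_pring (\<lambda>K. \<ominus>\<^bsub>K\<^esub> Rep_pring f K)"
definition "f - g = mk_pring (\<lambda>K. Rep_pring f K \<ominus>\<^bsub>K\<^esub> Rep_pring g K)"
definition "f * g = mk_pring (\<lambda>K. Rep_pring f K \<otimes>\<^bsub>K\<^esub> Rep_pring g K)"

lemma Rep_pring_ops:
  assumes "cring K"
  shows "Rep_pring 0 K = \<zero>\<^bsub>K\<^esub>" "Rep_pring (f + g) K = Rep_pring f K \<oplus>\<^bsub>K\<^esub> Rep_pring g K"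
    "Rep_pring (- f) K = \<ominus>\<^bsub>K\<^esub> Rep_pring f K" "Rep_pring (f - g) K = Rep_pring f K \<ominus>\<^bsub>K\<^esub> Rep_pring g K"
    "Rep_pring (f * g) K = Rep_pring f K \<otimes>\<^bsub>K\<^esub> Rep_pring g K"
proof -
  have c: "\<zero>\<^bsub>K\<^esub> \<in> carrier K" "Rep_pring f K \<oplus>\<^bsub>K\<^esub> Rep_pring g K \<in> carrier K"
    "\<ominus>\<^bsub>K\<^esub> Rep_pring f K \<in> carrier K" "Rep_pring f K \<ominus>\<^bsub>K\<^esub> Rep_pring g K \<in> carrier K"
    "Rep_pring f K \<otimes>\<^bsub>K\<^esub> Rep_pring g K \<in> carrier K" if "cring K" for K
  proof -
    interpret cring K by fact
    note * = Rep_pring_carrier[OF that, of f] Rep_pring_carrier[OF that, of g]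
    show "\<zero>\<^bsub>K\<^esub> \<in> carrier K" "Rep_pring f K \<oplus>\<^bsub>K\<^esub> Rep_pring g K \<in> carrier K"
      "\<ominus>\<^bsub>K\<^esub> Rep_pring f K \<in> carrier K" "Rep_pring f K \<ominus>\<^bsub>K\<^esub> Rep_pring g K \<in> carrier K"
      "Rep_pring f K \<otimes>\<^bsub>K\<^esub> Rep_pring g K \<in> carrier K" using * by auto
  qed
  show "Rep_pring 0 K = \<zero>\<^bsub>K\<^esub>" "Rep_pring (f + g) K = Rep_pring f K \<oplus>\<^bsub>K\<^esub> Rep_pring g K"
    "Rep_pring (- f) K = \<ominus>\<^bsub>K\<^esub> Rep_pring f K" "Rep_pring (f - g) K = Rep_pring f K \<ominus>\<^bsub>K\<^esub> Rep_pring g K"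
    "Rep_pring (f * g) K = Rep_pring f K \<otimes>\<^bsub>K\<^esub> Rep_pring g K"
    unfolding zero_pring_def plus_pring_def uminus_pring_def minus_pring_def times_pring_def
    by (subst Rep_mk_pring; use c assms in simp)+
qed

instance
proof
  fix a b c :: "('a, 'b) pring"
  show "a + b + c = a + (b + c)"
  proof (rule pring_eqI)
    fix K :: "('a, 'b) gring" assume K: "cring K"
    interpret cring K by fact
    show "Rep_pring (a + b + c) K = Rep_pring (a + (b + c)) K"
      by (simp add: Rep_pring_ops[OF K] Rep_pring_carrier[OF K] a_assoc)
  qed
  show "a + b = b + a"
  proof (rule pring_eqI)
    fix K :: "('a, 'b) gring" assume K: "cring K"
    interpret cring K by fact
    show "Rep_pring (a + b) K = Rep_pring (b + a) K"
      by (simp add: Rep_pring_ops[OF K] Rep_pring_carrier[OF K] a_comm)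
  qed
  show "0 + a = a"
  proof (rule pring_eqI)
    fix K :: "('a, 'b) gring" assume K: "cring K"
    interpret cring K by fact
    show "Rep_pring (0 + a) K = Rep_pring a K" by (simp add: Rep_pring_ops[OF K] Rep_pring_carrier[OF K])
  qed
  show "- a + a = 0"
  proof (rule pring_eqI)
    fix K :: "('a, 'b) gring" assume K: "cring K"
    interpret cring K by fact
    show "Rep_pring (- a + a) K = Rep_pring 0 K" by (simp add: Rep_pring_ops[OF K] Rep_pring_carrier[OF K] l_neg)
  qed
  show "a - b = a + - b"
  proof (rule pring_eqI)
    fix K :: "('a, 'b) gring" assume K: "cring K"
    interpret cring K by fact
    show "Rep_pring (a - b) K = Rep_pring (a + - b) K" by (simp add: Rep_pring_ops[OF K] minus_eq)
  qed
  show "a * b * c = a * (b * c)"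
  proof (rule pring_eqI)
    fix K :: "('a, 'b) gring" assume K: "cring K"
    interpret cring K by fact
    show "Rep_pring (a * b * c) K = Rep_pring (a * (b * c)) K"
      by (simp add: Rep_pring_ops[OF K] Rep_pring_carrier[OF K] m_assoc)
  qed
  show "a * b = b * a"
  proof (rule pring_eqI)
    fix K :: "('a, 'b) gring" assume K: "cring K"
    interpret cring K by fact
    show "Rep_pring (a * b) K = Rep_pring (b * a) K"
      by (simp add: Rep_pring_ops[OF K] Rep_pring_carrier[OF K] m_comm)
  qed
  show "(a + b) * c = a * c + b * c"
  proof (rule pring_eqI)
    fix K :: "('a, 'b) gring" assume K: "cring K"
    interpret cring K by fact
    show "Rep_pring ((a + b) * c) K = Rep_pring (a * c + b * c) K"
      by (simp add: Rep_pring_ops[OF K] Rep_pring_carrier[OF K] l_distr)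
  qed
qed

end

lemma Rep_pgrp_carrier: "abelian_group X \<Longrightarrow> Rep_pgrp f (j, X) \<in> carrier X"
  using Rep_pgrp[of f] unfolding mem_Collect_eq by (metis snd_conv)

lemma Rep_pgrp_undefined: "\<not> abelian_group X \<Longrightarrow> Rep_pgrp f (j, X) = undefined"
  using Rep_pgrp[of f] unfolding mem_Collect_eq by (metis snd_conv)

lemma pgrp_eqI: "(\<And>j X. abelian_group X \<Longrightarrow> Rep_pgrp f (j, X) = Rep_pgrp g (j, X)) \<Longrightarrow> f = g"
proof -
  assume *: "\<And>j X. abelian_group X \<Longrightarrow> Rep_pgrp f (j, X) = Rep_pgrp g (j, X)"
  have "Rep_pgrp f (j, X) = Rep_pgrp g (j, X)" for j X
    using *[of X j] Rep_pgrp_undefined[of X f j] Rep_pgrp_undefined[of X g j] by (cases "abelian_group X") auto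
  then have "Rep_pgrp f K = Rep_pgrp g K" for K by (cases K) simp
  then show ?thesis by (metis Rep_pgrp_inject ext)
qed

definition mk_pgrp :: "(nat \<Rightarrow> ('a, 'e, 'd) gmodule \<Rightarrow> 'e) \<Rightarrow> ('a, 'e, 'd) pgrp" where
  "mk_pgrp f = Abs_pgrp (\<lambda>(j, X). if abelian_group X then f j X else undefined)"

lemma Rep_mk_pgrp:
  assumes "\<And>j X. abelian_group X \<Longrightarrow> f j X \<in> carrier X" "abelian_group X"
  shows "Rep_pgrp (mk_pgrp f) (j, X) = f j X"
  unfolding mk_pgrp_def by (subst Abs_pgrp_inverse) (use assms in auto)

instantiation pgrp :: (type, type, type) ab_group_add
begin
definition "0 = mk_pgrp (\<lambda>j X. \<zero>\<^bsub>X\<^esub>)"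
definition "f + g = mk_pgrp (\<lambda>j X. Rep_pgrp f (j, X) \<oplus>\<^bsub>X\<^esub> Rep_pgrp g (j, X))"
definition "- f = mk_pgrp (\<lambda>j X. \<ominus>\<^bsub>X\<^esub> Rep_pgrp f (j, X))"
definition "f - g = mk_pgrp (\<lambda>j X. Rep_pgrp f (j, X) \<ominus>\<^bsub>X\<^esub> Rep_pgrp g (j, X))"

lemma Rep_pgrp_ops:
  assumes "abelian_group X"
  shows "Rep_pgrp 0 (j, X) = \<zero>\<^bsub>X\<^esub>" "Rep_pgrp (f + g) (j, X) = Rep_pgrp f (j, X) \<oplus>\<^bsub>X\<^esub> Rep_pgrp g (j, X)"
    "Rep_pgrp (- f) (j, X) = \<ominus>\<^bsub>X\<^esub> Rep_pgrp f (j, X)"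
    "Rep_pgrp (f - g) (j, X) = Rep_pgrp f (j, X) \<ominus>\<^bsub>X\<^esub> Rep_pgrp g (j, X)"
proof -
  have c: "\<zero>\<^bsub>X\<^esub> \<in> carrier X" "Rep_pgrp f (j, X) \<oplus>\<^bsub>X\<^esub> Rep_pgrp g (j, X) \<in> carrier X"
    "\<ominus>\<^bsub>X\<^esub> Rep_pgrp f (j, X) \<in> carrier X" "Rep_pgrp f (j, X) \<ominus>\<^bsub>X\<^esub> Rep_pgrp g (j, X) \<in> carrier X"
    if "abelian_group X" for j X
  proof -
    interpret abelian_group X by fact
    note * = Rep_pgrp_carrier[OF that, of f] Rep_pgrp_carrier[OF that, of g]
    show "\<zero>\<^bsub>X\<^esub> \<in> carrier X" "Rep_pgrp f (j, X) \<oplus>\<^bsub>X\<^esub> Rep_pgrp g (j, X) \<in> carrier X"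
      "\<ominus>\<^bsub>X\<^esub> Rep_pgrp f (j, X) \<in> carrier X" "Rep_pgrp f (j, X) \<ominus>\<^bsub>X\<^esub> Rep_pgrp g (j, X) \<in> carrier X"
      using * by auto
  qed
  show "Rep_pgrp 0 (j, X) = \<zero>\<^bsub>X\<^esub>" "Rep_pgrp (f + g) (j, X) = Rep_pgrp f (j, X) \<oplus>\<^bsub>X\<^esub> Rep_pgrp g (j, X)"
    "Rep_pgrp (- f) (j, X) = \<ominus>\<^bsub>X\<^esub> Rep_pgrp f (j, X)"
    "Rep_pgrp (f - g) (j, X) = Rep_pgrp f (j, X) \<ominus>\<^bsub>X\<^esub> Rep_pgrp g (j, X)"
    unfolding zero_pgrp_def plus_pgrp_def uminus_pgrp_def minus_pgrp_def
    by (subst Rep_mk_pgrp; use c assms in simp)+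
qed

instance
proof
  fix a b c :: "('a, 'b, 'c) pgrp"
  show "a + b + c = a + (b + c)"
  proof (rule pgrp_eqI)
    fix j and K :: "('a, 'b, 'c) gmodule" assume K: "abelian_group K"
    interpret abelian_group K by fact
    show "Rep_pgrp (a + b + c) (j, K) = Rep_pgrp (a + (b + c)) (j, K)"
      by (simp add: Rep_pgrp_ops[OF K] Rep_pgrp_carrier[OF K] a_assoc)
  qed
  show "a + b = b + a"
  proof (rule pgrp_eqI)
    fix j and K :: "('a, 'b, 'c) gmodule" assume K: "abelian_group K"
    interpret abelian_group K by fact
    show "Rep_pgrp (a + b) (j, K) = Rep_pgrp (b + a) (j, K)"
      by (simp add: Rep_pgrp_ops[OF K] Rep_pgrp_carrier[OF K] a_comm)
  qed
  show "0 + a = a"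
  proof (rule pgrp_eqI)
    fix j and K :: "('a, 'b, 'c) gmodule" assume K: "abelian_group K"
    interpret abelian_group K by fact
    show "Rep_pgrp (0 + a) (j, K) = Rep_pgrp a (j, K)" by (simp add: Rep_pgrp_ops[OF K] Rep_pgrp_carrier[OF K])
  qed
  show "- a + a = 0"
  proof (rule pgrp_eqI)
    fix j and K :: "('a, 'b, 'c) gmodule" assume K: "abelian_group K"
    interpret abelian_group K by fact
    show "Rep_pgrp (- a + a) (j, K) = Rep_pgrp 0 (j, K)"
      by (simp add: Rep_pgrp_ops[OF K] Rep_pgrp_carrier[OF K] l_neg)
  qed
  show "a - b = a + - b"
  proof (rule pgrp_eqI)
    fix j and K :: "('a, 'b, 'c) gmodule" assume K: "abelian_group K"
    interpret abelian_group K by fact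
    show "Rep_pgrp (a - b) (j, K) = Rep_pgrp (a + - b) (j, K)" by (simp add: Rep_pgrp_ops[OF K] minus_eq)
  qed
qed

end

text \<open>Additive and multiplicative, but \<open>\<one>\<close> goes to an idempotent that is
  zero outside the coordinate \<open>R\<close>; this is the \<open>one\<close> of
  \<open>hring\<close>.\<close>

definition inR :: "('a, 'd) gring \<Rightarrow> 'a \<Rightarrow> ('a, 'd) pring" where
  "inR R a = mk_pring (\<lambda>K. if K = R then a else \<zero>\<^bsub>K\<^esub>)"

text \<open>A vector is read as the coefficients of a polynomial and evaluated at an integer that is
  a root of none of the finitely many polynomials \<open>f (p - q)\<close> for distinct
  \<open>p\<close>, \<open>q\<close> in \<open>S\<close>.\<close>

lemma separating_functional:
  fixes S :: "(int ^ 'r) set"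
  assumes "finite S"
  obtains w :: "int ^ 'r \<Rightarrow> int" where "\<And>p q. w (p + q) = w p + w q" "inj_on w S"
proof -
  obtain ix :: "'r \<Rightarrow> nat" where ix: "inj ix"
    using finite_imp_inj_to_nat_seg[of "UNIV :: 'r set"] by auto
  define f where "f p = (\<Sum>i\<in>UNIV. monom (p $ i) (ix i))" for p :: "int ^ 'r"
  have coeff: "coeff (f p) (ix i) = p $ i" for p i
  proof -
    have "coeff (f p) (ix i) = (\<Sum>j\<in>UNIV. if j = i then p $ j else 0)"
      unfolding f_def coeff_sum using ix by (intro sum.cong) (auto simp: inj_def)
    then show ?thesis by simp
  qed
  have f_diff: "f (p - q) = f p - f q" for p q
    by (simp add: f_def sum_subtractf diff_monom[symmetric])
  have f_add: "f (p + q) = f p + f q" for p q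
    by (simp add: f_def sum.distrib add_monom[symmetric])
  have nz: "f (p - q) \<noteq> 0" if "p \<noteq> q" for p q
  proof
    assume "f (p - q) = 0"
    then have "(p - q) $ i = 0" for i using coeff[of "p - q" i] by simp
    then have "p = q" by (simp add: vec_eq_iff)
    with that show False by simp
  qed
  have "finite (\<Union>(p, q)\<in>{(p, q). p \<in> S \<and> q \<in> S \<and> p \<noteq> q}. {x. poly (f (p - q)) x = 0})"
    by (rule finite_UN_I) (use assms nz poly_roots_finite in \<open>auto intro: finite_subset[of _ "S \<times> S"]\<close>)
  then obtain x :: int where x: "x \<notin> (\<Union>(p, q)\<in>{(p, q). p \<in> S \<and> q \<in> S \<and> p \<noteq> q}. {x. poly (f (p - q)) x = 0})"
    using ex_new_if_finite[OF infinite_UNIV_int] by blast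
  show ?thesis
  proof (rule that[of "\<lambda>p. poly (f p) x"])
    show "inj_on (\<lambda>p. poly (f p) x) S"
    proof (rule inj_onI, rule ccontr)
      fix p q assume "p \<in> S" "q \<in> S" "poly (f p) x = poly (f q) x" "p \<noteq> q"
      then show False using x by (auto simp: f_diff)
    qed
  qed (simp add: f_add)
qed

text \<open>Maximizing an additive functional that is injective on the two finite sets replaces a
  total order on the degrees; this is the leading term argument for primality of graded
  ideals.\<close>

lemma unique_sum_pair:
  fixes S T :: "(int ^ 'r) set"
  assumes "finite S" "S \<noteq> {}" "finite T" "T \<noteq> {}"
  obtains p0 q0 where "p0 \<in> S" "q0 \<in> T" "\<And>p q. p \<in> S \<Longrightarrow> q \<in> T \<Longrightarrow> p + q = p0 + q0 \<Longrightarrow> p = p0 \<and> q = q0"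
proof -
  obtain w :: "int ^ 'r \<Rightarrow> int" where w: "\<And>p q. w (p + q) = w p + w q" "inj_on w (S \<union> T)"
    using separating_functional[of "S \<union> T"] assms by blast
  have "Max (w ` S) \<in> w ` S" using assms by (intro Max_in) auto
  then obtain p0 where "p0 \<in> S" "Max (w ` S) = w p0" by blast
  then have p0: "p0 \<in> S" "\<And>p. p \<in> S \<Longrightarrow> w p \<le> w p0"
    using Max_ge[of "w ` S"] assms by (simp, metis finite_imageI imageI)
  have "Max (w ` T) \<in> w ` T" using assms by (intro Max_in) auto
  then obtain q0 where "q0 \<in> T" "Max (w ` T) = w q0" by blast
  then have q0: "q0 \<in> T" "\<And>q. q \<in> T \<Longrightarrow> w q \<le> w q0"
    using Max_ge[of "w ` T"] assms by (simp, metis finite_imageI imageI)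
  have "p = p0 \<and> q = q0" if "p \<in> S" "q \<in> T" "p + q = p0 + q0" for p q
  proof -
    have "w p + w q = w p0 + w q0" using that(3) w(1) by metis
    then have "w p = w p0" "w q = w q0" using p0(2)[OF that(1)] q0(2)[OF that(2)] by auto
    then show ?thesis using w(2) that p0(1) q0(1) by (auto simp: inj_on_def)
  qed
  with p0 q0 that show ?thesis by blast
qed

section \<open>Standard graded rings\<close>

locale sring =
  fixes R :: "('a, int ^ 'r) gring" (structure)
  assumes noeth: "noetherian_ring R" and std: "standard_graded R"
    and local: "local_ring (degree_zero_ring R)"

sublocale sring \<subseteq> cring R
  using std by (simp add: standard_graded_def graded_ring_def)

sublocale sring \<subseteq> gs: gsum R "rcomp R"
  using std by unfold_locales (simp add: standard_graded_def graded_ring_def)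

context sring
begin

lemma cring_R: "cring R" by (rule is_cring)

lemma rcomp_mult: "x \<in> rcomp R p \<Longrightarrow> y \<in> rcomp R q \<Longrightarrow> x \<otimes> y \<in> rcomp R (p + q)"
  and rcomp_one: "\<one> \<in> rcomp R 0"
  using std by (auto simp: standard_graded_def graded_ring_def)

lemmas rcomp_carrier = gs.C_carrier

lemma Rep_inR: "a \<in> carrier R \<Longrightarrow> cring K \<Longrightarrow> Rep_pring (inR R a) K = (if K = R then a else \<zero>\<^bsub>K\<^esub>)"
  unfolding inR_def by (rule Rep_mk_pring) (auto simp: cring_def ring_def abelian_group_def abelian_monoid.zero_closed)

lemma Rep_inR_self: "a \<in> carrier R \<Longrightarrow> Rep_pring (inR R a) R = a"
  using Rep_inR[OF _ cring_R] by simp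

lemma inR_zero: "inR R \<zero> = 0"
  by (rule pring_eqI) (simp add: Rep_inR Rep_pring_ops)

lemma inR_add: "a \<in> carrier R \<Longrightarrow> b \<in> carrier R \<Longrightarrow> inR R (a \<oplus> b) = inR R a + inR R b"
proof (rule pring_eqI)
  fix K :: "('a, int ^ 'r) gring" assume K: "cring K" and ab: "a \<in> carrier R" "b \<in> carrier R"
  interpret K: cring K by fact
  show "Rep_pring (inR R (a \<oplus> b)) K = Rep_pring (inR R a + inR R b) K"
    using ab by (simp add: Rep_inR[OF _ K] Rep_pring_ops[OF K])
qed

lemma inR_diff: "a \<in> carrier R \<Longrightarrow> b \<in> carrier R \<Longrightarrow> inR R (a \<ominus> b) = inR R a - inR R b"
proof (rule pring_eqI)
  fix K :: "('a, int ^ 'r) gring" assume K: "cring K" and ab: "a \<in> carrier R" "b \<in> carrier R"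
  interpret K: cring K by fact
  show "Rep_pring (inR R (a \<ominus> b)) K = Rep_pring (inR R a - inR R b) K"
    using ab by (simp add: Rep_inR[OF _ K] Rep_pring_ops[OF K]) (simp add: K.minus_eq)
qed

lemma inR_mult: "a \<in> carrier R \<Longrightarrow> b \<in> carrier R \<Longrightarrow> inR R (a \<otimes> b) = inR R a * inR R b"
proof (rule pring_eqI)
  fix K :: "('a, int ^ 'r) gring" assume K: "cring K" and ab: "a \<in> carrier R" "b \<in> carrier R"
  interpret K: cring K by fact
  show "Rep_pring (inR R (a \<otimes> b)) K = Rep_pring (inR R a * inR R b) K"
    using ab by (simp add: Rep_inR[OF _ K] Rep_pring_ops[OF K])
qed

definition RR :: "int ^ 'r \<Rightarrow> ('a, int ^ 'r) pring set" where
  "RR p = inR R ` rcomp R p"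

lemma RRE: assumes "a \<in> RR p" obtains a' where "a' \<in> rcomp R p" "a = inR R a'" "a' \<in> carrier R"
  using assms rcomp_carrier unfolding RR_def by blast

lemma RRI: "a \<in> rcomp R p \<Longrightarrow> inR R a \<in> RR p"
  by (simp add: RR_def)

lemma subgrp_inR:
  assumes "additive_subgroup H R" shows "subgrp (inR R ` H)"
proof (rule subgrpI)
  interpret H: additive_subgroup H R by fact
  show "0 \<in> inR R ` H" using inR_zero H.zero_closed by (metis imageI)
  fix x y assume "x \<in> inR R ` H" "y \<in> inR R ` H"
  then obtain a b where ab: "x = inR R a" "y = inR R b" "a \<in> H" "b \<in> H" by blast
  have "\<ominus> b \<in> H" using subgroup.m_inv_closed[OF H.a_subgroup ab(4)] by (simp add: a_inv_def)
  then have "a \<ominus> b \<in> H" using ab(3) by (simp add: minus_eq)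
  moreover have "x - y = inR R (a \<ominus> b)" using ab H.a_Hcarr by (simp add: inR_diff)
  ultimately show "x - y \<in> inR R ` H" by blast
qed

lemma cmp_mult_homogeneous:
  assumes "r \<in> rcomp R q" "x \<in> carrier R"
  shows "gs.cmp (r \<otimes> x) (q + n) = r \<otimes> gs.cmp x n"
  by (rule cmp_map(2)[where f = "\<lambda>x. r \<otimes> x"])
    (use assms rcomp_carrier rcomp_mult in \<open>auto simp: r_distr gs.gsum_axioms\<close>)

text \<open>Replaces the convolution formula for the components of a product by closure under
  sums.\<close>

lemma cmp_mult_in:
  assumes x: "x \<in> carrier R" and y: "y \<in> carrier R" and U: "\<zero> \<in> U" "\<And>u v. u \<in> U \<Longrightarrow> v \<in> U \<Longrightarrow> u \<oplus> v \<in> U"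
    and *: "\<And>p q. p + q = n \<Longrightarrow> gs.cmp x p \<otimes> gs.cmp y q \<in> U"
  shows "gs.cmp (x \<otimes> y) n \<in> U"
proof (rule gs.cmp_closed_induct[of x "\<lambda>x. gs.cmp (x \<otimes> y) n \<in> U"])
  show "gs.cmp (\<zero> \<otimes> y) n \<in> U" using y U by (simp add: gs.cmp_zero)
  fix p
  have "gs.cmp (gs.cmp x p \<otimes> y) (p + (n - p)) = gs.cmp x p \<otimes> gs.cmp y (n - p)"
    by (rule cmp_mult_homogeneous[OF gs.cmp_C[OF x] y])
  then show "gs.cmp (gs.cmp x p \<otimes> y) n \<in> U" using *[of p "n - p"] by simp
qed (use x y U in \<open>auto simp: l_distr gs.cmp_add\<close>)

text \<open>The graded ideal of \<open>R\<close> whose homogeneous components are given by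
  \<open>J\<close>.\<close>

definition tot :: "(int ^ 'r \<Rightarrow> ('a, int ^ 'r) pring set) \<Rightarrow> 'a set" where
  "tot J = {x \<in> carrier R. \<forall>p. inR R (gs.cmp x p) \<in> J p}"

lemma hideal_parts:
  assumes "hideal RR J"
  shows "subgrp (J p)" "c \<in> J p \<Longrightarrow> \<exists>a'. a' \<in> rcomp R p \<and> a' \<in> carrier R \<and> c = inR R a'"
    "r \<in> rcomp R p \<Longrightarrow> a \<in> rcomp R q \<Longrightarrow> inR R a \<in> J q \<Longrightarrow> inR R (r \<otimes> a) \<in> J (p + q)"
    "a \<in> carrier R \<Longrightarrow> b \<in> carrier R \<Longrightarrow> inR R a \<in> J p \<Longrightarrow> inR R b \<in> J p \<Longrightarrow> inR R (a \<oplus> b) \<in> J p"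
    "inR R \<zero> \<in> J p" "a \<in> carrier R \<Longrightarrow> inR R a \<in> J p \<Longrightarrow> inR R (\<ominus> a) \<in> J p"
proof -
  show s: "subgrp (J p)" using assms by (simp add: hideal_def)
  show "c \<in> J p \<Longrightarrow> \<exists>a'. a' \<in> rcomp R p \<and> a' \<in> carrier R \<and> c = inR R a'"
    using assms RRE unfolding hideal_def by (metis subsetD)
  show "r \<in> rcomp R p \<Longrightarrow> a \<in> rcomp R q \<Longrightarrow> inR R a \<in> J q \<Longrightarrow> inR R (r \<otimes> a) \<in> J (p + q)"
    using assms inR_mult RRI rcomp_carrier unfolding hideal_def by metis
  show "a \<in> carrier R \<Longrightarrow> b \<in> carrier R \<Longrightarrow> inR R a \<in> J p \<Longrightarrow> inR R b \<in> J p \<Longrightarrow> inR R (a \<oplus> b) \<in> J p"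
    using s by (simp add: inR_add subgrp_add)
  show "inR R \<zero> \<in> J p" using s by (simp add: inR_zero subgrp_0)
  show "inR R (\<ominus> a) \<in> J p" if "a \<in> carrier R" "inR R a \<in> J p"
  proof -
    have "inR R (\<ominus> a) = 0 - inR R a" using inR_diff[of \<zero> a] that(1) by (simp add: inR_zero minus_eq)
    then show ?thesis using subgrp_minus[OF s that(2)] by simp
  qed
qed

lemma tot_homogeneous:
  assumes J: "hideal RR J" and a: "a \<in> rcomp R p"
  shows "a \<in> tot J \<longleftrightarrow> inR R a \<in> J p"
  using rcomp_carrier[OF a] hideal_parts(5)[OF J] by (auto simp: tot_def gs.cmp_homogeneous[OF a])

lemma tot_cmp: "hideal RR J \<Longrightarrow> x \<in> tot J \<Longrightarrow> gs.cmp x p \<in> tot J"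
  using tot_homogeneous[OF _ gs.cmp_C] by (auto simp: tot_def)

lemma additive_subgroupI':
  assumes "H \<subseteq> carrier R" "\<zero> \<in> H" "\<And>x y. x \<in> H \<Longrightarrow> y \<in> H \<Longrightarrow> x \<oplus> y \<in> H" "\<And>x. x \<in> H \<Longrightarrow> \<ominus> x \<in> H"
  shows "additive_subgroup H R"
  by (intro additive_subgroup.intro subgroup.intro) (use assms in \<open>auto simp: a_inv_def\<close>)

lemma tot_ideal: assumes J: "hideal RR J" shows "ideal (tot J) R"
proof (rule idealI)
  note P = hideal_parts[OF J]
  have "additive_subgroup (tot J) R"
    by (rule additive_subgroupI') (auto simp: tot_def gs.cmp_zero P(5) gs.cmp_add gs.cmp_minus gs.cmp_carrier intro!: P(4,6))
  then show "subgroup (tot J) (add_monoid R)" by (simp add: additive_subgroup.a_subgroup)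
  fix a x assume a: "a \<in> tot J" and x: "x \<in> carrier R"
  have ac: "a \<in> carrier R" using a by (simp add: tot_def)
  have "gs.cmp (x \<otimes> a) n \<in> {c \<in> carrier R. inR R c \<in> J n}" for n
  proof (rule cmp_mult_in[OF x ac])
    fix p q assume "p + q = n"
    then show "gs.cmp x p \<otimes> gs.cmp a q \<in> {c \<in> carrier R. inR R c \<in> J n}"
      using P(3)[OF gs.cmp_C[OF x, of p] gs.cmp_C[OF ac, of q]] a x ac gs.cmp_carrier by (auto simp: tot_def)
  qed (auto simp: P(5) intro: P(4))
  then show "x \<otimes> a \<in> tot J" using x ac by (simp add: tot_def)
  then show "a \<otimes> x \<in> tot J" using m_comm[OF x ac] by simp
qed (rule ring_axioms)

lemma tot_mono: "J \<le> J' \<Longrightarrow> tot J \<subseteq> tot J'"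
  by (auto simp: tot_def le_fun_def)

lemma tot_le: assumes "hideal RR J" "hideal RR J'" "tot J \<subseteq> tot J'" shows "J \<le> J'"
proof (intro le_funI subsetI)
  fix p a assume "a \<in> J p"
  then obtain a' where "a' \<in> rcomp R p" "a = inR R a'" using hideal_parts(2)[OF assms(1)] by blast
  then show "a \<in> J' p" using \<open>a \<in> J p\<close> assms tot_homogeneous by blast
qed

lemma tot_less: assumes "hideal RR J" "hideal RR J'" "J < J'" shows "tot J \<subset> tot J'"
  using tot_mono[of J J'] tot_le[OF assms(2,1)] assms(3) by (metis less_le_not_le psubsetI order_refl)

lemma RR_sub: "subgrp (RR n)" unfolding RR_def by (rule subgrp_inR[OF gs.C_subgroup])

lemma RR_mult: "a \<in> RR p \<Longrightarrow> b \<in> RR q \<Longrightarrow> a * b \<in> RR (p + q)"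
  by (auto elim!: RRE simp: inR_mult[symmetric] intro!: RRI rcomp_mult)

text \<open>\<open>tot\<close> preserves and reflects inclusion between homogeneous ideals, and in a
  Noetherian ring the union of a chain of ideals belongs to the chain, so Zorn's lemma
  applies.\<close>

lemma RR_ACC:
  assumes "\<J> \<noteq> {}" "\<And>J. J \<in> \<J> \<Longrightarrow> hideal RR J"
  shows "\<exists>J\<in>\<J>. \<forall>J'\<in>\<J>. J \<le> J' \<longrightarrow> J' = J"
proof -
  have "\<exists>M\<in>tot ` \<J>. \<forall>X\<in>tot ` \<J>. M \<subseteq> X \<longrightarrow> X = M"
  proof (rule subset_Zorn_nonempty)
    show "tot ` \<J> \<noteq> {}" using assms by simp
    fix \<C> assume ne: "\<C> \<noteq> {}" and ch: "subset.chain (tot ` \<J>) \<C>"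
    have "\<C> \<subseteq> {I. ideal I R}"
    proof
      fix I assume "I \<in> \<C>"
      then have "I \<in> tot ` \<J>" using ch unfolding subset_chain_def by blast
      then show "I \<in> {I. ideal I R}" using tot_ideal assms(2) by auto
    qed
    then have "subset.chain {I. ideal I R} \<C>" using ch unfolding subset_chain_def by blast
    then have "\<Union>\<C> \<in> \<C>" using noetherian_ring.ideal_chain_is_trivial[OF noeth ne] by blast
    then show "\<Union>\<C> \<in> tot ` \<J>" using ch unfolding pred_on.chain_def by blast
  qed
  then obtain J where J: "J \<in> \<J>" "\<And>J'. J' \<in> \<J> \<Longrightarrow> tot J \<subseteq> tot J' \<Longrightarrow> tot J' = tot J" by blast
  have "J' = J" if "J' \<in> \<J>" "J \<le> J'" for J'
    using J(2)[OF that(1) tot_mono[OF that(2)]] tot_le[of J' J] assms(2) J(1) that by (intro antisym) auto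
  then show ?thesis using J(1) by blast
qed

text \<open>Elements of degree \<open>n\<close> visibly built from \<open>rcomp R 0\<close> and the
  \<open>rcomp R (axis i 1)\<close>. The rules of \<open>generate_ring\<close> do not respect
  degrees; \<open>mon_cmp\<close> shows that nevertheless every component of every element has this
  form.\<close>

inductive mon :: "int ^ 'r \<Rightarrow> 'a \<Rightarrow> bool" where
  base: "a \<in> rcomp R 0 \<Longrightarrow> mon 0 a"
| zero: "mon n \<zero>"
| step: "mon n a \<Longrightarrow> g \<in> rcomp R (axis i 1) \<Longrightarrow> mon (n + axis i 1) (a \<otimes> g)"
| add: "mon n a \<Longrightarrow> mon n b \<Longrightarrow> mon n (a \<oplus> b)"
| minus: "mon n a \<Longrightarrow> mon n (\<ominus> a)"

lemma mon_rcomp: "mon n a \<Longrightarrow> a \<in> rcomp R n"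
  by (induction rule: mon.induct) (auto intro: rcomp_mult gs.C_add gs.C_minus)

lemma mon_carrier: "mon n a \<Longrightarrow> a \<in> carrier R"
  using mon_rcomp rcomp_carrier by blast

lemma mon_base_mult: "mon n a \<Longrightarrow> b \<in> rcomp R 0 \<Longrightarrow> mon n (a \<otimes> b)"
proof (induction rule: mon.induct)
  case (base a)
  then show ?case using rcomp_mult[of a 0 b 0] by (auto intro: mon.base)
next
  case (zero n)
  then show ?case using rcomp_carrier by (auto intro: mon.zero)
next
  case (step n a g i)
  have "a \<otimes> g \<otimes> b = a \<otimes> b \<otimes> g"
    using step mon_carrier rcomp_carrier m_ac by (metis m_assoc m_comm)
  then show ?case using step mon.step by metis
next
  case (add n a b')
  then show ?case using mon_carrier rcomp_carrier by (auto simp: l_distr intro: mon.add)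
next
  case (minus n a)
  then show ?case using mon_carrier rcomp_carrier by (auto simp: l_minus intro: mon.minus)
qed

lemma mon_mult: "mon m b \<Longrightarrow> mon n a \<Longrightarrow> mon (n + m) (a \<otimes> b)"
proof (induction arbitrary: n a rule: mon.induct)
  case (base b)
  then show ?case using mon_base_mult by simp
next
  case (zero m)
  then show ?case using mon_carrier by (auto intro: mon.zero)
next
  case (step m b g i)
  then have "mon (n + m + axis i 1) (a \<otimes> b \<otimes> g)" by (intro mon.step) auto
  then show ?case using step mon_carrier rcomp_carrier by (simp add: m_assoc add.assoc)
next
  case (add m b c)
  then show ?case using mon_carrier by (auto simp: r_distr intro: mon.add)
next
  case (minus m b)
  then show ?case using mon_carrier by (auto simp: r_minus intro: mon.minus)
qed

lemma mon_cmp: "x \<in> carrier R \<Longrightarrow> mon n (gs.cmp x n)"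
proof -
  assume "x \<in> carrier R"
  then have "x \<in> generate_ring R (rcomp R 0 \<union> (\<Union>i. rcomp R (axis i 1)))"
    using std by (simp add: standard_graded_def)
  then have "x \<in> carrier R \<and> (\<forall>n. mon n (gs.cmp x n))"
  proof (induction rule: generate_ring.induct)
    case one
    then show ?case by (auto simp: gs.cmp_homogeneous[OF rcomp_one] intro: mon.zero mon.base rcomp_one)
  next
    case (incl x)
    then consider "x \<in> rcomp R 0" | i where "x \<in> rcomp R (axis i 1)" by blast
    then show ?case
    proof cases
      case 1
      then show ?thesis using rcomp_carrier by (auto simp: gs.cmp_homogeneous[OF 1] intro: mon.zero mon.base)
    next
      case (2 i)
      have "mon (0 + axis i 1) (\<one> \<otimes> x)" by (rule mon.step[OF mon.base[OF rcomp_one] 2])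
      then have "mon (axis i 1) x" using rcomp_carrier[OF 2] by simp
      then show ?thesis using rcomp_carrier[OF 2] by (auto simp: gs.cmp_homogeneous[OF 2] intro: mon.zero)
    qed
  next
    case (a_inv x)
    then show ?case by (auto simp: gs.cmp_minus intro: mon.minus)
  next
    case (eng_add x y)
    then show ?case by (auto simp: gs.cmp_add intro: mon.add)
  next
    case (eng_mult x y)
    have "gs.cmp (x \<otimes> y) n \<in> {a. mon n a}" for n
    proof (rule cmp_mult_in)
      fix p q assume "p + q = n"
      then show "gs.cmp x p \<otimes> gs.cmp y q \<in> {a. mon n a}" using eng_mult mon_mult by auto
    qed (use eng_mult in \<open>auto intro: mon.zero mon.add\<close>)
    then show ?case using eng_mult by auto
  qed
  then show ?thesis by blast
qed

text \<open>If the last factor has another direction than \<open>i\<close>, a factor of direction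
  \<open>i\<close> is found further left, and the last factor is moved into its coefficient.\<close>

lemma mon_gen:
  assumes "mon n x" "1 \<le> n $ i"
  shows "inR R x \<in> addspan {a * g | a g. a \<in> RR (n - axis i 1) \<and> g \<in> RR (axis i 1)}"
  using assms
proof (induction rule: mon.induct)
  case (zero n)
  then show ?case by (simp add: inR_zero subgrp_0[OF subgrp_addspan])
next
  case (step n a g k)
  have eq: "inR R (a \<otimes> g) = inR R a * inR R g" using step mon_carrier rcomp_carrier by (simp add: inR_mult)
  show ?case
  proof (cases "k = i")
    case True
    have "inR R a \<in> RR (n + axis k 1 - axis i 1)" "inR R g \<in> RR (axis i 1)"
      using step mon_rcomp True by (auto intro: RRI)
    then show ?thesis unfolding eq by (intro subsetD[OF addspan_superset]) blast
  next
    case False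
    then have "inR R a \<in> addspan {a * g | a g. a \<in> RR (n - axis i 1) \<and> g \<in> RR (axis i 1)}"
      using step by (simp add: axis_def)
    then show ?thesis
      unfolding eq
    proof (induction rule: addspan_induct)
      case (base s)
      then obtain c d where s: "s = c * d" "c \<in> RR (n - axis i 1)" "d \<in> RR (axis i 1)" by blast
      have "c * inR R g \<in> RR (n - axis i 1 + axis k 1)" using RR_mult[OF s(2)] step(2) RRI by blast
      then have "c * inR R g \<in> RR (n + axis k 1 - axis i 1)" by (simp add: algebra_simps)
      moreover have "s * inR R g = (c * inR R g) * d" by (simp add: s(1) ac_simps)
      ultimately show ?case using s(3) by (intro subsetD[OF addspan_superset]) blast
    qed (auto simp: left_diff_distrib subgrp_0[OF subgrp_addspan] intro: subgrp_diff[OF subgrp_addspan])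
  qed
next
  case (add n a b)
  then show ?case using mon_carrier by (simp add: inR_add subgrp_add[OF subgrp_addspan])
next
  case (minus n a)
  have "inR R (\<ominus> a) = 0 - inR R a"
    using inR_diff[of \<zero> a] mon_carrier[OF minus(1)] by (simp add: inR_zero minus_eq)
  then show ?case using minus subgrp_minus[OF subgrp_addspan] by simp
qed simp

lemma hring_RR: "hring RR (inR R \<one>)"
proof
  show "inR R \<one> * a = a" if "a \<in> RR p" for a p
    using that by (auto elim!: RRE simp: inR_mult[symmetric])
  show "x \<in> addspan {a * g |a g. a \<in> RR (n - axis i 1) \<and> g \<in> RR (axis i 1)}" if "x \<in> RR n" "1 \<le> n $ i" for x n i
  proof -
    obtain x' where x': "x' \<in> rcomp R n" "x = inR R x'" by (rule RRE[OF \<open>x \<in> RR n\<close>])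
    have "mon n x'" using mon_cmp[OF rcomp_carrier[OF x'(1)], of n] gs.cmp_homogeneous[OF x'(1)] by simp
    then show ?thesis using mon_gen that(2) x'(2) by blast
  qed
  show "\<exists>J\<in>\<J>. \<forall>J'\<in>\<J>. J \<le> J' \<longrightarrow> J' = J" if "\<J> \<noteq> {}" "\<And>J. J \<in> \<J> \<Longrightarrow> hideal RR J" for \<J>
    using RR_ACC that by blast
qed (auto simp: RR_sub RR_mult RRI rcomp_one)

end

sublocale sring \<subseteq> H: hring RR "inR R \<one>"
  by (rule hring_RR)

section \<open>The local ring in degree 0 and graded primes\<close>

context sring
begin

abbreviation A where "A \<equiv> degree_zero_ring R"

lemma cring_A: "cring A" using local by (simp add: local_ring_def)

lemma A_simps [simp]: "carrier A = rcomp R 0" "mult A = mult R" "one A = one R" "zero A = zero R" "add A = add R"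
  by (simp_all add: degree_zero_ring_def)

definition mx :: "'a set" where "mx = the_maximal_ideal A"

lemma mx: "maximalideal mx A" "maximalideal M A \<Longrightarrow> M = mx"
proof -
  have ex: "\<exists>!M. maximalideal M A" using local by (simp add: local_ring_def)
  show "maximalideal mx A" unfolding mx_def the_maximal_ideal_def by (rule theI'[OF ex])
  with ex show "maximalideal M A \<Longrightarrow> M = mx" by blast
qed

text \<open>A non-unit would lie in a maximal ideal by Zorn's lemma, and \<open>mx\<close> is the
  only one.\<close>

lemma mx_unit:
  assumes u: "u \<in> rcomp R 0" "u \<notin> mx"
  shows "\<exists>v\<in>rcomp R 0. v \<otimes> u = \<one>"
proof (rule ccontr)
  interpret A: cring A by (rule cring_A)
  assume no: "\<not> ?thesis"
  have uA: "u \<in> carrier A" using u(1) by simp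
  define \<A> where "\<A> = {I. ideal I A \<and> u \<in> I \<and> \<one> \<notin> I}"
  have "PIdl\<^bsub>A\<^esub> u \<in> \<A>"
    using A.cgenideal_ideal[OF uA] A.cgenideal_self[OF uA] no by (auto simp: \<A>_def cgenideal_def)
  then have ne: "\<A> \<noteq> {}" by blast
  have "\<exists>M\<in>\<A>. \<forall>X\<in>\<A>. M \<subseteq> X \<longrightarrow> X = M"
  proof (rule subset_Zorn_nonempty[OF ne])
    fix \<C> assume C: "\<C> \<noteq> {}" "subset.chain \<A> \<C>"
    have "subset.chain {I. ideal I A} \<C>" using C unfolding pred_on.chain_def \<A>_def by blast
    from A.chain_Union_is_ideal[OF this] have "ideal (\<Union>\<C>) A" using C by simp
    then show "\<Union>\<C> \<in> \<A>" using C unfolding \<A>_def pred_on.chain_def by blast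
  qed
  then obtain M where M: "ideal M A" "u \<in> M" "\<one> \<notin> M" and
    max: "\<And>X. ideal X A \<Longrightarrow> u \<in> X \<Longrightarrow> \<one> \<notin> X \<Longrightarrow> M \<subseteq> X \<Longrightarrow> X = M" by (auto simp: \<A>_def)
  have "maximalideal M A"
  proof (rule maximalidealI[OF M(1)])
    show "carrier A \<noteq> M" using M(3) rcomp_one by auto
    fix J assume J: "ideal J A" "M \<subseteq> J" "J \<subseteq> carrier A"
    show "J = M \<or> J = carrier A"
      using max[OF J(1)] M(2) J ideal.one_imp_carrier[OF J(1)] by auto
  qed
  then show False using mx(2) M(2) u(2) by blast
qed

lemma mx_rcomp: "mx \<subseteq> rcomp R 0"
  using ideal.Icarr[of mx A] mx(1) by (auto simp: maximalideal_def)

lemma mx_ideal: "ideal mx A" using mx(1) by (simp add: maximalideal_def)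

lemma mx_one: "\<one> \<notin> mx"
  using maximalideal.I_notcarr[OF mx(1)] ideal.one_imp_carrier[OF mx_ideal] by auto

lemma mx_closed: "x \<in> mx \<Longrightarrow> y \<in> mx \<Longrightarrow> x \<oplus> y \<in> mx" "a \<in> rcomp R 0 \<Longrightarrow> x \<in> mx \<Longrightarrow> a \<otimes> x \<in> mx" "\<zero> \<in> mx"
  "x \<in> mx \<Longrightarrow> \<ominus> x \<in> mx"
proof -
  interpret I: ideal mx A by (rule mx_ideal)
  interpret A: cring A by (rule cring_A)
  show "x \<in> mx \<Longrightarrow> y \<in> mx \<Longrightarrow> x \<oplus> y \<in> mx" 
    using additive_subgroup.a_closed[OF I.additive_subgroup_axioms, of x y] by simp
  show 1: "a \<otimes> x \<in> mx" if "a \<in> rcomp R 0" "x \<in> mx" for a x using I.I_l_closed[of x a] that by simp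
  show "\<zero> \<in> mx" using additive_subgroup.zero_closed[OF I.additive_subgroup_axioms] by simp
  show "\<ominus> x \<in> mx" if x: "x \<in> mx"
  proof -
    have "\<ominus> \<one> \<in> rcomp R 0" using gs.C_minus rcomp_one by blast
    then have "\<ominus> \<one> \<otimes> x \<in> mx" using 1 x by blast
    moreover have "\<ominus> \<one> \<otimes> x = \<ominus> x" using x mx_rcomp rcomp_carrier by (auto simp: l_minus)
    ultimately show ?thesis by simp
  qed
qed

lemma hlocal_RR: "hlocal RR (inR R \<one>) (inR R ` mx)"
proof (rule hlocal.intro[OF hring_RR], unfold_locales)
  have "additive_subgroup mx R"
    by (rule additive_subgroupI') (use mx_rcomp rcomp_carrier mx_closed in auto)
  then show "subgrp (inR R ` mx)" by (rule subgrp_inR)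
  show "inR R ` mx \<subseteq> RR 0" using mx_rcomp by (auto simp: RR_def)
  show "a * \<mu> \<in> inR R ` mx" if "a \<in> RR 0" "\<mu> \<in> inR R ` mx" for a \<mu>
    using that mx_closed(2) mx_rcomp rcomp_carrier by (auto elim!: RRE simp: inR_mult[symmetric] subset_iff)
  show "\<exists>u\<in>RR 0. u * (inR R \<one> - \<mu>) = inR R \<one>" if "\<mu> \<in> inR R ` mx" for \<mu>
  proof -
    obtain m where m: "m \<in> mx" "\<mu> = inR R m" using \<open>\<mu> \<in> inR R ` mx\<close> by blast
    have m0: "m \<in> rcomp R 0" using m mx_rcomp by blast
    have mc: "m \<in> carrier R" using rcomp_carrier[OF m0] .
    have "\<one> \<ominus> m \<in> rcomp R 0" using rcomp_one m0 gs.C_add gs.C_minus by (simp add: minus_eq)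
    moreover have "\<one> \<ominus> m \<notin> mx"
    proof
      assume "\<one> \<ominus> m \<in> mx"
      then have "(\<one> \<ominus> m) \<oplus> m \<in> mx" using mx_closed m by blast
      moreover have "(\<one> \<ominus> m) \<oplus> m = \<one>" using mc by (simp add: minus_eq a_assoc l_neg)
      ultimately show False using mx_one by simp
    qed
    ultimately obtain v where v: "v \<in> rcomp R 0" "v \<otimes> (\<one> \<ominus> m) = \<one>" using mx_unit by blast
    have "inR R v * (inR R \<one> - \<mu>) = inR R \<one>"
      using v mc rcomp_carrier[OF v(1)] by (simp add: m(2) inR_diff[symmetric] inR_mult[symmetric])
    then show ?thesis using RRI[OF v(1)] by blast
  qed
qed

text \<open>Let \<open>p0\<close>, \<open>q0\<close> be degrees where \<open>x\<close> and
  \<open>y\<close> have components outside \<open>P\<close>, such that \<open>p0 + q0\<close> is a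
  sum of two such degrees in only one way. Then the component of \<open>x y\<close> in degree
  \<open>p0 + q0\<close> is the product of these two components modulo \<open>tot P\<close>, and the
  product is not in \<open>tot P\<close>.\<close>

lemma tot_prime:
  assumes P: "H.relevant_prime P"
  shows "primeideal (tot P) R"
proof (rule primeidealI)
  have hP: "hideal RR P" by (rule H.relevant_prime_hideal[OF P])
  show id: "ideal (tot P) R" by (rule tot_ideal[OF hP])
  interpret I: ideal "tot P" R by (rule id)
  note Iz = additive_subgroup.zero_closed[OF I.additive_subgroup_axioms]
    and Ia = additive_subgroup.a_closed[OF I.additive_subgroup_axioms]
    and Im = subgroup.m_inv_closed[OF additive_subgroup.a_subgroup[OF I.additive_subgroup_axioms], folded a_inv_def]
  show "carrier R \<noteq> tot P"
    using H.relevant_prime_one[OF P] tot_homogeneous[OF hP rcomp_one] by auto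
  fix x y assume x: "x \<in> carrier R" and y: "y \<in> carrier R" and xy: "x \<otimes> y \<in> tot P"
  show "x \<in> tot P \<or> y \<in> tot P"
  proof (rule ccontr)
    assume no: "\<not> ?thesis"
    define S where "S z = {p. inR R (gs.cmp z p) \<notin> P p}" for z
    have fS: "finite (S z)" if "z \<in> carrier R" for z
      by (rule finite_subset[OF _ gs.cmp_finite[OF that]]) (auto simp: S_def hideal_parts(5)[OF hP])
    have "S x \<noteq> {}" "S y \<noteq> {}" using no x y unfolding S_def tot_def by blast+
    then obtain p0 q0 where pq: "p0 \<in> S x" "q0 \<in> S y"
      and uniq: "\<And>p q. p \<in> S x \<Longrightarrow> q \<in> S y \<Longrightarrow> p + q = p0 + q0 \<Longrightarrow> p = p0 \<and> q = q0"
      using unique_sum_pair[OF fS[OF x] _ fS[OF y]] by metis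
    let ?n = "p0 + q0" and ?x0 = "gs.cmp x p0" and ?y0 = "gs.cmp y q0"
    note xc = gs.cmp_carrier[OF x] and yc = gs.cmp_carrier[OF y]
    note xC = gs.cmp_C[OF x] and yC = gs.cmp_C[OF y]
    have prod: "?x0 \<otimes> ?y0 \<notin> tot P"
    proof -
      have "inR R ?x0 * inR R ?y0 \<notin> P ?n"
        using H.relevant_prime_prime[OF P RRI[OF xC] RRI[OF yC], of p0 q0] pq by (simp add: S_def)
      then show ?thesis using tot_homogeneous[OF hP rcomp_mult[OF xC yC], of p0 q0] xc yc by (simp add: inR_mult)
    qed
    let ?x' = "x \<ominus> ?x0" and ?y' = "y \<ominus> ?y0"
    have cx': "gs.cmp ?x' p = (if p = p0 then \<zero> else gs.cmp x p)" for p
      using x xc by (simp add: minus_eq gs.cmp_add gs.cmp_minus gs.cmp_homogeneous[OF xC] r_neg)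
    have cy': "gs.cmp ?y' p = (if p = q0 then \<zero> else gs.cmp y p)" for p
      using y yc by (simp add: minus_eq gs.cmp_add gs.cmp_minus gs.cmp_homogeneous[OF yC] r_neg)
    have 1: "gs.cmp (?x' \<otimes> y) ?n \<in> tot P"
    proof (rule cmp_mult_in)
      fix p q assume *: "p + q = ?n"
      show "gs.cmp ?x' p \<otimes> gs.cmp y q \<in> tot P"
      proof (cases "p = p0")
        case False
        then have "p \<notin> S x \<or> q \<notin> S y" using uniq * by blast
        then have "gs.cmp x p \<in> tot P \<or> gs.cmp y q \<in> tot P"
          using tot_homogeneous[OF hP xC] tot_homogeneous[OF hP yC] by (auto simp: S_def)
        then show ?thesis using False xc yc I.I_l_closed I.I_r_closed by (auto simp: cx')
      qed (simp add: cx' yc Iz)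
    qed (use x y xc Iz Ia in auto)
    have 2: "gs.cmp (?x0 \<otimes> ?y') ?n = \<zero>"
      using cmp_mult_homogeneous[OF xC[of p0], of ?y' q0] y yc xc by (simp add: cy')
    have "x \<otimes> y = ?x' \<otimes> y \<oplus> (?x0 \<otimes> ?y' \<oplus> ?x0 \<otimes> ?y0)"
    proof -
      have "?x0 \<otimes> ?y' \<oplus> ?x0 \<otimes> ?y0 = ?x0 \<otimes> y"
        using xc yc y by (simp add: r_distr[symmetric] minus_eq a_assoc l_neg)
      moreover have "?x' \<otimes> y \<oplus> ?x0 \<otimes> y = x \<otimes> y"
        using xc x y by (simp add: l_distr[symmetric] minus_eq a_assoc l_neg)
      ultimately show ?thesis by simp
    qed
    then have "gs.cmp (x \<otimes> y) ?n = gs.cmp (?x' \<otimes> y) ?n \<oplus> ?x0 \<otimes> ?y0"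
      using x y xc yc 2 gs.cmp_homogeneous[OF rcomp_mult[OF xC yC], of p0 q0 ?n] by (simp add: gs.cmp_add gs.cmp_carrier)
    moreover have "gs.cmp (x \<otimes> y) ?n \<in> tot P" using tot_cmp[OF hP xy] .
    ultimately have s: "gs.cmp (?x' \<otimes> y) ?n \<oplus> ?x0 \<otimes> ?y0 \<in> tot P" by simp
    have "\<ominus> gs.cmp (?x' \<otimes> y) ?n \<in> tot P" using 1 Im by blast
    from Ia[OF this s] have "?x0 \<otimes> ?y0 \<in> tot P"
      using x y xc yc gs.cmp_carrier by (simp add: a_assoc[symmetric] l_neg)
    then show False using prod by simp
  qed
qed (rule cring_R)

lemma tot_graded:
  assumes J: "hideal RR J"
  shows "graded_ideal (tot J) R"
proof -
  interpret I: ideal "tot J" R by (rule tot_ideal[OF J])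
  have "internal_direct_sum (R\<lparr>carrier := tot J\<rparr>) (\<lambda>n. tot J \<inter> rcomp R (n - 0))"
    by (rule internal_direct_sum_restrict[OF gs.gsum_axioms I.additive_subgroup_axioms]) (auto simp: tot_cmp[OF J])
  then show ?thesis using I.ideal_axioms by (simp add: graded_ideal_def)
qed

lemma tot_relevant:
  assumes P: "H.relevant_prime P"
  shows "\<not> irrelevant_ideal R \<subseteq> tot P"
proof
  assume *: "irrelevant_ideal R \<subseteq> tot P"
  have hP: "hideal RR P" by (rule H.relevant_prime_hideal[OF P])
  have "rcomp R 1 \<subseteq> tot P" using * genideal_self[of "rcomp R 1"] rcomp_carrier unfolding irrelevant_ideal_def by blast
  then have "RR 1 \<subseteq> P 1" using tot_homogeneous[OF hP] by (auto simp: RR_def)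
  then show False using P by (simp add: H.relevant_prime_def)
qed

end

section \<open>Graded injective resolutions\<close>

hide_const (open) Polynomial.smult

lemma abelian_group_minus_zero:
  assumes "abelian_group X" shows "\<ominus>\<^bsub>X\<^esub> \<zero>\<^bsub>X\<^esub> = \<zero>\<^bsub>X\<^esub>"
proof -
  interpret abelian_group X by fact
  show ?thesis by (rule minus_equality) auto
qed

text \<open>The index \<open>j\<close> is part of the coordinate because two terms of the resolution
  may be the same record.\<close>

definition inE :: "(nat \<Rightarrow> ('a, 'e, 'd) gmodule) \<Rightarrow> nat \<Rightarrow> 'e \<Rightarrow> ('a, 'e, 'd) pgrp" where
  "inE E j x = mk_pgrp (\<lambda>i X. if i = j \<and> X = E j then x else \<zero>\<^bsub>X\<^esub>)"

text \<open>Defined on the whole product and zero outside the coordinates of the resolution, so that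
  the laws of \<open>action\<close> hold without membership conditions; likewise for
  \<open>diffE\<close>.\<close>

definition actE :: "('a, 'd) gring \<Rightarrow> (nat \<Rightarrow> ('a, 'e, 'd) gmodule) \<Rightarrow> ('a, 'd) pring \<Rightarrow>
    ('a, 'e, 'd) pgrp \<Rightarrow> ('a, 'e, 'd) pgrp" where
  "actE R E a w = mk_pgrp (\<lambda>i X. if X = E i then Rep_pring a R \<odot>\<^bsub>X\<^esub> Rep_pgrp w (i, X) else \<zero>\<^bsub>X\<^esub>)"

definition diffE :: "(nat \<Rightarrow> ('a, 'e, 'd) gmodule) \<Rightarrow> (nat \<Rightarrow> 'e \<Rightarrow> 'e) \<Rightarrow>
    ('a, 'e, 'd) pgrp \<Rightarrow> ('a, 'e, 'd) pgrp" where
  "diffE E \<delta> w = mk_pgrp (\<lambda>i X. case i of 0 \<Rightarrow> \<zero>\<^bsub>X\<^esub>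
     | Suc j \<Rightarrow> if X = E (Suc j) then \<delta> j (Rep_pgrp w (j, E j)) else \<zero>\<^bsub>X\<^esub>)"

lemma hom_zero_minus:
  assumes "abelian_group G" "abelian_group G'"
    and f: "\<And>x. x \<in> carrier G \<Longrightarrow> f x \<in> carrier G'"
      "\<And>x y. x \<in> carrier G \<Longrightarrow> y \<in> carrier G \<Longrightarrow> f (x \<oplus>\<^bsub>G\<^esub> y) = f x \<oplus>\<^bsub>G'\<^esub> f y"
  shows "f \<zero>\<^bsub>G\<^esub> = \<zero>\<^bsub>G'\<^esub>" "x \<in> carrier G \<Longrightarrow> f (\<ominus>\<^bsub>G\<^esub> x) = \<ominus>\<^bsub>G'\<^esub> f x"
    "x \<in> carrier G \<Longrightarrow> y \<in> carrier G \<Longrightarrow> f (x \<ominus>\<^bsub>G\<^esub> y) = f x \<ominus>\<^bsub>G'\<^esub> f y"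
proof -
  interpret G: abelian_group G by fact
  interpret H: abelian_group G' by fact
  show z: "f \<zero>\<^bsub>G\<^esub> = \<zero>\<^bsub>G'\<^esub>"
    using f(1)[of "\<zero>\<^bsub>G\<^esub>"] f(2)[of "\<zero>\<^bsub>G\<^esub>" "\<zero>\<^bsub>G\<^esub>"] by (metis G.zero_closed G.l_zero H.add.r_cancel_one')
  show m: "f (\<ominus>\<^bsub>G\<^esub> x) = \<ominus>\<^bsub>G'\<^esub> f x" if x: "x \<in> carrier G" for x
  proof -
    have "f (\<ominus>\<^bsub>G\<^esub> x) \<oplus>\<^bsub>G'\<^esub> f x = \<zero>\<^bsub>G'\<^esub>" using f(2)[of "\<ominus>\<^bsub>G\<^esub> x" x] x z by (simp add: G.l_neg)
    then show ?thesis using H.minus_equality[of "f (\<ominus>\<^bsub>G\<^esub> x)" "f x"] f(1) x by simp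
  qed
  show "f (x \<ominus>\<^bsub>G\<^esub> y) = f x \<ominus>\<^bsub>G'\<^esub> f y" if "x \<in> carrier G" "y \<in> carrier G"
    using that by (simp add: G.minus_eq H.minus_eq f m)
qed

locale sres = sring R for R :: "('a, int ^ 'r) gring" (structure) +
  fixes M :: "('a, 'm, int ^ 'r) gmodule" and \<epsilon> :: "'m \<Rightarrow> 'e"
    and E :: "nat \<Rightarrow> ('a, 'e, int ^ 'r) gmodule" and \<delta> :: "nat \<Rightarrow> 'e \<Rightarrow> 'e"
  assumes gM: "graded_module R M" and res: "graded_injective_resolution R M \<epsilon> E \<delta>"

sublocale sres \<subseteq> M: module R M
  using gM by (simp add: graded_module_def)

sublocale sres \<subseteq> E: module R "E i" for i
  using res by (simp add: graded_injective_resolution_def graded_module_def)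

sublocale sres \<subseteq> gM: gsum M "gcomp M"
  using gM by unfold_locales (simp add: graded_module_def)

sublocale sres \<subseteq> gE: gsum "E i" "gcomp (E i)" for i
  using res by unfold_locales (simp add: graded_injective_resolution_def graded_module_def)

context sres
begin

lemma ab_E: "abelian_group (E i)" by (rule E.abelian_group_axioms)

lemma \<delta>_hom: "\<delta> i \<in> graded_hom R (E i) (E (Suc i))"
  using res by (simp add: graded_injective_resolution_def)

lemma \<delta>_closed: "x \<in> carrier (E i) \<Longrightarrow> \<delta> i x \<in> carrier (E (Suc i))"
  and \<delta>_plus: "x \<in> carrier (E i) \<Longrightarrow> y \<in> carrier (E i) \<Longrightarrow> \<delta> i (x \<oplus>\<^bsub>E i\<^esub> y) = \<delta> i x \<oplus>\<^bsub>E (Suc i)\<^esub> \<delta> i y"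
  and \<delta>_smult: "a \<in> carrier R \<Longrightarrow> x \<in> carrier (E i) \<Longrightarrow> \<delta> i (a \<odot>\<^bsub>E i\<^esub> x) = a \<odot>\<^bsub>E (Suc i)\<^esub> \<delta> i x"
  using \<delta>_hom[of i] by (auto simp: graded_hom_def)

lemma \<delta>_gcomp: "x \<in> gcomp (E i) n \<Longrightarrow> \<delta> i x \<in> gcomp (E (Suc i)) n"
  using \<delta>_hom[of i] unfolding graded_hom_def by blast

lemma \<epsilon>_hom: "\<epsilon> \<in> graded_hom R M (E 0)"
  using res by (simp add: graded_injective_resolution_def)

lemma \<epsilon>_closed: "x \<in> carrier M \<Longrightarrow> \<epsilon> x \<in> carrier (E 0)"
  and \<epsilon>_plus: "x \<in> carrier M \<Longrightarrow> y \<in> carrier M \<Longrightarrow> \<epsilon> (x \<oplus>\<^bsub>M\<^esub> y) = \<epsilon> x \<oplus>\<^bsub>E 0\<^esub> \<epsilon> y"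
  and \<epsilon>_smult: "a \<in> carrier R \<Longrightarrow> x \<in> carrier M \<Longrightarrow> \<epsilon> (a \<odot>\<^bsub>M\<^esub> x) = a \<odot>\<^bsub>E 0\<^esub> \<epsilon> x"
  using \<epsilon>_hom by (auto simp: graded_hom_def)

lemma \<epsilon>_gcomp: "x \<in> gcomp M n \<Longrightarrow> \<epsilon> x \<in> gcomp (E 0) n"
  using \<epsilon>_hom unfolding graded_hom_def by blast

lemma \<epsilon>_inj: "inj_on \<epsilon> (carrier M)"
  and \<epsilon>_image: "\<epsilon> ` carrier M = {x \<in> carrier (E 0). \<delta> 0 x = \<zero>\<^bsub>E 1\<^esub>}"
  and \<delta>_image: "\<delta> i ` carrier (E i) = {x \<in> carrier (E (Suc i)). \<delta> (Suc i) x = \<zero>\<^bsub>E (Suc (Suc i))\<^esub>}"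
  using res by (auto simp: graded_injective_resolution_def)

lemma \<delta>_\<delta>: "x \<in> carrier (E i) \<Longrightarrow> \<delta> (Suc i) (\<delta> i x) = \<zero>\<^bsub>E (Suc (Suc i))\<^esub>"
  using \<delta>_image[of i] by blast

lemma \<delta>_zero: "\<delta> i \<zero>\<^bsub>E i\<^esub> = \<zero>\<^bsub>E (Suc i)\<^esub>"
  and \<delta>_minus: "x \<in> carrier (E i) \<Longrightarrow> y \<in> carrier (E i) \<Longrightarrow> \<delta> i (x \<ominus>\<^bsub>E i\<^esub> y) = \<delta> i x \<ominus>\<^bsub>E (Suc i)\<^esub> \<delta> i y"
  using hom_zero_minus[OF ab_E ab_E, where f = "\<delta> i"] \<delta>_closed \<delta>_plus by blast+

lemma smult_gcomp: "a \<in> rcomp R p \<Longrightarrow> x \<in> gcomp (E i) q \<Longrightarrow> a \<odot>\<^bsub>E i\<^esub> x \<in> gcomp (E i) (p + q)"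
  and smult_gcomp_M: "a \<in> rcomp R p \<Longrightarrow> x' \<in> gcomp M q \<Longrightarrow> a \<odot>\<^bsub>M\<^esub> x' \<in> gcomp M (p + q)"
  using res gM by (auto simp: graded_injective_resolution_def graded_module_def)

lemma Rep_inE: "x \<in> carrier (E j) \<Longrightarrow> abelian_group X \<Longrightarrow>
    Rep_pgrp (inE E j x) (i, X) = (if i = j \<and> X = E j then x else \<zero>\<^bsub>X\<^esub>)"
  unfolding inE_def by (rule Rep_mk_pgrp) (auto simp: abelian_group_def abelian_monoid.zero_closed)

lemma Rep_inE_self: "x \<in> carrier (E j) \<Longrightarrow> Rep_pgrp (inE E j x) (j, E j) = x"
  using Rep_inE[OF _ ab_E] by simp

lemma Rep_pgrp_E: "Rep_pgrp w (j, E j) \<in> carrier (E j)"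
  by (rule Rep_pgrp_carrier[OF ab_E])

lemma Rep_actE: "abelian_group X \<Longrightarrow> Rep_pgrp (actE R E a w) (i, X) =
    (if X = E i then Rep_pring a R \<odot>\<^bsub>X\<^esub> Rep_pgrp w (i, X) else \<zero>\<^bsub>X\<^esub>)"
  unfolding actE_def
  by (rule Rep_mk_pgrp)
    (auto simp: abelian_group_def abelian_monoid.zero_closed intro!: E.smult_closed Rep_pring_carrier[OF cring_R] Rep_pgrp_E)

lemma Rep_diffE: "abelian_group X \<Longrightarrow> Rep_pgrp (diffE E \<delta> w) (i, X) =
    (case i of 0 \<Rightarrow> \<zero>\<^bsub>X\<^esub> | Suc j \<Rightarrow> if X = E (Suc j) then \<delta> j (Rep_pgrp w (j, E j)) else \<zero>\<^bsub>X\<^esub>)"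
  unfolding diffE_def
  by (rule Rep_mk_pgrp) (auto simp: abelian_group_def abelian_monoid.zero_closed intro!: \<delta>_closed Rep_pgrp_E split: nat.split)

lemma inE_inj: "x \<in> carrier (E j) \<Longrightarrow> y \<in> carrier (E j) \<Longrightarrow> inE E j x = inE E j y \<longleftrightarrow> x = y"
  using Rep_inE_self by metis

lemma inE_zero: "inE E j \<zero>\<^bsub>E j\<^esub> = 0"
  by (rule pgrp_eqI) (simp add: Rep_inE Rep_pgrp_ops)

lemma inE_diff: "x \<in> carrier (E j) \<Longrightarrow> y \<in> carrier (E j) \<Longrightarrow> inE E j (x \<ominus>\<^bsub>E j\<^esub> y) = inE E j x - inE E j y"
proof (rule pgrp_eqI)
  fix i and X :: "('a, 'e, int ^ 'r) gmodule"
  assume X: "abelian_group X" and xy: "x \<in> carrier (E j)" "y \<in> carrier (E j)"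
  interpret X: abelian_group X by fact
  show "Rep_pgrp (inE E j (x \<ominus>\<^bsub>E j\<^esub> y)) (i, X) = Rep_pgrp (inE E j x - inE E j y) (i, X)"
    using xy by (simp add: Rep_inE[OF _ X] Rep_pgrp_ops[OF X]) (simp add: X.minus_eq abelian_group_minus_zero[OF X])
qed

lemma inE_act: "a \<in> carrier R \<Longrightarrow> x \<in> carrier (E j) \<Longrightarrow> actE R E (inR R a) (inE E j x) = inE E j (a \<odot>\<^bsub>E j\<^esub> x)"
  by (rule pgrp_eqI) (auto simp: Rep_actE Rep_inE Rep_inR_self)

lemma inE_diffE: "x \<in> carrier (E j) \<Longrightarrow> diffE E \<delta> (inE E j x) = inE E (Suc j) (\<delta> j x)"
  by (rule pgrp_eqI) (auto simp: Rep_diffE Rep_inE \<delta>_closed \<delta>_zero ab_E split: nat.split)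

lemma action_E: "action (actE R E)"
proof
  fix a b :: "('a, int ^ 'r) pring" and x y :: "('a, 'e, int ^ 'r) pgrp"
  note car = Rep_pring_carrier[OF cring_R] Rep_pgrp_E Rep_pgrp_carrier
  show "actE R E a (x + y) = actE R E a x + actE R E a y"
  proof (rule pgrp_eqI)
    fix i and X :: "('a, 'e, int ^ 'r) gmodule" assume X: "abelian_group X"
    interpret X: abelian_group X by fact
    show "Rep_pgrp (actE R E a (x + y)) (i, X) = Rep_pgrp (actE R E a x + actE R E a y) (i, X)"
      by (auto simp: Rep_actE[OF X] Rep_pgrp_ops[OF X] Rep_pgrp_ops[OF ab_E] car intro!: E.smult_r_distr)
  qed
  show "actE R E (a + b) x = actE R E a x + actE R E b x"
  proof (rule pgrp_eqI)
    fix i and X :: "('a, 'e, int ^ 'r) gmodule" assume X: "abelian_group X"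
    interpret X: abelian_group X by fact
    show "Rep_pgrp (actE R E (a + b) x) (i, X) = Rep_pgrp (actE R E a x + actE R E b x) (i, X)"
      by (auto simp: Rep_actE[OF X] Rep_pgrp_ops[OF X] Rep_pring_ops[OF cring_R] car intro!: E.smult_l_distr)
  qed
  show "actE R E (a * b) x = actE R E a (actE R E b x)"
  proof (rule pgrp_eqI)
    fix i and X :: "('a, 'e, int ^ 'r) gmodule" assume X: "abelian_group X"
    show "Rep_pgrp (actE R E (a * b) x) (i, X) = Rep_pgrp (actE R E a (actE R E b x)) (i, X)"
      by (auto simp: Rep_actE[OF X] Rep_actE[OF ab_E] Rep_pring_ops[OF cring_R] car intro!: E.smult_assoc1)
  qed
qed

definition XX :: "int \<Rightarrow> int ^ 'r \<Rightarrow> ('a, 'e, int ^ 'r) pgrp set" where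
  "XX j n = (if j < 0 then {0} else inE E (nat j) ` gcomp (E (nat j)) n)"

lemma XXI: "x \<in> gcomp (E j) n \<Longrightarrow> inE E j x \<in> XX (int j) n"
  by (simp add: XX_def)

lemma XXE:
  assumes "w \<in> XX (int j) n"
  obtains x where "x \<in> gcomp (E j) n" "x \<in> carrier (E j)" "w = inE E j x"
  using assms gE.C_carrier by (auto simp: XX_def)

lemma hmod_XX: "H.hmod (actE R E) (XX j)"
proof (cases "j < 0")
  case True
  interpret action "actE R E" by (rule action_E)
  show ?thesis using True by (auto simp: H.hmod_def XX_def subgrp_def)
next
  case False
  then obtain i where j: "j = int i" by (metis nonneg_int_cases not_less)
  show ?thesis
    unfolding H.hmod_def j
  proof (intro conjI allI ballI)
    fix n show "subgrp (XX (int i) n)"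
    proof (rule subgrpI)
      show "0 \<in> XX (int i) n" using XXI[OF gE.C_zero] by (simp add: inE_zero)
      fix x y assume "x \<in> XX (int i) n" "y \<in> XX (int i) n"
      then obtain x' y' where *: "x' \<in> gcomp (E i) n" "x' \<in> carrier (E i)" "x = inE E i x'"
        "y' \<in> gcomp (E i) n" "y' \<in> carrier (E i)" "y = inE E i y'" by (metis XXE)
      have "x' \<ominus>\<^bsub>E i\<^esub> y' \<in> gcomp (E i) n" using * gE.C_add gE.C_minus by (simp add: E.minus_eq)
      then show "x - y \<in> XX (int i) n" using XXI * by (metis inE_diff)
    qed
  next
    fix p q a x assume "a \<in> RR p" "x \<in> XX (int i) q"
    then show "actE R E a x \<in> XX (int i) (p + q)"
      by (auto elim!: RRE XXE simp: inE_act intro!: XXI smult_gcomp)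
  next
    fix n x assume "x \<in> XX (int i) n"
    then show "actE R E (inR R \<one>) x = x" by (auto elim!: XXE simp: inE_act)
  qed
qed

lemma \<delta>_cmp: "x \<in> carrier (E i) \<Longrightarrow> gE.cmp (Suc i) (\<delta> i x) n = \<delta> i (gE.cmp i x n)"
  using cmp_map(2)[OF gE.gsum_axioms gE.gsum_axioms, where f = "\<delta> i" and d = 0 and x = x and n = n] \<delta>_plus \<delta>_gcomp by simp

lemma \<epsilon>_cmp: "x \<in> carrier M \<Longrightarrow> gE.cmp 0 (\<epsilon> x) n = \<epsilon> (gM.cmp x n)"
  using cmp_map(2)[OF gM.gsum_axioms gE.gsum_axioms, where f = \<epsilon> and d = 0 and x = x and n = n] \<epsilon>_plus \<epsilon>_gcomp by simp

lemma smult_cmp: "a \<in> rcomp R p \<Longrightarrow> x \<in> carrier (E i) \<Longrightarrow> gE.cmp i (a \<odot>\<^bsub>E i\<^esub> x) (p + n) = a \<odot>\<^bsub>E i\<^esub> gE.cmp i x n"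
  using cmp_map(2)[OF gE.gsum_axioms gE.gsum_axioms, where f = "\<lambda>x. a \<odot>\<^bsub>E i\<^esub> x" and d = p and x = x and n = n] smult_gcomp rcomp_carrier
  by (simp add: E.smult_r_distr)

lemma smult_cmp_left: "x \<in> gcomp M n \<Longrightarrow> a \<in> carrier R \<Longrightarrow> gM.cmp (a \<odot>\<^bsub>M\<^esub> x) (n + p) = gs.cmp a p \<odot>\<^bsub>M\<^esub> x"
  by (rule cmp_map(2)[OF gs.gsum_axioms gM.gsum_axioms, where f = "\<lambda>a. a \<odot>\<^bsub>M\<^esub> x"])
    (use smult_gcomp_M gM.C_carrier in \<open>auto simp: M.smult_l_distr add.commute\<close>)

lemma XX_exact:
  assumes "1 \<le> j" "x \<in> XX j n" "diffE E \<delta> x = 0"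
  shows "\<exists>y\<in>XX (j - 1) n. diffE E \<delta> y = x"
proof -
  obtain i where j: "j = int (Suc i)" using assms(1) by (metis nonneg_int_cases le_add_diff_inverse of_nat_Suc zle_iff_zadd)
  obtain x' where x': "x' \<in> gcomp (E (Suc i)) n" "x' \<in> carrier (E (Suc i))" "x = inE E (Suc i) x'"
    using XXE assms(2) unfolding j by blast
  have "inE E (Suc (Suc i)) (\<delta> (Suc i) x') = inE E (Suc (Suc i)) \<zero>\<^bsub>E (Suc (Suc i))\<^esub>"
    using assms(3) x' by (simp add: inE_diffE inE_zero)
  then have "\<delta> (Suc i) x' = \<zero>\<^bsub>E (Suc (Suc i))\<^esub>" using inE_inj \<delta>_closed x'(2) E.zero_closed by blast
  then obtain y where y: "y \<in> carrier (E i)" "x' = \<delta> i y" using \<delta>_image[of i] x'(2) by blast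
  have "\<delta> i (gE.cmp i y n) = x'" using \<delta>_cmp[OF y(1)] gE.cmp_homogeneous[OF x'(1)] y(2) by simp
  then have "diffE E \<delta> (inE E i (gE.cmp i y n)) = x" using inE_diffE[OF gE.cmp_carrier[OF y(1)]] x'(3) by simp
  then show ?thesis using XXI[OF gE.cmp_C[OF y(1)]] j by auto
qed

text \<open>The ideal \<open>I\<close> shifted by \<open>d\<close>, the test module for
  homomorphisms of degree \<open>d\<close>; \<open>I = carrier R\<close> gives the shifted
  ring.\<close>

lemma graded_module_ideal:
  fixes d :: "int ^ 'r"
  assumes I: "ideal I R" and c: "\<And>x n. x \<in> I \<Longrightarrow> gs.cmp x n \<in> I"
  shows "graded_module R \<lparr>carrier = I, mult = mult R, one = one R, zero = zero R, add = add R, smult = mult R,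
    gcomp = (\<lambda>n. I \<inter> rcomp R (n - d))\<rparr>" (is "graded_module R ?L")
proof -
  interpret I: ideal I R by fact
  have sub: "I \<subseteq> carrier R" using I.Icarr by blast
  have ab: "abelian_group ?L"
    by (rule abelian_group_restrict[OF abelian_group_axioms I.additive_subgroup_axioms]) auto
  have "Module.module R ?L"
  proof (rule moduleI[OF cring_R ab])
  qed (use sub I.I_l_closed in \<open>auto simp: l_distr r_distr m_assoc subset_iff\<close>)
  moreover have "internal_direct_sum ?L (\<lambda>n. I \<inter> rcomp R (n - d))"
    by (rule internal_direct_sum_restrict[OF gs.gsum_axioms I.additive_subgroup_axioms]) (auto simp: c)
  moreover have "a \<otimes> x \<in> I \<inter> rcomp R (p + q - d)" if "a \<in> rcomp R p" "x \<in> I \<inter> rcomp R (q - d)" for a x p q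
    using that I.I_l_closed rcomp_carrier rcomp_mult[of a p x "q - d"] by (auto simp: add_diff_eq)
  ultimately show ?thesis unfolding graded_module_def by simp blast
qed

text \<open>A homomorphism of degree \<open>d\<close> on \<open>J\<close> is a degree-preserving one
  on the shifted ideal \<open>tot J\<close>. It extends to the shifted ring by
  \<open>graded_injective\<close>, and the image of \<open>\<one>\<close> is the required
  element.\<close>

lemma baer_XX: "H.baer (actE R E) (XX j)"
  unfolding H.baer_def
proof (intro allI impI)
  fix J d \<phi> assume J: "hideal RR J" and \<phi>: "H.hhom (*) (actE R E) J (XX j) d \<phi>"
  interpret action "actE R E" by (rule action_E)
  show "\<exists>e\<in>XX j d. \<forall>p. \<forall>a\<in>J p. \<phi> p a = actE R E a e"
  proof (cases "j < 0")
    case True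
    then show ?thesis using H.hhomD(1)[OF \<phi>] by (auto simp: XX_def)
  next
    case False
    then obtain i where j: "j = int i" by (metis nonneg_int_cases not_less)
    note P = hideal_parts[OF J]
    have \<phi>0: "\<phi> p 0 = 0" for p by (rule H.hhom_0[OF \<phi> P(1)])
    have \<phi>add: "\<phi> p (a + b) = \<phi> p a + \<phi> p b" if "a \<in> J p" "b \<in> J p" for p a b
      by (rule H.hhom_add[OF \<phi> P(1) that])
    \<comment> \<open>\<open>\<phi>\<close> is given on homogeneous elements only;
      \<open>\<Phi>\<close> is its additive extension to \<open>tot J\<close>, summed in the ambient
      class and then read off in the coordinate of \<open>E i\<close>.\<close>
    define \<Phi> where "\<Phi> x = (\<Sum>p\<in>{p. gs.cmp x p \<noteq> \<zero>}. \<phi> p (inR R (gs.cmp x p)))" for x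
    define g where "g x = Rep_pgrp (\<Phi> x) (i, E i)" for x
    let ?I = "tot J"
    interpret I: ideal ?I R by (rule tot_ideal[OF J])
    have IR: "x \<in> carrier R" if "x \<in> ?I" for x using that unfolding tot_def by blast
    have IJ: "inR R (gs.cmp x p) \<in> J p" if "x \<in> ?I" for x p using that unfolding tot_def by blast
    have Icmp: "gs.cmp x p \<in> ?I" if "x \<in> ?I" for x p using tot_cmp[OF J that] .
    have Iadd: "x \<oplus> y \<in> ?I" if "x \<in> ?I" "y \<in> ?I" for x y
      using additive_subgroup.a_closed[OF I.additive_subgroup_axioms that] .
    have Izero: "\<zero> \<in> ?I" using additive_subgroup.zero_closed[OF I.additive_subgroup_axioms] .
    have \<Phi>sup: "\<Phi> x = (\<Sum>p\<in>A. \<phi> p (inR R (gs.cmp x p)))"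
      if "x \<in> ?I" "finite A" "{p. gs.cmp x p \<noteq> \<zero>} \<subseteq> A" for x A
      unfolding \<Phi>_def by (rule sum.mono_neutral_left) (use that in \<open>auto simp: inR_zero \<phi>0\<close>)
    have \<Phi>add: "\<Phi> (x \<oplus> y) = \<Phi> x + \<Phi> y" if x: "x \<in> ?I" and y: "y \<in> ?I" for x y
    proof -
      let ?A = "{p. gs.cmp x p \<noteq> \<zero>} \<union> {p. gs.cmp y p \<noteq> \<zero>}"
      have A: "finite ?A" using gs.cmp_finite[OF IR[OF x]] gs.cmp_finite[OF IR[OF y]] by simp
      have "\<Phi> (x \<oplus> y) = (\<Sum>p\<in>?A. \<phi> p (inR R (gs.cmp (x \<oplus> y) p)))"
        by (rule \<Phi>sup[OF Iadd[OF x y] A]) (use IR x y in \<open>auto simp: gs.cmp_add\<close>)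
      also have "\<dots> = (\<Sum>p\<in>?A. \<phi> p (inR R (gs.cmp x p)) + \<phi> p (inR R (gs.cmp y p)))"
        using IR x y IJ by (intro sum.cong) (auto simp: gs.cmp_add inR_add gs.cmp_carrier \<phi>add)
      also have "\<dots> = \<Phi> x + \<Phi> y"
        using \<Phi>sup[OF x A] \<Phi>sup[OF y A] by (simp add: sum.distrib)
      finally show ?thesis .
    qed
    have \<Phi>contracting: "\<Phi> x = \<phi> p (inR R x)" if x: "x \<in> ?I" "x \<in> rcomp R p" for x p
    proof -
      have "\<Phi> x = (\<Sum>p\<in>{p}. \<phi> p (inR R (gs.cmp x p)))"
        by (rule \<Phi>sup[OF x(1)]) (auto simp: gs.cmp_homogeneous[OF x(2)])
      then show ?thesis by (simp add: gs.cmp_homogeneous[OF x(2)])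
    qed
    have \<Phi>zero: "\<Phi> \<zero> = 0" by (simp add: \<Phi>_def gs.cmp_zero)
    have \<Phi>hact: "\<Phi> (r \<otimes> x) = actE R E (inR R r) (\<Phi> x)" if r: "r \<in> rcomp R q" and x: "x \<in> ?I" for r q x
    proof -
      have rc: "r \<in> carrier R" using rcomp_carrier[OF r] .
      have "x \<in> ?I \<and> \<Phi> (r \<otimes> x) = actE R E (inR R r) (\<Phi> x)"
      proof (rule gs.cmp_closed_induct[OF IR[OF x]])
        show "\<zero> \<in> ?I \<and> \<Phi> (r \<otimes> \<zero>) = actE R E (inR R r) (\<Phi> \<zero>)" using rc Izero by (simp add: \<Phi>zero)
      next
        fix u v assume "u \<in> carrier R" "v \<in> carrier R" "u \<in> ?I \<and> \<Phi> (r \<otimes> u) = actE R E (inR R r) (\<Phi> u)"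
          "v \<in> ?I \<and> \<Phi> (r \<otimes> v) = actE R E (inR R r) (\<Phi> v)"
        then show "u \<oplus> v \<in> ?I \<and> \<Phi> (r \<otimes> (u \<oplus> v)) = actE R E (inR R r) (\<Phi> (u \<oplus> v))"
          using rc Iadd I.I_l_closed by (simp add: r_distr \<Phi>add act_add)
      next
        fix p
        let ?c = "gs.cmp x p"
        have c: "?c \<in> ?I" "?c \<in> rcomp R p" "?c \<in> carrier R" using Icmp[OF x] gs.cmp_C[OF IR[OF x]] gs.cmp_carrier[OF IR[OF x]] by auto
        have "\<Phi> (r \<otimes> ?c) = \<phi> (q + p) (inR R r * inR R ?c)"
          using \<Phi>contracting[OF I.I_l_closed[OF c(1) rc] rcomp_mult[OF r c(2)]] rc c by (simp add: inR_mult)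
        also have "\<dots> = actE R E (inR R r) (\<Phi> ?c)"
          using H.hhomD(3)[OF \<phi> RRI[OF r]] tot_homogeneous[OF J c(2)] c(1) \<Phi>contracting[OF c(1,2)] by simp
        finally show "?c \<in> ?I \<and> \<Phi> (r \<otimes> ?c) = actE R E (inR R r) (\<Phi> ?c)" using c by blast
      qed
      then show ?thesis by blast
    qed
    have \<Phi>act: "\<Phi> (r \<otimes> x) = actE R E (inR R r) (\<Phi> x)" if r: "r \<in> carrier R" and x: "x \<in> ?I" for r x
      using r
    proof (induction rule: gs.homogeneous_induct)
      case zero
      then show ?case using IR[OF x] by (simp add: \<Phi>zero inR_zero)
    next
      case (add r s)
      then show ?case using IR[OF x] x I.I_l_closed by (simp add: l_distr \<Phi>add inR_add act_plus)
    next
      case (homogeneous q r)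
      then show ?case using \<Phi>hact x by blast
    qed
    define L' where "L' = \<lparr>carrier = ?I, mult = mult R, one = one R, zero = zero R, add = add R, smult = mult R,
       gcomp = (\<lambda>n. ?I \<inter> rcomp R (n - d))\<rparr>"
    define L where "L = \<lparr>carrier = carrier R, mult = mult R, one = one R, zero = zero R, add = add R, smult = mult R,
       gcomp = (\<lambda>n. carrier R \<inter> rcomp R (n - d))\<rparr>"
    have "graded_module R L'" unfolding L'_def by (rule graded_module_ideal[OF I.ideal_axioms Icmp])
    moreover have "graded_module R L" unfolding L_def by (rule graded_module_ideal[OF oneideal gs.cmp_carrier])
    moreover have "(\<lambda>x. x) \<in> graded_hom R L' L" using IR by (auto simp: graded_hom_def L_def L'_def)
    moreover have "inj_on (\<lambda>x. x) (carrier L')" by simp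
    moreover have "g \<in> graded_hom R L' (E i)"
      unfolding graded_hom_def
    proof (intro CollectI conjI ballI allI funcsetI)
      fix x assume x: "x \<in> carrier L'"
      then have xI: "x \<in> ?I" by (simp add: L'_def)
      show "g x \<in> carrier (E i)" unfolding g_def by (rule Rep_pgrp_E)
      { fix y assume "y \<in> carrier L'"
        then show "g (x \<oplus>\<^bsub>L'\<^esub> y) = g x \<oplus>\<^bsub>E i\<^esub> g y" using xI by (simp add: L'_def g_def \<Phi>add Rep_pgrp_ops[OF ab_E]) }
    next
      fix a x assume "a \<in> carrier R" "x \<in> carrier L'"
      then show "g (a \<odot>\<^bsub>L'\<^esub> x) = a \<odot>\<^bsub>E i\<^esub> g x"
        by (simp add: L'_def g_def \<Phi>act Rep_actE[OF ab_E] Rep_inR_self)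
    next
      fix n show "g ` gcomp L' n \<subseteq> gcomp (E i) n"
      proof
        fix y assume "y \<in> g ` gcomp L' n"
        then obtain x where x: "x \<in> ?I" "x \<in> rcomp R (n - d)" "y = g x" by (auto simp: L'_def)
        have "\<phi> (n - d) (inR R x) \<in> XX j (n - d + d)"
          using H.hhomD(1)[OF \<phi>] tot_homogeneous[OF J x(2)] x(1) by blast
        then obtain u where "u \<in> gcomp (E i) n" "u \<in> carrier (E i)" "\<phi> (n - d) (inR R x) = inE E i u"
          unfolding j by (auto elim: XXE)
        then show "y \<in> gcomp (E i) n" using x(3) \<Phi>contracting[OF x(1,2)] by (simp add: g_def Rep_inE_self)
      qed
    qed
    moreover have "graded_injective R (E i)" using res by (simp add: graded_injective_resolution_def)
    ultimately obtain h where h: "h \<in> graded_hom R L (E i)" "\<And>x. x \<in> ?I \<Longrightarrow> h x = g x"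
      unfolding graded_injective_def by (metis (no_types, lifting) L'_def partial_object.select_convs(1))
    define e where "e = h \<one>"
    have "\<one> \<in> gcomp L d" using rcomp_one by (simp add: L_def)
    then have e: "e \<in> gcomp (E i) d" using h(1) unfolding graded_hom_def e_def by blast
    have "\<phi> p a = actE R E a (inE E i e)" if a: "a \<in> J p" for p a
    proof -
      obtain a' where a': "a' \<in> rcomp R p" "a' \<in> carrier R" "a = inR R a'" using P(2)[OF a] by blast
      have aI: "a' \<in> ?I" using tot_homogeneous[OF J a'(1)] a a'(3) by blast
      obtain u where u: "u \<in> carrier (E i)" "\<phi> p a = inE E i u"
        using H.hhomD(1)[OF \<phi> a] unfolding j by (auto elim: XXE)
      have "u = g a'" using \<Phi>contracting[OF aI a'(1)] u a'(3) by (simp add: g_def Rep_inE_self)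
      also have "\<dots> = h (a' \<odot>\<^bsub>L\<^esub> \<one>)" using h(2)[OF aI] a'(2) by (simp add: L_def)
      also have "\<dots> = a' \<odot>\<^bsub>E i\<^esub> h \<one>"
      proof -
        have "h (b \<odot>\<^bsub>L\<^esub> x) = b \<odot>\<^bsub>E i\<^esub> h x" if "b \<in> carrier R" "x \<in> carrier L" for b x
          using h(1) that unfolding graded_hom_def by blast
        moreover have "\<one> \<in> carrier L" by (simp add: L_def)
        ultimately show ?thesis using a'(2) by blast
      qed
      finally have "u = a' \<odot>\<^bsub>E i\<^esub> e" by (simp add: e_def)
      then show ?thesis using u(2) a' gE.C_carrier[OF e] by (simp add: inE_act)
    qed
    then show ?thesis using XXI[OF e] unfolding j by blast
  qed
qed

lemma hcomplex_XX: "hcomplex RR (inR R \<one>) (actE R E) XX (diffE E \<delta>)"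
proof (rule hcomplex.intro[OF hring_RR action_E], rule hcomplex_axioms.intro)
  fix j n show "H.hmod (actE R E) (XX j)" by (rule hmod_XX)
  show "j < 0 \<Longrightarrow> XX j n = {0}" by (simp add: XX_def)
  show "H.baer (actE R E) (XX j)" by (rule baer_XX)
next
  fix x y :: "('a, 'e, int ^ 'r) pgrp"
  show "diffE E \<delta> (x - y) = diffE E \<delta> x - diffE E \<delta> y"
  proof (rule pgrp_eqI)
    fix i and X :: "('a, 'e, int ^ 'r) gmodule" assume X: "abelian_group X"
    interpret X: abelian_group X by fact
    show "Rep_pgrp (diffE E \<delta> (x - y)) (i, X) = Rep_pgrp (diffE E \<delta> x - diffE E \<delta> y) (i, X)"
      by (auto simp: Rep_diffE[OF X] Rep_pgrp_ops[OF X] Rep_pgrp_ops[OF ab_E] \<delta>_minus Rep_pgrp_E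
          X.minus_eq[of "\<zero>\<^bsub>X\<^esub>"] abelian_group_minus_zero[OF X] split: nat.split)
  qed
next
  fix a and x :: "('a, 'e, int ^ 'r) pgrp"
  show "diffE E \<delta> (actE R E a x) = actE R E a (diffE E \<delta> x)"
  proof (rule pgrp_eqI)
    fix i and X :: "('a, 'e, int ^ 'r) gmodule" assume X: "abelian_group X"
    have "Rep_pring a R \<in> carrier R" by (rule Rep_pring_carrier[OF cring_R])
    then show "Rep_pgrp (diffE E \<delta> (actE R E a x)) (i, X) = Rep_pgrp (actE R E a (diffE E \<delta> x)) (i, X)"
      by (auto simp: Rep_diffE[OF X] Rep_diffE[OF ab_E] Rep_actE[OF X] Rep_actE[OF ab_E] \<delta>_smult Rep_pgrp_E split: nat.split)
  qed
next
  fix x j n assume x: "x \<in> XX j n"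
  show "diffE E \<delta> x \<in> XX (j + 1) n"
  proof (cases "j < 0")
    case True
    have "diffE E \<delta> x = 0"
    proof (rule pgrp_eqI)
      fix i and X :: "('a, 'e, int ^ 'r) gmodule" assume X: "abelian_group X"
      show "Rep_pgrp (diffE E \<delta> x) (i, X) = Rep_pgrp 0 (i, X)"
        using x True by (auto simp: XX_def Rep_diffE[OF X] Rep_pgrp_ops[OF X] Rep_pgrp_ops[OF ab_E] \<delta>_zero split: nat.split)
    qed
    then show ?thesis using subgrp_0[OF H.hmodD(1)[OF hmod_XX]] by simp
  next
    case False
    then obtain i where j: "j = int i" by (metis nonneg_int_cases not_less)
    obtain x' where x': "x' \<in> gcomp (E i) n" "x' \<in> carrier (E i)" "x = inE E i x'" using XXE x unfolding j by blast
    then show ?thesis using XXI[OF \<delta>_gcomp[OF x'(1)]] by (simp add: inE_diffE j add.commute)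
  qed
next
  fix x :: "('a, 'e, int ^ 'r) pgrp"
  show "diffE E \<delta> (diffE E \<delta> x) = 0"
  proof (rule pgrp_eqI)
    fix i and X :: "('a, 'e, int ^ 'r) gmodule" assume X: "abelian_group X"
    show "Rep_pgrp (diffE E \<delta> (diffE E \<delta> x)) (i, X) = Rep_pgrp 0 (i, X)"
      by (auto simp: Rep_diffE[OF X] Rep_diffE[OF ab_E] Rep_pgrp_ops[OF X] \<delta>_\<delta> \<delta>_zero Rep_pgrp_E split: nat.split)
  qed
next
  fix x j n assume "1 \<le> j" "x \<in> XX j n" "diffE E \<delta> x = 0"
  then show "\<exists>y\<in>XX (j - 1) n. diffE E \<delta> y = x" by (rule XX_exact)
qed

end

sublocale sres \<subseteq> HC: hcomplex RR "inR R \<one>" "actE R E" XX "diffE E \<delta>"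
  by (rule hcomplex_XX)

sublocale sres \<subseteq> HL: hlocal RR "inR R \<one>" "inR R ` mx"
  by (rule hlocal_RR)

section \<open>Torsion, local cohomology and annihilators in the resolution\<close>

context sres
begin

lemma irrelevant_ideal_ideal: "ideal (irrelevant_ideal R) R"
  unfolding irrelevant_ideal_def by (rule genideal_ideal) (use rcomp_carrier in blast)

lemma ideals_pow_Suc:
  "I [^]\<^bsub>ideals_set R\<^esub> Suc k = ideal_prod R (I [^]\<^bsub>ideals_set R\<^esub> k) I"
proof -
  interpret S: comm_monoid "ideals_set R" by (rule ideals_set_is_comm_monoid)
  show ?thesis by (simp add: ideals_set_def[of R])
qed

lemma ideals_set_one: "\<one>\<^bsub>ideals_set R\<^esub> = carrier R"
  by (simp add: ideals_set_def)

lemma ideals_pow_carrier: "x \<in> irrelevant_ideal R [^]\<^bsub>ideals_set R\<^esub> (k::nat) \<Longrightarrow> x \<in> carrier R"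
proof (induction k arbitrary: x)
  case 0
  then show ?case by (simp add: ideals_set_one)
next
  case (Suc k)
  have "x \<in> ideal_prod R (irrelevant_ideal R [^]\<^bsub>ideals_set R\<^esub> k) (irrelevant_ideal R)"
    using Suc.prems by (simp only: ideals_pow_Suc)
  then show ?case
    by (induction rule: ideal_prod.induct) (use Suc.IH ideal.Icarr[OF irrelevant_ideal_ideal] in auto)
qed

text \<open>The elements \<open>c\<close> for which \<open>R (of_nat k)\<close> kills
  \<open>c z\<close> form an ideal. If \<open>R (of_nat (k + 1))\<close> kills \<open>z\<close>,
  this ideal contains \<open>R 1\<close> and so the irrelevant ideal, and the induction hypothesis
  applies to each such \<open>c z\<close>.\<close>

lemma ideals_pow_kills:
  assumes "z \<in> carrier (E j)" "\<And>f. f \<in> rcomp R (of_nat k) \<Longrightarrow> f \<odot>\<^bsub>E j\<^esub> z = \<zero>\<^bsub>E j\<^esub>"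
    and "a \<in> irrelevant_ideal R [^]\<^bsub>ideals_set R\<^esub> k"
  shows "a \<odot>\<^bsub>E j\<^esub> z = \<zero>\<^bsub>E j\<^esub>"
  using assms
proof (induction k arbitrary: z a)
  case 0
  have "\<one> \<odot>\<^bsub>E j\<^esub> z = \<zero>\<^bsub>E j\<^esub>" using 0(2)[of \<one>] rcomp_one by simp
  then have "z = \<zero>\<^bsub>E j\<^esub>" using 0(1) by simp
  then show ?case using 0(3) by (simp add: ideals_set_one)
next
  case (Suc k)
  note z = Suc.prems(1)
  have "a \<in> ideal_prod R (irrelevant_ideal R [^]\<^bsub>ideals_set R\<^esub> k) (irrelevant_ideal R)"
    using Suc.prems(3) by (simp only: ideals_pow_Suc)
  then have "a \<in> carrier R \<and> a \<odot>\<^bsub>E j\<^esub> z = \<zero>\<^bsub>E j\<^esub>"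
  proof (induction rule: ideal_prod.induct)
    case (prod b c)
    let ?Z = "{z \<in> carrier (E j). \<forall>f\<in>rcomp R (of_nat k). f \<odot>\<^bsub>E j\<^esub> z = \<zero>\<^bsub>E j\<^esub>}"
    have "ideal {c \<in> carrier R. c \<odot>\<^bsub>E j\<^esub> z \<in> ?Z} R"
    proof (rule idealI)
      have smc: "f \<odot>\<^bsub>E j\<^esub> (c \<odot>\<^bsub>E j\<^esub> z) = c \<odot>\<^bsub>E j\<^esub> (f \<odot>\<^bsub>E j\<^esub> z)" if "f \<in> carrier R" "c \<in> carrier R" for f c
        using that z by (simp add: E.smult_assoc1[symmetric] m_comm)
      have "additive_subgroup {c \<in> carrier R. c \<odot>\<^bsub>E j\<^esub> z \<in> ?Z} R"
        by (rule additive_subgroupI')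
          (use z rcomp_carrier in \<open>auto simp: E.smult_l_distr E.smult_r_distr E.smult_l_minus E.smult_r_minus abelian_group_minus_zero[OF ab_E]\<close>)
      then show "subgroup {c \<in> carrier R. c \<odot>\<^bsub>E j\<^esub> z \<in> ?Z} (add_monoid R)" by (simp add: additive_subgroup.a_subgroup)
      fix u x assume u: "u \<in> {c \<in> carrier R. c \<odot>\<^bsub>E j\<^esub> z \<in> ?Z}" and x: "x \<in> carrier R"
      have "f \<odot>\<^bsub>E j\<^esub> ((x \<otimes> u) \<odot>\<^bsub>E j\<^esub> z) = \<zero>\<^bsub>E j\<^esub>" if f: "f \<in> rcomp R (of_nat k)" for f
      proof -
        have "f \<odot>\<^bsub>E j\<^esub> ((x \<otimes> u) \<odot>\<^bsub>E j\<^esub> z) = x \<odot>\<^bsub>E j\<^esub> (f \<odot>\<^bsub>E j\<^esub> (u \<odot>\<^bsub>E j\<^esub> z))"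
          using rcomp_carrier[OF f] u x z by (simp add: E.smult_assoc1[symmetric] m_ac)
        then show ?thesis using u f x by simp
      qed
      then show 1: "x \<otimes> u \<in> {c \<in> carrier R. c \<odot>\<^bsub>E j\<^esub> z \<in> ?Z}" using u x z by simp
      have "u \<otimes> x = x \<otimes> u" using u x m_comm by simp
      then show "u \<otimes> x \<in> {c \<in> carrier R. c \<odot>\<^bsub>E j\<^esub> z \<in> ?Z}" using 1 by simp
    qed (rule ring_axioms)
    moreover have "rcomp R 1 \<subseteq> {c \<in> carrier R. c \<odot>\<^bsub>E j\<^esub> z \<in> ?Z}"
    proof
      fix f assume f: "f \<in> rcomp R 1"
      have "g \<odot>\<^bsub>E j\<^esub> (f \<odot>\<^bsub>E j\<^esub> z) = \<zero>\<^bsub>E j\<^esub>" if g: "g \<in> rcomp R (of_nat k)" for g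
        using Suc.prems(2)[of "g \<otimes> f"] rcomp_mult[OF g f] rcomp_carrier[OF f] rcomp_carrier[OF g] z
        by (simp add: E.smult_assoc1 add.commute)
      then show "f \<in> {c \<in> carrier R. c \<odot>\<^bsub>E j\<^esub> z \<in> ?Z}" using rcomp_carrier[OF f] z by simp
    qed
    ultimately have "irrelevant_ideal R \<subseteq> {c \<in> carrier R. c \<odot>\<^bsub>E j\<^esub> z \<in> ?Z}"
      unfolding irrelevant_ideal_def by (rule genideal_minimal)
    then have c: "c \<in> carrier R" "c \<odot>\<^bsub>E j\<^esub> z \<in> ?Z" using prod(2) by blast+
    have "b \<odot>\<^bsub>E j\<^esub> (c \<odot>\<^bsub>E j\<^esub> z) = \<zero>\<^bsub>E j\<^esub>"
      by (rule Suc.IH[OF _ _ prod(1)]) (use c(2) in auto)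
    then show ?case using ideals_pow_carrier[OF prod(1)] c(1) z by (simp add: E.smult_assoc1)
  next
    case (sum b c)
    then show ?case using z by (simp add: E.smult_l_distr)
  qed
  then show ?case by blast
qed

lemma torsion_partI:
  assumes x: "x \<in> gcomp (E j) n" and t: "H.tors (actE R E) (inE E j x)"
  shows "x \<in> torsion_part R (irrelevant_ideal R) (E j)"
proof -
  have xc: "x \<in> carrier (E j)" using gE.C_carrier[OF x] .
  obtain N where N: "\<And>a. a \<in> RR (of_nat N) \<Longrightarrow> actE R E a (inE E j x) = 0"
    using HC.tors_annihilated[OF XXI[OF x] t] by blast
  have "f \<odot>\<^bsub>E j\<^esub> x = \<zero>\<^bsub>E j\<^esub>" if f: "f \<in> rcomp R (of_nat N)" for f
  proof -
    have "inE E j (f \<odot>\<^bsub>E j\<^esub> x) = inE E j \<zero>\<^bsub>E j\<^esub>"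
      using N[OF RRI[OF f]] rcomp_carrier[OF f] xc by (simp add: inE_act inE_zero)
    then show ?thesis using inE_inj rcomp_carrier[OF f] xc by simp
  qed
  from ideals_pow_kills[OF xc this] show ?thesis using xc unfolding torsion_part_def by blast
qed

text \<open>Multiplication by the homogeneous \<open>f^k\<close> only shifts components, so what it
  does to \<open>y\<close> it does to every component of \<open>y\<close>.\<close>

lemma torsion_part_tors:
  assumes y: "y \<in> torsion_part R (irrelevant_ideal R) (E j)"
  shows "H.tors (actE R E) (inE E j (gE.cmp j y n))"
  unfolding H.tors_def
proof
  have yc: "y \<in> carrier (E j)" using y by (simp add: torsion_part_def)
  obtain k where k: "\<And>a. a \<in> irrelevant_ideal R [^]\<^bsub>ideals_set R\<^esub> (k::nat) \<Longrightarrow> a \<odot>\<^bsub>E j\<^esub> y = \<zero>\<^bsub>E j\<^esub>"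
    using y by (auto simp: torsion_part_def)
  fix f assume "f \<in> RR 1"
  then obtain f' where f': "f' \<in> rcomp R 1" "f = inR R f'" "f' \<in> carrier R" by (rule RRE)
  have fI: "f' \<in> irrelevant_ideal R"
    unfolding irrelevant_ideal_def using genideal_self[of "rcomp R 1"] rcomp_carrier f'(1) by blast
  have pk: "f' [^] t \<in> irrelevant_ideal R [^]\<^bsub>ideals_set R\<^esub> t" for t :: nat
  proof (induction t)
    case 0
    then show ?case by (simp add: ideals_set_one)
  next
    case (Suc t)
    then show ?case unfolding ideals_pow_Suc using fI by (auto intro: ideal_prod.prod)
  qed
  have pd: "f' [^] t \<in> rcomp R (of_nat t)" for t :: nat
  proof (induction t)
    case (Suc t)
    then show ?case using rcomp_mult[OF Suc f'(1)] by (simp add: add.commute)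
  qed (simp add: rcomp_one)
  let ?z = "gE.cmp j y n"
  have zc: "?z \<in> carrier (E j)" by (rule gE.cmp_carrier[OF yc])
  have pw: "(actE R E f ^^ t) (inE E j ?z) = inE E j ((f' [^] t) \<odot>\<^bsub>E j\<^esub> ?z)" for t
  proof (induction t)
    case (Suc t)
    have "f' \<odot>\<^bsub>E j\<^esub> ((f' [^] t) \<odot>\<^bsub>E j\<^esub> ?z) = (f' [^] Suc t) \<odot>\<^bsub>E j\<^esub> ?z"
      using f'(3) zc by (simp add: E.smult_assoc1[symmetric] m_comm)
    then show ?case using Suc f' zc by (simp add: inE_act del: nat_pow_Suc)
  qed (use zc in simp)
  have "(f' [^] k) \<odot>\<^bsub>E j\<^esub> ?z = gE.cmp j ((f' [^] k) \<odot>\<^bsub>E j\<^esub> y) (of_nat k + n)"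
    using smult_cmp[OF pd yc] by simp
  also have "\<dots> = \<zero>\<^bsub>E j\<^esub>" using k[OF pk] by (simp add: gE.cmp_zero)
  finally have "(actE R E f ^^ k) (inE E j ?z) = 0" using pw[of k] by (simp add: inE_zero)
  then show "\<exists>t. (actE R E f ^^ t) (inE E j ?z) = 0" by blast
qed

lemma zero_torsion: "\<zero>\<^bsub>E j\<^esub> \<in> torsion_part R (irrelevant_ideal R) (E j)"
  unfolding torsion_part_def using ideals_pow_carrier by (auto intro!: exI[of _ 0])

text \<open>A zero component of the quotient puts the torsion cocycle into the group of boundaries.
  Its primitive in the torsion part may be inhomogeneous and is replaced by the component of degree
  \<open>n\<close>.\<close>

lemma vanishing_XX:
  assumes van: "\<And>i. gcomp (local_cohomology R (irrelevant_ideal R) E \<delta> i) n =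
      {\<zero>\<^bsub>local_cohomology R (irrelevant_ideal R) E \<delta> i\<^esub>}"
    and x: "x \<in> XX j n" "H.tors (actE R E) x" "diffE E \<delta> x = 0"
  shows "\<exists>y\<in>XX (j - 1) n. H.tors (actE R E) y \<and> diffE E \<delta> y = x"
proof (cases "j < 0")
  case True
  then have "x = 0" using x(1) by (simp add: XX_def)
  then show ?thesis using True H.tors_0[OF action_E] HC.\<delta>_0 by (auto simp: XX_def)
next
  case False
  then obtain i where j: "j = int i" by (metis nonneg_int_cases not_less)
  obtain x' where x': "x' \<in> gcomp (E i) n" "x' \<in> carrier (E i)" "x = inE E i x'" using XXE x(1) unfolding j by blast
  have xt: "x' \<in> torsion_part R (irrelevant_ideal R) (E i)" using torsion_partI[OF x'(1)] x(2) x'(3) by simp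
  have "inE E (Suc i) (\<delta> i x') = inE E (Suc i) \<zero>\<^bsub>E (Suc i)\<^esub>"
    using x(3) x' by (simp add: inE_diffE inE_zero)
  then have dx: "\<delta> i x' = \<zero>\<^bsub>E (Suc i)\<^esub>" using inE_inj \<delta>_closed x'(2) E.zero_closed by blast
  define S where "S = {x \<in> torsion_part R (irrelevant_ideal R) (E i). \<delta> i x = \<zero>\<^bsub>E (Suc i)\<^esub>}"
  define B where "B = (case i of 0 \<Rightarrow> {\<zero>\<^bsub>E 0\<^esub>} | Suc j \<Rightarrow> \<delta> j ` torsion_part R (irrelevant_ideal R) (E j))"
  have B0: "\<zero>\<^bsub>E i\<^esub> \<in> B"
    using zero_torsion \<delta>_zero by (auto simp: B_def image_iff split: nat.split) metis
  have "(\<lambda>x. B +>\<^bsub>grestrict (E i) S\<^esub> x) ` (S \<inter> gcomp (E i) n) = {B}"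
    using van[of i] by (simp add: local_cohomology_def gquot_def S_def B_def grestrict_def)
  then have "B +>\<^bsub>grestrict (E i) S\<^esub> x' = B" using xt dx x'(1) by (auto simp: S_def)
  moreover have "x' \<in> B +>\<^bsub>grestrict (E i) S\<^esub> x'"
  proof -
    have "\<zero>\<^bsub>E i\<^esub> \<oplus>\<^bsub>E i\<^esub> x' \<in> B +>\<^bsub>grestrict (E i) S\<^esub> x'"
      using B0 unfolding a_r_coset_def' by (auto simp: grestrict_def)
    then show ?thesis using x'(2) by simp
  qed
  ultimately have xB: "x' \<in> B" by simp
  show ?thesis
  proof (cases i)
    case 0
    then have "x' = \<zero>\<^bsub>E i\<^esub>" using xB by (simp add: B_def)
    then have "x = 0" using x'(3) by (simp add: inE_zero)
    then show ?thesis using H.tors_0[OF action_E] HC.\<delta>_0 subgrp_0[OF H.hmodD(1)[OF hmod_XX]] by auto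
  next
    case (Suc k)
    then obtain y where y: "y \<in> torsion_part R (irrelevant_ideal R) (E k)" "x' = \<delta> k y" using xB by (auto simp: B_def)
    have yc: "y \<in> carrier (E k)" using y(1) by (simp add: torsion_part_def)
    have "\<delta> k (gE.cmp k y n) = x'"
      using \<delta>_cmp[OF yc] gE.cmp_homogeneous[OF x'(1)] y(2) Suc by simp
    then have "diffE E \<delta> (inE E k (gE.cmp k y n)) = x" using inE_diffE[OF gE.cmp_carrier[OF yc]] x'(3) Suc by simp
    moreover have "inE E k (gE.cmp k y n) \<in> XX (j - 1) n" using XXI[OF gE.cmp_C[OF yc]] Suc j by simp
    ultimately show ?thesis using torsion_part_tors[OF y(1)] by blast
  qed
qed

text \<open>\<open>\<epsilon>\<close> identifies \<open>M\<close> with the cocycles in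
  \<open>E 0\<close>, and it suffices to test homogeneous elements of \<open>M\<close>.\<close>

lemma ann_iff:
  assumes a: "a \<in> rcomp R p"
  shows "inR R a \<in> HC.ann p \<longleftrightarrow> (\<forall>x\<in>carrier M. a \<odot>\<^bsub>M\<^esub> x = \<zero>\<^bsub>M\<^esub>)"
proof
  have ac: "a \<in> carrier R" using rcomp_carrier[OF a] .
  have e0: "\<epsilon> \<zero>\<^bsub>M\<^esub> = \<zero>\<^bsub>E 0\<^esub>"
    by (rule hom_zero_minus(1)[OF M.abelian_group_axioms ab_E \<epsilon>_closed \<epsilon>_plus])
  {
    assume L: "inR R a \<in> HC.ann p"
    show "\<forall>x\<in>carrier M. a \<odot>\<^bsub>M\<^esub> x = \<zero>\<^bsub>M\<^esub>"
    proof
      fix x assume "x \<in> carrier M"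
      then show "a \<odot>\<^bsub>M\<^esub> x = \<zero>\<^bsub>M\<^esub>"
      proof (induction rule: gM.homogeneous_induct)
        case (add x y)
        then show ?case using ac by (simp add: M.smult_r_distr)
      next
        case (homogeneous n x)
        have xc: "x \<in> carrier M" using gM.C_carrier[OF homogeneous] .
        have d0: "\<delta> 0 (\<epsilon> x) = \<zero>\<^bsub>E (Suc 0)\<^esub>" using \<epsilon>_image xc by auto
        have "inE E 0 (\<epsilon> x) \<in> XX 0 n" using XXI[OF \<epsilon>_gcomp[OF homogeneous]] by simp
        moreover have "diffE E \<delta> (inE E 0 (\<epsilon> x)) = 0" using inE_diffE[OF \<epsilon>_closed[OF xc]] d0 by (simp add: inE_zero)
        ultimately have "actE R E (inR R a) (inE E 0 (\<epsilon> x)) = 0" using L by (simp add: HC.ann_def)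
        then have "inE E 0 (\<epsilon> (a \<odot>\<^bsub>M\<^esub> x)) = inE E 0 (\<epsilon> \<zero>\<^bsub>M\<^esub>)"
          using ac xc by (simp add: inE_act \<epsilon>_closed \<epsilon>_smult e0 inE_zero)
        then have "\<epsilon> (a \<odot>\<^bsub>M\<^esub> x) = \<epsilon> \<zero>\<^bsub>M\<^esub>" using inE_inj \<epsilon>_closed ac xc M.smult_closed M.zero_closed by blast
        then show ?case using \<epsilon>_inj ac xc by (simp add: inj_on_def)
      qed (use ac in simp)
    qed
  next
    assume K: "\<forall>x\<in>carrier M. a \<odot>\<^bsub>M\<^esub> x = \<zero>\<^bsub>M\<^esub>"
    have "actE R E (inR R a) w = 0" if w: "w \<in> XX 0 n" "diffE E \<delta> w = 0" for w n
    proof -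
      have "w \<in> XX (int 0) n" using w(1) by simp
      then obtain w' where w': "w' \<in> gcomp (E 0) n" "w' \<in> carrier (E 0)" "w = inE E 0 w'" by (rule XXE)
      have "inE E (Suc 0) (\<delta> 0 w') = inE E (Suc 0) \<zero>\<^bsub>E (Suc 0)\<^esub>"
        using w(2) w' by (simp add: inE_diffE inE_zero)
      then have "\<delta> 0 w' = \<zero>\<^bsub>E 1\<^esub>" using inE_inj \<delta>_closed[OF w'(2)] E.zero_closed[of "Suc 0"] by simp
      then obtain x where x: "x \<in> carrier M" "w' = \<epsilon> x" using \<epsilon>_image w'(2) by blast
      have "actE R E (inR R a) w = inE E 0 (a \<odot>\<^bsub>E 0\<^esub> \<epsilon> x)" using w' x ac by (simp add: inE_act)
      also have "a \<odot>\<^bsub>E 0\<^esub> \<epsilon> x = \<zero>\<^bsub>E 0\<^esub>" using K x \<epsilon>_smult[OF ac x(1)] e0 by simp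
      finally show ?thesis by (simp add: inE_zero)
    qed
    then show "inR R a \<in> HC.ann p" using RRI[OF a] by (simp add: HC.ann_def)
  }
qed

end

section \<open>Primes in the support\<close>

text \<open>The submodule \<open>P G\<close> for an ideal \<open>P\<close>, in a form built up term
  by term so that the coefficient of one generator can be isolated.\<close>

inductive_set wspan :: "('a, 'x) ring_scheme \<Rightarrow> ('a, 'm, 'y) module_scheme \<Rightarrow> 'a set \<Rightarrow> 'm set \<Rightarrow> 'm set"
  for R and M and P and G where
  zero: "\<zero>\<^bsub>M\<^esub> \<in> wspan R M P G"
| add: "p \<in> P \<Longrightarrow> g \<in> G \<Longrightarrow> w \<in> wspan R M P G \<Longrightarrow> (p \<odot>\<^bsub>M\<^esub> g) \<oplus>\<^bsub>M\<^esub> w \<in> wspan R M P G"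

context module
begin

lemma wspan_carrier: "P \<subseteq> carrier R \<Longrightarrow> G \<subseteq> carrier M \<Longrightarrow> w \<in> wspan R M P G \<Longrightarrow> w \<in> carrier M"
  by (rotate_tac 2, induction rule: wspan.induct) auto

lemma wspan_plus:
  assumes "P \<subseteq> carrier R" "G \<subseteq> carrier M" "v \<in> wspan R M P G" "w \<in> wspan R M P G"
  shows "v \<oplus>\<^bsub>M\<^esub> w \<in> wspan R M P G"
  using assms(3)
proof (induction rule: wspan.induct)
  case zero
  then show ?case using assms wspan_carrier by simp
next
  case (add p g v)
  have "p \<odot>\<^bsub>M\<^esub> g \<oplus>\<^bsub>M\<^esub> v \<oplus>\<^bsub>M\<^esub> w = p \<odot>\<^bsub>M\<^esub> g \<oplus>\<^bsub>M\<^esub> (v \<oplus>\<^bsub>M\<^esub> w)"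
    using add assms wspan_carrier[OF assms(1,2)] by (intro M.a_assoc) auto
  then show ?case using wspan.add[OF add(1,2,4)] by simp
qed

lemma wspan_smult:
  assumes "ideal P R" "G \<subseteq> carrier M" "r \<in> carrier R" "w \<in> wspan R M P G"
  shows "r \<odot>\<^bsub>M\<^esub> w \<in> wspan R M P G"
proof -
  have P: "P \<subseteq> carrier R" using ideal.Icarr[OF assms(1)] by blast
  show ?thesis
    using assms(4)
  proof (induction rule: wspan.induct)
    case zero
    then show ?case using assms by (simp add: wspan.zero)
  next
    case (add p g w)
    have "p \<in> carrier R" "g \<in> carrier M" "w \<in> carrier M" using add P wspan_carrier[OF P assms(2)] assms(2) by auto
    then have "r \<odot>\<^bsub>M\<^esub> (p \<odot>\<^bsub>M\<^esub> g \<oplus>\<^bsub>M\<^esub> w) = (r \<otimes> p) \<odot>\<^bsub>M\<^esub> g \<oplus>\<^bsub>M\<^esub> r \<odot>\<^bsub>M\<^esub> w"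
      using assms(3) by (simp add: smult_r_distr smult_assoc1)
    moreover have "r \<otimes> p \<in> P" using ideal.I_l_closed[OF assms(1) add(1) assms(3)] .
    ultimately show ?case using wspan.add[OF _ add(2,4)] by simp
  qed
qed

lemma wspan_single: "P \<subseteq> carrier R \<Longrightarrow> G \<subseteq> carrier M \<Longrightarrow> p \<in> P \<Longrightarrow> g \<in> G \<Longrightarrow> p \<odot>\<^bsub>M\<^esub> g \<in> wspan R M P G"
  using wspan.add[OF _ _ wspan.zero, of p P g G M R] by (auto simp: subset_iff)

lemma wspan_insert:
  assumes P: "ideal P R" and G: "insert g G \<subseteq> carrier M" and w: "w \<in> wspan R M P (insert g G)"
  shows "\<exists>p\<in>P. \<exists>v\<in>wspan R M P G. w = p \<odot>\<^bsub>M\<^esub> g \<oplus>\<^bsub>M\<^esub> v"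
  using w
proof (induction rule: wspan.induct)
  interpret P: ideal P R by (rule P)
  have Pc: "P \<subseteq> carrier R" using P.Icarr by blast
  {
    case zero
    have "\<zero>\<^bsub>M\<^esub> = \<zero> \<odot>\<^bsub>M\<^esub> g \<oplus>\<^bsub>M\<^esub> \<zero>\<^bsub>M\<^esub>" using G by simp
    then show ?case using additive_subgroup.zero_closed[OF P.additive_subgroup_axioms] wspan.zero by blast
  next
    case (add p x w)
    then obtain q v where v: "q \<in> P" "v \<in> wspan R M P G" "w = q \<odot>\<^bsub>M\<^esub> g \<oplus>\<^bsub>M\<^esub> v" by blast
    have vc: "v \<in> carrier M" using wspan_carrier[OF Pc _ v(2)] G by blast
    have pq: "p \<in> carrier R" "q \<in> carrier R" "g \<in> carrier M" "x \<in> carrier M" using add v Pc G by auto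
    show ?case
    proof (cases "x = g")
      case True
      have "p \<odot>\<^bsub>M\<^esub> x \<oplus>\<^bsub>M\<^esub> w = (p \<oplus> q) \<odot>\<^bsub>M\<^esub> g \<oplus>\<^bsub>M\<^esub> v"
        using pq vc True v(3) by (simp add: smult_l_distr M.a_assoc)
      moreover have "p \<oplus> q \<in> P" using additive_subgroup.a_closed[OF P.additive_subgroup_axioms add(1) v(1)] .
      ultimately show ?thesis using v(2) by blast
    next
      case False
      have "p \<odot>\<^bsub>M\<^esub> x \<oplus>\<^bsub>M\<^esub> w = q \<odot>\<^bsub>M\<^esub> g \<oplus>\<^bsub>M\<^esub> (p \<odot>\<^bsub>M\<^esub> x \<oplus>\<^bsub>M\<^esub> v)"
        using pq vc v(3) by (simp add: M.a_lcomm)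
      moreover have "p \<odot>\<^bsub>M\<^esub> x \<oplus>\<^bsub>M\<^esub> v \<in> wspan R M P G" using wspan.add[OF add(1) _ v(2)] add(2) False by blast
      ultimately show ?thesis using v(1) by blast
    qed
  }
qed

lemma wspan_kill:
  assumes "P \<subseteq> carrier R" "G \<subseteq> carrier M" "t \<in> carrier R" "\<And>g. g \<in> G \<Longrightarrow> t \<odot>\<^bsub>M\<^esub> g = \<zero>\<^bsub>M\<^esub>" "w \<in> wspan R M P G"
  shows "t \<odot>\<^bsub>M\<^esub> w = \<zero>\<^bsub>M\<^esub>"
  using assms(5)
proof (induction rule: wspan.induct)
  case (add p g w)
  have pc: "p \<in> carrier R" "g \<in> carrier M" "w \<in> carrier M" using add assms wspan_carrier[OF assms(1,2)] by auto
  have "t \<odot>\<^bsub>M\<^esub> (p \<odot>\<^bsub>M\<^esub> g) = p \<odot>\<^bsub>M\<^esub> (t \<odot>\<^bsub>M\<^esub> g)" using pc assms(3) by (simp add: smult_assoc1[symmetric] R.m_comm)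
  then show ?case using pc assms(3,4) add by (simp add: smult_r_distr)
qed (use assms in simp)

text \<open>Nakayama's lemma over the local ring at \<open>P\<close> with the denominators written
  out: \<open>t - p\<close> stays outside \<open>P\<close>, so \<open>g\<close> can be eliminated
  from the other relations after multiplying them by it, and the multipliers are collected.\<close>

lemma localized_nakayama:
  assumes P: "primeideal P R" and "finite G" "G \<subseteq> carrier M" "t \<in> carrier R - P"
    and "\<And>g. g \<in> G \<Longrightarrow> t \<odot>\<^bsub>M\<^esub> g \<in> wspan R M P G"
  shows "\<exists>t'\<in>carrier R - P. \<forall>g\<in>G. t' \<odot>\<^bsub>M\<^esub> g = \<zero>\<^bsub>M\<^esub>"
  using assms(2-)
proof (induction G arbitrary: t rule: finite_induct)
  case empty
  then show ?case by blast
next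
  case (insert g G)
  interpret P: primeideal P R by (rule P)
  have Pi: "ideal P R" by (rule P.ideal_axioms)
  have Pc: "P \<subseteq> carrier R" using P.Icarr by blast
  have G: "G \<subseteq> carrier M" "g \<in> carrier M" and t: "t \<in> carrier R" "t \<notin> P" using insert.prems by auto
  obtain p w where w: "p \<in> P" "w \<in> wspan R M P G" "t \<odot>\<^bsub>M\<^esub> g = p \<odot>\<^bsub>M\<^esub> g \<oplus>\<^bsub>M\<^esub> w"
    using wspan_insert[OF Pi insert.prems(1) insert.prems(3)[of g]] by blast
  have wc: "w \<in> carrier M" using wspan_carrier[OF Pc G(1) w(2)] .
  have pc: "p \<in> carrier R" using w(1) Pc by blast
  define s where "s = t \<ominus> p"
  have sc: "s \<in> carrier R" using t pc by (simp add: s_def)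
  have sP: "s \<notin> P"
  proof
    assume "s \<in> P"
    from additive_subgroup.a_closed[OF P.additive_subgroup_axioms this w(1)] have "s \<oplus> p \<in> P" .
    moreover have "s \<oplus> p = t" using t pc by (simp add: s_def R.minus_eq R.a_assoc R.l_neg)
    ultimately show False using t by simp
  qed
  have sg: "s \<odot>\<^bsub>M\<^esub> g = w"
  proof -
    have "s \<odot>\<^bsub>M\<^esub> g = t \<odot>\<^bsub>M\<^esub> g \<oplus>\<^bsub>M\<^esub> \<ominus>\<^bsub>M\<^esub> (p \<odot>\<^bsub>M\<^esub> g)"
      using t pc G by (simp add: s_def R.minus_eq smult_l_distr smult_l_minus)
    also have "\<dots> = w" using w(3) wc pc G by (simp add: M.a_comm[of "p \<odot>\<^bsub>M\<^esub> g" w] M.a_assoc M.r_neg)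
    finally show ?thesis .
  qed
  have "\<exists>t'\<in>carrier R - P. \<forall>g\<in>G. t' \<odot>\<^bsub>M\<^esub> g = \<zero>\<^bsub>M\<^esub>"
  proof (rule insert.IH[OF G(1)])
    show "s \<otimes> t \<in> carrier R - P" using P.I_prime[OF sc t(1)] sc t sP by blast
    fix x assume x: "x \<in> G"
    have xc: "x \<in> carrier M" using x G by blast
    obtain q v where v: "q \<in> P" "v \<in> wspan R M P G" "t \<odot>\<^bsub>M\<^esub> x = q \<odot>\<^bsub>M\<^esub> g \<oplus>\<^bsub>M\<^esub> v"
      using wspan_insert[OF Pi insert.prems(1) insert.prems(3)[of x]] x by blast
    have vc: "v \<in> carrier M" using wspan_carrier[OF Pc G(1) v(2)] .
    have qc: "q \<in> carrier R" using v(1) Pc by blast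
    have "(s \<otimes> t) \<odot>\<^bsub>M\<^esub> x = q \<odot>\<^bsub>M\<^esub> (s \<odot>\<^bsub>M\<^esub> g) \<oplus>\<^bsub>M\<^esub> s \<odot>\<^bsub>M\<^esub> v"
    proof -
      have "(s \<otimes> t) \<odot>\<^bsub>M\<^esub> x = s \<odot>\<^bsub>M\<^esub> (q \<odot>\<^bsub>M\<^esub> g \<oplus>\<^bsub>M\<^esub> v)" using sc t xc v(3) by (simp add: smult_assoc1)
      also have "\<dots> = s \<odot>\<^bsub>M\<^esub> (q \<odot>\<^bsub>M\<^esub> g) \<oplus>\<^bsub>M\<^esub> s \<odot>\<^bsub>M\<^esub> v" using sc qc G vc by (simp add: smult_r_distr)
      also have "s \<odot>\<^bsub>M\<^esub> (q \<odot>\<^bsub>M\<^esub> g) = q \<odot>\<^bsub>M\<^esub> (s \<odot>\<^bsub>M\<^esub> g)" using sc qc G by (simp add: smult_assoc1[symmetric] R.m_comm)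
      finally show ?thesis .
    qed
    then show "(s \<otimes> t) \<odot>\<^bsub>M\<^esub> x \<in> wspan R M P G"
      using wspan_plus[OF Pc G(1) wspan_smult[OF Pi G(1) qc w(2)] wspan_smult[OF Pi G(1) sc v(2)]] by (simp add: sg)
  qed
  then obtain t' where t': "t' \<in> carrier R" "t' \<notin> P" "\<And>x. x \<in> G \<Longrightarrow> t' \<odot>\<^bsub>M\<^esub> x = \<zero>\<^bsub>M\<^esub>" by blast
  have "(t' \<otimes> s) \<odot>\<^bsub>M\<^esub> g = \<zero>\<^bsub>M\<^esub>"
    using wspan_kill[OF Pc G(1) t'(1,3) w(2)] t'(1) sc G by (simp add: smult_assoc1 sg)
  moreover have "(t' \<otimes> s) \<odot>\<^bsub>M\<^esub> x = \<zero>\<^bsub>M\<^esub>" if x: "x \<in> G" for x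
  proof -
    have "(t' \<otimes> s) \<odot>\<^bsub>M\<^esub> x = s \<odot>\<^bsub>M\<^esub> (t' \<odot>\<^bsub>M\<^esub> x)"
      using t'(1) sc x G by (auto simp: smult_assoc1[symmetric] R.m_comm subset_iff)
    then show ?thesis using t'(3)[OF x] sc by simp
  qed
  moreover have "t' \<otimes> s \<in> carrier R - P" using P.I_prime[OF t'(1) sc] t' sc sP by blast
  ultimately show ?case by blast
qed

lemma submodule_gen: "S \<subseteq> carrier M \<Longrightarrow> submodule (gen_submodule R M S) R M"
proof (rule submoduleI)
  assume S: "S \<subseteq> carrier M"
  have car: "submodule (carrier M) R M" by (rule carrier_is_submodule)
  show "gen_submodule R M S \<subseteq> carrier M" using car S by (auto simp: gen_submodule_def)
  have z: "\<zero>\<^bsub>M\<^esub> \<in> H" if "submodule H R M" for H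
    using subgroup.one_closed[OF submodule.axioms(1)[OF that]] by simp
  show "\<zero>\<^bsub>M\<^esub> \<in> gen_submodule R M S" using z by (auto simp: gen_submodule_def)
  show "\<ominus>\<^bsub>M\<^esub> a \<in> gen_submodule R M S" if "a \<in> gen_submodule R M S" for a
    using that submoduleE(3) by (auto simp: gen_submodule_def)
  show "a \<oplus>\<^bsub>M\<^esub> b \<in> gen_submodule R M S" if "a \<in> gen_submodule R M S" "b \<in> gen_submodule R M S" for a b
    using that submoduleE(5) by (auto simp: gen_submodule_def)
  show "a \<odot>\<^bsub>M\<^esub> x \<in> gen_submodule R M S" if "a \<in> carrier R" "x \<in> gen_submodule R M S" for a x
    using that submoduleE(4) by (auto simp: gen_submodule_def)
qed

lemma gen_submodule_le: "submodule H R M \<Longrightarrow> S \<subseteq> H \<Longrightarrow> gen_submodule R M S \<subseteq> H"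
  unfolding gen_submodule_def by blast

lemma uniform_multiplier:
  assumes P: "primeideal P R" and K: "submodule K R M" and "finite S" "S \<subseteq> carrier M"
    "\<And>x. x \<in> S \<Longrightarrow> \<exists>u\<in>carrier R - P. u \<odot>\<^bsub>M\<^esub> x \<in> K"
  shows "\<exists>u\<in>carrier R - P. \<forall>x\<in>S. u \<odot>\<^bsub>M\<^esub> x \<in> K"
  using assms(3-)
proof (induction S rule: finite_induct)
  interpret P: primeideal P R by (rule P)
  {
    case empty
    show ?case using P.I_notcarr P.one_imp_carrier by auto
  next
    case (insert x S)
    then obtain u v where u: "u \<in> carrier R" "u \<notin> P" "\<And>y. y \<in> S \<Longrightarrow> u \<odot>\<^bsub>M\<^esub> y \<in> K"
      and v: "v \<in> carrier R" "v \<notin> P" "v \<odot>\<^bsub>M\<^esub> x \<in> K" by (metis DiffD1 DiffD2 insert_subset insertCI)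
    have "u \<otimes> v \<in> carrier R - P" using P.I_prime u v by blast
    moreover have "(u \<otimes> v) \<odot>\<^bsub>M\<^esub> y \<in> K" if "y \<in> insert x S" for y
    proof (cases "y = x")
      case True
      then show ?thesis using submoduleE(4)[OF K u(1) v(3)] u v insert.prems(1) by (simp add: smult_assoc1)
    next
      case False
      then have y: "y \<in> S" "y \<in> carrier M" using that insert.prems(1) by auto
      have "(u \<otimes> v) \<odot>\<^bsub>M\<^esub> y = v \<odot>\<^bsub>M\<^esub> (u \<odot>\<^bsub>M\<^esub> y)" using u v y by (simp add: smult_assoc1[symmetric] R.m_comm)
      then show ?thesis using submoduleE(4)[OF K v(1) u(3)[OF y(1)]] by simp
    qed
    ultimately show ?case by blast
  }
qed

end

lemma quotient_localization_zero:
  fixes R :: "('a, 'x) ring_scheme" and M :: "('a, 'm, 'd) gmodule"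
  assumes "module R M" and P: "primeideal P R" and K: "submodule K R M"
    and zero: "localization R (gquot M K) P = {fraction R (gquot M K) P \<zero>\<^bsub>gquot M K\<^esub> \<one>\<^bsub>R\<^esub>}"
    and x: "x \<in> carrier M"
  shows "\<exists>u\<in>carrier R - P. u \<odot>\<^bsub>M\<^esub> x \<in> K"
proof -
  interpret module R M by fact
  interpret P: primeideal P R by (rule P)
  let ?Q = "gquot M K"
  have sub: "K \<subseteq> carrier M" using submoduleE(1)[OF K] .
  have sg: "subgroup K (add_monoid M)" using submodule.axioms(1)[OF K] .
  have one: "\<one>\<^bsub>R\<^esub> \<in> carrier R - P" using P.I_notcarr P.one_imp_carrier by auto
  have sm: "a \<odot>\<^bsub>?Q\<^esub> (K +>\<^bsub>M\<^esub> y) = K +>\<^bsub>M\<^esub> (a \<odot>\<^bsub>M\<^esub> y)" if a: "a \<in> carrier R" and y: "y \<in> carrier M" for a y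
  proof -
    have "K +>\<^bsub>M\<^esub> (a \<odot>\<^bsub>M\<^esub> (k \<oplus>\<^bsub>M\<^esub> y)) = K +>\<^bsub>M\<^esub> (a \<odot>\<^bsub>M\<^esub> y)" if k: "k \<in> K" for k
    proof -
      have ak: "a \<odot>\<^bsub>M\<^esub> k \<in> K" using submoduleE(4)[OF K a k] .
      have "K +>\<^bsub>M\<^esub> (a \<odot>\<^bsub>M\<^esub> (k \<oplus>\<^bsub>M\<^esub> y)) = K +>\<^bsub>M\<^esub> (a \<odot>\<^bsub>M\<^esub> k) +>\<^bsub>M\<^esub> (a \<odot>\<^bsub>M\<^esub> y)"
        using M.a_coset_add_assoc[OF sub, of "a \<odot>\<^bsub>M\<^esub> k" "a \<odot>\<^bsub>M\<^esub> y"] a y k sub by (auto simp: smult_r_distr subset_iff)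
      also have "K +>\<^bsub>M\<^esub> (a \<odot>\<^bsub>M\<^esub> k) = K" using M.a_coset_join2[OF _ sg ak] ak sub by blast
      finally show ?thesis .
    qed
    moreover have "K \<noteq> {}" using submoduleE(2)[OF K] .
    ultimately show ?thesis by (auto simp: gquot_def a_r_coset_def'[of M K y])
  qed
  let ?X = "K +>\<^bsub>M\<^esub> x"
  have X: "?X \<in> carrier ?Q" using x by (auto simp: gquot_def A_RCOSETS_def')
  have "fraction R ?Q P ?X \<one>\<^bsub>R\<^esub> \<in> localization R ?Q P" using X one unfolding localization_def by blast
  then have "fraction R ?Q P ?X \<one>\<^bsub>R\<^esub> = fraction R ?Q P \<zero>\<^bsub>?Q\<^esub> \<one>\<^bsub>R\<^esub>" using zero by blast
  moreover have "(?X, \<one>\<^bsub>R\<^esub>) \<in> fraction R ?Q P ?X \<one>\<^bsub>R\<^esub>" using X one by (auto simp: fraction_def)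
  ultimately have "(?X, \<one>\<^bsub>R\<^esub>) \<in> fraction R ?Q P \<zero>\<^bsub>?Q\<^esub> \<one>\<^bsub>R\<^esub>" by simp
  then obtain u where u: "u \<in> carrier R - P"
    and eq: "u \<odot>\<^bsub>?Q\<^esub> (\<one>\<^bsub>R\<^esub> \<odot>\<^bsub>?Q\<^esub> \<zero>\<^bsub>?Q\<^esub>) = u \<odot>\<^bsub>?Q\<^esub> (\<one>\<^bsub>R\<^esub> \<odot>\<^bsub>?Q\<^esub> ?X)"
    unfolding fraction_def by blast
  have "\<zero>\<^bsub>?Q\<^esub> = K +>\<^bsub>M\<^esub> \<zero>\<^bsub>M\<^esub>" using M.a_coset_join2[OF _ sg, of "\<zero>\<^bsub>M\<^esub>"] subgroup.one_closed[OF sg] by (simp add: gquot_def)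
  then have "u \<odot>\<^bsub>?Q\<^esub> (\<one>\<^bsub>R\<^esub> \<odot>\<^bsub>?Q\<^esub> \<zero>\<^bsub>?Q\<^esub>) = K +>\<^bsub>M\<^esub> \<zero>\<^bsub>M\<^esub>" using sm[of _ "\<zero>\<^bsub>M\<^esub>"] u by simp
  moreover have "u \<odot>\<^bsub>?Q\<^esub> (\<one>\<^bsub>R\<^esub> \<odot>\<^bsub>?Q\<^esub> ?X) = K +>\<^bsub>M\<^esub> (u \<odot>\<^bsub>M\<^esub> x)" using sm[of _ x] u x by simp
  moreover have "K +>\<^bsub>M\<^esub> \<zero>\<^bsub>M\<^esub> = K" using M.a_coset_join2[OF _ sg, of "\<zero>\<^bsub>M\<^esub>"] subgroup.one_closed[OF sg] by simp
  ultimately have "K +>\<^bsub>M\<^esub> (u \<odot>\<^bsub>M\<^esub> x) = K" using eq by simp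
  then have "u \<odot>\<^bsub>M\<^esub> x \<in> K" using M.a_coset_join1[OF _ _ sg] u x by blast
  then show ?thesis using u by blast
qed

section \<open>The spread as a bound for chains, and the passage back to \<open>M\<close>\<close>

context sres
begin

text \<open>If the localization vanished, some \<open>u\<close> outside \<open>tot P\<close> would
  map the generators of \<open>M\<close> into \<open>mM\<close>, hence into
  \<open>(tot P) M\<close>, and by Nakayama some \<open>t\<close> outside \<open>tot P\<close> would
  kill \<open>M\<close>. All homogeneous components of \<open>t\<close> then kill \<open>M\<close>,
  and one of them is outside \<open>P\<close>, although \<open>P\<close> contains the
  annihilator.\<close>

lemma support_prime:
  assumes fg: "fin_gen_module R M" and P: "H.relevant_prime P" and AP: "HL.msum HC.ann \<le> P"
  shows "tot P \<in> relevant_support R (gquot M (ideal_smult R mx M))"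
proof -
  have hP: "hideal RR P" by (rule H.relevant_prime_hideal[OF P])
  have pr: "primeideal (tot P) R" by (rule tot_prime[OF P])
  interpret P: primeideal "tot P" R by (rule pr)
  have Pc: "tot P \<subseteq> carrier R" using P.Icarr by blast
  obtain S where S: "finite S" "S \<subseteq> carrier M" "gen_submodule R M S = carrier M"
    using fg by (auto simp: fin_gen_module_def)
  define K where "K = ideal_smult R mx M"
  have mxc: "mx \<subseteq> carrier R" using mx_rcomp rcomp_carrier by blast
  have Kg: "{a \<odot>\<^bsub>M\<^esub> x |a x. a \<in> mx \<and> x \<in> carrier M} \<subseteq> carrier M" using mxc by auto
  have K: "submodule K R M" unfolding K_def ideal_smult_def by (rule M.submodule_gen[OF Kg])
  have mxP: "mx \<subseteq> tot P"
  proof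
    fix m assume m: "m \<in> mx"
    then have "inR R m \<in> P 0" using HL.mm_msum[OF HC.hideal_ann] AP by (auto simp: le_fun_def)
    then show "m \<in> tot P" using tot_homogeneous[OF hP, of m 0] m mx_rcomp by blast
  qed
  have annP: "inR R a \<in> P p" if "a \<in> rcomp R p" "\<And>x. x \<in> carrier M \<Longrightarrow> a \<odot>\<^bsub>M\<^esub> x = \<zero>\<^bsub>M\<^esub>" for a p
  proof -
    have "inR R a \<in> HC.ann p" using ann_iff[OF that(1)] that(2) by blast
    then show ?thesis using HL.msum_ge[of HC.ann] AP by (auto simp: le_fun_def)
  qed
  have W: "submodule (wspan R M (tot P) S) R M"
  proof (rule M.submoduleI)
    show "wspan R M (tot P) S \<subseteq> carrier M" using M.wspan_carrier[OF Pc S(2)] by blast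
    show "\<zero>\<^bsub>M\<^esub> \<in> wspan R M (tot P) S" by (rule wspan.zero)
    show sm: "a \<odot>\<^bsub>M\<^esub> x \<in> wspan R M (tot P) S" if "a \<in> carrier R" "x \<in> wspan R M (tot P) S" for a x
      by (rule M.wspan_smult[OF P.ideal_axioms S(2) that])
    show "a \<oplus>\<^bsub>M\<^esub> b \<in> wspan R M (tot P) S" if "a \<in> wspan R M (tot P) S" "b \<in> wspan R M (tot P) S" for a b
      by (rule M.wspan_plus[OF Pc S(2) that])
    show "\<ominus>\<^bsub>M\<^esub> a \<in> wspan R M (tot P) S" if "a \<in> wspan R M (tot P) S" for a
    proof -
      have "a \<in> carrier M" using M.wspan_carrier[OF Pc S(2) that] .
      then have "\<ominus>\<^bsub>M\<^esub> a = (\<ominus> \<one>) \<odot>\<^bsub>M\<^esub> a" by (simp add: M.smult_l_minus)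
      then show ?thesis using sm[of "\<ominus> \<one>" a] that by simp
    qed
  qed
  have PM: "p \<odot>\<^bsub>M\<^esub> x \<in> wspan R M (tot P) S" if p: "p \<in> tot P" and x: "x \<in> carrier M" for p x
  proof -
    have pc: "p \<in> carrier R" using p Pc by blast
    have H: "submodule {x \<in> carrier M. p \<odot>\<^bsub>M\<^esub> x \<in> wspan R M (tot P) S} R M"
    proof (rule M.submoduleI)
      fix a x assume a: "a \<in> carrier R" and x: "x \<in> {x \<in> carrier M. p \<odot>\<^bsub>M\<^esub> x \<in> wspan R M (tot P) S}"
      have "p \<odot>\<^bsub>M\<^esub> (a \<odot>\<^bsub>M\<^esub> x) = a \<odot>\<^bsub>M\<^esub> (p \<odot>\<^bsub>M\<^esub> x)" using a x pc by (simp add: M.smult_assoc1[symmetric] m_comm)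
      then show "a \<odot>\<^bsub>M\<^esub> x \<in> {x \<in> carrier M. p \<odot>\<^bsub>M\<^esub> x \<in> wspan R M (tot P) S}"
        using a x M.submoduleE(4)[OF W a] by simp
    next
      fix a b assume "a \<in> {x \<in> carrier M. p \<odot>\<^bsub>M\<^esub> x \<in> wspan R M (tot P) S}" "b \<in> {x \<in> carrier M. p \<odot>\<^bsub>M\<^esub> x \<in> wspan R M (tot P) S}"
      then show "a \<oplus>\<^bsub>M\<^esub> b \<in> {x \<in> carrier M. p \<odot>\<^bsub>M\<^esub> x \<in> wspan R M (tot P) S}"
        using pc M.submoduleE(5)[OF W] by (simp add: M.smult_r_distr)
    next
      fix a assume "a \<in> {x \<in> carrier M. p \<odot>\<^bsub>M\<^esub> x \<in> wspan R M (tot P) S}"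
      then show "\<ominus>\<^bsub>M\<^esub> a \<in> {x \<in> carrier M. p \<odot>\<^bsub>M\<^esub> x \<in> wspan R M (tot P) S}"
        using pc M.submoduleE(3)[OF W] by (simp add: M.smult_r_minus)
    qed (use pc wspan.zero[of M R] in auto)
    have "S \<subseteq> {x \<in> carrier M. p \<odot>\<^bsub>M\<^esub> x \<in> wspan R M (tot P) S}"
      using S(2) M.wspan_single[OF Pc S(2) p] by blast
    from M.gen_submodule_le[OF H this] have "carrier M \<subseteq> {x \<in> carrier M. p \<odot>\<^bsub>M\<^esub> x \<in> wspan R M (tot P) S}"
      unfolding S(3) .
    then show ?thesis using x by blast
  qed
  have KW: "K \<subseteq> wspan R M (tot P) S"
    unfolding K_def ideal_smult_def by (rule M.gen_submodule_le[OF W]) (use PM mxP in blast)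
  have "localization R (gquot M K) (tot P) \<noteq> {fraction R (gquot M K) (tot P) \<zero>\<^bsub>gquot M K\<^esub> \<one>}"
  proof
    assume "localization R (gquot M K) (tot P) = {fraction R (gquot M K) (tot P) \<zero>\<^bsub>gquot M K\<^esub> \<one>}"
    from quotient_localization_zero[OF M.module_axioms pr K this]
    have "\<exists>u\<in>carrier R - tot P. u \<odot>\<^bsub>M\<^esub> x \<in> K" if "x \<in> S" for x using that S(2) by blast
    from M.uniform_multiplier[OF pr K S(1,2) this]
    obtain u where "u \<in> carrier R - tot P" "\<And>x. x \<in> S \<Longrightarrow> u \<odot>\<^bsub>M\<^esub> x \<in> wspan R M (tot P) S" using KW by blast
    from M.localized_nakayama[OF pr S(1,2) this]
    obtain t where t: "t \<in> carrier R" "t \<notin> tot P" "\<And>x. x \<in> S \<Longrightarrow> t \<odot>\<^bsub>M\<^esub> x = \<zero>\<^bsub>M\<^esub>" by blast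
    have H: "submodule {x \<in> carrier M. t \<odot>\<^bsub>M\<^esub> x = \<zero>\<^bsub>M\<^esub>} R M"
    proof (rule M.submoduleI)
      fix a x assume a: "a \<in> carrier R" and x: "x \<in> {x \<in> carrier M. t \<odot>\<^bsub>M\<^esub> x = \<zero>\<^bsub>M\<^esub>}"
      have "t \<odot>\<^bsub>M\<^esub> (a \<odot>\<^bsub>M\<^esub> x) = a \<odot>\<^bsub>M\<^esub> (t \<odot>\<^bsub>M\<^esub> x)" using a x t(1) M.smult_assoc1[of t a x] M.smult_assoc1[of a t x] m_comm[of a t] by (simp del: M.smult_assoc1)
      then show "a \<odot>\<^bsub>M\<^esub> x \<in> {x \<in> carrier M. t \<odot>\<^bsub>M\<^esub> x = \<zero>\<^bsub>M\<^esub>}" using a x by simp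
    qed (use t abelian_group_minus_zero[OF M.abelian_group_axioms] in \<open>auto simp: M.smult_r_minus M.smult_r_distr\<close>)
    have "S \<subseteq> {x \<in> carrier M. t \<odot>\<^bsub>M\<^esub> x = \<zero>\<^bsub>M\<^esub>}" using t(3) S(2) by blast
    from M.gen_submodule_le[OF H this] have "carrier M \<subseteq> {x \<in> carrier M. t \<odot>\<^bsub>M\<^esub> x = \<zero>\<^bsub>M\<^esub>}"
      unfolding S(3) .
    then have tM: "t \<odot>\<^bsub>M\<^esub> x = \<zero>\<^bsub>M\<^esub>" if "x \<in> carrier M" for x
      using that by blast
    obtain p where p: "inR R (gs.cmp t p) \<notin> P p" using t(1,2) unfolding tot_def by blast
    let ?c = "gs.cmp t p"
    have cc: "?c \<in> carrier R" by (rule gs.cmp_carrier[OF t(1)])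
    have "?c \<odot>\<^bsub>M\<^esub> x = \<zero>\<^bsub>M\<^esub>" if "x \<in> carrier M" for x
      using that
    proof (induction rule: gM.homogeneous_induct)
      case (homogeneous n x)
      have "?c \<odot>\<^bsub>M\<^esub> x = gM.cmp (t \<odot>\<^bsub>M\<^esub> x) (n + p)" using smult_cmp_left[OF homogeneous t(1)] by simp
      then show ?case using tM[OF gM.C_carrier[OF homogeneous]] by (simp add: gM.cmp_zero)
    qed (use cc in \<open>auto simp: M.smult_r_distr\<close>)
    then show False using annP[OF gs.cmp_C[OF t(1)]] p by blast
  qed
  then show ?thesis
    using pr tot_graded[OF hP] tot_relevant[OF P] unfolding relevant_support_def K_def by blast
qed

text \<open>A chain of length \<open>k\<close> gives \<open>k + 1 <= s(M) <= l + 1 - c\<close>. In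
  particular a chain forces \<open>l + 1 - c\<close> to be positive, so the truncation by
  \<open>nat\<close> does no harm.\<close>

lemma spread_chain_bound:
  assumes fg: "fin_gen_module R M" and s: "ereal (real_of_int l) \<ge> ereal (real_of_int c) + spread R M - 1"
  shows "H.chain_bound (HL.msum HC.ann) (nat (l + 1 - c))"
  unfolding H.chain_bound_def
proof (intro allI impI)
  fix k P assume P: "\<forall>i\<le>k. H.relevant_prime (P i) \<and> HL.msum HC.ann \<le> P i" and ch: "\<forall>i<k. P i < P (Suc i)"
  let ?S = "relevant_support R (gquot M (ideal_smult R mx M))"
  have in_S: "tot (P i) \<in> ?S" if "i \<le> k" for i using support_prime[OF fg] P that by blast
  moreover have "tot (P i) \<subset> tot (P (Suc i))" if "i < k" for i
    using tot_less[of "P i" "P (Suc i)"] P ch that by (simp add: H.relevant_prime_hideal)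
  ultimately have "k \<in> {k. \<exists>p. (\<forall>i\<le>k. p i \<in> ?S) \<and> (\<forall>i<k. p i \<subset> p (Suc i))}"
    by (intro CollectI exI[of _ "\<lambda>i. tot (P i)"]) blast
  then have "ereal (real k) \<le> (SUP k\<in>{k. \<exists>p. (\<forall>i\<le>k. p i \<in> ?S) \<and> (\<forall>i<k. p i \<subset> p (Suc i))}. ereal (real k))"
    by (rule SUP_upper)
  then have "ereal (real k) \<le> chain_dim ?S"
    using in_S[of 0] unfolding chain_dim_def by (subst if_not_P) auto
  then have "ereal (real k) + 1 \<le> spread R M" unfolding spread_def mx_def by (rule add_right_mono)
  then have "ereal (real_of_int c) + (ereal (real k) + 1) - 1 \<le> ereal (real_of_int c) + spread R M - 1"
    by (intro ereal_minus_mono add_left_mono) auto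
  then have "ereal (real_of_int c) + (ereal (real k) + 1) - 1 \<le> ereal (real_of_int l)" using s by (rule order_trans)
  then have "real_of_int c + real k \<le> real_of_int l" by (simp add: one_ereal_def)
  then have "c + int k \<le> l" by linarith
  then show "k < nat (l + 1 - c)" by linarith
qed

text \<open>The generation result for cocycles in \<open>E 0\<close>, carried back along
  \<open>\<epsilon>\<close>: the coefficients of degree \<open>n - e_i\<close> come from elements of
  \<open>M\<close> of that degree, which lie in \<open>N\<close> by \<open>IH\<close>.\<close>

lemma generated_from_below:
  assumes fg: "fin_gen_module R M" and s: "ereal (real_of_int l) \<ge> ereal (real_of_int (total_degree b)) + spread R M - 1"
    and van: "\<And>i n. n \<ge> b \<Longrightarrow> gcomp (local_cohomology R (irrelevant_ideal R) E \<delta> i) n =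
             {\<zero>\<^bsub>local_cohomology R (irrelevant_ideal R) E \<delta> i\<^esub>}"
    and N: "submodule N R M" and n: "b \<le> n" "l < total_degree n"
    and IH: "\<And>i. b \<le> n - axis i 1 \<Longrightarrow> gcomp M (n - axis i 1) \<subseteq> N"
  shows "gcomp M n \<subseteq> N"
proof
  interpret reg: regularity RR "inR R \<one>" "actE R E" XX "diffE E \<delta>" "inR R ` mx" b "nat (l + 1 - total_degree b)"
  proof unfold_locales
    fix n x j assume "b \<le> n" "x \<in> XX j n" "H.tors (actE R E) x" "diffE E \<delta> x = 0"
    then show "\<exists>y\<in>XX (j - 1) n. H.tors (actE R E) y \<and> diffE E \<delta> y = x" using vanishing_XX van by blast
  qed (rule spread_chain_bound[OF fg s])
  note Ns = M.submoduleE[OF N]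
  fix x assume x: "x \<in> gcomp M n"
  have xc: "x \<in> carrier M" using gM.C_carrier[OF x] .
  have \<epsilon>0: "\<delta> 0 (\<epsilon> y) = \<zero>\<^bsub>E (Suc 0)\<^esub>" if "y \<in> carrier M" for y using \<epsilon>_image that by auto
  let ?y = "inE E 0 (\<epsilon> x)"
  have "?y \<in> XX 0 n" using XXI[OF \<epsilon>_gcomp[OF x]] by simp
  moreover have "diffE E \<delta> ?y = 0" using inE_diffE[OF \<epsilon>_closed[OF xc]] \<epsilon>0[OF xc] by (simp add: inE_zero)
  \<comment> \<open>If \<open>l + 1 < |b|\<close>, then \<open>nat\<close> gives 0 and the claim is
    \<open>|b| <= |n|\<close>, which follows from \<open>b <= n\<close>.\<close>
  moreover have "total_degree b + int (nat (l + 1 - total_degree b)) \<le> total_degree n"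
  proof -
    have "0 \<le> total_degree n - total_degree b"
      using total_degree_nonneg[of "n - b"] n(1) by (simp add: total_degree_diff less_eq_vec_def)
    then show ?thesis using n(2) by linarith
  qed
  ultimately have "?y \<in> addspan {actE R E a z | a z i. a \<in> RR (axis i 1) \<and> z \<in> XX 0 (n - axis i 1) \<and>
      diffE E \<delta> z = 0 \<and> b \<le> n - axis i 1}" using reg.generation[OF n(1)] by blast
  then have "\<exists>w\<in>N. ?y = inE E 0 (\<epsilon> w)"
  proof (induction rule: addspan_induct)
    case (base w)
    then obtain a z i where az: "w = actE R E a z" "a \<in> RR (axis i 1)" "z \<in> XX 0 (n - axis i 1)"
      "diffE E \<delta> z = 0" "b \<le> n - axis i 1" by blast
    obtain a' where a': "a' \<in> rcomp R (axis i 1)" "a = inR R a'" "a' \<in> carrier R" using az(2) by (rule RRE)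
    have "z \<in> XX (int 0) (n - axis i 1)" using az(3) by simp
    then obtain z' where z': "z' \<in> gcomp (E 0) (n - axis i 1)" "z' \<in> carrier (E 0)" "z = inE E 0 z'" by (rule XXE)
    have "inE E (Suc 0) (\<delta> 0 z') = inE E (Suc 0) \<zero>\<^bsub>E (Suc 0)\<^esub>" using az(4) z' by (simp add: inE_diffE inE_zero)
    then have "\<delta> 0 z' = \<zero>\<^bsub>E 1\<^esub>" using inE_inj \<delta>_closed[OF z'(2)] E.zero_closed[of "Suc 0"] by simp
    then obtain v where v: "v \<in> carrier M" "z' = \<epsilon> v" using \<epsilon>_image z'(2) by blast
    let ?v = "gM.cmp v (n - axis i 1)"
    have "\<epsilon> ?v = z'" using \<epsilon>_cmp[OF v(1)] gE.cmp_homogeneous[OF z'(1)] v(2) by simp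
    moreover have vN: "?v \<in> N" using IH[OF az(5)] gM.cmp_C[OF v(1)] by blast
    moreover have "?v \<in> carrier M" by (rule gM.cmp_carrier[OF v(1)])
    ultimately have "w = inE E 0 (\<epsilon> (a' \<odot>\<^bsub>M\<^esub> ?v))"
      using az(1) a' z' by (simp add: inE_act \<epsilon>_smult)
    then show ?case using Ns(4)[OF a'(3) vN] by blast
  next
    case zero
    have "\<epsilon> \<zero>\<^bsub>M\<^esub> = \<zero>\<^bsub>E 0\<^esub>"
      by (rule hom_zero_minus(1)[OF M.abelian_group_axioms ab_E \<epsilon>_closed \<epsilon>_plus])
    moreover have "\<zero>\<^bsub>M\<^esub> \<in> N" using subgroup.one_closed[OF submodule.axioms(1)[OF N]] by simp
    ultimately show ?case by (metis inE_zero)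
  next
    case (diff u v)
    then obtain u' v' where uv: "u' \<in> N" "u = inE E 0 (\<epsilon> u')" "v' \<in> N" "v = inE E 0 (\<epsilon> v')" by blast
    have c: "u' \<in> carrier M" "v' \<in> carrier M" using uv Ns(1) by auto
    have "\<epsilon> (u' \<ominus>\<^bsub>M\<^esub> v') = \<epsilon> u' \<ominus>\<^bsub>E 0\<^esub> \<epsilon> v'"
      by (rule hom_zero_minus(3)[OF M.abelian_group_axioms ab_E \<epsilon>_closed \<epsilon>_plus]) (use c in auto)
    then have "u - v = inE E 0 (\<epsilon> (u' \<ominus>\<^bsub>M\<^esub> v'))" using uv c \<epsilon>_closed by (simp add: inE_diff)
    moreover have "u' \<ominus>\<^bsub>M\<^esub> v' \<in> N" using Ns(3,5) uv by (simp add: M.minus_eq)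
    ultimately show ?case by blast
  qed
  then obtain w where w: "w \<in> N" "inE E 0 (\<epsilon> x) = inE E 0 (\<epsilon> w)" by blast
  have wc: "w \<in> carrier M" using w(1) Ns(1) by blast
  have "\<epsilon> x = \<epsilon> w" using w(2) inE_inj \<epsilon>_closed xc wc by blast
  then have "x = w" using \<epsilon>_inj xc wc by (simp add: inj_on_def)
  then show "x \<in> N" using w(1) by simp
qed

lemma quotient_component_zero:
  assumes N: "submodule N R M"
  shows "gcomp (gquot M N) n = {\<zero>\<^bsub>gquot M N\<^esub>} \<longleftrightarrow> gcomp M n \<subseteq> N"
proof -
  have sg: "subgroup N (add_monoid M)" using submodule.axioms(1)[OF N] .
  have "N +>\<^bsub>M\<^esub> x = N \<longleftrightarrow> x \<in> N" if "x \<in> gcomp M n" for x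
    using M.a_coset_join1[OF _ _ sg] M.a_coset_join2[OF _ sg] gM.C_carrier[OF that] by blast
  moreover have "gcomp M n \<noteq> {}" using gM.C_zero by blast
  ultimately show ?thesis by (auto simp: gquot_def)
qed

end

theorem theorem4p1:
  fixes R :: "('a, int ^ 'r) gring"
    and M :: "('a, 'm, int ^ 'r) gmodule"
    and N :: "'m set"
    and \<epsilon> :: "'m \<Rightarrow> 'e"
    and E :: "nat \<Rightarrow> ('a, 'e, int ^ 'r) gmodule"
    and \<delta> :: "nat \<Rightarrow> 'e \<Rightarrow> 'e"
    and b :: "int ^ 'r"
    and l :: int
  assumes "noetherian_ring R"
    and "standard_graded R"
    and "local_ring (degree_zero_ring R)"
    and "graded_module R M"
    and "fin_gen_module R M"
    and "graded_submodule R N M"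
    and "graded_injective_resolution R M \<epsilon> E \<delta>"
    and "ereal (real_of_int l) \<ge> ereal (real_of_int (total_degree b)) + spread R M - 1"
    and "\<And>i n. n \<ge> b \<Longrightarrow>
           gcomp (local_cohomology R (irrelevant_ideal R) E \<delta> i) n =
             {\<zero>\<^bsub>local_cohomology R (irrelevant_ideal R) E \<delta> i\<^esub>}"
    and "\<And>n. n \<ge> b \<Longrightarrow> total_degree n = l \<Longrightarrow> gcomp (gquot M N) n = {\<zero>\<^bsub>gquot M N\<^esub>}"
  shows "\<forall>n. n \<ge> b \<and> total_degree n \<ge> l \<longrightarrow> gcomp (gquot M N) n = {\<zero>\<^bsub>gquot M N\<^esub>}"
proof -
  interpret sres R M \<epsilon> E \<delta>
    by (intro sres.intro sring.intro sres_axioms.intro) (fact assms)+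
  have N: "submodule N R M" using assms(6) by (simp add: graded_submodule_def)
  have "gcomp M n \<subseteq> N" if "b \<le> n" "total_degree n = l + int k" for n k
    using that
  proof (induction k arbitrary: n)
    case 0
    then show ?case using assms(10)[of n] quotient_component_zero[OF N] by simp
  next
    case (Suc k)
    show ?case
    proof (rule generated_from_below[OF assms(5,8,9) N Suc.prems(1)])
      show "l < total_degree n" using Suc.prems by simp
      fix i assume "b \<le> n - axis i 1"
      then show "gcomp M (n - axis i 1) \<subseteq> N"
        using Suc.prems by (intro Suc.IH) (auto simp: total_degree_diff total_degree_axis)
    qed
  qed
  then have "gcomp M n \<subseteq> N" if "b \<le> n" "l \<le> total_degree n" for n
    using that(1) that(2)[unfolded zle_iff_zadd] by blast
  then show ?thesis using quotient_component_zero[OF N] by blast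
qed

end
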